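(* Let $(G,c)$ be a network satisfying the standing assumptions. Then the domain of the Friedrichs extension $\Delta_{\mathcal F}$ of the energy-space Laplacian $\Delta_{\mathcal E}$ is $$\operatorname{dom}\Delta_{\mathcal F}=\widetilde\Phi\left(\operatorname{dom}\Delta_2^{1/2}\cap\operatorname{dom}\Delta_2^{-1/2}\right).$$
   Context: A network $(G,c)$ is a connected undirected graph $G$ (we write $x\in G$ for vertices) with a symmetric conductance function $c:G\times G\to[0,\infty)$, where $x,y$ are neighbours, $x\sim y$, iff $c_{xy}>0$. Every vertex has finitely many neighbours; $c(x)=\sum_{y\sim x}c_{xy}$. Fix a reference vertex $o\in G$. The Laplacian acts on $u:G\to\mathbb R$ by $(\Delta u)(x)=\sum_{y\sim x}c_{xy}(u(x)-u(y))$. The energy form is $\mathcal E(u,v)=\frac12\sum_{x,y\in G}c_{xy}(u(x)-u(y))(v(x)-v(y))$ on $\operatorname{dom}\mathcal E=\{u:G\to\mathbb R:\mathcal E(u,u)<\infty\}$, and $\mathcal E(u)=\mathcal E(u,u)$. The energy space $\mathcal H_{\mathcal E}=\operatorname{dom}\mathcal E/\mathbb R\mathbf 1$ (functions modulo constants) is a Hilbert space with inner product $\langle u,v\rangle_{\mathcal E}=\mathcal E(u,v)$; $\Delta$ acts unambiguously on classes, and $\Delta u$ may be regarded as a function or as its class. For $x\in G$, $v_x\in\mathcal H_{\mathcal E}$ is the unique element with $\langle v_x,u\rangle_{\mathcal E}=u(x)-u(o)$ for all $u\in\mathcal H_{\mathcal E}$. A monopole at $x$ is $w\in\mathcal H_{\mathcal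 E}$ with $\Delta w=\delta_x$ (the characteristic function of $\{x\}$). Standing assumptions: $G$ is infinite and the network is transient (equivalently, monopoles exist). Let $w_o$ be the unique energy-minimizing monopole at $o$, and $w_x^{v}:=w_o+v_x$ for $x\in G$ (so $w_o^v=w_o$). $\Delta_{\mathcal E}$: the closure in $\mathcal H_{\mathcal E}$ of $\Delta$ restricted to $\operatorname{span}\{w_x^v\}_{x\in G}$; it is densely defined and non-negative. Its Friedrichs extension $\Delta_{\mathcal F}$: let $q_\Delta$ be the closure of the quadratic form $u\mapsto\langle u,\Delta u\rangle_{\mathcal E}+\|u\|_{\mathcal E}^2$, $u\in\operatorname{dom}\Delta_{\mathcal E}$; then $\Delta_{\mathcal F}$ is the non-negative self-adjoint extension of $\Delta_{\mathcal E}$ with $\operatorname{dom}\Delta_{\mathcal F}^{1/2}=\operatorname{dom}q_\Delta$ and $q_\Delta(u)=\|\Delta_{\mathcal F}^{1/2}u\|_{\mathcal E}^2+\|u\|_{\mathcal E}^2$. $\ell^2(G)$ carries $\langle u,v\rangle_2=\sum_x u(x)v(x)$. $\Delta_2$: the closure in $\ell^2(G)$ of $\Delta$ on $\operatorname{span}\{\delta_x\}_{x\in G}$; it is known to be self-adjoint and non-negative, and $0$ is not an eigenvalue. $\Delta_2^{-1/2}:=\pi^{-1/2}\int_0^\infty t^{-1/2}e^{-t\Delta_2}\,dt$ with domain $\{\xi\in\ell^2(G):(\pi^{-1/2}\int_0^\infty t^{-1/2}e^{-t\Delta_2}dt)(\xi)\in\ell^2(G)\}$ (i.e. the functional calculus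 inverse of $\Delta_2^{1/2}$). $\Phi$: the linear map $\ell^2(G)\to\mathcal H_{\mathcal E}$ with domain $\operatorname{span}\{\delta_x\}_{x\in G}$ and $\Phi\delta_x=w_x^v$. $M$ is the infinite matrix $M_{xy}=\langle w_x^v,w_y^v\rangle_{\mathcal E}$, so that $\langle\xi,M\xi\rangle_2=\|\Phi\xi\|_{\mathcal E}^2$ for $\xi\in\operatorname{dom}\Phi$; $q_M$ is the closure in $\ell^2(G)$ of the quadratic form $\xi\mapsto\langle\xi,M\xi\rangle_2$. $\widetilde\Phi$: for $\xi\in\operatorname{dom}q_M$, $\widetilde\Phi(\xi):=\lim_{n\to\infty}\Phi(\xi_n)$ in $\mathcal H_{\mathcal E}$, for any sequence $(\xi_n)\subset\operatorname{dom}\Phi$ with $q_M(\xi_n-\xi)\to0$. Here $\operatorname{dom}q_M=\operatorname{dom}\Delta_2^{-1/2}$, the self-adjoint operator associated with $q_M$ being the inverse of $\Delta_2$.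
   Formalization: If non-constant harmonic functions of finite energy exist, q_M is not closable and the limit defining Φ̃(ξ) depends on the sequence; Φ̃ is therefore taken as the relation of all such limits (q_M as least limit), which is the stated map whenever q_M is closable. *)

theory Defs
  imports "HOL-Analysis.Analysis" "HOL-Library.Function_Algebras"
begin

section \<open>Vector spaces of functions\<close>

instantiation "fun" :: (type, real_vector) real_vector
begin

definition scaleR_fun_def: "r *\<^sub>R f = (\<lambda>x. r *\<^sub>R f x)"

instance
  by standard (simp_all add: scaleR_fun_def fun_eq_iff scaleR_add_right scaleR_add_left)

end

lemma scaleR_fun_apply [simp]: "(r *\<^sub>R f) x = r *\<^sub>R f x"
  by (simp add: scaleR_fun_def)

text \<open>Real functions modulo constants. The quotient is formed for all functions, so that the
  type does not depend on the conductances; the energy space is a subspace of it.\<close>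

definition eq_mod_const :: "('v \<Rightarrow> real) \<Rightarrow> ('v \<Rightarrow> real) \<Rightarrow> bool" where
  "eq_mod_const u v \<longleftrightarrow> (\<exists>k. \<forall>x. u x = v x + k)"

lemma equivp_eq_mod_const: "equivp eq_mod_const"
proof (rule equivpI)
  show "reflp eq_mod_const"
    unfolding reflp_def eq_mod_const_def by (metis add.right_neutral)
  show "symp eq_mod_const"
  proof (rule sympI)
    fix u v :: "'v \<Rightarrow> real"
    assume "eq_mod_const u v"
    then obtain k where "\<forall>x. u x = v x + k" by (auto simp: eq_mod_const_def)
    then have "\<forall>x. v x = u x + (- k)" by simp
    then show "eq_mod_const v u" unfolding eq_mod_const_def by blast
  qed
  show "transp eq_mod_const"
  proof (rule transpI)
    fix u v w :: "'v \<Rightarrow> real"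
    assume "eq_mod_const u v" "eq_mod_const v w"
    then obtain k l where "\<forall>x. u x = v x + k" "\<forall>x. v x = w x + l"
      by (auto simp: eq_mod_const_def)
    then have "\<forall>x. u x = w x + (l + k)" by simp
    then show "eq_mod_const u w" unfolding eq_mod_const_def by blast
  qed
qed

quotient_type 'v fun_mod_const = "'v \<Rightarrow> real" / eq_mod_const
  by (rule equivp_eq_mod_const)

lift_definition fclass :: "('v \<Rightarrow> real) \<Rightarrow> 'v fun_mod_const" is "\<lambda>u. u" .

instantiation fun_mod_const :: (type) real_vector
begin

lift_definition zero_fun_mod_const :: "'a fun_mod_const" is "0" .

lift_definition plus_fun_mod_const ::
  "'a fun_mod_const \<Rightarrow> 'a fun_mod_const \<Rightarrow> 'a fun_mod_const" is "(+)"
proof -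
  fix u u' v v' :: "'a \<Rightarrow> real"
  assume "eq_mod_const u u'" "eq_mod_const v v'"
  then obtain k l where "\<forall>x. u x = u' x + k" "\<forall>x. v x = v' x + l"
    by (auto simp: eq_mod_const_def)
  then show "eq_mod_const (u + v) (u' + v')"
    unfolding eq_mod_const_def by (intro exI[of _ "k + l"]) simp
qed

lift_definition uminus_fun_mod_const :: "'a fun_mod_const \<Rightarrow> 'a fun_mod_const" is "uminus"
proof -
  fix u u' :: "'a \<Rightarrow> real"
  assume "eq_mod_const u u'"
  then obtain k where "\<forall>x. u x = u' x + k" by (auto simp: eq_mod_const_def)
  then show "eq_mod_const (- u) (- u')"
    unfolding eq_mod_const_def by (intro exI[of _ "- k"]) simp
qed

lift_definition minus_fun_mod_const ::
  "'a fun_mod_const \<Rightarrow> 'a fun_mod_const \<Rightarrow> 'a fun_mod_const" is "(-)"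
proof -
  fix u u' v v' :: "'a \<Rightarrow> real"
  assume "eq_mod_const u u'" "eq_mod_const v v'"
  then obtain k l where "\<forall>x. u x = u' x + k" "\<forall>x. v x = v' x + l"
    by (auto simp: eq_mod_const_def)
  then show "eq_mod_const (u - v) (u' - v')"
    unfolding eq_mod_const_def by (intro exI[of _ "k - l"]) simp
qed

lift_definition scaleR_fun_mod_const :: "real \<Rightarrow> 'a fun_mod_const \<Rightarrow> 'a fun_mod_const"
  is "scaleR"
proof -
  fix r :: real and u u' :: "'a \<Rightarrow> real"
  assume "eq_mod_const u u'"
  then obtain k where "\<forall>x. u x = u' x + k" by (auto simp: eq_mod_const_def)
  then show "eq_mod_const (r *\<^sub>R u) (r *\<^sub>R u')"
    unfolding eq_mod_const_def by (intro exI[of _ "r * k"]) (simp add: algebra_simps)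
qed

instance
  by standard
    (transfer,
     auto simp: eq_mod_const_def fun_eq_iff algebra_simps intro!: exI[of _ 0])+

end

section \<open>Unbounded operators and forms on a Hilbert space\<close>

text \<open>A real Hilbert space is given by a subspace \<open>H\<close> of a real vector space together with
  its inner product \<open>ip\<close>. An operator in it is represented by its graph, a subset of
  \<open>H \<times> H\<close>.\<close>

definition hs_top :: "'a::real_vector set \<Rightarrow> ('a \<Rightarrow> 'a \<Rightarrow> real) \<Rightarrow> 'a topology" where
  "hs_top H ip = Metric_space.mtopology H (\<lambda>u v. sqrt (ip (u - v) (u - v)))"

definition op_closure ::
  "'a::real_vector set \<Rightarrow> ('a \<Rightarrow> 'a \<Rightarrow> real) \<Rightarrow> ('a \<times> 'a) set \<Rightarrow> ('a \<times> 'a) set" where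
  "op_closure H ip A = prod_topology (hs_top H ip) (hs_top H ip) closure_of A"

definition op_app :: "('a \<times> 'a) set \<Rightarrow> 'a \<Rightarrow> 'a" where
  "op_app A u = (THE w. (u, w) \<in> A)"

definition op_adjoint ::
  "'a set \<Rightarrow> ('a \<Rightarrow> 'a \<Rightarrow> real) \<Rightarrow> ('a \<times> 'a) set \<Rightarrow> ('a \<times> 'a) set" where
  "op_adjoint H ip A = {(u, w) \<in> H \<times> H. \<forall>(x, y) \<in> A. ip y u = ip x w}"

definition self_adjoint ::
  "'a::real_vector set \<Rightarrow> ('a \<Rightarrow> 'a \<Rightarrow> real) \<Rightarrow> ('a \<times> 'a) set \<Rightarrow> bool" where
  "self_adjoint H ip A \<longleftrightarrow> hs_top H ip closure_of Domain A = H \<and> op_adjoint H ip A = A"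

definition nonneg_op :: "('a \<Rightarrow> 'a \<Rightarrow> real) \<Rightarrow> ('a \<times> 'a) set \<Rightarrow> bool" where
  "nonneg_op ip A \<longleftrightarrow> (\<forall>(u, w) \<in> A. 0 \<le> ip u w)"

text \<open>The square root of a non-negative self-adjoint operator; \<open>B O B\<close> is the graph of
  \<open>B\<^sup>2\<close> with its natural domain.\<close>

definition op_sqrt ::
  "'a::real_vector set \<Rightarrow> ('a \<Rightarrow> 'a \<Rightarrow> real) \<Rightarrow> ('a \<times> 'a) set \<Rightarrow> ('a \<times> 'a) set" where
  "op_sqrt H ip A = (THE B. self_adjoint H ip B \<and> nonneg_op ip B \<and> B O B = A)"

definition c0_semigroup ::
  "'a::real_vector set \<Rightarrow> ('a \<Rightarrow> 'a \<Rightarrow> real) \<Rightarrow> (real \<Rightarrow> 'a \<Rightarrow> 'a) \<Rightarrow> bool" where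
  "c0_semigroup H ip T \<longleftrightarrow>
     (\<forall>t\<ge>0. \<forall>u\<in>H. T t u \<in> H) \<and>
     (\<forall>t\<ge>0. \<forall>u\<in>H. \<forall>v\<in>H. T t (u + v) = T t u + T t v) \<and>
     (\<forall>t\<ge>0. \<forall>u\<in>H. \<forall>r. T t (r *\<^sub>R u) = r *\<^sub>R T t u) \<and>
     (\<forall>t\<ge>0. \<exists>K. \<forall>u\<in>H. sqrt (ip (T t u) (T t u)) \<le> K * sqrt (ip u u)) \<and>
     (\<forall>u\<in>H. T 0 u = u) \<and>
     (\<forall>s\<ge>0. \<forall>t\<ge>0. \<forall>u\<in>H. T (s + t) u = T s (T t u)) \<and>
     (\<forall>u\<in>H. limitin (hs_top H ip) (\<lambda>t. T t u) u (at_right 0))"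

definition semigroup_generator ::
  "'a::real_vector set \<Rightarrow> ('a \<Rightarrow> 'a \<Rightarrow> real) \<Rightarrow> (real \<Rightarrow> 'a \<Rightarrow> 'a) \<Rightarrow> ('a \<times> 'a) set" where
  "semigroup_generator H ip T =
     {(u, w). u \<in> H \<and> limitin (hs_top H ip) (\<lambda>t. (1 / t) *\<^sub>R (T t u - u)) w (at_right 0)}"

text \<open>\<open>exp_neg H ip A t\<close> is \<open>exp (- t A)\<close>, for \<open>t \<ge> 0\<close>: the semigroup generated by \<open>- A\<close>.\<close>

definition exp_neg ::
  "'a::real_vector set \<Rightarrow> ('a \<Rightarrow> 'a \<Rightarrow> real) \<Rightarrow> ('a \<times> 'a) set \<Rightarrow> real \<Rightarrow> 'a \<Rightarrow> 'a" where
  "exp_neg H ip A t u =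
     (THE v. \<exists>T. c0_semigroup H ip T \<and>
        semigroup_generator H ip T = (\<lambda>(x, y). (x, - y)) ` A \<and> v = T t u)"

text \<open>Closure of a non-negative quadratic form \<open>q\<close> with domain \<open>D\<close>: the elements of its domain are
  the limits in \<open>H\<close> of \<open>q\<close>-Cauchy sequences in \<open>D\<close>, and its value there is the limit of
  \<open>q\<close> along such a sequence. For closable \<open>q\<close> that limit is the same for all these sequences;
  for other \<open>q\<close> the infimum selects the smallest one.\<close>

definition form_conv ::
  "'a::real_vector set \<Rightarrow> ('a \<Rightarrow> 'a \<Rightarrow> real) \<Rightarrow> 'a set \<Rightarrow> ('a \<Rightarrow> real) \<Rightarrow> (nat \<Rightarrow> 'a) \<Rightarrow> 'a \<Rightarrow> bool" where
  "form_conv H ip D q s u \<longleftrightarrow>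
     (\<forall>n. s n \<in> D) \<and> limitin (hs_top H ip) s u sequentially \<and>
     (\<forall>e>0. \<exists>N. \<forall>m\<ge>N. \<forall>n\<ge>N. q (s m - s n) < e)"

definition form_closure_dom ::
  "'a::real_vector set \<Rightarrow> ('a \<Rightarrow> 'a \<Rightarrow> real) \<Rightarrow> 'a set \<Rightarrow> ('a \<Rightarrow> real) \<Rightarrow> 'a set" where
  "form_closure_dom H ip D q = {u. \<exists>s. form_conv H ip D q s u}"

definition form_closure ::
  "'a::real_vector set \<Rightarrow> ('a \<Rightarrow> 'a \<Rightarrow> real) \<Rightarrow> 'a set \<Rightarrow> ('a \<Rightarrow> real) \<Rightarrow> 'a \<Rightarrow> real" where
  "form_closure H ip D q u = Inf {r. \<exists>s. form_conv H ip D q s u \<and> (\<lambda>n. q (s n)) \<longlonglongrightarrow> r}"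

definition friedrichs_form ::
  "('a::real_vector \<Rightarrow> 'a \<Rightarrow> real) \<Rightarrow> ('a \<times> 'a) set \<Rightarrow> 'a \<Rightarrow> real" where
  "friedrichs_form ip A u = ip u (op_app A u) + ip u u"

definition friedrichs ::
  "'a::real_vector set \<Rightarrow> ('a \<Rightarrow> 'a \<Rightarrow> real) \<Rightarrow> ('a \<times> 'a) set \<Rightarrow> ('a \<times> 'a) set" where
  "friedrichs H ip A =
     (THE S. self_adjoint H ip S \<and> nonneg_op ip S \<and> A \<subseteq> S \<and>
        Domain (op_sqrt H ip S) = form_closure_dom H ip (Domain A) (friedrichs_form ip A) \<and>
        (\<forall>(u, w) \<in> op_sqrt H ip S.
           form_closure H ip (Domain A) (friedrichs_form ip A) u = ip w w + ip u u))"

section \<open>Networks and the energy space\<close>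

text \<open>The vertex set is the whole type \<open>'v\<close>. Loops are not excluded; they contribute neither to
  the Laplacian nor to the energy.\<close>

definition network :: "('v \<Rightarrow> 'v \<Rightarrow> real) \<Rightarrow> bool" where
  "network c \<longleftrightarrow>
     (\<forall>x y. 0 \<le> c x y) \<and> (\<forall>x y. c x y = c y x) \<and>
     (\<forall>x. finite {y. 0 < c x y}) \<and> (\<forall>x y. (\<lambda>x y. 0 < c x y)\<^sup>*\<^sup>* x y)"

definition laplacian :: "('v \<Rightarrow> 'v \<Rightarrow> real) \<Rightarrow> ('v \<Rightarrow> real) \<Rightarrow> 'v \<Rightarrow> real" where
  "laplacian c u x = (\<Sum>y | 0 < c x y. c x y * (u x - u y))"

definition energy :: "('v \<Rightarrow> 'v \<Rightarrow> real) \<Rightarrow> ('v \<Rightarrow> real) \<Rightarrow> ('v \<Rightarrow> real) \<Rightarrow> real" where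
  "energy c u v = 1/2 * (\<Sum>\<^sub>\<infinity>(x, y)\<in>UNIV. c x y * (u x - u y) * (v x - v y))"

definition energy_dom :: "('v \<Rightarrow> 'v \<Rightarrow> real) \<Rightarrow> ('v \<Rightarrow> real) set" where
  "energy_dom c = {u. (\<lambda>(x, y). c x y * (u x - u y)\<^sup>2) summable_on UNIV}"

definition energy_space :: "('v \<Rightarrow> 'v \<Rightarrow> real) \<Rightarrow> 'v fun_mod_const set" where
  "energy_space c = fclass ` energy_dom c"

lift_definition energy_ip ::
  "('v \<Rightarrow> 'v \<Rightarrow> real) \<Rightarrow> 'v fun_mod_const \<Rightarrow> 'v fun_mod_const \<Rightarrow> real" is energy
proof -
  fix c :: "'v \<Rightarrow> 'v \<Rightarrow> real" and u u' v v' :: "'v \<Rightarrow> real"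
  assume "eq_mod_const u u'" "eq_mod_const v v'"
  then have "\<And>x y. u x - u y = u' x - u' y" "\<And>x y. v x - v y = v' x - v' y"
    by (auto simp: eq_mod_const_def)
  then show "energy c u v = energy c u' v'"
    unfolding energy_def by simp
qed

lift_definition laplacian_class ::
  "('v \<Rightarrow> 'v \<Rightarrow> real) \<Rightarrow> 'v fun_mod_const \<Rightarrow> 'v \<Rightarrow> real" is laplacian
proof -
  fix c :: "'v \<Rightarrow> 'v \<Rightarrow> real" and u u' :: "'v \<Rightarrow> real"
  assume "eq_mod_const u u'"
  then have "\<And>x y. u x - u y = u' x - u' y"
    by (auto simp: eq_mod_const_def)
  then show "laplacian c u = laplacian c u'"
    unfolding laplacian_def fun_eq_iff by simp
qed

definition delta :: "'v \<Rightarrow> 'v \<Rightarrow> real" where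
  "delta x = indicator {x}"

definition dipole :: "('v \<Rightarrow> 'v \<Rightarrow> real) \<Rightarrow> 'v \<Rightarrow> 'v \<Rightarrow> 'v fun_mod_const" where
  "dipole c ref x =
     (THE v. v \<in> energy_space c \<and>
        (\<forall>u\<in>energy_dom c. energy_ip c v (fclass u) = u x - u ref))"

definition monopole :: "('v \<Rightarrow> 'v \<Rightarrow> real) \<Rightarrow> 'v \<Rightarrow> 'v fun_mod_const \<Rightarrow> bool" where
  "monopole c x w \<longleftrightarrow> w \<in> energy_space c \<and> laplacian_class c w = delta x"

text \<open>Transience in the form of existence of a finite-energy monopole.\<close>

definition transient :: "('v \<Rightarrow> 'v \<Rightarrow> real) \<Rightarrow> bool" where
  "transient c \<longleftrightarrow> (\<exists>x w. monopole c x w)"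

definition min_monopole :: "('v \<Rightarrow> 'v \<Rightarrow> real) \<Rightarrow> 'v \<Rightarrow> 'v fun_mod_const" where
  "min_monopole c x =
     (THE w. monopole c x w \<and> (\<forall>w'. monopole c x w' \<longrightarrow> energy_ip c w w \<le> energy_ip c w' w'))"

definition wv :: "('v \<Rightarrow> 'v \<Rightarrow> real) \<Rightarrow> 'v \<Rightarrow> 'v \<Rightarrow> 'v fun_mod_const" where
  "wv c ref x = min_monopole c ref + dipole c ref x"

definition laplacian_E ::
  "('v \<Rightarrow> 'v \<Rightarrow> real) \<Rightarrow> 'v \<Rightarrow> ('v fun_mod_const \<times> 'v fun_mod_const) set" where
  "laplacian_E c ref =
     op_closure (energy_space c) (energy_ip c)
       ((\<lambda>u. (u, fclass (laplacian_class c u))) ` span (range (wv c ref)))"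

definition laplacian_F ::
  "('v \<Rightarrow> 'v \<Rightarrow> real) \<Rightarrow> 'v \<Rightarrow> ('v fun_mod_const \<times> 'v fun_mod_const) set" where
  "laplacian_F c ref = friedrichs (energy_space c) (energy_ip c) (laplacian_E c ref)"

section \<open>The Laplacian on square-summable functions\<close>

definition ell2 :: "('v \<Rightarrow> real) set" where
  "ell2 = {u. (\<lambda>x. (u x)\<^sup>2) summable_on UNIV}"

definition ell2_ip :: "('v \<Rightarrow> real) \<Rightarrow> ('v \<Rightarrow> real) \<Rightarrow> real" where
  "ell2_ip u v = (\<Sum>\<^sub>\<infinity>x. u x * v x)"

definition laplacian_2 :: "('v \<Rightarrow> 'v \<Rightarrow> real) \<Rightarrow> (('v \<Rightarrow> real) \<times> ('v \<Rightarrow> real)) set" where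
  "laplacian_2 c = op_closure ell2 ell2_ip ((\<lambda>\<xi>. (\<xi>, laplacian c \<xi>)) ` span (range delta))"

definition laplacian_2_sqrt :: "('v \<Rightarrow> 'v \<Rightarrow> real) \<Rightarrow> (('v \<Rightarrow> real) \<times> ('v \<Rightarrow> real)) set" where
  "laplacian_2_sqrt c = op_sqrt ell2 ell2_ip (laplacian_2 c)"

text \<open>The integral defining the inverse square root is evaluated at each vertex; it is required to
  converge there and to define a square-summable function.\<close>

definition laplacian_2_inv_sqrt ::
  "('v \<Rightarrow> 'v \<Rightarrow> real) \<Rightarrow> (('v \<Rightarrow> real) \<times> ('v \<Rightarrow> real)) set" where
  "laplacian_2_inv_sqrt c =
     {(\<xi>, \<eta>) \<in> ell2 \<times> ell2. \<forall>x.
        set_integrable lborel {0<..}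
          (\<lambda>t. t powr (- 1/2) * exp_neg ell2 ell2_ip (laplacian_2 c) t \<xi> x) \<and>
        \<eta> x = pi powr (- 1/2) *
          (LINT t:{0<..}|lborel. t powr (- 1/2) * exp_neg ell2 ell2_ip (laplacian_2 c) t \<xi> x)}"

definition Phi :: "('v \<Rightarrow> 'v \<Rightarrow> real) \<Rightarrow> 'v \<Rightarrow> ('v \<Rightarrow> real) \<Rightarrow> 'v fun_mod_const" where
  "Phi c ref \<xi> = (\<Sum>x | \<xi> x \<noteq> 0. \<xi> x *\<^sub>R wv c ref x)"

definition Phi_dom :: "('v \<Rightarrow> real) set" where
  "Phi_dom = span (range delta)"

definition M_matrix :: "('v \<Rightarrow> 'v \<Rightarrow> real) \<Rightarrow> 'v \<Rightarrow> 'v \<Rightarrow> 'v \<Rightarrow> real" where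
  "M_matrix c ref x y = energy_ip c (wv c ref x) (wv c ref y)"

definition M_form :: "('v \<Rightarrow> 'v \<Rightarrow> real) \<Rightarrow> 'v \<Rightarrow> ('v \<Rightarrow> real) \<Rightarrow> real" where
  "M_form c ref \<xi> = ell2_ip \<xi> (\<lambda>x. \<Sum>y | \<xi> y \<noteq> 0. M_matrix c ref x y * \<xi> y)"

definition qM_dom :: "('v \<Rightarrow> 'v \<Rightarrow> real) \<Rightarrow> 'v \<Rightarrow> ('v \<Rightarrow> real) set" where
  "qM_dom c ref = form_closure_dom ell2 ell2_ip Phi_dom (M_form c ref)"

definition qM :: "('v \<Rightarrow> 'v \<Rightarrow> real) \<Rightarrow> 'v \<Rightarrow> ('v \<Rightarrow> real) \<Rightarrow> real" where
  "qM c ref = form_closure ell2 ell2_ip Phi_dom (M_form c ref)"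

text \<open>The graph of the extension of \<open>Phi\<close> to \<open>qM_dom\<close>. It is kept as a relation because the limit is
  independent of the approximating sequence only if the form is closable, which fails when there
  are non-constant harmonic functions of finite energy.\<close>

definition Phi_tilde ::
  "('v \<Rightarrow> 'v \<Rightarrow> real) \<Rightarrow> 'v \<Rightarrow> (('v \<Rightarrow> real) \<times> 'v fun_mod_const) set" where
  "Phi_tilde c ref =
     {(\<xi>, u). \<xi> \<in> qM_dom c ref \<and>
        (\<exists>s. (\<forall>n. s n \<in> Phi_dom) \<and> (\<lambda>n. qM c ref (s n - \<xi>)) \<longlonglongrightarrow> 0 \<and>
           limitin (hs_top (energy_space c) (energy_ip c)) (\<lambda>n. Phi c ref (s n)) u sequentially)}"

end

theory Submission
  imports Defs "HOL-Probability.Probability"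
begin

text \<open>Let \<open>D2\<close> be the space of square-summable functions of finite energy and let
  \<open>\<iota> \<eta> = fclass \<eta>\<close>, an operator from \<open>ell2\<close> to the energy space with domain \<open>D2\<close>. The theorem
  holds because the two Laplacians are \<open>\<iota>\<^sup>* \<iota>\<close> and \<open>\<iota> \<iota>\<^sup>*\<close>.

  \<^item> The Laplacian on \<open>ell2\<close> is the operator \<open>\<iota>\<^sup>* \<iota>\<close> of the closed form \<open>energy\<close> on \<open>D2\<close>
    (\<open>laplacian_2_eq\<close>). By definition it is the closure of its restriction to finitely supported
    functions; the two agree because \<open>1 + laplacian\<close> is injective on \<open>ell2\<close> by a maximum principle.
    Therefore its square root has domain \<open>D2\<close>, and the range of the square root, which is the
    domain of the inverse square root, is the range of \<open>\<iota>\<^sup>*\<close> (\<open>Domain_G\<close>).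
  \<^item> The relation \<open>G\<close> below is the inverse of \<open>\<iota>\<^sup>*\<close>. It contains the graph of \<open>Phi\<close>, because \<open>W x\<close>
    represents evaluation at \<open>x\<close> on \<open>D2\<close> (\<open>W_reproducing\<close>), it is the closure of that graph
    (\<open>G_approx\<close>), and it coincides with \<open>Phi_tilde\<close> (\<open>Phi_tilde_eq\<close>). It is multivalued exactly when
    some non-zero class is orthogonal to all classes of \<open>D2\<close>.
  \<^item> The quadratic form of the Laplacian on the energy space is \<open>u \<mapsto> |\<iota>\<^sup>* u|\<^sup>2\<close>, and the domain of
    \<open>\<iota>\<^sup>*\<close> is the domain of its closure. The Friedrichs extension is thus the operator of this closed
    form (\<open>laplacian_F_eq\<close>), and that operator is \<open>\<iota> \<iota>\<^sup>*\<close> (\<open>FE_form_op_iff\<close>).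

  So \<open>u\<close> belongs to the domain of the Friedrichs extension if and only if \<open>\<iota>\<^sup>* u\<close> is defined and lies
  in \<open>D2\<close>; equivalently \<open>u\<close> is related by \<open>G\<close> to an element of \<open>D2\<close>, which then belongs to
  \<open>D2 \<inter> Domain G\<close>.

  Square roots, Friedrichs extensions and semigroups are specified by descriptions, so that existence
  and uniqueness have to be established in general. The tool is the continuous functional calculus of
  the resolvent \<open>R = (1 + A)\<^sup>-\<^sup>1\<close>, a positive contraction: its spectral measures solve a Hausdorff
  moment problem (\<open>spectral_measure_exists\<close>). It provides the square root and its uniqueness
  (\<open>root_unique\<close>), the semigroup (\<open>generator_T\<close>, with uniqueness in \<open>semigroup_unique\<close>) and the
  integral formula for the inverse square root (\<open>inverse_root_integral\<close>).\<close>

section \<open>Hilbert spaces on a carrier\<close>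

locale hilbert =
  fixes H :: "'a::real_vector set" and ip :: "'a \<Rightarrow> 'a \<Rightarrow> real"
  assumes subspace_H: "subspace H"
    and ip_add: "\<lbrakk>u \<in> H; v \<in> H; w \<in> H\<rbrakk> \<Longrightarrow> ip (u + v) w = ip u w + ip v w"
    and ip_scale: "\<lbrakk>u \<in> H; w \<in> H\<rbrakk> \<Longrightarrow> ip (r *\<^sub>R u) w = r * ip u w"
    and ip_commute: "\<lbrakk>u \<in> H; v \<in> H\<rbrakk> \<Longrightarrow> ip u v = ip v u"
    and ip_nonneg: "u \<in> H \<Longrightarrow> 0 \<le> ip u u"
    and ip_definite: "\<lbrakk>u \<in> H; ip u u = 0\<rbrakk> \<Longrightarrow> u = 0"
    and complete: "\<lbrakk>\<And>n. s n \<in> H;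
        \<And>e. 0 < e \<Longrightarrow> \<exists>N. \<forall>m\<ge>N. \<forall>n\<ge>N. ip (s m - s n) (s m - s n) < e\<rbrakk>
      \<Longrightarrow> \<exists>l\<in>H. (\<lambda>n::nat. ip (s n - l) (s n - l)) \<longlonglongrightarrow> 0"
begin

lemma H_0 [simp]: "0 \<in> H"
  and H_add [simp]: "u \<in> H \<Longrightarrow> v \<in> H \<Longrightarrow> u + v \<in> H"
  and H_diff [simp]: "u \<in> H \<Longrightarrow> v \<in> H \<Longrightarrow> u - v \<in> H"
  and H_neg [simp]: "u \<in> H \<Longrightarrow> - u \<in> H"
  and H_scale [simp]: "u \<in> H \<Longrightarrow> r *\<^sub>R u \<in> H"
  and H_sum [simp]: "(\<And>i. i \<in> I \<Longrightarrow> f i \<in> H) \<Longrightarrow> sum f I \<in> H"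
  using subspace_H
  by (auto intro: subspace_0 subspace_add subspace_diff subspace_neg subspace_scale subspace_sum)

lemma ip_add2: "\<lbrakk>u \<in> H; v \<in> H; w \<in> H\<rbrakk> \<Longrightarrow> ip w (u + v) = ip w u + ip w v"
  by (metis H_add ip_add ip_commute)

lemma ip_scale2: "\<lbrakk>u \<in> H; w \<in> H\<rbrakk> \<Longrightarrow> ip w (r *\<^sub>R u) = r * ip w u"
  by (metis H_scale ip_scale ip_commute)

lemma ip_neg: "\<lbrakk>u \<in> H; w \<in> H\<rbrakk> \<Longrightarrow> ip (- u) w = - ip u w"
  using ip_scale[of u w "-1"] by simp

lemma ip_neg2: "\<lbrakk>u \<in> H; w \<in> H\<rbrakk> \<Longrightarrow> ip w (- u) = - ip w u"
  using ip_scale2[of u w "-1"] by simp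

lemma ip_diff: "\<lbrakk>u \<in> H; v \<in> H; w \<in> H\<rbrakk> \<Longrightarrow> ip (u - v) w = ip u w - ip v w"
  using ip_add[of u "-v" w] by (simp add: ip_neg)

lemma ip_diff2: "\<lbrakk>u \<in> H; v \<in> H; w \<in> H\<rbrakk> \<Longrightarrow> ip w (u - v) = ip w u - ip w v"
  using ip_add2[of u "-v" w] by (simp add: ip_neg2)

lemma ip_0 [simp]: "w \<in> H \<Longrightarrow> ip 0 w = 0" "w \<in> H \<Longrightarrow> ip w 0 = 0"
  using ip_scale[of w w 0] ip_scale2[of w w 0] by simp_all

lemmas ip_simps = ip_add ip_add2 ip_scale ip_scale2 ip_neg ip_neg2 ip_diff ip_diff2

lemma ip_sum:
  assumes "\<And>i. i \<in> I \<Longrightarrow> f i \<in> H" "w \<in> H"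
  shows "ip (sum f I) w = (\<Sum>i\<in>I. ip (f i) w)"
  using assms by (induction I rule: infinite_finite_induct) (auto simp: ip_add)

definition nrm :: "'a \<Rightarrow> real" where "nrm u = sqrt (ip u u)"

lemma nrm_nonneg [simp]: "u \<in> H \<Longrightarrow> 0 \<le> nrm u"
  by (simp add: nrm_def ip_nonneg)

lemma nrm_sq: "u \<in> H \<Longrightarrow> (nrm u)\<^sup>2 = ip u u"
  by (simp add: nrm_def ip_nonneg)

lemma nrm_0 [simp]: "nrm 0 = 0"
  by (simp add: nrm_def)

lemma nrm_eq_0: "u \<in> H \<Longrightarrow> nrm u = 0 \<longleftrightarrow> u = 0"
  using ip_definite[of u] by (auto simp: nrm_def)

lemma nrm_scale: "u \<in> H \<Longrightarrow> nrm (r *\<^sub>R u) = \<bar>r\<bar> * nrm u"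
  by (simp add: nrm_def ip_simps real_sqrt_mult flip: mult.assoc)

lemma nrm_neg: "u \<in> H \<Longrightarrow> nrm (- u) = nrm u"
  by (simp add: nrm_def ip_simps)

lemma nrm_minus_commute: "u \<in> H \<Longrightarrow> v \<in> H \<Longrightarrow> nrm (u - v) = nrm (v - u)"
  using nrm_neg[of "u - v"] by simp

lemma ip_eqI: "\<lbrakk>u \<in> H; v \<in> H; \<And>w. w \<in> H \<Longrightarrow> ip u w = ip v w\<rbrakk> \<Longrightarrow> u = v"
  using ip_definite[of "u - v"] by (simp add: ip_simps)

lemma ip_square_add: "\<lbrakk>u \<in> H; v \<in> H\<rbrakk> \<Longrightarrow> ip (u + v) (u + v) = ip u u + 2 * ip u v + ip v v"
  by (simp add: ip_simps ip_commute[of v u])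

lemma ip_square_diff: "\<lbrakk>u \<in> H; v \<in> H\<rbrakk> \<Longrightarrow> ip (u - v) (u - v) = ip u u - 2 * ip u v + ip v v"
  by (simp add: ip_simps ip_commute[of v u])

lemma cauchy_schwarz_sq:
  assumes u: "u \<in> H" and v: "v \<in> H"
  shows "(ip u v)\<^sup>2 \<le> ip u u * ip v v"
proof (cases "v = 0")
  case False
  then have pos: "ip v v > 0"
    using ip_nonneg[OF v] ip_definite[OF v] by fastforce
  define r where "r = ip u v / ip v v"
  have "0 \<le> ip (u - r *\<^sub>R v) (u - r *\<^sub>R v)"
    using u v by (simp add: ip_nonneg)
  also have "\<dots> = ip u u - 2 * r * ip u v + r\<^sup>2 * ip v v"
    using u v by (simp add: ip_square_diff ip_scale ip_scale2 power2_eq_square)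
  also have "\<dots> = ip u u - (ip u v)\<^sup>2 / ip v v"
    using pos by (simp add: r_def power2_eq_square field_simps)
  finally show ?thesis
    using pos by (simp add: field_simps)
qed (use u in simp)

lemma cauchy_schwarz: "\<lbrakk>u \<in> H; v \<in> H\<rbrakk> \<Longrightarrow> \<bar>ip u v\<bar> \<le> nrm u * nrm v"
  using cauchy_schwarz_sq[of u v] unfolding nrm_def
  by (metis real_sqrt_abs real_sqrt_le_mono real_sqrt_mult)

lemma nrm_triangle: 
  assumes u: "u \<in> H" and v: "v \<in> H"
  shows "nrm (u + v) \<le> nrm u + nrm v"
proof (rule power2_le_imp_le)
  show "(nrm (u + v))\<^sup>2 \<le> (nrm u + nrm v)\<^sup>2"
    using cauchy_schwarz[OF u v] u v by (simp add: nrm_sq ip_square_add power2_sum)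
qed (use u v in simp)

lemma nrm_triangle3: "\<lbrakk>u \<in> H; v \<in> H; w \<in> H\<rbrakk> \<Longrightarrow> nrm (u - w) \<le> nrm (u - v) + nrm (v - w)"
  using nrm_triangle[of "u - v" "v - w"] by simp

lemma nrm_triangle_diff: "\<lbrakk>u \<in> H; v \<in> H\<rbrakk> \<Longrightarrow> \<bar>nrm u - nrm v\<bar> \<le> nrm (u - v)"
  using nrm_triangle3[of u v 0] nrm_triangle3[of v u 0] nrm_minus_commute[of u v] by simp

lemma ip_square_add_le: "\<lbrakk>u \<in> H; v \<in> H\<rbrakk> \<Longrightarrow> ip (u + v) (u + v) \<le> 2 * ip u u + 2 * ip v v"
  using ip_nonneg[of "u - v"] by (simp add: ip_square_add ip_square_diff)

subsection \<open>Convergence\<close>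

definition tends :: "('i \<Rightarrow> 'a) \<Rightarrow> 'a \<Rightarrow> 'i filter \<Rightarrow> bool" where
  "tends s l F \<longleftrightarrow> ((\<lambda>i. nrm (s i - l)) \<longlongrightarrow> 0) F"

lemma tends_sq:
  assumes "eventually (\<lambda>i. s i \<in> H) F" "l \<in> H"
  shows "tends s l F \<longleftrightarrow> ((\<lambda>i. ip (s i - l) (s i - l)) \<longlongrightarrow> 0) F"
proof
  show "((\<lambda>i. ip (s i - l) (s i - l)) \<longlongrightarrow> 0) F \<Longrightarrow> tends s l F"
    unfolding tends_def nrm_def using tendsto_real_sqrt by fastforce
  assume "tends s l F"
  then have "((\<lambda>i. (nrm (s i - l))\<^sup>2) \<longlongrightarrow> 0\<^sup>2) F"
    unfolding tends_def by (intro tendsto_intros)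
  moreover have "eventually (\<lambda>i. (nrm (s i - l))\<^sup>2 = ip (s i - l) (s i - l)) F"
    using assms(1) by eventually_elim (use assms(2) in \<open>simp add: nrm_sq\<close>)
  ultimately show "((\<lambda>i. ip (s i - l) (s i - l)) \<longlongrightarrow> 0) F"
    using Lim_transform_eventually by fastforce
qed

lemma tends_const: "l \<in> H \<Longrightarrow> tends (\<lambda>_. l) l F"
  by (simp add: tends_def)

lemma tends_squeeze:
  assumes "eventually (\<lambda>i. nrm (s i - l) \<le> f i) F" "(f \<longlongrightarrow> 0) F" "eventually (\<lambda>i. s i \<in> H) F" "l \<in> H"
  shows "tends s l F"
  unfolding tends_def
  by (rule tendsto_sandwich[OF _ assms(1) tendsto_const assms(2)])
     (use assms(3) in eventually_elim, use assms(4) in simp)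

lemma tends_add:
  assumes "tends s l F" "tends t m F" "eventually (\<lambda>i. s i \<in> H) F" "eventually (\<lambda>i. t i \<in> H) F"
    "l \<in> H" "m \<in> H"
  shows "tends (\<lambda>i. s i + t i) (l + m) F"
proof (rule tends_squeeze)
  show "((\<lambda>i. nrm (s i - l) + nrm (t i - m)) \<longlongrightarrow> 0) F"
    using assms(1,2) unfolding tends_def by (rule tendsto_add_zero)
  show "eventually (\<lambda>i. nrm (s i + t i - (l + m)) \<le> nrm (s i - l) + nrm (t i - m)) F"
    using assms(3,4)
  proof eventually_elim
    case (elim i)
    then show ?case using nrm_triangle[of "s i - l" "t i - m"] assms(5,6)
      by (simp add: algebra_simps)
  qed
  show "eventually (\<lambda>i. s i + t i \<in> H) F"
    using assms(3,4) by eventually_elim simp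
qed (use assms in simp)

lemma tends_scale:
  assumes "tends s l F" "eventually (\<lambda>i. s i \<in> H) F" "l \<in> H"
  shows "tends (\<lambda>i. r *\<^sub>R s i) (r *\<^sub>R l) F"
proof (rule tends_squeeze)
  show "((\<lambda>i. \<bar>r\<bar> * nrm (s i - l)) \<longlongrightarrow> 0) F"
    using assms(1) unfolding tends_def by (rule tendsto_mult_right_zero)
  show "eventually (\<lambda>i. nrm (r *\<^sub>R s i - r *\<^sub>R l) \<le> \<bar>r\<bar> * nrm (s i - l)) F"
    using assms(2) by eventually_elim (use assms(3) in \<open>simp add: nrm_scale flip: scaleR_diff_right\<close>)
  show "eventually (\<lambda>i. r *\<^sub>R s i \<in> H) F"
    using assms(2) by eventually_elim simp
qed (use assms in simp)

lemma tends_diff: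
  assumes "tends s l F" "tends t m F" "eventually (\<lambda>i. s i \<in> H) F" "eventually (\<lambda>i. t i \<in> H) F"
    "l \<in> H" "m \<in> H"
  shows "tends (\<lambda>i. s i - t i) (l - m) F"
proof -
  have "eventually (\<lambda>i. - 1 *\<^sub>R t i \<in> H) F"
    using assms(4) by eventually_elim simp
  with tends_add[OF assms(1) tends_scale[OF assms(2), of "-1"]] assms show ?thesis
    by simp
qed

lemma tends_nrm:
  assumes "tends s l F" "eventually (\<lambda>i. s i \<in> H) F" "l \<in> H"
  shows "((\<lambda>i. nrm (s i)) \<longlongrightarrow> nrm l) F"
proof -
  have "((\<lambda>i. nrm (s i) - nrm l) \<longlongrightarrow> 0) F"
  proof (rule tendsto_rabs_zero_cancel, rule tendsto_sandwich[OF _ _ tendsto_const])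
    show "((\<lambda>i. nrm (s i - l)) \<longlongrightarrow> 0) F" using assms(1) by (simp add: tends_def)
    show "eventually (\<lambda>i. \<bar>nrm (s i) - nrm l\<bar> \<le> nrm (s i - l)) F"
      using assms(2) by eventually_elim (rule nrm_triangle_diff[OF _ assms(3)])
  qed simp
  then show ?thesis by (simp add: LIM_zero_iff)
qed

lemma nrm_polarization:
  "\<lbrakk>u \<in> H; v \<in> H\<rbrakk> \<Longrightarrow> ((nrm (u + v))\<^sup>2 - (nrm (u - v))\<^sup>2) / 4 = ip u v"
  by (simp add: nrm_sq ip_square_add ip_square_diff)

lemma tends_ip:
  assumes "tends s l F" "tends t m F" "eventually (\<lambda>i. s i \<in> H) F" "eventually (\<lambda>i. t i \<in> H) F"
    "l \<in> H" "m \<in> H"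
  shows "((\<lambda>i. ip (s i) (t i)) \<longlongrightarrow> ip l m) F"
proof -
  have "((\<lambda>i. ((nrm (s i + t i))\<^sup>2 - (nrm (s i - t i))\<^sup>2) / 4) \<longlongrightarrow>
      ((nrm (l + m))\<^sup>2 - (nrm (l - m))\<^sup>2) / 4) F"
    using assms eventually_elim2[OF assms(3,4) H_add] eventually_elim2[OF assms(3,4) H_diff]
    by (intro tendsto_intros tends_nrm tends_add tends_diff) auto
  moreover have "eventually (\<lambda>i. ((nrm (s i + t i))\<^sup>2 - (nrm (s i - t i))\<^sup>2) / 4 = ip (s i) (t i)) F"
    using assms(3,4) by eventually_elim (simp add: nrm_polarization)
  ultimately show ?thesis
    using Lim_transform_eventually nrm_polarization[OF assms(5,6)] by force
qed

lemma tends_ip_const: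
  assumes "tends s l F" "eventually (\<lambda>i. s i \<in> H) F" "l \<in> H" "w \<in> H"
  shows "((\<lambda>i. ip (s i) w) \<longlongrightarrow> ip l w) F"
  using assms by (intro tends_ip tends_const) auto

lemma tends_unique:
  assumes "tends s l F" "tends s m F" "eventually (\<lambda>i. s i \<in> H) F" "l \<in> H" "m \<in> H" "F \<noteq> bot"
  shows "l = m"
proof (rule ip_eqI)
  show "ip l w = ip m w" if "w \<in> H" for w
    using tends_ip_const[OF assms(1,3,4) that] tends_ip_const[OF assms(2,3,5) that] assms(6)
    by (metis tendsto_unique)
qed (use assms in auto)

lemma cauchy_tends:
  assumes "\<And>n::nat. s n \<in> H"
    and "\<And>e. 0 < e \<Longrightarrow> \<exists>N. \<forall>m\<ge>N. \<forall>n\<ge>N. ip (s m - s n) (s m - s n) < e"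
  obtains l where "l \<in> H" "tends s l sequentially"
  using complete[OF assms] tends_sq[of s sequentially] assms(1) by auto

lemma tends_cauchy:
  assumes "\<And>n::nat. s n \<in> H" "l \<in> H" "tends s l sequentially" "0 < e"
  shows "\<exists>N. \<forall>m\<ge>N. \<forall>n\<ge>N. ip (s m - s n) (s m - s n) < e"
proof -
  have "(\<lambda>n. ip (s n - l) (s n - l)) \<longlonglongrightarrow> 0"
    using assms by (simp add: tends_sq)
  then have "eventually (\<lambda>n. ip (s n - l) (s n - l) < e / 4) sequentially"
    using \<open>0 < e\<close> by (intro order_tendstoD) auto
  then obtain N where N: "\<And>n. n \<ge> N \<Longrightarrow> ip (s n - l) (s n - l) < e / 4"
    by (auto simp: eventually_sequentially)
  have "ip (s m - s n) (s m - s n) < e" if "m \<ge> N" "n \<ge> N" for m n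
  proof -
    have "ip (s m - s n) (s m - s n) = ip ((s m - l) + - (s n - l)) ((s m - l) + - (s n - l))"
      by simp
    also have "\<dots> \<le> 2 * ip (s m - l) (s m - l) + 2 * ip (s n - l) (s n - l)"
      using ip_square_add_le[of "s m - l" "- (s n - l)"] assms(1,2) by (simp add: ip_neg ip_neg2 del: minus_diff_eq)
    also have "\<dots> < e" using N[OF that(1)] N[OF that(2)] by simp
    finally show ?thesis .
  qed
  then show ?thesis by blast
qed

text \<open>The basic variational argument. It minimises \<open>|T d|\<^sup>2 - 2 \<phi> d\<close>; by the parallelogram law the
  images of a minimising sequence form a Cauchy sequence, and its limit represents \<open>\<phi>\<close>.
  Riesz representation, density criteria and the description of ranges of adjoints all follow.\<close>

lemma dominated_functional:
  fixes T :: "'d::real_vector \<Rightarrow> 'a" and \<phi> :: "'d \<Rightarrow> real"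
  assumes D: "subspace D"
    and T: "\<And>d. d \<in> D \<Longrightarrow> T d \<in> H"
    and T_add: "\<And>d e. d \<in> D \<Longrightarrow> e \<in> D \<Longrightarrow> T (d + e) = T d + T e"
    and T_scale: "\<And>r d. d \<in> D \<Longrightarrow> T (r *\<^sub>R d) = r *\<^sub>R T d"
    and phi_add: "\<And>d e. d \<in> D \<Longrightarrow> e \<in> D \<Longrightarrow> \<phi> (d + e) = \<phi> d + \<phi> e"
    and phi_scale: "\<And>r d. d \<in> D \<Longrightarrow> \<phi> (r *\<^sub>R d) = r * \<phi> d"
    and bound: "\<And>d. d \<in> D \<Longrightarrow> \<bar>\<phi> d\<bar> \<le> K * nrm (T d)"
  obtains w s where "w \<in> H" "\<And>d. d \<in> D \<Longrightarrow> \<phi> d = ip w (T d)"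
    "\<And>n::nat. s n \<in> D" "tends (\<lambda>n. T (s n)) w sequentially"
proof -
  define F where "F d = ip (T d) (T d) - 2 * \<phi> d" for d
  define m where "m = Inf (F ` D)"
  have D_closed: "d + e \<in> D" "r *\<^sub>R d \<in> D" if "d \<in> D" "e \<in> D" for d e r
    using D that by (auto intro: subspace_add subspace_scale)
  have "0 \<in> D" using D by (rule subspace_0)
  have F_lower: "F d \<ge> - K\<^sup>2" if "d \<in> D" for d
  proof -
    have "0 \<le> (nrm (T d) - K)\<^sup>2" by simp
    also have "\<dots> = ip (T d) (T d) - 2 * (K * nrm (T d)) + K\<^sup>2"
      using T[OF that] by (simp add: power2_diff nrm_sq)
    also have "\<dots> \<le> F d + K\<^sup>2"
      using bound[OF that] by (simp add: F_def)
    finally show ?thesis by simp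
  qed
  have bdd: "bdd_below (F ` D)"
    using F_lower by (intro bdd_belowI[of _ "- K\<^sup>2"]) auto
  have m_le: "m \<le> F d" if "d \<in> D" for d
    unfolding m_def using bdd that by (intro cInf_lower) auto
  have ex: "\<exists>d\<in>D. F d < m + 1 / Suc n" for n
  proof -
    have "Inf (F ` D) < m + 1 / Suc n" unfolding m_def by simp
    then show ?thesis using cInf_lessD[of "F ` D" "m + 1 / Suc n"] \<open>0 \<in> D\<close> by auto
  qed
  then obtain s where s: "\<And>n. s n \<in> D" "\<And>n. F (s n) < m + 1 / Suc n"
    by metis
  \<comment> \<open>The parallelogram law at the midpoint of two almost minimal points.\<close>
  have par: "ip (T (s j) - T (s k)) (T (s j) - T (s k)) \<le> 2 / Suc j + 2 / Suc k" for j k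
  proof -
    let ?d = "(1/2) *\<^sub>R (s j + s k)"
    have d: "?d \<in> D" using s D_closed by blast
    have Td: "T ?d = (1/2) *\<^sub>R (T (s j) + T (s k))" "\<phi> ?d = (\<phi> (s j) + \<phi> (s k)) / 2"
      using s D_closed by (simp_all add: T_scale T_add phi_scale phi_add)
    have "4 * ip (T ?d) (T ?d) = ip (T (s j) + T (s k)) (T (s j) + T (s k))"
      unfolding Td using s T by (simp add: ip_scale ip_scale2)
    then have "4 * F ?d = ip (T (s j) + T (s k)) (T (s j) + T (s k)) - 4 * (\<phi> (s j) + \<phi> (s k))"
      unfolding F_def Td(2) by (simp add: field_simps)
    also have "\<dots> = 2 * F (s j) + 2 * F (s k) - ip (T (s j) - T (s k)) (T (s j) - T (s k))"
      using s T by (simp add: F_def ip_square_add ip_square_diff)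
    finally show ?thesis
      using m_le[OF d] s(2)[of j] s(2)[of k] by simp
  qed
  obtain w where w: "w \<in> H" "tends (\<lambda>n. T (s n)) w sequentially"
  proof (rule cauchy_tends)
    show "T (s n) \<in> H" for n using s T by blast
    fix e :: real assume "0 < e"
    obtain N where N: "4 / e < real N" using reals_Archimedean2 by blast
    have small: "2 / Suc j < e / 2" if "j \<ge> N" for j
    proof -
      have "4 / e < real (Suc j)" using N that by linarith
      then show ?thesis using \<open>0 < e\<close> by (simp add: field_simps)
    qed
    have "ip (T (s j) - T (s k)) (T (s j) - T (s k)) < e" if "j \<ge> N" "k \<ge> N" for j k
      using par[of j k] small[OF that(1)] small[OF that(2)] by linarith
    then show "\<exists>N. \<forall>j\<ge>N. \<forall>k\<ge>N. ip (T (s j) - T (s k)) (T (s j) - T (s k)) < e" by blast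
  qed auto
  have "\<phi> d = ip w (T d)" if d: "d \<in> D" for d
  proof -
    define a where "a = ip w (T d) - \<phi> d"
    define b where "b = ip (T d) (T d)"
    have ineq: "0 \<le> 2 * r * a + r\<^sup>2 * b" for r
    proof -
      have step: "0 \<le> 1 / Suc n + 2 * r * (ip (T (s n)) (T d) - \<phi> d) + r\<^sup>2 * b" for n
      proof -
        have "m \<le> F (s n + r *\<^sub>R d)" using m_le s d D_closed by blast
        also have "\<dots> = F (s n) + 2 * r * (ip (T (s n)) (T d) - \<phi> d) + r\<^sup>2 * b"
          using s d D_closed T unfolding F_def b_def
          by (simp add: T_add T_scale phi_add phi_scale ip_square_add ip_scale ip_scale2
              power2_eq_square algebra_simps)
        finally show ?thesis using s(2)[of n] by linarith
      qed
      have "(\<lambda>n. ip (T (s n)) (T d)) \<longlonglongrightarrow> ip w (T d)"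
        using w s T d by (intro tends_ip_const) auto
      then have "(\<lambda>n. 1 / Suc n + 2 * r * (ip (T (s n)) (T d) - \<phi> d) + r\<^sup>2 * b)
          \<longlonglongrightarrow> 0 + 2 * r * (ip w (T d) - \<phi> d) + r\<^sup>2 * b"
        by (intro tendsto_intros LIMSEQ_Suc[OF lim_1_over_n])
      then show ?thesis
        using LIMSEQ_le_const[of _ _ 0] step unfolding a_def by fastforce
    qed
    have "a = 0"
    proof (rule ccontr)
      assume "a \<noteq> 0"
      have "b \<ge> 0" using T[OF d] by (simp add: b_def ip_nonneg)
      have "2 * (- a / (b + 1)) * a + (- a / (b + 1))\<^sup>2 * b = - (a\<^sup>2 * (b + 2)) / (b + 1)\<^sup>2"
        using \<open>b \<ge> 0\<close> by (simp add: field_simps power2_eq_square add_nonneg_eq_0_iff)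
      moreover have "\<dots> < 0"
        using \<open>a \<noteq> 0\<close> \<open>b \<ge> 0\<close> by (simp add: divide_neg_pos mult_pos_pos)
      ultimately show False using ineq[of "- a / (b + 1)"] by linarith
    qed
    then show ?thesis by (simp add: a_def)
  qed
  then show thesis using that w s(1) by blast
qed

corollary riesz:
  assumes "\<And>u v. u \<in> H \<Longrightarrow> v \<in> H \<Longrightarrow> \<phi> (u + v) = \<phi> u + \<phi> v"
    and "\<And>r u. u \<in> H \<Longrightarrow> \<phi> (r *\<^sub>R u) = r * \<phi> u"
    and "\<And>u. u \<in> H \<Longrightarrow> \<bar>\<phi> u\<bar> \<le> K * nrm u"
  obtains w where "w \<in> H" "\<And>u. u \<in> H \<Longrightarrow> \<phi> u = ip w u"
proof -
  obtain w where "w \<in> H" "\<And>u. u \<in> H \<Longrightarrow> \<phi> u = ip w u"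
    by (rule dominated_functional[of H "\<lambda>u. u" \<phi> K]) (use assms subspace_H in auto)
  then show thesis by (rule that)
qed

corollary dense_of_trivial_complement:
  assumes D: "subspace D" "D \<subseteq> H"
    and triv: "\<And>z. \<lbrakk>z \<in> H; \<And>d. d \<in> D \<Longrightarrow> ip z d = 0\<rbrakk> \<Longrightarrow> z = 0"
    and u: "u \<in> H"
  obtains s where "\<And>n::nat. s n \<in> D" "tends s u sequentially"
proof -
  obtain w s where w: "w \<in> H" "\<And>d. d \<in> D \<Longrightarrow> ip u d = ip w d" 
    and s: "\<And>n::nat. s n \<in> D" "tends s w sequentially"
    using dominated_functional[of D "\<lambda>d. d" "ip u" "nrm u"] D u cauchy_schwarz[OF u]
    by (auto simp: ip_simps subset_iff)
  have "u - w = 0"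
    using D u w by (intro triv) (auto simp: ip_diff subset_iff)
  then have "w = u" by simp
  with s that show thesis by blast
qed

end

text \<open>The topology used for operators is the one of the norm. The two extra assumptions concern
  arbitrary vectors, because the metric is a total function.\<close>

locale hilbert_top = hilbert +
  assumes ip_square_nonneg: "0 \<le> ip u u"
    and ip_square_neg: "ip (- u) (- u) = ip u u"
begin

lemma metric: "Metric_space H (\<lambda>u v. nrm (u - v))"
proof
  show "0 \<le> nrm (x - y)" for x y
    by (simp add: nrm_def ip_square_nonneg)
  show "nrm (x - y) = nrm (y - x)" for x y
    using ip_square_neg[of "x - y"] by (simp add: nrm_def)
  show "nrm (x - y) = 0 \<longleftrightarrow> x = y" if "x \<in> H" "y \<in> H" for x y
    using that nrm_eq_0[of "x - y"] by simp
  show "nrm (x - z) \<le> nrm (x - y) + nrm (y - z)" if "x \<in> H" "y \<in> H" "z \<in> H" for x y z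
    using that by (rule nrm_triangle3)
qed

lemma hs_top_eq: "hs_top H ip = Metric_space.mtopology H (\<lambda>u v. nrm (u - v))"
  by (simp add: hs_top_def nrm_def)

lemma topspace_hs_top [simp]: "topspace (hs_top H ip) = H"
  unfolding hs_top_eq by (rule Metric_space.topspace_mtopology[OF metric])

lemma limitin_hs_top:
  "limitin (hs_top H ip) s l F \<longleftrightarrow> l \<in> H \<and> (\<forall>\<^sub>F i in F. s i \<in> H) \<and> tends s l F"
proof -
  have eq: "limitin (hs_top H ip) s l F \<longleftrightarrow>
      l \<in> H \<and> (\<forall>e>0. \<forall>\<^sub>F i in F. s i \<in> H \<and> nrm (s i - l) < e)"
    unfolding hs_top_eq by (simp add: Metric_space.limitin_metric[OF metric])
  have pos: "\<bar>nrm u\<bar> = nrm u" for u by (simp add: nrm_def ip_square_nonneg)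
  show ?thesis
    unfolding eq tends_def tendsto_iff dist_real_def eventually_conj_iff
    by (auto simp: pos eventually_conj_iff intro: zero_less_one)
qed

lemma closure_of_hs_top:
  "u \<in> hs_top H ip closure_of A \<longleftrightarrow>
     u \<in> H \<and> (\<exists>s. (\<forall>n::nat. s n \<in> A \<and> s n \<in> H) \<and> tends s u sequentially)"
proof -
  have "u \<in> hs_top H ip closure_of A \<longleftrightarrow>
      (\<exists>s. range s \<subseteq> A \<inter> H \<and> limitin (hs_top H ip) s u sequentially)"
    unfolding hs_top_eq by (auto simp: Metric_space.closure_of_sequentially[OF metric]
        Metric_space.limitin_metric[OF metric])
  also have "\<dots> \<longleftrightarrow> u \<in> H \<and> (\<exists>s. (\<forall>n. s n \<in> A \<and> s n \<in> H) \<and> tends s u sequentially)"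
    unfolding limitin_hs_top by (auto simp: image_subset_iff subset_iff)
  finally show ?thesis .
qed

lemma op_closure_iff:
  "(u, w) \<in> op_closure H ip A \<longleftrightarrow> u \<in> H \<and> w \<in> H \<and>
     (\<exists>s t. (\<forall>n::nat. (s n, t n) \<in> A \<and> s n \<in> H \<and> t n \<in> H) \<and>
        tends s u sequentially \<and> tends t w sequentially)"
  (is "?L \<longleftrightarrow> ?R")
proof
  note closure = op_closure_def in_closure_of hs_top_eq
  assume L: ?L
  interpret Metric_space H "\<lambda>u v. nrm (u - v)" by (rule metric)
  have uw: "u \<in> H" "w \<in> H"
    using L by (auto simp: op_closure_def in_closure_of)
  have "\<exists>a b. (a, b) \<in> A \<and> a \<in> mball u (1 / Suc n) \<and> b \<in> mball w (1 / Suc n)" for n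
  proof -
    have "openin (prod_topology mtopology mtopology) (mball u (1 / Suc n) \<times> mball w (1 / Suc n))"
      by (simp add: openin_prod_Times_iff)
    moreover have "(u, w) \<in> mball u (1 / Suc n) \<times> mball w (1 / Suc n)"
      using uw by simp
    ultimately have "\<exists>p\<in>A. p \<in> mball u (1 / Suc n) \<times> mball w (1 / Suc n)"
      using L unfolding op_closure_def in_closure_of hs_top_eq by meson
    then show ?thesis unfolding Bex_def mem_Times_iff by (metis prod.collapse)
  qed
  then obtain s t where st: "\<And>n. (s n, t n) \<in> A" "\<And>n. s n \<in> mball u (1 / Suc n)"
    "\<And>n. t n \<in> mball w (1 / Suc n)"
    by metis
  have st_H: "s n \<in> H" "t n \<in> H" for n using st by (auto simp: mball_def)
  have "tends s u sequentially" "tends t w sequentially"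
    using st uw st_H
    by (auto intro!: tends_squeeze[where f = "\<lambda>n. 1 / Suc n"] eventuallyI LIMSEQ_Suc[OF lim_1_over_n] less_imp_le
        simp: mball_def nrm_minus_commute)
  then show ?R using uw st st_H by blast
next
  assume ?R
  then obtain s t where uw: "u \<in> H" "w \<in> H"
    and st: "\<And>n. (s n, t n) \<in> A" "\<And>n. s n \<in> H" "\<And>n. t n \<in> H"
    and lim: "tends s u sequentially" "tends t w sequentially"
    by blast
  have "limitin (prod_topology (hs_top H ip) (hs_top H ip)) (\<lambda>n. (s n, t n)) (u, w) sequentially"
    using uw st lim by (simp add: limitin_pairwise limitin_hs_top o_def)
  then show ?L
    unfolding op_closure_def in_closure_of limitin_def eventually_sequentially using st(1) by fastforce
qed

end

section \<open>The functional calculus of a positive contraction\<close>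

locale pos_contraction = hilbert +
  fixes R :: "'a \<Rightarrow> 'a"
  assumes R_in [simp]: "u \<in> H \<Longrightarrow> R u \<in> H"
    and R_add: "\<lbrakk>u \<in> H; v \<in> H\<rbrakk> \<Longrightarrow> R (u + v) = R u + R v"
    and R_scale: "u \<in> H \<Longrightarrow> R (r *\<^sub>R u) = r *\<^sub>R R u"
    and R_sym: "\<lbrakk>u \<in> H; v \<in> H\<rbrakk> \<Longrightarrow> ip (R u) v = ip u (R v)"
    and R_pos: "u \<in> H \<Longrightarrow> 0 \<le> ip (R u) u"
    and R_le: "u \<in> H \<Longrightarrow> ip (R u) u \<le> ip u u"
begin

lemma R_0 [simp]: "R 0 = 0"
  using R_scale[of 0 0] by simp

lemma R_diff: "\<lbrakk>u \<in> H; v \<in> H\<rbrakk> \<Longrightarrow> R (u - v) = R u - R v"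
  using R_add[of u "-v"] R_scale[of v "-1"] by simp

subsection \<open>Polynomials of the operator\<close>

definition pop :: "real poly \<Rightarrow> 'a \<Rightarrow> 'a" where
  "pop p u = (\<Sum>i\<le>degree p. coeff p i *\<^sub>R (R ^^ i) u)"

lemma Rpow_in [simp]: "u \<in> H \<Longrightarrow> (R ^^ i) u \<in> H"
  by (induction i) auto

lemma pop_eq_sum:
  assumes "degree p \<le> n"
  shows "pop p u = (\<Sum>i\<le>n. coeff p i *\<^sub>R (R ^^ i) u)"
  unfolding pop_def using assms
  by (intro sum.mono_neutral_left) (auto simp: coeff_eq_0)

lemma pop_in [simp]: "u \<in> H \<Longrightarrow> pop p u \<in> H"
  unfolding pop_def by (intro H_sum H_scale) auto

lemma R_sum: "(\<And>i. i \<in> I \<Longrightarrow> f i \<in> H) \<Longrightarrow> R (sum f I) = (\<Sum>i\<in>I. R (f i))"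
  by (induction I rule: infinite_finite_induct) (auto simp: R_add)

lemma pop_pCons: "u \<in> H \<Longrightarrow> pop (pCons a p) u = a *\<^sub>R u + R (pop p u)"
proof -
  assume u: "u \<in> H"
  have "pop (pCons a p) u = (\<Sum>i\<le>Suc (degree p). coeff (pCons a p) i *\<^sub>R (R ^^ i) u)"
    by (rule pop_eq_sum) (simp add: degree_pCons_le)
  also have "\<dots> = a *\<^sub>R u + (\<Sum>i\<le>degree p. R (coeff p i *\<^sub>R (R ^^ i) u))"
    using u by (subst sum.atMost_Suc_shift) (simp add: R_scale)
  finally show ?thesis
    using u by (simp add: pop_def R_sum)
qed

lemma pop_0 [simp]: "pop 0 u = 0"
  by (simp add: pop_def)

lemma pop_add: "u \<in> H \<Longrightarrow> pop (p + q) u = pop p u + pop q u"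
  by (induction p q rule: poly_induct2) (simp_all add: pop_pCons R_add scaleR_add_left ac_simps)

lemma pop_smult: "u \<in> H \<Longrightarrow> pop (smult r p) u = r *\<^sub>R pop p u"
  by (induction p) (simp_all add: pop_pCons R_scale scaleR_add_right)

lemma pop_minus: "u \<in> H \<Longrightarrow> pop (- p) u = - pop p u"
  using pop_smult[of u "-1" p] by simp

lemma pop_diff: "u \<in> H \<Longrightarrow> pop (p - q) u = pop p u - pop q u"
  using pop_add[of u p "-q"] by (simp add: pop_minus)

lemma pop_mult: "u \<in> H \<Longrightarrow> pop (p * q) u = pop p (pop q u)"
  by (induction p) (simp_all add: pop_pCons pop_add pop_smult)

lemma pop_1 [simp]: "u \<in> H \<Longrightarrow> pop 1 u = u"
  using pop_pCons[of u 1 0] by (simp add: one_pCons)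

lemma pop_X: "u \<in> H \<Longrightarrow> pop [:0, 1:] u = R u"
  by (simp add: pop_pCons)

lemma pop_add2: "u \<in> H \<Longrightarrow> v \<in> H \<Longrightarrow> pop p (u + v) = pop p u + pop p v"
  by (induction p) (simp_all add: pop_pCons R_add scaleR_add_right ac_simps)

lemma pop_scale2: "u \<in> H \<Longrightarrow> pop p (r *\<^sub>R u) = r *\<^sub>R pop p u"
  by (induction p) (simp_all add: pop_pCons R_scale scaleR_add_right mult.commute)

lemma pop_diff2: "u \<in> H \<Longrightarrow> v \<in> H \<Longrightarrow> pop p (u - v) = pop p u - pop p v"
  using pop_add2[of u "-v" p] pop_scale2[of v p "-1"] by simp

lemma R_pop: "u \<in> H \<Longrightarrow> R (pop p u) = pop p (R u)"
  by (induction p) (simp_all add: pop_pCons R_add R_scale)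

lemma pop_sym: "u \<in> H \<Longrightarrow> v \<in> H \<Longrightarrow> ip (pop p u) v = ip u (pop p v)"
proof (induction p arbitrary: v)
  case (pCons a p)
  then have "ip (R (pop p u)) v = ip u (pop p (R v))" by (simp add: R_sym)
  then show ?case using pCons by (simp add: pop_pCons ip_simps R_pop)
qed simp

lemma pop_sum: "u \<in> H \<Longrightarrow> pop (sum f I) u = (\<Sum>i\<in>I. pop (f i) u)"
  by (induction I rule: infinite_finite_induct) (simp_all add: pop_add)

end

subsection \<open>The spectral measure of a vector\<close>

lemma power_eq_square_or:
  fixes P :: "'r::comm_semiring_1"
  shows "\<exists>q. P ^ n = q ^ 2 \<or> P ^ n = P * q ^ 2"
proof (cases "even n")
  case True
  then obtain j where "n = 2 * j" by blast
  then show ?thesis by (metis power_mult mult.commute)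
next
  case False
  then obtain j where "n = Suc (2 * j)" by (auto elim: oddE)
  then show ?thesis by (metis power_Suc power_mult mult.commute)
qed

lemma power_product_squares:
  fixes X Y :: "'r::comm_semiring_1"
  shows "\<exists>q. X ^ k * Y ^ m = 1 * q ^ 2 \<or> X ^ k * Y ^ m = X * q ^ 2 \<or>
    X ^ k * Y ^ m = Y * q ^ 2 \<or> X ^ k * Y ^ m = X * Y * q ^ 2"
proof -
  obtain a b where "X ^ k = a ^ 2 \<or> X ^ k = X * a ^ 2" "Y ^ m = b ^ 2 \<or> Y ^ m = Y * b ^ 2"
    using power_eq_square_or by metis
  then show ?thesis
    by (intro exI[of _ "a * b"]) (auto simp: power_mult_distrib ac_simps)
qed

lemma split_unit:
  fixes X Y :: "'r::comm_ring_1"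
  assumes "X + Y = 1"
  shows "X * Y * q ^ 2 = Y * (X * q) ^ 2 + X * (Y * q) ^ 2"
proof -
  have "X * Y * q ^ 2 = X * Y * q ^ 2 * (X + Y)" using assms by simp
  also have "\<dots> = Y * (X * q) ^ 2 + X * (Y * q) ^ 2" by (simp add: algebra_simps power2_eq_square)
  finally show ?thesis .
qed

context pos_contraction
begin

text \<open>Products of powers of \<open>R\<close> and \<open>1 - R\<close> are non-negative operators: up to the square of a
  symmetric operator they are \<open>1\<close>, \<open>R\<close>, \<open>1 - R\<close> or \<open>R (1 - R) = R (1 - R)\<^sup>2 + (1 - R) R\<^sup>2\<close>.\<close>

lemma pop_bernstein_nonneg:
  assumes u: "u \<in> H"
  shows "0 \<le> ip (pop ([:0, 1:] ^ k * [:1, -1:] ^ m) u) u"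
proof -
  let ?X = "[:0, 1:] :: real poly" and ?Y = "[:1, -1:] :: real poly"
  have sq: "ip (pop (p * q ^ 2) u) u = ip (pop p (pop q u)) (pop q u)" for p q
  proof -
    have "p * q ^ 2 = q * (p * q)" by (simp add: power2_eq_square)
    then have "pop (p * q ^ 2) u = pop q (pop p (pop q u))"
      using u by (simp only: pop_mult pop_in)
    then show ?thesis using u by (simp add: pop_sym)
  qed
  have 1: "0 \<le> ip (pop (1 * q ^ 2) u) u" for q
    unfolding sq using u by (simp add: ip_nonneg)
  have X: "0 \<le> ip (pop (?X * q ^ 2) u) u" for q
    unfolding sq using u by (simp add: pop_X R_pos)
  have Y: "0 \<le> ip (pop (?Y * q ^ 2) u) u" for q
  proof -
    have "ip (pop ?Y (pop q u)) (pop q u) = ip (pop q u) (pop q u) - ip (R (pop q u)) (pop q u)"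
      using u R_scale[of "pop q u" "-1"] by (simp add: pop_pCons ip_simps)
    then show ?thesis unfolding sq using R_le[of "pop q u"] u by simp
  qed
  have XY: "0 \<le> ip (pop (?X * ?Y * q ^ 2) u) u" for q
  proof -
    have "?X + ?Y = 1" by (simp add: one_pCons)
    from split_unit[OF this] show ?thesis
      using X[of "?Y * q"] Y[of "?X * q"] u by (simp only: pop_add ip_add pop_in add_nonneg_nonneg)
  qed
  consider q where "?X ^ k * ?Y ^ m = 1 * q ^ 2" | q where "?X ^ k * ?Y ^ m = ?X * q ^ 2"
    | q where "?X ^ k * ?Y ^ m = ?Y * q ^ 2" | q where "?X ^ k * ?Y ^ m = ?X * ?Y * q ^ 2"
    using power_product_squares[of ?X k ?Y m] by metis
  then show ?thesis
    by cases (simp_all only: 1 X Y XY)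
qed

end

text \<open>The factorial moments of the binomial distribution, as an identity of polynomials.\<close>

lemma binomial_factorial_moment:
  fixes X Y :: "'r::comm_ring_1"
  assumes XY: "X + Y = 1" and j: "j \<le> n"
  shows "(\<Sum>k\<le>n. of_nat (k choose j) * of_nat (n choose k) * X ^ k * Y ^ (n - k)) = of_nat (n choose j) * X ^ j"
proof -
  have "(\<Sum>k\<le>n. of_nat (k choose j) * of_nat (n choose k) * X ^ k * Y ^ (n - k)) =
      (\<Sum>k\<in>{j..n}. of_nat (k choose j) * of_nat (n choose k) * X ^ k * Y ^ (n - k))"
    by (rule sum.mono_neutral_right) (auto simp: binomial_eq_0)
  also have "\<dots> = (\<Sum>i\<le>n - j. of_nat ((i + j) choose j) * of_nat (n choose (i + j)) * X ^ (i + j) * Y ^ (n - (i + j)))"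
    by (rule sum.reindex_bij_witness[of _ "\<lambda>i. i + j" "\<lambda>k. k - j"]) (use j in auto)
  also have "\<dots> = (\<Sum>i\<le>n - j. of_nat (n choose j) * X ^ j * (of_nat ((n - j) choose i) * X ^ i * Y ^ (n - j - i)))"
  proof (rule sum.cong)
    fix i assume "i \<in> {..n - j}"
    then have le: "i + j \<le> n" using j by auto
    have "(n choose (i + j)) * ((i + j) choose j) = (n choose j) * ((n - j) choose i)"
      using choose_mult[OF _ le, of j] by simp
    then have "of_nat ((i + j) choose j) * of_nat (n choose (i + j)) =
        (of_nat (n choose j) * of_nat ((n - j) choose i) :: 'r)"
      by (metis of_nat_mult mult.commute)
    then show "of_nat ((i + j) choose j) * of_nat (n choose (i + j)) * X ^ (i + j) * Y ^ (n - (i + j)) =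
        of_nat (n choose j) * X ^ j * (of_nat ((n - j) choose i) * X ^ i * Y ^ (n - j - i))"
      by (simp add: power_add mult_ac diff_diff_add add.commute)
  qed simp
  also have "\<dots> = of_nat (n choose j) * X ^ j * (X + Y) ^ (n - j)"
    by (simp add: binomial_ring sum_distrib_left)
  finally show ?thesis by (simp add: XY)
qed

text \<open>The price of replacing factorial moments by powers.\<close>

lemma choose_ratio_bound:
  assumes k: "k \<le> n" and n: "j < n"
  shows "\<bar>(real k / real n) ^ j - real (k choose j) / real (n choose j)\<bar> \<le> (real j)\<^sup>2 / real n"
proof (cases "j \<le> k")
  case True
  have "real (k choose j) / real (n choose j) = (\<Prod>i<j. real (k - i) / real (n - i))"
    using True n by (simp add: binomial_altdef_of_nat prod_dividef atLeast0LessThan)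
  then have "\<bar>(real k / real n) ^ j - real (k choose j) / real (n choose j)\<bar> =
      norm ((\<Prod>i<j. real k / real n) - (\<Prod>i<j. real (k - i) / real (n - i)))"
    by simp
  also have "\<dots> \<le> (\<Sum>i<j. norm (real k / real n - real (k - i) / real (n - i)))"
    using k n by (intro norm_prod_diff) (auto simp: divide_le_eq_1)
  also have "\<dots> \<le> (\<Sum>i<j. real j / real n)"
  proof (rule sum_mono)
    fix i assume i: "i \<in> {..<j}"
    have pos: "real n - real i > 0" "real n > 0" using i n by auto
    have "real k / real n - real (k - i) / real (n - i) = real i * (real n - real k) / (real n * (real n - real i))"
      using i True n k pos by (simp add: of_nat_diff field_simps)
    moreover have "\<dots> \<le> real i * (real n - real i) / (real n * (real n - real i))"
      using i True k n pos by (intro divide_right_mono mult_left_mono) auto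
    moreover have "\<dots> = real i / real n"
      using pos by simp
    moreover have "0 \<le> real i * (real n - real k) / (real n * (real n - real i))"
      using pos k by simp
    moreover have "real i / real n \<le> real j / real n" using i by (simp add: divide_right_mono)
    ultimately show "norm (real k / real n - real (k - i) / real (n - i)) \<le> real j / real n"
      unfolding real_norm_def by (metis abs_of_nonneg order_trans)
  qed
  also have "\<dots> = (real j)\<^sup>2 / real n" by (simp add: power2_eq_square)
  finally show ?thesis .
next
  case False
  then have j: "k < j" "j > 0" by auto
  have "(real k / real n) ^ j \<le> (real k / real n) ^ 1"
    using j k n by (intro power_decreasing) (auto simp: divide_le_eq_1)
  also have "\<dots> \<le> real j ^ 2 / real n"
  proof -
    have "real k \<le> real j * real j" using j
      by (metis less_imp_le le_square le_trans of_nat_le_iff of_nat_mult)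
    then show ?thesis by (simp add: divide_right_mono power2_eq_square)
  qed
  finally show ?thesis using j by (simp add: binomial_eq_0)
qed

context pos_contraction
begin

text \<open>Hausdorff's solution of the moment problem: the Bernstein weights of \<open>u\<close> are probability
  measures on the points \<open>k / n\<close> whose moments converge to \<open>\<langle>R\<^sup>j u, u\<rangle> / |u|\<^sup>2\<close>, and Helly's selection
  theorem provides a weak limit. The map \<open>clamp\<close> moves the limit to the unit interval
  without a discussion of its support.\<close>

lemma spectral_measure_exists:
  assumes u: "u \<in> H"
  shows "\<exists>M. finite_measure M \<and> sets M = sets (restrict_space borel {0..1::real}) \<and>
    (\<forall>p. ip (pop p u) u = (\<integral>x. poly p x \<partial>M))"
proof (cases "u = 0")
  case True
  have "pop p 0 = 0" for p using pop_scale2[of 0 p 0] by simp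
  then show ?thesis
    using True by (intro exI[of _ "null_measure (restrict_space borel {0..1})"])
      (auto intro!: finite_measureI)
next
  case False
  define c where "c = ip u u"
  have c: "c > 0" using ip_nonneg[OF u] ip_definite[OF u] False by (force simp: c_def)
  define mom where "mom j = ip (pop ([:0, 1:] ^ j) u) u / c" for j
  define a where "a n k = real (n choose k) * ip (pop ([:0, 1:] ^ k * [:1, -1:] ^ (n - k)) u) u / c" for n k
  have a_nonneg: "a n k \<ge> 0" for n k
    unfolding a_def using pop_bernstein_nonneg[OF u] c by simp
  have fact_mom: "(\<Sum>k\<le>n. real (k choose j) * a n k) = real (n choose j) * mom j" if "j \<le> n" for j n
  proof -
    have of_nat_pop: "pop (of_nat m * p) u = real m *\<^sub>R pop p u" for m p
      using pop_smult[OF u, of "real m" p] by (simp add: of_nat_poly)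
    have "(\<Sum>k\<le>n. real (k choose j) * a n k) * c =
        ip (pop (\<Sum>k\<le>n. of_nat (k choose j) * (of_nat (n choose k) * ([:0, 1:] ^ k * [:1, -1:] ^ (n - k)))) u) u"
      using u c by (simp add: pop_sum ip_sum of_nat_pop ip_scale a_def sum_distrib_right mult.assoc)
    also have "(\<Sum>k\<le>n. of_nat (k choose j) * (of_nat (n choose k) * ([:0, 1:] ^ k * [:1, -1:] ^ (n - k)))) =
        of_nat (n choose j) * ([:0, 1:] :: real poly) ^ j"
      using binomial_factorial_moment[of "[:0, 1:] :: real poly" "[:1, -1:]" j n] that
      by (simp add: one_pCons mult.assoc)
    finally show ?thesis
      using u c by (simp add: of_nat_pop ip_scale mom_def field_simps)
  qed
  have a_sum: "(\<Sum>k\<le>n. a n k) = 1" for n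
    using fact_mom[of 0 n] c u by (simp add: mom_def c_def)
  define \<mu> where "\<mu> n = distr (point_measure {..n} (a n)) borel (\<lambda>k. real k / real n)" for n
  have \<mu>_prob: "prob_space (point_measure {..n} (a n))" for n
    by (rule prob_spaceI) (use a_sum a_nonneg in \<open>simp add: space_point_measure emeasure_point_measure_finite sum_ennreal\<close>)
  have \<mu>_meas: "(\<lambda>k. real k / real n) \<in> borel_measurable (point_measure {..n} (a n))" for n
    by (auto simp: measurable_def space_point_measure sets_point_measure)
  have \<mu>_real: "real_distribution (\<mu> n)" for n
  proof -
    interpret prob_space "\<mu> n"
      unfolding \<mu>_def by (rule prob_space.prob_space_distr[OF \<mu>_prob \<mu>_meas])
    show ?thesis by unfold_locales (simp add: \<mu>_def)+
  qed
  have \<mu>_int: "(\<integral>x. f x \<partial>\<mu> n) = (\<Sum>k\<le>n. a n k * f (real k / real n))" 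
    if "f \<in> borel_measurable borel" for f :: "real \<Rightarrow> real" and n
    unfolding \<mu>_def using that a_nonneg
    by (simp add: integral_distr[OF \<mu>_meas] lebesgue_integral_point_measure_finite)
  have "tight \<mu>"
    unfolding tight_def
  proof (intro conjI allI impI)
    fix e :: real assume "e > 0"
    have "measure (\<mu> n) {-1<..2} = 1" for n
    proof -
      interpret real_distribution "\<mu> n" by (rule \<mu>_real)
      have "measure (\<mu> n) {-1<..2} = (\<integral>x. indicator {-1<..2} x \<partial>\<mu> n)" by simp
      also have "\<dots> = (\<Sum>k\<le>n. a n k * indicator {-1<..2} (real k / real n))" by (rule \<mu>_int) simp
      also have "\<dots> = (\<Sum>k\<le>n. a n k)"
      proof (rule sum.cong)
        fix k assume "k \<in> {..n}"
        then have "real k / real n \<le> 1" by (auto simp: divide_le_eq_1)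
        moreover have "-1 < real k / real n" by (rule less_le_trans[of _ 0]) auto
        ultimately show "a n k * indicator {-1<..2} (real k / real n) = a n k" by (simp add: indicator_def)
      qed simp
      finally show ?thesis by (simp add: a_sum)
    qed
    with \<open>e > 0\<close> show "\<exists>a b. a < b \<and> (\<forall>n. 1 - e < measure (\<mu> n) {a<..b})"
      by (intro exI[of _ "-1"] exI[of _ 2]) auto
  qed (rule \<mu>_real)
  then obtain r M where r: "strict_mono (r :: nat \<Rightarrow> nat)" and M: "real_distribution M"
    and conv: "weak_conv_m (\<mu> \<circ> id \<circ> r) M"
    using tight_imp_convergent_subsubsequence[of \<mu> id] by (auto simp: strict_mono_def)
  interpret M: real_distribution M by (rule M)
  define clamp where "clamp x = max 0 (min 1 x)" for x :: real
  have clamp: "0 \<le> clamp x" "clamp x \<le> 1" for x by (auto simp: clamp_def)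
  have clamp_cont: "isCont clamp x" for x
    unfolding clamp_def by (intro continuous_intros)
  have clamp_meas: "clamp \<in> borel_measurable borel"
    unfolding clamp_def by measurable
  have mom_conv: "(\<lambda>n. \<integral>x. clamp x ^ j \<partial>\<mu> n) \<longlonglongrightarrow> mom j" for j
  proof (rule LIM_zero_cancel, rule Lim_null_comparison)
    have "\<bar>(\<integral>x. clamp x ^ j \<partial>\<mu> n) - mom j\<bar> \<le> (real j)\<^sup>2 / real n" if n: "n > j" for n
    proof -
      have "(\<integral>x. clamp x ^ j \<partial>\<mu> n) = (\<Sum>k\<le>n. a n k * clamp (real k / real n) ^ j)"
        using clamp_meas by (intro \<mu>_int) measurable
      also have "\<dots> = (\<Sum>k\<le>n. a n k * (real k / real n) ^ j)"
      proof (rule sum.cong)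
        fix k assume "k \<in> {..n}"
        then have "real k / real n \<le> 1" by (auto simp: divide_le_eq_1)
        then have "clamp (real k / real n) = real k / real n" by (simp add: clamp_def)
        then show "a n k * clamp (real k / real n) ^ j = a n k * (real k / real n) ^ j" by simp
      qed simp
      finally have 1: "(\<integral>x. clamp x ^ j \<partial>\<mu> n) = (\<Sum>k\<le>n. a n k * (real k / real n) ^ j)" .
      have 2: "mom j = (\<Sum>k\<le>n. a n k * (real (k choose j) / real (n choose j)))"
        using fact_mom[of j n] n by (simp add: field_simps flip: sum_divide_distrib)
      have "\<bar>(\<integral>x. clamp x ^ j \<partial>\<mu> n) - mom j\<bar> =
          \<bar>\<Sum>k\<le>n. a n k * ((real k / real n) ^ j - real (k choose j) / real (n choose j))\<bar>"
        unfolding 1 2 by (simp add: right_diff_distrib sum_subtractf)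
      also have "\<dots> \<le> (\<Sum>k\<le>n. a n k * ((real j)\<^sup>2 / real n))"
        using choose_ratio_bound n a_nonneg
        by (intro order_trans[OF sum_abs] sum_mono) (simp add: abs_mult mult_left_mono del: times_divide_eq_right)
      also have "\<dots> = (real j)\<^sup>2 / real n" using a_sum[of n] by (simp flip: sum_distrib_right sum_divide_distrib)
      finally show ?thesis .
    qed
    then show "\<forall>\<^sub>F n in sequentially. norm ((\<integral>x. clamp x ^ j \<partial>\<mu> n) - mom j) \<le> (real j)\<^sup>2 / real n"
      unfolding real_norm_def using eventually_gt_at_top[of j] by (rule eventually_mono[rotated])
    show "(\<lambda>n. (real j)\<^sup>2 / real n) \<longlonglongrightarrow> 0" by (rule lim_const_over_n)
  qed
  have mom_M: "(\<integral>x. clamp x ^ j \<partial>M) = mom j" for j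
  proof (rule LIMSEQ_unique)
    show "(\<lambda>n. \<integral>x. clamp x ^ j \<partial>(\<mu> \<circ> id \<circ> r) n) \<longlonglongrightarrow> (\<integral>x. clamp x ^ j \<partial>M)"
      by (rule weak_conv_imp_integral_bdd_continuous_conv[where B = 1])
        (use \<mu>_real M conv clamp clamp_cont in \<open>auto intro!: continuous_intros power_le_one simp: o_def\<close>)
    show "(\<lambda>n. \<integral>x. clamp x ^ j \<partial>(\<mu> \<circ> id \<circ> r) n) \<longlonglongrightarrow> mom j"
      using LIMSEQ_subseq_LIMSEQ[OF mom_conv r] by (simp add: o_def)
  qed
  let ?I = "restrict_space borel {0..1::real}"
  have clamp_I: "clamp \<in> measurable M ?I"
    using clamp clamp_meas by (intro measurable_restrict_space2) (auto simp: measurable_def)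
  define N where "N = density (distr M ?I clamp) (\<lambda>_. ennreal c)"
  have "finite_measure N"
  proof (rule finite_measureI)
    interpret D: prob_space "distr M ?I clamp" by (rule M.prob_space_distr[OF clamp_I])
    have "emeasure N (space N) = ennreal c * emeasure (distr M ?I clamp) (space (distr M ?I clamp))"
      unfolding N_def space_density by (rule emeasure_density_const[OF sets.top])
    then show "emeasure N (space N) \<noteq> \<infinity>" using D.emeasure_space_1 by simp
  qed
  moreover have "ip (pop p u) u = (\<integral>x. poly p x \<partial>N)" for p
  proof -
    have poly_I: "poly q \<in> borel_measurable ?I" for q :: "real poly"
      by (intro borel_measurable_continuous_on_restrict continuous_intros)
    have "(\<integral>x. poly p x \<partial>N) = (\<integral>x. c * poly p x \<partial>distr M ?I clamp)"
      unfolding N_def using c poly_I by (subst integral_density) auto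
    also have "\<dots> = (\<integral>x. c * poly p (clamp x) \<partial>M)"
      using clamp_I poly_I by (subst integral_distr) auto
    also have "\<dots> = (\<integral>x. c * (\<Sum>i\<le>degree p. coeff p i * clamp x ^ i) \<partial>M)"
      by (simp add: poly_altdef)
    also have "\<dots> = c * (\<Sum>i\<le>degree p. coeff p i * (\<integral>x. clamp x ^ i \<partial>M))"
    proof -
      have "integrable M (\<lambda>x. clamp x ^ i)" for i
        by (rule M.integrable_const_bound[where B = 1])
           (use clamp clamp_meas in \<open>auto intro!: power_le_one borel_measurable_power simp: power_le_one\<close>)
      then show ?thesis by simp
    qed
    also have "\<dots> = (\<Sum>i\<le>degree p. coeff p i * ip (pop ([:0, 1:] ^ i) u) u)"
      using c unfolding mom_M by (simp add: mom_def sum_distrib_left)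
    also have "\<dots> = ip (\<Sum>i\<le>degree p. coeff p i *\<^sub>R pop ([:0, 1:] ^ i) u) u"
      using u by (simp add: ip_sum ip_scale)
    also have "(\<Sum>i\<le>degree p. coeff p i *\<^sub>R pop ([:0, 1:] ^ i) u) = pop (\<Sum>i\<le>degree p. smult (coeff p i) ([:0, 1:] ^ i)) u"
      using u by (simp add: pop_sum pop_smult)
    also have "(\<Sum>i\<le>degree p. smult (coeff p i) ([:0, 1:] ^ i)) = p"
      using poly_as_sum_of_monoms[of p] by (simp add: monom_altdef)
    finally show ?thesis ..
  qed
  ultimately show ?thesis by (intro exI[of _ N]) (simp add: N_def)
qed

end

lemma nonpos_of_le_eps:
  fixes a K :: real
  assumes "\<And>e. e > 0 \<Longrightarrow> a \<le> K * e"
  shows "a \<le> 0"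
proof (rule ccontr)
  assume "\<not> a \<le> 0"
  then have a: "a > 0" by simp
  have "a \<le> K * (a / (2 * (\<bar>K\<bar> + 1)))" using a by (intro assms) simp
  also have "\<dots> \<le> (\<bar>K\<bar> + 1) * (a / (2 * (\<bar>K\<bar> + 1)))" using a by (intro mult_right_mono) auto
  also have "\<dots> = a / 2" by (simp add: field_simps add_nonneg_eq_0_iff)
  finally show False using a by simp
qed

lemma weierstrass_poly:
  fixes f :: "real \<Rightarrow> real"
  assumes "continuous_on {0..1} f" "e > 0"
  obtains p where "\<And>x. x \<in> {0..1} \<Longrightarrow> \<bar>poly p x - f x\<bar> \<le> e"
proof -
  obtain g where g: "real_polynomial_function g" "\<And>x. x \<in> {0..1} \<Longrightarrow> \<bar>f x - g x\<bar> < e"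
    using Stone_Weierstrass_real_polynomial_function[of "{0..1}" f e] assms by auto
  then obtain a n where g_eq: "g = (\<lambda>x. \<Sum>i\<le>n. a i * x ^ i)"
    unfolding real_polynomial_function_iff_sum by blast
  have "poly (\<Sum>i\<le>n. monom (a i) i) x = g x" for x
    by (simp add: g_eq poly_sum poly_monom)
  then show thesis
    using g(2) by (intro that[of "\<Sum>i\<le>n. monom (a i) i"]) (force simp: abs_minus_commute)
qed

lemma continuous_bounded_01:
  fixes f :: "real \<Rightarrow> real"
  assumes "continuous_on {0..1} f"
  obtains B where "B > 0" "\<And>x. x \<in> {0..1} \<Longrightarrow> \<bar>f x\<bar> \<le> B"
proof -
  have "bounded (f ` {0..1})"
    using assms by (intro compact_imp_bounded compact_continuous_image) auto
  then show thesis using that unfolding bounded_pos by auto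
qed

context pos_contraction
begin

definition spec :: "'a \<Rightarrow> real measure" where
  "spec u = (SOME M. finite_measure M \<and> sets M = sets (restrict_space borel {0..1::real}) \<and>
    (\<forall>p. ip (pop p u) u = (\<integral>x. poly p x \<partial>M)))"

lemma
  assumes "u \<in> H"
  shows finite_spec: "finite_measure (spec u)"
    and sets_spec: "sets (spec u) = sets (restrict_space borel {0..1})"
    and pop_spec: "ip (pop p u) u = (\<integral>x. poly p x \<partial>spec u)"
proof -
  have "finite_measure (spec u) \<and> sets (spec u) = sets (restrict_space borel {0..1}) \<and>
      (\<forall>p. ip (pop p u) u = (\<integral>x. poly p x \<partial>spec u))"
    unfolding spec_def by (rule someI_ex[OF spectral_measure_exists[OF assms]])
  then show "finite_measure (spec u)" "sets (spec u) = sets (restrict_space borel {0..1})"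
    "ip (pop p u) u = (\<integral>x. poly p x \<partial>spec u)" by blast+
qed

lemma space_spec: "u \<in> H \<Longrightarrow> space (spec u) = {0..1}"
  using sets_eq_imp_space_eq[OF sets_spec] by (simp add: space_restrict_space)

lemma measurable_spec:
  fixes f :: "real \<Rightarrow> real"
  assumes "u \<in> H" "continuous_on {0..1} f"
  shows "f \<in> borel_measurable (spec u)"
  using borel_measurable_continuous_on_restrict[OF assms(2)] sets_spec[OF assms(1)]
  by (simp cong: measurable_cong_sets)

lemma bounded_integrable_spec:
  fixes f :: "real \<Rightarrow> real"
  assumes u: "u \<in> H" and f: "f \<in> borel_measurable (spec u)" "\<And>x. x \<in> {0..1} \<Longrightarrow> \<bar>f x\<bar> \<le> B"
  shows "integrable (spec u) f"
proof (rule finite_measure.integrable_const_bound[OF finite_spec[OF u]])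
  show "AE x in spec u. norm (f x) \<le> B"
    by (rule AE_I2) (use f(2) in \<open>simp add: space_spec[OF u]\<close>)
qed (rule f(1))

lemma integrable_spec:
  fixes f :: "real \<Rightarrow> real"
  assumes u: "u \<in> H" and f: "continuous_on {0..1} f"
  shows "integrable (spec u) f"
  using continuous_bounded_01[OF f] bounded_integrable_spec[OF u measurable_spec[OF u f]] by metis

lemma mass_spec: "u \<in> H \<Longrightarrow> measure (spec u) {0..1} = ip u u"
  using pop_spec[of u 1] space_spec[of u] by simp

lemma integral_spec_bound:
  fixes f :: "real \<Rightarrow> real"
  assumes u: "u \<in> H" and f: "continuous_on {0..1} f" "\<And>x. x \<in> {0..1} \<Longrightarrow> f x \<le> B"
  shows "(\<integral>x. f x \<partial>spec u) \<le> B * ip u u"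
proof -
  have "(\<integral>x. f x \<partial>spec u) \<le> (\<integral>x. B \<partial>spec u)"
    using integrable_spec[OF u] f by (intro integral_mono) (auto simp: space_spec[OF u])
  then show ?thesis using u by (simp add: space_spec mass_spec mult.commute)
qed

lemma pop_square: "u \<in> H \<Longrightarrow> ip (pop p u) (pop p u) = (\<integral>x. (poly p x)\<^sup>2 \<partial>spec u)"
  using pop_spec[of u "p * p"] by (simp add: pop_mult pop_sym power2_eq_square)

lemma pop_bound:
  assumes u: "u \<in> H" and p: "\<And>x. x \<in> {0..1} \<Longrightarrow> \<bar>poly p x\<bar> \<le> d"
  shows "nrm (pop p u) \<le> d * nrm u"
proof (rule power2_le_imp_le)
  have "d \<ge> 0" using p[of 0] by simp
  then show "0 \<le> d * nrm u" using u by simp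
  have "(nrm (pop p u))\<^sup>2 = (\<integral>x. (poly p x)\<^sup>2 \<partial>spec u)"
    using u by (simp add: nrm_sq pop_square)
  also have "\<dots> \<le> d\<^sup>2 * ip u u"
    using p by (intro integral_spec_bound[OF u] continuous_intros) (metis power2_abs power_mono abs_ge_zero)
  also have "\<dots> = (d * nrm u)\<^sup>2" using u by (simp add: power_mult_distrib nrm_sq)
  finally show "(nrm (pop p u))\<^sup>2 \<le> (d * nrm u)\<^sup>2" .
qed

subsection \<open>Continuous functions of the operator\<close>

text \<open>The vector is the limit of \<open>pop p u\<close> as the polynomials \<open>p\<close> approach \<open>f\<close> uniformly on the unit
  interval; the error estimate pins it down without a choice of approximating sequence.\<close>

definition fc :: "(real \<Rightarrow> real) \<Rightarrow> 'a \<Rightarrow> 'a" where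
  "fc f u = (SOME v. v \<in> H \<and>
     (\<forall>p d. (\<forall>x\<in>{0..1}. \<bar>poly p x - f x\<bar> \<le> d) \<longrightarrow> nrm (pop p u - v) \<le> d * nrm u))"

lemma fc_exists:
  assumes u: "u \<in> H" and f: "continuous_on {0..1} f"
  shows "\<exists>v. v \<in> H \<and> (\<forall>p d. (\<forall>x\<in>{0..1}. \<bar>poly p x - f x\<bar> \<le> d) \<longrightarrow> nrm (pop p u - v) \<le> d * nrm u)"
proof -
  have "\<exists>p. \<forall>x\<in>{0..1}. \<bar>poly p x - f x\<bar> \<le> 1 / Suc n" for n
    using weierstrass_poly[OF f, of "1 / Suc n"] by (metis of_nat_0_less_iff zero_less_Suc zero_less_divide_1_iff)
  then obtain P where P: "\<And>n x. x \<in> {0..1} \<Longrightarrow> \<bar>poly (P n) x - f x\<bar> \<le> 1 / Suc n"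
    by metis
  have close: "nrm (pop p u - pop (P n) u) \<le> (d + 1 / Suc n) * nrm u"
    if "\<And>x. x \<in> {0..1} \<Longrightarrow> \<bar>poly p x - f x\<bar> \<le> d" for p d n
  proof -
    have "\<bar>poly (p - P n) x\<bar> \<le> d + 1 / Suc n" if x: "x \<in> {0..1}" for x
      using P[OF x, of n] \<open>\<And>x. x \<in> {0..1} \<Longrightarrow> \<bar>poly p x - f x\<bar> \<le> d\<close>[OF x] by simp
    from pop_bound[OF u this] show ?thesis using u by (simp add: pop_diff)
  qed
  obtain v where v: "v \<in> H" "tends (\<lambda>n. pop (P n) u) v sequentially"
  proof (rule cauchy_tends)
    show "pop (P n) u \<in> H" for n using u by simp
    fix e :: real assume "e > 0"
    have "(\<lambda>n. 2 * (1 / Suc n) * nrm u) \<longlonglongrightarrow> 2 * 0 * nrm u"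
      by (intro tendsto_intros LIMSEQ_Suc[OF lim_1_over_n])
    then have "\<forall>\<^sub>F n in sequentially. 2 * (1 / Suc n) * nrm u < sqrt e"
      using \<open>e > 0\<close> by (intro order_tendstoD) auto
    then obtain N where N: "2 * (1 / Suc N) * nrm u < sqrt e" by (auto simp: eventually_sequentially)
    have "ip (pop (P m) u - pop (P n) u) (pop (P m) u - pop (P n) u) < e" if "m \<ge> N" "n \<ge> N" for m n
    proof -
      have "nrm (pop (P m) u - pop (P n) u) \<le> (1 / Suc m + 1 / Suc n) * nrm u"
        using close[OF P] .
      also have "\<dots> \<le> 2 * (1 / Suc N) * nrm u"
      proof (intro mult_right_mono)
        have "1 / Suc m \<le> 1 / Suc N" "1 / Suc n \<le> 1 / Suc N" using that by (auto simp: frac_le)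
        then show "1 / Suc m + 1 / Suc n \<le> 2 * (1 / Suc N)" by linarith
      qed (use u in simp)
      finally have "nrm (pop (P m) u - pop (P n) u) < sqrt e" using N by linarith
      then show ?thesis by (simp add: nrm_def)
    qed
    then show "\<exists>N. \<forall>m\<ge>N. \<forall>n\<ge>N. ip (pop (P m) u - pop (P n) u) (pop (P m) u - pop (P n) u) < e" by blast
  qed auto
  have "nrm (pop p u - v) \<le> d * nrm u" if p: "\<forall>x\<in>{0..1}. \<bar>poly p x - f x\<bar> \<le> d" for p d
  proof (rule LIMSEQ_le_const)
    have "(\<lambda>n. (d + 1 / Suc n) * nrm u + nrm (pop (P n) u - v)) \<longlonglongrightarrow> (d + 0) * nrm u + 0"
      using v(2) unfolding tends_def by (intro tendsto_intros LIMSEQ_Suc[OF lim_1_over_n])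
    then show "(\<lambda>n. (d + 1 / Suc n) * nrm u + nrm (pop (P n) u - v)) \<longlonglongrightarrow> d * nrm u" by simp
    show "\<exists>N. \<forall>n\<ge>N. nrm (pop p u - v) \<le> (d + 1 / Suc n) * nrm u + nrm (pop (P n) u - v)"
    proof (intro exI allI impI)
      fix n
      show "nrm (pop p u - v) \<le> (d + 1 / Suc n) * nrm u + nrm (pop (P n) u - v)"
        using close[of p d n] p nrm_triangle3[of "pop p u" "pop (P n) u" v] u v by fastforce
    qed
  qed
  with v show ?thesis by blast
qed

lemma fc_char:
  assumes "u \<in> H" "continuous_on {0..1} f"
  shows "fc f u \<in> H \<and> (\<forall>p d. (\<forall>x\<in>{0..1}. \<bar>poly p x - f x\<bar> \<le> d) \<longrightarrow> nrm (pop p u - fc f u) \<le> d * nrm u)"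
  unfolding fc_def by (rule someI_ex[OF fc_exists[OF assms]])

lemma fc_in [simp]: "u \<in> H \<Longrightarrow> continuous_on {0..1} f \<Longrightarrow> fc f u \<in> H"
  using fc_char by blast

lemma fc_approx: "\<lbrakk>u \<in> H; continuous_on {0..1} f; \<And>x. x \<in> {0..1} \<Longrightarrow> \<bar>poly p x - f x\<bar> \<le> d\<rbrakk>
    \<Longrightarrow> nrm (pop p u - fc f u) \<le> d * nrm u"
  using fc_char by blast

lemma eq_of_nrm_le:
  assumes "u \<in> H" "v \<in> H" "\<And>e. e > 0 \<Longrightarrow> nrm (u - v) \<le> K * e"
  shows "u = v"
proof -
  have "nrm (u - v) \<le> 0" by (rule nonpos_of_le_eps) (rule assms(3))
  moreover have "0 \<le> nrm (u - v)" using assms by simp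
  ultimately have "nrm (u - v) = 0" by simp
  then show ?thesis using assms by (simp add: nrm_eq_0)
qed

lemma fc_eqI:
  assumes u: "u \<in> H" and v: "v \<in> H" and f: "continuous_on {0..1} f"
    and ex: "\<And>e. e > 0 \<Longrightarrow> \<exists>p. (\<forall>x\<in>{0..1}. \<bar>poly p x - f x\<bar> \<le> e) \<and> nrm (pop p u - v) \<le> K * e"
  shows "fc f u = v"
proof (rule eq_of_nrm_le)
  fix e :: real assume "e > 0"
  then obtain p where p: "\<And>x. x \<in> {0..1} \<Longrightarrow> \<bar>poly p x - f x\<bar> \<le> e" "nrm (pop p u - v) \<le> K * e"
    using ex by blast
  have "nrm (fc f u - v) \<le> nrm (fc f u - pop p u) + nrm (pop p u - v)"
    using u v f by (intro nrm_triangle3) auto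
  also have "nrm (fc f u - pop p u) = nrm (pop p u - fc f u)"
    using u f by (intro nrm_minus_commute) auto
  also have "\<dots> \<le> e * nrm u" by (rule fc_approx[OF u f p(1)])
  finally show "nrm (fc f u - v) \<le> (nrm u + K) * e"
    using p(2) by (simp add: algebra_simps)
qed (use u v f in auto)

lemma fc_cong: "(\<And>x. x \<in> {0..1} \<Longrightarrow> f x = g x) \<Longrightarrow> fc f u = fc g u"
  unfolding fc_def by simp

lemma fc_poly: "u \<in> H \<Longrightarrow> fc (poly p) u = pop p u"
proof (rule fc_eqI[where K = 0])
  show "continuous_on {0..1} (poly p)" by (intro continuous_intros)
qed (auto intro!: exI[of _ p])

lemma fc_1 [simp]: "u \<in> H \<Longrightarrow> fc (\<lambda>_. 1) u = u"
proof -
  have "poly 1 = (\<lambda>_. 1 :: real)" by auto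
  then show "u \<in> H \<Longrightarrow> ?thesis" using fc_poly[of u 1] by simp
qed

lemma fc_id [simp]: "u \<in> H \<Longrightarrow> fc (\<lambda>x. x) u = R u"
proof -
  have "poly [:0, 1:] = (\<lambda>x. x :: real)" by auto
  then show "u \<in> H \<Longrightarrow> ?thesis" using fc_poly[of u "[:0, 1:]"] by (simp add: pop_X)
qed

lemma fc_add:
  assumes u: "u \<in> H" and f: "continuous_on {0..1} f" and g: "continuous_on {0..1} g"
  shows "fc (\<lambda>x. f x + g x) u = fc f u + fc g u"
proof (rule fc_eqI[where K = "nrm u"])
  fix e :: real assume e: "e > 0"
  obtain p where p: "\<And>x. x \<in> {0..1} \<Longrightarrow> \<bar>poly p x - f x\<bar> \<le> e / 2"
    using weierstrass_poly[OF f, of "e / 2"] e by auto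
  obtain q where q: "\<And>x. x \<in> {0..1} \<Longrightarrow> \<bar>poly q x - g x\<bar> \<le> e / 2"
    using weierstrass_poly[OF g, of "e / 2"] e by auto
  have "\<bar>poly (p + q) x - (f x + g x)\<bar> \<le> e" if "x \<in> {0..1}" for x
    using p[OF that] q[OF that] unfolding poly_add by linarith
  moreover have "nrm (pop (p + q) u - (fc f u + fc g u)) \<le> nrm u * e"
  proof -
    have "nrm (pop (p + q) u - (fc f u + fc g u)) = nrm ((pop p u - fc f u) + (pop q u - fc g u))"
      using u by (simp only: pop_add add_diff_add)
    also have "\<dots> \<le> nrm (pop p u - fc f u) + nrm (pop q u - fc g u)"
      using u f g by (intro nrm_triangle) auto
    also have "\<dots> \<le> e / 2 * nrm u + e / 2 * nrm u"
      by (intro add_mono fc_approx u f g p q)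
    finally show ?thesis by (simp add: mult.commute)
  qed
  ultimately show "\<exists>p. (\<forall>x\<in>{0..1}. \<bar>poly p x - (f x + g x)\<bar> \<le> e) \<and>
      nrm (pop p u - (fc f u + fc g u)) \<le> nrm u * e" by blast
qed (use u f g in \<open>auto intro: continuous_intros\<close>)

text \<open>The core of multiplicativity: a polynomial factor acts as a bounded operator.\<close>

lemma fc_poly_mult:
  assumes u: "u \<in> H" and f: "continuous_on {0..1} f"
  shows "fc (\<lambda>x. poly p x * f x) u = pop p (fc f u)"
proof (rule fc_eqI[where K = "nrm u"])
  fix e :: real assume e: "e > 0"
  obtain B where B: "B > 0" "\<And>x. x \<in> {0..1} \<Longrightarrow> \<bar>poly p x\<bar> \<le> B"
    by (rule continuous_bounded_01[of "poly p"]) (auto intro: continuous_intros)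
  obtain q where q: "\<And>x. x \<in> {0..1} \<Longrightarrow> \<bar>poly q x - f x\<bar> \<le> e / B"
    using weierstrass_poly[OF f, of "e / B"] e B by auto
  have "\<bar>poly (p * q) x - poly p x * f x\<bar> \<le> e" if x: "x \<in> {0..1}" for x
  proof -
    have "\<bar>poly (p * q) x - poly p x * f x\<bar> = \<bar>poly p x\<bar> * \<bar>poly q x - f x\<bar>"
      by (simp add: right_diff_distrib flip: abs_mult)
    also have "\<dots> \<le> B * (e / B)" using B q[OF x] x by (intro mult_mono) auto
    finally show ?thesis using B by simp
  qed
  moreover have "nrm (pop (p * q) u - pop p (fc f u)) \<le> nrm u * e"
  proof -
    have "nrm (pop (p * q) u - pop p (fc f u)) = nrm (pop p (pop q u - fc f u))"
      using u f by (simp add: pop_mult pop_diff2)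
    also have "\<dots> \<le> B * nrm (pop q u - fc f u)"
      using u f B(2) by (intro pop_bound) auto
    also have "\<dots> \<le> B * (e / B * nrm u)"
      using fc_approx[OF u f q] B by (intro mult_left_mono) auto
    finally show ?thesis using B by (simp add: mult.commute)
  qed
  ultimately show "\<exists>q. (\<forall>x\<in>{0..1}. \<bar>poly q x - poly p x * f x\<bar> \<le> e) \<and>
      nrm (pop q u - pop p (fc f u)) \<le> nrm u * e" by blast
next
  show "continuous_on {0..1} (\<lambda>x. poly p x * f x)" using f by (intro continuous_intros)
qed (use u f in auto)

lemma fc_scale: "\<lbrakk>u \<in> H; continuous_on {0..1} f\<rbrakk> \<Longrightarrow> fc (\<lambda>x. r * f x) u = r *\<^sub>R fc f u"
  using fc_poly_mult[of u f "[:r:]"] by (simp add: pop_pCons)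

lemma fc_diff:
  assumes "u \<in> H" "continuous_on {0..1} f" "continuous_on {0..1} g"
  shows "fc (\<lambda>x. f x - g x) u = fc f u - fc g u"
  using fc_add[OF assms(1,2), of "\<lambda>x. -1 * g x"] fc_scale[OF assms(1,3), of "-1"] assms(3)
  by (simp add: continuous_on_minus)

lemma fc_bound:
  assumes u: "u \<in> H" and f: "continuous_on {0..1} f" and d: "\<And>x. x \<in> {0..1} \<Longrightarrow> \<bar>f x\<bar> \<le> d"
  shows "nrm (fc f u) \<le> d * nrm u"
proof -
  have "nrm (fc f u) - d * nrm u \<le> 2 * nrm u * e" if e: "e > 0" for e
  proof -
    obtain p where p: "\<And>x. x \<in> {0..1} \<Longrightarrow> \<bar>poly p x - f x\<bar> \<le> e"
      using weierstrass_poly[OF f e] by auto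
    have "\<bar>poly p x\<bar> \<le> d + e" if "x \<in> {0..1}" for x using p[OF that] d[OF that] by linarith
    then have "nrm (pop p u) \<le> (d + e) * nrm u" by (rule pop_bound[OF u])
    moreover have "\<bar>nrm (pop p u) - nrm (fc f u)\<bar> \<le> e * nrm u"
      using nrm_triangle_diff[of "pop p u" "fc f u"] fc_approx[OF u f p] u f by fastforce
    ultimately show ?thesis by (simp add: algebra_simps)
  qed
  then have "nrm (fc f u) - d * nrm u \<le> 0" by (rule nonpos_of_le_eps)
  then show ?thesis by simp
qed

lemma fc_mult:
  assumes u: "u \<in> H" and f: "continuous_on {0..1} f" and g: "continuous_on {0..1} g"
  shows "fc (\<lambda>x. f x * g x) u = fc f (fc g u)"
proof -
  obtain G where G: "G > 0" "\<And>x. x \<in> {0..1} \<Longrightarrow> \<bar>g x\<bar> \<le> G"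
    using continuous_bounded_01[OF g] by blast
  have fg: "continuous_on {0..1} (\<lambda>x. f x * g x)" using f g by (intro continuous_intros)
  show ?thesis
  proof (rule eq_of_nrm_le[where K = "G * nrm u + nrm (fc g u)"])
    fix e :: real assume e: "e > 0"
    obtain p where p: "\<And>x. x \<in> {0..1} \<Longrightarrow> \<bar>poly p x - f x\<bar> \<le> e"
      using weierstrass_poly[OF f e] by auto
    have pg: "continuous_on {0..1} (\<lambda>x. poly p x * g x)" using g by (intro continuous_intros)
    have "nrm (fc (\<lambda>x. f x * g x) u - pop p (fc g u)) =
        nrm (fc (\<lambda>x. f x * g x - poly p x * g x) u)"
      using u f g fg pg by (simp add: fc_diff fc_poly_mult)
    also have "\<dots> \<le> e * G * nrm u"
    proof (rule fc_bound[OF u])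
      fix x :: real assume x: "x \<in> {0..1}"
      have "\<bar>f x * g x - poly p x * g x\<bar> = \<bar>poly p x - f x\<bar> * \<bar>g x\<bar>"
        by (simp add: abs_minus_commute left_diff_distrib flip: abs_mult)
      also have "\<dots> \<le> e * G" using p[OF x] G(2)[OF x] e by (intro mult_mono) auto
      finally show "\<bar>f x * g x - poly p x * g x\<bar> \<le> e * G" .
    qed (use fg pg in \<open>rule continuous_on_diff\<close>)
    finally have 1: "nrm (fc (\<lambda>x. f x * g x) u - pop p (fc g u)) \<le> e * G * nrm u" .
    have 2: "nrm (pop p (fc g u) - fc f (fc g u)) \<le> e * nrm (fc g u)"
      using u f g p by (intro fc_approx) auto
    have "nrm (fc (\<lambda>x. f x * g x) u - fc f (fc g u)) \<le>
        nrm (fc (\<lambda>x. f x * g x) u - pop p (fc g u)) + nrm (pop p (fc g u) - fc f (fc g u))"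
      using u f g fg by (intro nrm_triangle3) auto
    with 1 2 show "nrm (fc (\<lambda>x. f x * g x) u - fc f (fc g u)) \<le> (G * nrm u + nrm (fc g u)) * e"
      by (simp add: algebra_simps)
  qed (use u f g fg in auto)
qed

lemma fc_commute: "\<lbrakk>u \<in> H; continuous_on {0..1} f; continuous_on {0..1} g\<rbrakk> \<Longrightarrow> fc f (fc g u) = fc g (fc f u)"
  by (simp add: mult.commute flip: fc_mult)

lemma fc_sym:
  assumes u: "u \<in> H" and v: "v \<in> H" and f: "continuous_on {0..1} f"
  shows "ip (fc f u) v = ip u (fc f v)"
proof -
  have "\<bar>ip (fc f u) v - ip u (fc f v)\<bar> \<le> 2 * nrm u * nrm v * e" if e: "e > 0" for e
  proof -
    obtain p where p: "\<And>x. x \<in> {0..1} \<Longrightarrow> \<bar>poly p x - f x\<bar> \<le> e"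
      using weierstrass_poly[OF f e] by auto
    have "ip (fc f u) v - ip u (fc f v) = ip u (pop p v - fc f v) - ip (pop p u - fc f u) v"
      using u v f by (simp add: ip_simps pop_sym)
    moreover have "\<bar>ip u (pop p v - fc f v)\<bar> \<le> nrm u * (e * nrm v)"
      using cauchy_schwarz[of u "pop p v - fc f v"] fc_approx[OF v f p] u v f
      by (meson H_diff fc_in mult_left_mono nrm_nonneg order_trans pop_in)
    moreover have "\<bar>ip (pop p u - fc f u) v\<bar> \<le> e * nrm u * nrm v"
      using cauchy_schwarz[of "pop p u - fc f u" v] fc_approx[OF u f p] u v f
      by (meson H_diff fc_in mult_right_mono nrm_nonneg order_trans pop_in)
    ultimately show ?thesis by (simp add: algebra_simps)
  qed
  then have "\<bar>ip (fc f u) v - ip u (fc f v)\<bar> \<le> 0" by (rule nonpos_of_le_eps)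
  then show ?thesis by simp
qed

lemma fc_add2:
  assumes "u \<in> H" "v \<in> H" "continuous_on {0..1} f"
  shows "fc f (u + v) = fc f u + fc f v"
  using assms by (intro ip_eqI) (simp_all add: fc_sym ip_add)

lemma fc_scale2:
  assumes "u \<in> H" "continuous_on {0..1} f"
  shows "fc f (r *\<^sub>R u) = r *\<^sub>R fc f u"
  using assms by (intro ip_eqI) (simp_all add: fc_sym ip_scale)

lemma fc_diff2:
  assumes "u \<in> H" "v \<in> H" "continuous_on {0..1} f"
  shows "fc f (u - v) = fc f u - fc f v"
  using assms by (intro ip_eqI) (simp_all add: fc_sym ip_diff)

lemma fc_spec:
  assumes u: "u \<in> H" and f: "continuous_on {0..1} f"
  shows "ip (fc f u) u = (\<integral>x. f x \<partial>spec u)"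
proof -
  have "\<bar>ip (fc f u) u - (\<integral>x. f x \<partial>spec u)\<bar> \<le> 2 * ip u u * e" if e: "e > 0" for e
  proof -
    obtain p where p: "\<And>x. x \<in> {0..1} \<Longrightarrow> \<bar>poly p x - f x\<bar> \<le> e"
      using weierstrass_poly[OF f e] by auto
    have "\<bar>ip (pop p u - fc f u) u\<bar> \<le> e * nrm u * nrm u"
      using cauchy_schwarz[of "pop p u - fc f u" u] fc_approx[OF u f p] u f
      by (meson H_diff fc_in mult_right_mono nrm_nonneg order_trans pop_in)
    also have "\<dots> = e * ip u u" using u by (simp add: power2_eq_square flip: nrm_sq)
    finally have 1: "\<bar>ip (pop p u) u - ip (fc f u) u\<bar> \<le> e * ip u u"
      using u f by (simp add: ip_diff)
    have int: "integrable (spec u) f" "integrable (spec u) (poly p)"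
      using u f by (auto intro!: integrable_spec continuous_intros)
    have "\<bar>(\<integral>x. poly p x \<partial>spec u) - (\<integral>x. f x \<partial>spec u)\<bar> = \<bar>\<integral>x. poly p x - f x \<partial>spec u\<bar>"
      using int by simp
    also have "\<dots> \<le> (\<integral>x. \<bar>poly p x - f x\<bar> \<partial>spec u)" by (rule integral_abs_bound)
    also have "\<dots> \<le> e * ip u u"
      using f p by (intro integral_spec_bound[OF u] continuous_intros) auto
    finally show ?thesis using 1 pop_spec[OF u, of p] by (simp add: algebra_simps)
  qed
  then have "\<bar>ip (fc f u) u - (\<integral>x. f x \<partial>spec u)\<bar> \<le> 0" by (rule nonpos_of_le_eps)
  then show ?thesis by simp
qed

lemma fc_square:
  "\<lbrakk>u \<in> H; continuous_on {0..1} f\<rbrakk> \<Longrightarrow> ip (fc f u) (fc f u) = (\<integral>x. (f x)\<^sup>2 \<partial>spec u)"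
  using fc_spec[of u "\<lambda>x. f x * f x"]
  by (simp add: continuous_on_mult fc_mult fc_sym power2_eq_square)

lemma fc_nonneg:
  assumes u: "u \<in> H" and f: "continuous_on {0..1} f" "\<And>x. x \<in> {0..1} \<Longrightarrow> 0 \<le> f x"
  shows "0 \<le> ip (fc f u) u"
  unfolding fc_spec[OF u f(1)] using f(2) by (intro integral_nonneg_AE AE_I2) (simp add: space_spec[OF u])

text \<open>For polynomial \<open>g\<close> this is multiplicativity, and polynomials are dense. The lemma lets two square
  roots of the same operator be compared.\<close>

lemma fc_compose:
  assumes S: "pos_contraction H ip S" and S_eq: "\<And>u. u \<in> H \<Longrightarrow> S u = fc f u"
    and f: "continuous_on {0..1} f" "\<And>x. x \<in> {0..1} \<Longrightarrow> f x \<in> {0..1}"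
    and g: "continuous_on {0..1} g" and u: "u \<in> H"
  shows "pos_contraction.fc H ip S g u = fc (\<lambda>x. g (f x)) u"
proof -
  interpret S: pos_contraction H ip S by (rule S)
  have pf: "continuous_on {0..1} (\<lambda>x. poly p (f x))" for p :: "real poly"
    using f(1) by (intro continuous_intros)
  have gf: "continuous_on {0..1} (\<lambda>x. g (f x))"
    by (rule continuous_on_compose2[OF g f(1)]) (use f(2) in blast)
  have poly: "S.pop p u = fc (\<lambda>x. poly p (f x)) u" for p
  proof (induction p)
    case 0
    then show ?case using u fc_scale[of u "\<lambda>_. 1" 0] by simp
  next
    case (pCons a p)
    have "fc (\<lambda>x. poly (pCons a p) (f x)) u = fc (\<lambda>x. a * 1 + f x * poly p (f x)) u" by simp
    also have "\<dots> = a *\<^sub>R u + fc f (fc (\<lambda>x. poly p (f x)) u)"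
      using u f(1) pf by (subst fc_add) (auto simp: fc_mult fc_scale[of u "\<lambda>_. 1", simplified] intro: continuous_intros)
    finally show ?case using u pf pCons by (simp add: S.pop_pCons S_eq)
  qed
  show ?thesis
  proof (rule S.fc_eqI[where K = "nrm u"])
    fix e :: real assume e: "e > 0"
    obtain p where p: "\<And>x. x \<in> {0..1} \<Longrightarrow> \<bar>poly p x - g x\<bar> \<le> e"
      using weierstrass_poly[OF g e] by auto
    have "nrm (S.pop p u - fc (\<lambda>x. g (f x)) u) = nrm (fc (\<lambda>x. poly p (f x) - g (f x)) u)"
      using u pf gf by (simp add: poly fc_diff)
    also have "\<dots> \<le> e * nrm u"
    proof (rule fc_bound[OF u continuous_on_diff[OF pf gf]])
      show "\<bar>poly p (f x) - g (f x)\<bar> \<le> e" if "x \<in> {0..1}" for x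
        using p f(2) that by blast
    qed
    finally show "\<exists>p. (\<forall>x\<in>{0..1}. \<bar>poly p x - g x\<bar> \<le> e) \<and> nrm (S.pop p u - fc (\<lambda>x. g (f x)) u) \<le> nrm u * e"
      using p by (intro exI[of _ p]) (auto simp: mult.commute)
  qed (use u g gf in auto)
qed

text \<open>A continuous function that gives an injective operator has a null set of zeros: the operator
  then has dense range, and on its range \<open>1 - n |k|\<close> acts as an operator of norm at most \<open>1 / n\<close>.\<close>

lemma injective_fc_null:
  assumes k: "continuous_on {0..1} k" and inj: "\<And>v. v \<in> H \<Longrightarrow> fc k v = 0 \<Longrightarrow> v = 0"
    and u: "u \<in> H"
  shows "AE x in spec u. k x \<noteq> 0"
proof -
  interpret finite_measure "spec u" by (rule finite_spec[OF u])
  let ?Z = "{x \<in> space (spec u). k x = 0}"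
  have k_meas: "k \<in> borel_measurable (spec u)" by (rule measurable_spec[OF u k])
  have Z: "?Z \<in> sets (spec u)" using k_meas by measurable
  have fk0: "fc k 0 = 0" using fc_scale2[of 0 k 0] k by simp
  obtain s where s: "\<And>n. s n \<in> fc k ` H" "tends s u sequentially"
  proof (rule dense_of_trivial_complement[of "fc k ` H" u])
    show "subspace (fc k ` H)"
    proof (rule subspaceI)
      show "0 \<in> fc k ` H" using fk0 H_0 by (metis image_eqI)
      show "x + y \<in> fc k ` H" if "x \<in> fc k ` H" "y \<in> fc k ` H" for x y
        using that k by (auto simp flip: fc_add2)
      show "c *\<^sub>R x \<in> fc k ` H" if "x \<in> fc k ` H" for c x
        using that k by (auto simp flip: fc_scale2)
    qed
    fix z assume z: "z \<in> H" "\<And>d. d \<in> fc k ` H \<Longrightarrow> ip z d = 0"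
    have "ip (fc k z) w = 0" if "w \<in> H" for w
      using z that k by (simp add: fc_sym)
    then have "fc k z = 0" using z k by (intro ip_eqI) auto
    then show "z = 0" using inj z by blast
  qed (use u k in auto)
  have "measure (spec u) ?Z \<le> 0"
  proof (rule nonpos_of_le_eps[where K = 4])
    fix e :: real assume e: "e > 0"
    have "(\<lambda>n. ip (s n - u) (s n - u)) \<longlonglongrightarrow> 0"
    proof (subst tends_sq[symmetric])
      have "s n \<in> H" for n using s(1)[of n] k by auto
      then show "\<forall>\<^sub>F n in sequentially. s n \<in> H" by simp
    qed (use s u in auto)
    then have "\<forall>\<^sub>F n in sequentially. ip (s n - u) (s n - u) < e" using e by (rule order_tendstoD)
    then obtain n where n: "ip (s n - u) (s n - u) < e" by (auto simp: eventually_sequentially)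
    obtain v where v: "v \<in> H" "s n = fc k v" using s(1)[of n] by auto
    obtain m0 where m0: "ip v v / e < real m0" using reals_Archimedean2 by blast
    define m where "m = Suc m0"
    have m: "m > 0" "ip v v / e < real m" using m0 by (auto simp: m_def)
    define h where "h x = max 0 (1 - real m * \<bar>k x\<bar>)" for x
    have h: "continuous_on {0..1} h" unfolding h_def using k by (intro continuous_intros)
    have h_bd: "0 \<le> h x" "h x \<le> 1" for x by (auto simp: h_def)
    have "measure (spec u) ?Z = (\<integral>x. indicator ?Z x \<partial>spec u)" using Z by simp
    also have "\<dots> \<le> (\<integral>x. (h x)\<^sup>2 \<partial>spec u)"
    proof (rule integral_mono)
      show "integrable (spec u) (indicator ?Z :: real \<Rightarrow> real)"
        using Z by (intro integrable_real_indicator) (simp_all add: emeasure_eq_measure)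
      show "integrable (spec u) (\<lambda>x. (h x)\<^sup>2)" using u h by (intro integrable_spec continuous_intros)
      show "indicator ?Z x \<le> (h x)\<^sup>2" for x by (auto simp: indicator_def h_def)
    qed
    also have "\<dots> = ip (fc h u) (fc h u)" using u h by (simp add: fc_square)
    also have "\<dots> = ip (fc h (u - s n) + fc h (fc k v)) (fc h (u - s n) + fc h (fc k v))"
      using u v h k by (simp add: fc_diff2)
    also have "\<dots> \<le> 2 * ip (fc h (u - s n)) (fc h (u - s n)) + 2 * ip (fc h (fc k v)) (fc h (fc k v))"
      using u v h k by (intro ip_square_add_le) auto
    also have "ip (fc h (u - s n)) (fc h (u - s n)) \<le> 1 * ip (u - s n) (u - s n)"
    proof -
      have "u - s n \<in> H" using u v k by simp
      from integral_spec_bound[OF this, of "\<lambda>x. (h x)\<^sup>2" 1] fc_square[OF this h] show ?thesis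
        using h h_bd by (simp add: continuous_on_power power_le_one)
    qed
    also have "ip (u - s n) (u - s n) = ip (s n - u) (s n - u)"
      using u v k by (simp add: ip_square_diff ip_commute)
    also have "ip (fc h (fc k v)) (fc h (fc k v)) \<le> (1 / real m) * ip v v"
    proof -
      have hk: "continuous_on {0..1} (\<lambda>x. h x * k x)" using h k by (intro continuous_intros)
      have "\<bar>h x * k x\<bar> \<le> 1 / real m" for x
      proof (cases "real m * \<bar>k x\<bar> \<le> 1")
        case True
        then have "\<bar>k x\<bar> \<le> 1 / real m" using m by (simp add: field_simps)
        then show ?thesis using h_bd[of x] by (simp add: abs_mult) (meson abs_ge_zero mult_left_le_one_le order_trans)
      qed (simp add: h_def)
      then have "(h x * k x)\<^sup>2 \<le> 1 / real m" for x
      proof -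
        have "(h x * k x)\<^sup>2 \<le> (1 / real m)\<^sup>2"
          using \<open>\<bar>h x * k x\<bar> \<le> 1 / real m\<close> by (metis abs_ge_zero power2_abs power_mono)
        also have "\<dots> \<le> 1 / real m" using m by (simp add: power2_eq_square field_simps)
        finally show ?thesis .
      qed
      then show ?thesis
        using integral_spec_bound[OF v(1), of "\<lambda>x. (h x * k x)\<^sup>2" "1 / real m"] v h k hk
        by (simp add: continuous_on_power fc_square flip: fc_mult)
    qed
    finally have "measure (spec u) ?Z \<le> 2 * ip (s n - u) (s n - u) + 2 * (1 / real m * ip v v)" by simp
    moreover have "1 / real m * ip v v \<le> e" using m e by (simp add: field_simps)
    ultimately show "measure (spec u) ?Z \<le> 4 * e" using n by simp
  qed
  then have "emeasure (spec u) ?Z = 0" by (simp add: emeasure_eq_measure measure_le_0_iff)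
  then show ?thesis using Z by (intro AE_I'[of ?Z]) (auto simp: null_sets_def)
qed

end

section \<open>Resolvents, square roots and closed forms\<close>

lemma (in hilbert_top) closure_of_eqI:
  assumes "D \<subseteq> H" "\<And>u. u \<in> H \<Longrightarrow> \<exists>s. (\<forall>n::nat. s n \<in> D) \<and> tends s u sequentially"
  shows "hs_top H ip closure_of D = H"
proof (rule subset_antisym)
  show "hs_top H ip closure_of D \<subseteq> H" by (metis closure_of_subset_topspace topspace_hs_top)
  show "H \<subseteq> hs_top H ip closure_of D"
  proof
    fix u assume u: "u \<in> H"
    then obtain s where "\<forall>n::nat. s n \<in> D" "tends s u sequentially" using assms(2) by blast
    then show "u \<in> hs_top H ip closure_of D"
      unfolding closure_of_hs_top using u assms(1) by blast
  qed
qed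

text \<open>Such an \<open>R\<close> is the resolvent \<open>(1 + A)\<^sup>-\<^sup>1\<close> of a non-negative self-adjoint operator \<open>A\<close>, which
  is called \<open>gen\<close> below.\<close>

locale resolvent = hilbert_top H ip + pos_contraction H ip R
  for H :: "'a::real_vector set" and ip :: "'a \<Rightarrow> 'a \<Rightarrow> real" and R :: "'a \<Rightarrow> 'a" +
  assumes R_inj: "\<lbrakk>v \<in> H; R v = 0\<rbrakk> \<Longrightarrow> v = 0"
begin

definition gen :: "('a \<times> 'a) set" where
  "gen = (\<lambda>v. (R v, v - R v)) ` H"

definition C :: "'a \<Rightarrow> 'a" where "C = fc sqrt"
definition S :: "'a \<Rightarrow> 'a" where "S = fc (\<lambda>x. sqrt (1 - x))"

text \<open>Since \<open>A = R\<^sup>-\<^sup>1 - 1\<close>, the square root of \<open>A\<close> is \<open>S C\<^sup>-\<^sup>1\<close>.\<close>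

definition root :: "('a \<times> 'a) set" where
  "root = (\<lambda>v. (C v, S v)) ` H"

lemma cont_sqrt: "continuous_on {0..1::real} sqrt" "continuous_on {0..1::real} (\<lambda>x. sqrt (1 - x))"
  by (intro continuous_intros)+

lemma C_in [simp]: "v \<in> H \<Longrightarrow> C v \<in> H" and S_in [simp]: "v \<in> H \<Longrightarrow> S v \<in> H"
  using cont_sqrt by (auto simp: C_def S_def)

lemma C_C: "v \<in> H \<Longrightarrow> C (C v) = R v"
proof -
  assume v: "v \<in> H"
  have "C (C v) = fc (\<lambda>x. sqrt x * sqrt x) v"
    unfolding C_def by (rule fc_mult[OF v cont_sqrt(1) cont_sqrt(1), symmetric])
  also have "\<dots> = fc (\<lambda>x. x) v" by (rule fc_cong) simp
  finally show ?thesis using v by simp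
qed

lemma S_S: "v \<in> H \<Longrightarrow> S (S v) = v - R v"
proof -
  assume v: "v \<in> H"
  have "S (S v) = fc (\<lambda>x. sqrt (1 - x) * sqrt (1 - x)) v"
    unfolding S_def by (rule fc_mult[OF v cont_sqrt(2) cont_sqrt(2), symmetric])
  also have "\<dots> = fc (\<lambda>x. 1 - x) v" by (rule fc_cong) simp
  also have "\<dots> = fc (\<lambda>x. 1) v - fc (\<lambda>x. x) v" by (intro fc_diff v continuous_intros)
  finally show ?thesis using v by simp
qed

lemma S_C: "v \<in> H \<Longrightarrow> S (C v) = C (S v)"
  unfolding C_def S_def using cont_sqrt by (intro fc_commute)

lemma C_sym: "u \<in> H \<Longrightarrow> v \<in> H \<Longrightarrow> ip (C u) v = ip u (C v)"
  and S_sym: "u \<in> H \<Longrightarrow> v \<in> H \<Longrightarrow> ip (S u) v = ip u (S v)"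
  unfolding C_def S_def using cont_sqrt by (auto intro: fc_sym)

lemma C_linear: "u \<in> H \<Longrightarrow> v \<in> H \<Longrightarrow> C (u + v) = C u + C v" "u \<in> H \<Longrightarrow> v \<in> H \<Longrightarrow> C (u - v) = C u - C v"
    "u \<in> H \<Longrightarrow> C (r *\<^sub>R u) = r *\<^sub>R C u"
  and S_linear: "u \<in> H \<Longrightarrow> v \<in> H \<Longrightarrow> S (u + v) = S u + S v" "u \<in> H \<Longrightarrow> v \<in> H \<Longrightarrow> S (u - v) = S u - S v"
    "u \<in> H \<Longrightarrow> S (r *\<^sub>R u) = r *\<^sub>R S u"
  unfolding C_def S_def using cont_sqrt by (auto simp: fc_add2 fc_diff2 fc_scale2)

lemma ip_C_S: "u \<in> H \<Longrightarrow> v \<in> H \<Longrightarrow> ip (C u) (C v) + ip (S u) (S v) = ip u v"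
  by (simp add: C_sym S_sym C_C S_S ip_simps)

lemma nrm_C_le: "v \<in> H \<Longrightarrow> nrm (C v) \<le> 1 * nrm v"
  unfolding C_def using cont_sqrt by (intro fc_bound) auto

lemma C_inj: "v \<in> H \<Longrightarrow> C v = 0 \<Longrightarrow> v = 0"
  using C_C[of v] R_inj[of v] C_linear(3)[of 0 0] by simp

lemma tends_C:
  assumes "tends s u sequentially" "\<And>n. s n \<in> H" "u \<in> H"
  shows "tends (\<lambda>n. C (s n)) (C u) sequentially"
proof (rule tends_squeeze)
  show "\<forall>\<^sub>F n in sequentially. nrm (C (s n) - C u) \<le> nrm (s n - u)"
    using assms nrm_C_le by (simp flip: C_linear)
  show "(\<lambda>n. nrm (s n - u)) \<longlonglongrightarrow> 0" using assms(1) by (simp add: tends_def)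
qed (use assms in auto)

lemma dense_C:
  assumes "u \<in> H"
  obtains s where "\<And>n::nat. s n \<in> H" "tends (\<lambda>n. C (s n)) u sequentially"
proof -
  obtain t where t: "\<And>n::nat. t n \<in> C ` H" "tends t u sequentially"
  proof (rule dense_of_trivial_complement[of "C ` H" u])
    show "subspace (C ` H)"
    proof (rule subspaceI)
      have "C 0 = 0" using C_linear(3)[of 0 0] by simp
      then show "0 \<in> C ` H" using H_0 by (metis image_eqI)
    qed (auto simp flip: C_linear)
    fix z assume z: "z \<in> H" "\<And>d. d \<in> C ` H \<Longrightarrow> ip z d = 0"
    then have "C z = 0" by (intro ip_eqI) (auto simp: C_sym)
    then show "z = 0" using C_inj z by blast
  qed (use assms in auto)
  then have "\<forall>n. \<exists>v\<in>H. t n = C v" by auto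
  then obtain s where "\<And>n. s n \<in> H" "\<And>n. t n = C (s n)" by metis
  moreover have "t = (\<lambda>n. C (s n))" using \<open>\<And>n. t n = C (s n)\<close> by auto
  ultimately show thesis using t(2) that by blast
qed

lemma root_iff: "(x, y) \<in> root \<longleftrightarrow> x \<in> H \<and> y \<in> H \<and> C y = S x"
proof
  assume R: "x \<in> H \<and> y \<in> H \<and> C y = S x"
  define v where "v = C x + S y"
  have "C (S y) = S (S x)" "C (S x) = R y" using R by (metis S_C, metis C_C)
  then have "C v = x" "S v = y"
    using R by (simp_all add: v_def C_linear S_linear C_C S_S S_C)
  moreover have "v \<in> H" using R by (simp add: v_def)
  ultimately show "(x, y) \<in> root" unfolding root_def by blast
qed (auto simp: root_def S_C)

lemma self_adjoint_root: "self_adjoint H ip root"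
  unfolding self_adjoint_def
proof
  have "Domain root = C ` H" by (auto simp: root_def)
  then show "hs_top H ip closure_of Domain root = H"
  proof (simp, intro closure_of_eqI)
    show "\<exists>s. (\<forall>n::nat. s n \<in> C ` H) \<and> tends s u sequentially" if u: "u \<in> H" for u
      by (rule dense_C[OF u]) (rule exI, rule conjI, rule allI, rule imageI)
  qed auto
  show "op_adjoint H ip root = root"
  proof (intro subset_antisym subrelI)
    fix x y assume "(x, y) \<in> op_adjoint H ip root"
    then have xy: "x \<in> H" "y \<in> H" and *: "\<And>v. v \<in> H \<Longrightarrow> ip (S v) x = ip (C v) y"
      by (auto simp: op_adjoint_def root_def)
    have "C y = S x"
    proof (rule ip_eqI)
      show "ip (C y) v = ip (S x) v" if v: "v \<in> H" for v
        using *[OF v] xy v ip_commute[of "S v" x] ip_commute[of "C v" y] by (simp add: C_sym S_sym)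
    qed (use xy in auto)
    then show "(x, y) \<in> root" using xy by (simp add: root_iff)
  next
    fix x y assume "(x, y) \<in> root"
    then show "(x, y) \<in> op_adjoint H ip root"
      by (auto simp: op_adjoint_def root_def C_sym S_sym S_C)
  qed
qed

lemma nonneg_root: "nonneg_op ip root"
proof -
  have "0 \<le> ip (C v) (S v)" if v: "v \<in> H" for v
  proof -
    have cs: "continuous_on {0..1::real} (\<lambda>x. sqrt (1 - x) * sqrt x)" by (intro continuous_intros)
    have "ip (C v) (S v) = ip v (S (C v))" using v by (simp add: C_sym S_C)
    also have "\<dots> = ip (fc (\<lambda>x. sqrt (1 - x) * sqrt x) v) v"
      using v cs unfolding C_def S_def by (simp add: fc_mult[OF v cont_sqrt(2,1)] ip_commute cont_sqrt)
    finally show ?thesis using fc_nonneg[OF v cs] by simp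
  qed
  then show ?thesis by (auto simp: nonneg_op_def root_def)
qed

lemma gen_iff: "(u, w) \<in> gen \<longleftrightarrow> u \<in> H \<and> w \<in> H \<and> R (u + w) = u"
proof
  assume "u \<in> H \<and> w \<in> H \<and> R (u + w) = u"
  then show "(u, w) \<in> gen" unfolding gen_def by (intro image_eqI[of _ _ "u + w"]) auto
qed (auto simp: gen_def)

lemma root_root: "root O root = gen"
proof (intro subset_antisym subrelI)
  fix x z assume "(x, z) \<in> root O root"
  then obtain y where xy: "(x, y) \<in> root" and yz: "(y, z) \<in> root" by auto
  then obtain v where v: "v \<in> H" "x = C v" "y = S v" by (auto simp: root_def)
  have z: "z \<in> H" "C z = S (S v)" using yz v by (auto simp: root_iff)
  have "R z = C (S (S v))" using z by (simp flip: C_C)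
  also have "\<dots> = S (S (C v))" using v by (simp flip: S_C)
  also have "\<dots> = x - R x" using v by (simp add: S_S)
  finally show "(x, z) \<in> gen" using z v by (simp add: gen_iff R_add)
next
  fix x z assume "(x, z) \<in> gen"
  then obtain v where v: "v \<in> H" "x = C (C v)" "z = S (S v)" by (auto simp: gen_def C_C S_S)
  then have "(x, S (C v)) \<in> root" "(C (S v), z) \<in> root" by (auto simp: root_def)
  then show "(x, z) \<in> root O root" using v by (auto simp: S_C)
qed

lemma self_adjoint_gen: "self_adjoint H ip gen"
  unfolding self_adjoint_def
proof
  have "Domain gen = R ` H" by (auto simp: gen_def)
  moreover have "hs_top H ip closure_of (R ` H) = H"
  proof (rule closure_of_eqI)
    fix u assume u: "u \<in> H"
    show "\<exists>s. (\<forall>n::nat. s n \<in> R ` H) \<and> tends s u sequentially"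
    proof (rule dense_of_trivial_complement[of "R ` H" u])
      show "subspace (R ` H)"
        by (rule subspaceI) (auto intro: image_eqI[of _ R 0] simp flip: R_add R_scale)
      fix z assume z: "z \<in> H" "\<And>d. d \<in> R ` H \<Longrightarrow> ip z d = 0"
      then have "R z = 0" by (intro ip_eqI) (auto simp: R_sym)
      then show "z = 0" using R_inj z by blast
    qed (use u in auto)
  qed auto
  ultimately show "hs_top H ip closure_of Domain gen = H" by simp
  show "op_adjoint H ip gen = gen"
  proof (intro subset_antisym subrelI)
    fix x y assume "(x, y) \<in> op_adjoint H ip gen"
    then have xy: "x \<in> H" "y \<in> H" and *: "\<And>v. v \<in> H \<Longrightarrow> ip (v - R v) x = ip (R v) y"
      by (auto simp: op_adjoint_def gen_def)
    have "R (x + y) = x"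
    proof (rule ip_eqI)
      fix v assume v: "v \<in> H"
      show "ip (R (x + y)) v = ip x v"
        using *[OF v] v xy ip_commute[of "R v" x] ip_commute[of "R v" y] ip_commute[of v x]
        by (simp add: R_sym ip_simps)
    qed (use xy in auto)
    then show "(x, y) \<in> gen" using xy by (simp add: gen_iff)
  next
    fix x y assume "(x, y) \<in> gen"
    then show "(x, y) \<in> op_adjoint H ip gen"
      by (auto simp: op_adjoint_def gen_def R_sym ip_simps)
  qed
qed

lemma nonneg_gen: "nonneg_op ip gen"
proof -
  have "0 \<le> ip (R v) (v - R v)" if v: "v \<in> H" for v
  proof -
    have "ip (R v) (v - R v) = ip (C (C v)) (S (S v))" using v by (simp add: C_C S_S)
    also have "\<dots> = ip (S (C v)) (S (C v))" using v by (simp add: C_sym S_sym S_C)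
    finally have "ip (R v) (v - R v) = ip (S (C v)) (S (C v))" .
    then show ?thesis using v by (simp add: ip_nonneg)
  qed
  then show ?thesis by (auto simp: nonneg_op_def gen_def)
qed

end

context hilbert_top
begin

lemma op_adjoint_antimono: "A \<subseteq> B \<Longrightarrow> op_adjoint H ip B \<subseteq> op_adjoint H ip A"
  by (auto simp: op_adjoint_def)

lemma self_adjoint_subset_eq:
  "self_adjoint H ip A \<Longrightarrow> self_adjoint H ip B \<Longrightarrow> A \<subseteq> B \<Longrightarrow> A = B"
  using op_adjoint_antimono[of A B] by (auto simp: self_adjoint_def)

lemma self_adjointD:
  assumes "self_adjoint H ip A"
  shows "(u, w) \<in> A \<Longrightarrow> u \<in> H" "(u, w) \<in> A \<Longrightarrow> w \<in> H"
    and "(u, w) \<in> A \<Longrightarrow> (x, y) \<in> A \<Longrightarrow> ip y u = ip x w"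
    and "\<lbrakk>u \<in> H; w \<in> H; \<And>x y. (x, y) \<in> A \<Longrightarrow> ip y u = ip x w\<rbrakk> \<Longrightarrow> (u, w) \<in> A"
proof -
  have eq: "A = op_adjoint H ip A" using assms by (simp add: self_adjoint_def)
  show "(u, w) \<in> A \<Longrightarrow> u \<in> H" "(u, w) \<in> A \<Longrightarrow> w \<in> H"
    by (subst (asm) eq, simp add: op_adjoint_def)+
  show "(u, w) \<in> A \<Longrightarrow> (x, y) \<in> A \<Longrightarrow> ip y u = ip x w"
    by (subst (asm) eq) (auto simp: op_adjoint_def)
  show "\<lbrakk>u \<in> H; w \<in> H; \<And>x y. (x, y) \<in> A \<Longrightarrow> ip y u = ip x w\<rbrakk> \<Longrightarrow> (u, w) \<in> A"
    by (subst eq) (auto simp: op_adjoint_def)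
qed

lemma self_adjoint_linear:
  assumes A: "self_adjoint H ip A"
  shows "(u, w) \<in> A \<Longrightarrow> (u', w') \<in> A \<Longrightarrow> (u + u', w + w') \<in> A"
    and "(u, w) \<in> A \<Longrightarrow> (r *\<^sub>R u, r *\<^sub>R w) \<in> A"
    and "(u, w) \<in> A \<Longrightarrow> (u', w') \<in> A \<Longrightarrow> (u - u', w - w') \<in> A"
    and "(0, 0) \<in> A"
proof -
  note D = self_adjointD[OF A]
  have add: "(u + u', w + w') \<in> A" if 1: "(u, w) \<in> A" and 2: "(u', w') \<in> A" for u w u' w'
  proof (rule D(4))
    fix x y assume xy: "(x, y) \<in> A"
    show "ip y (u + u') = ip x (w + w')"
      using D(3)[OF 1 xy] D(3)[OF 2 xy] D(1,2)[OF 1] D(1,2)[OF 2] D(1,2)[OF xy] by (simp add: ip_add2)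
  qed (use D(1,2)[OF 1] D(1,2)[OF 2] in auto)
  have scale: "(r *\<^sub>R u, r *\<^sub>R w) \<in> A" if 1: "(u, w) \<in> A" for u w r
  proof (rule D(4))
    fix x y assume xy: "(x, y) \<in> A"
    show "ip y (r *\<^sub>R u) = ip x (r *\<^sub>R w)"
      using D(3)[OF 1 xy] D(1,2)[OF 1] D(1,2)[OF xy] by (simp add: ip_scale2)
  qed (use D(1,2)[OF 1] in auto)
  show "(u, w) \<in> A \<Longrightarrow> (u', w') \<in> A \<Longrightarrow> (u + u', w + w') \<in> A" by (rule add)
  show "(u, w) \<in> A \<Longrightarrow> (r *\<^sub>R u, r *\<^sub>R w) \<in> A" by (rule scale)
  show "(u, w) \<in> A \<Longrightarrow> (u', w') \<in> A \<Longrightarrow> (u - u', w - w') \<in> A"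
    using add[of u w "- u'" "- w'"] scale[of u' w' "-1"] by simp
  show "(0, 0) \<in> A"
  proof (rule D(4))
    show "ip y 0 = ip x 0" if "(x, y) \<in> A" for x y using D(1,2)[OF that] by simp
  qed auto
qed

lemma closure_of_trivial_complement:
  assumes "hs_top H ip closure_of D = H" "z \<in> H" "\<And>x. x \<in> D \<Longrightarrow> ip x z = 0"
  shows "z = 0"
proof -
  obtain s where s: "\<And>n. s n \<in> D" "\<And>n::nat. s n \<in> H" "tends s z sequentially"
    using assms(1,2) closure_of_hs_top[of z D] by blast
  have "(\<lambda>n. ip (s n) z) \<longlonglongrightarrow> ip z z"
    using s assms(2) by (intro tends_ip_const) auto
  then have "ip z z = 0" using s(1) assms(3) by (simp add: LIMSEQ_const_iff)
  then show ?thesis using ip_definite assms(2) by blast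
qed

text \<open>Every non-negative self-adjoint operator has a resolvent: \<open>1 + A\<close> is bounded below, so its range
  is closed, and a vector orthogonal to the range would be an eigenvector for \<open>-1\<close>.\<close>

lemma resolvent_exists:
  assumes A: "self_adjoint H ip A" and nn: "nonneg_op ip A"
  obtains R where "resolvent H ip R" "A = resolvent.gen H R"
proof -
  note D = self_adjointD[OF A] and L = self_adjoint_linear[OF A]
  have pos: "0 \<le> ip u w" if "(u, w) \<in> A" for u w using nn that by (auto simp: nonneg_op_def)
  have below: "ip u u + ip w w \<le> ip (u + w) (u + w)" if "(u, w) \<in> A" for u w
    using pos[OF that] D(1,2)[OF that] by (simp add: ip_square_add)
  have "\<exists>u w. (u, w) \<in> A \<and> u + w = v" if v: "v \<in> H" for v
  proof -
    have sub: "subspace A"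
      by (rule subspaceI) (auto simp: zero_prod_def intro: L)
    obtain z s where z: "z \<in> H" "\<And>d. d \<in> A \<Longrightarrow> ip v (fst d + snd d) = ip z (fst d + snd d)"
      and s: "\<And>n::nat. s n \<in> A" "tends (\<lambda>n. fst (s n) + snd (s n)) z sequentially"
    proof (rule dominated_functional[OF sub, where T = "\<lambda>d. fst d + snd d" and \<phi> = "\<lambda>d. ip v (fst d + snd d)" and K = "nrm v"])
      fix d e assume "d \<in> A" "e \<in> A"
      then have "fst d \<in> H" "snd d \<in> H" "fst e \<in> H" "snd e \<in> H"
        using D(1,2) by (metis prod.collapse)+
      then show "\<bar>ip v (fst d + snd d)\<bar> \<le> nrm v * nrm (fst d + snd d)"
        "ip v (fst (d + e) + snd (d + e)) = ip v (fst d + snd d) + ip v (fst e + snd e)"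
        "\<And>r. ip v (fst (r *\<^sub>R d) + snd (r *\<^sub>R d)) = r * ip v (fst d + snd d)"
        "fst d + snd d \<in> H"
        using v cauchy_schwarz[OF v, of "fst d + snd d"] by (simp_all add: ip_simps distrib_left)
    qed (auto simp: scaleR_add_right)
    have "(v - z, - (v - z)) \<in> A"
    proof (rule D(4))
      fix x y assume xy: "(x, y) \<in> A"
      then have "ip v (x + y) = ip z (x + y)" using z(2) by fastforce
      then show "ip y (v - z) = ip x (- (v - z))"
        using D(1,2)[OF xy] v z(1) by (simp add: ip_simps ip_commute)
    qed (use v z in simp_all)
    from pos[OF this] have "ip (v - z) (v - z) \<le> 0" using v z by (simp add: ip_neg2 del: minus_diff_eq)
    then have "ip (v - z) (v - z) = 0" using ip_nonneg[of "v - z"] v z by simp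
    then have vz: "v = z" using ip_definite[of "v - z"] v z by simp
    have sH: "fst (s n) \<in> H" "snd (s n) \<in> H" for n using s(1)[of n] D(1,2) by (metis prod.collapse)+
    have cauchy: "\<exists>N. \<forall>m\<ge>N. \<forall>n\<ge>N. ip (fst (s m) - fst (s n)) (fst (s m) - fst (s n)) +
        ip (snd (s m) - snd (s n)) (snd (s m) - snd (s n)) < e" if e: "e > 0" for e
    proof -
      obtain N where N: "\<And>m n. m \<ge> N \<Longrightarrow> n \<ge> N \<Longrightarrow> ip ((fst (s m) + snd (s m)) - (fst (s n) + snd (s n)))
          ((fst (s m) + snd (s m)) - (fst (s n) + snd (s n))) < e"
        using tends_cauchy[OF _ z(1) s(2) e] sH by (metis (no_types, lifting) H_add)
      have "ip (fst (s m) - fst (s n)) (fst (s m) - fst (s n)) +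
        ip (snd (s m) - snd (s n)) (snd (s m) - snd (s n)) < e" if "m \<ge> N" "n \<ge> N" for m n
      proof -
        have "(fst (s m) - fst (s n), snd (s m) - snd (s n)) \<in> A"
          using L(3)[of "fst (s m)" "snd (s m)" "fst (s n)" "snd (s n)"] s(1) by simp
        from below[OF this] N[OF that] show ?thesis by (simp only: add_diff_add)
      qed
      then show ?thesis by blast
    qed
    have nn': "0 \<le> ip (fst (s m) - fst (s n)) (fst (s m) - fst (s n))"
        "0 \<le> ip (snd (s m) - snd (s n)) (snd (s m) - snd (s n))" for m n
      using sH by (simp_all add: ip_nonneg)
    obtain u where u: "u \<in> H" "tends (\<lambda>n. fst (s n)) u sequentially"
    proof (rule cauchy_tends[of "\<lambda>n. fst (s n)"])
      fix e :: real assume "e > 0"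
      from cauchy[OF this] obtain N where N: "\<And>m n. m \<ge> N \<Longrightarrow> n \<ge> N \<Longrightarrow>
          ip (fst (s m) - fst (s n)) (fst (s m) - fst (s n)) +
          ip (snd (s m) - snd (s n)) (snd (s m) - snd (s n)) < e" by blast
      have "ip (fst (s m) - fst (s n)) (fst (s m) - fst (s n)) < e" if "m \<ge> N" "n \<ge> N" for m n
        using N[OF that] nn'[of m n] by linarith
      then show "\<exists>N. \<forall>m\<ge>N. \<forall>n\<ge>N. ip (fst (s m) - fst (s n)) (fst (s m) - fst (s n)) < e" by blast
    qed (use sH in auto)
    obtain w where w: "w \<in> H" "tends (\<lambda>n. snd (s n)) w sequentially"
    proof (rule cauchy_tends[of "\<lambda>n. snd (s n)"])
      fix e :: real assume "e > 0"
      from cauchy[OF this] obtain N where N: "\<And>m n. m \<ge> N \<Longrightarrow> n \<ge> N \<Longrightarrow>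
          ip (fst (s m) - fst (s n)) (fst (s m) - fst (s n)) +
          ip (snd (s m) - snd (s n)) (snd (s m) - snd (s n)) < e" by blast
      have "ip (snd (s m) - snd (s n)) (snd (s m) - snd (s n)) < e" if "m \<ge> N" "n \<ge> N" for m n
        using N[OF that] nn'[of m n] by linarith
      then show "\<exists>N. \<forall>m\<ge>N. \<forall>n\<ge>N. ip (snd (s m) - snd (s n)) (snd (s m) - snd (s n)) < e" by blast
    qed (use sH in auto)
    have "(u, w) \<in> A"
    proof (rule D(4)[OF u(1) w(1)])
      fix x y assume xy: "(x, y) \<in> A"
      have xyH: "x \<in> H" "y \<in> H" using D(1,2)[OF xy] by auto
      have "(\<lambda>n. ip y (fst (s n))) \<longlonglongrightarrow> ip y u"
        by (rule tends_ip) (use xyH u sH in \<open>auto simp: tends_const\<close>)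
      moreover have "(\<lambda>n. ip x (snd (s n))) \<longlonglongrightarrow> ip x w"
        by (rule tends_ip) (use xyH w sH in \<open>auto simp: tends_const\<close>)
      moreover have "ip y (fst (s n)) = ip x (snd (s n))" for n
        using D(3)[OF _ xy, of "fst (s n)" "snd (s n)"] s(1) by simp
      ultimately show "ip y u = ip x w" by (simp add: LIMSEQ_unique)
    qed
    moreover have "u + w = z"
    proof (rule tends_unique)
      show "tends (\<lambda>n. fst (s n) + snd (s n)) (u + w) sequentially"
        using u w sH by (intro tends_add) auto
    qed (use s(2) z u w sH in auto)
    ultimately show ?thesis using vz by auto
  qed
  then obtain R W where RW: "\<And>v. v \<in> H \<Longrightarrow> (R v, W v) \<in> A" "\<And>v. v \<in> H \<Longrightarrow> R v + W v = v"
    by metis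
  have RH: "R v \<in> H" "W v \<in> H" if "v \<in> H" for v using RW(1)[OF that] D(1,2) by auto
  have W: "W v = v - R v" if "v \<in> H" for v using RW(2)[OF that] by (metis add_diff_cancel_left')
  have uniq: "u = R v" if uw: "(u, w) \<in> A" and v: "u + w = v" for u w v
  proof -
    have vH: "v \<in> H" using v D(1,2)[OF uw] by auto
    have in_A: "(u - R v, w - W v) \<in> A" using L(3)[OF uw RW(1)[OF vH]] .
    have "w - W v = - (u - R v)" using v RW(2)[OF vH] by (simp add: algebra_simps) 
    with pos[OF in_A] have "ip (u - R v) (u - R v) \<le> 0"
      using D(1)[OF uw] RH vH by (simp add: ip_neg2 del: minus_diff_eq)
    then have "ip (u - R v) (u - R v) = 0" using ip_nonneg[of "u - R v"] D(1)[OF uw] RH vH by simp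
    then show ?thesis using ip_definite[of "u - R v"] D(1)[OF uw] RH vH by simp
  qed
  have res: "resolvent H ip R"
  proof
    fix u v assume uv: "u \<in> H" "v \<in> H"
    show "R (u + v) = R u + R v"
      using uniq[OF L(1)[OF RW(1)[OF uv(1)] RW(1)[OF uv(2)]], of "u + v"] W uv by simp
    show "R (r *\<^sub>R u) = r *\<^sub>R R u" for r
      using uniq[OF L(2)[OF RW(1)[OF uv(1)]], of r "r *\<^sub>R u"] W uv by (simp add: scaleR_diff_right)
    have "ip (W u) (R v) = ip (R u) (W v)" using D(3)[OF RW(1)[OF uv(2)] RW(1)[OF uv(1)]] .
    then show "ip (R u) v = ip u (R v)" using uv RH by (simp add: W ip_simps)
    have p: "0 \<le> ip (R u) (W u)" using pos[OF RW(1)[OF uv(1)]] .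
    then show "0 \<le> ip (R u) u" using uv RH ip_nonneg[of "R u"] by (simp add: W ip_simps)
    have "ip u u = ip (R u) u + ip (W u) u" using uv RH RW(2)[OF uv(1)] using ip_add[of "R u" "W u" u] by simp
    moreover have "ip (W u) u = ip (R u) (W u) + ip (W u) (W u)"
      using uv RH RW(2)[OF uv(1)] ip_add2[of "R u" "W u" "W u"] ip_commute[of "R u" "W u"] by simp
    ultimately show "ip (R u) u \<le> ip u u" using p RH ip_nonneg[of "W u"] uv by simp
    assume R0: "R u = 0"
    have dense: "hs_top H ip closure_of Domain A = H" using A by (simp add: self_adjoint_def)
    show "u = 0"
    proof (rule closure_of_trivial_complement[OF dense uv(1)])
      fix x assume "x \<in> Domain A"
      then obtain y where xy: "(x, y) \<in> A" by auto
      have "(0, u) \<in> A" using RW(1)[OF uv(1)] W[OF uv(1)] R0 by simp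
      from D(3)[OF this xy] show "ip x u = 0" using D(2)[OF xy] by simp
    qed
  qed (use RH in auto)
  interpret R: resolvent H ip R by (rule res)
  have "A = R.gen"
  proof (intro subset_antisym subrelI)
    fix u w assume uw: "(u, w) \<in> A"
    then show "(u, w) \<in> R.gen" using uniq[OF uw refl] D(1,2)[OF uw] by (simp add: R.gen_iff)
  next
    fix u w assume "(u, w) \<in> R.gen"
    then show "(u, w) \<in> A" using RW(1) W by (auto simp: R.gen_def)
  qed
  with res show thesis using that by blast
qed

end

context resolvent
begin

text \<open>Uniqueness of the square root. If \<open>B\<^sup>2 = A\<close> and \<open>Q = (1 + B)\<^sup>-\<^sup>1\<close>, then
  \<open>R = (1 + B\<^sup>2)\<^sup>-\<^sup>1\<close> is the function \<open>q\<^sup>2 / (q\<^sup>2 + (1 - q)\<^sup>2)\<close> of \<open>Q\<close>; thus \<open>C\<close> and \<open>S\<close> are functions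
  of \<open>Q\<close> as well, and \<open>C (1 - Q) = S Q\<close> places the graph of \<open>B\<close> inside \<open>root\<close>.\<close>

lemma root_unique:
  assumes B: "self_adjoint H ip B" "nonneg_op ip B" "B O B = gen"
  shows "B = root"
proof -
  obtain Q where Q: "resolvent H ip Q" and BQ: "B = resolvent.gen H Q"
    using resolvent_exists[OF B(1,2)] by blast
  interpret Q: resolvent H ip Q by (rule Q)
  define D where "D q = q\<^sup>2 + (1 - q)\<^sup>2" for q :: real
  have D_pos: "D q > 0" for q
    unfolding D_def by (cases "q = 0") (auto intro: add_pos_nonneg)
  have D_cont: "continuous_on {0..1} D" unfolding D_def by (intro continuous_intros)
  define f where "f q = q\<^sup>2 / D q" for q
  have D_inv: "continuous_on {0..1} (\<lambda>q. 1 / D q)"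
    using D_cont D_pos by (intro continuous_intros) (auto simp: less_imp_neq[symmetric])
  have f_cont: "continuous_on {0..1} f"
    unfolding f_def using D_cont D_pos by (intro continuous_intros) (auto simp: less_imp_neq[symmetric])
  have f_01: "f q \<in> {0..1}" for q
    using D_pos[of q] by (auto simp: f_def divide_le_eq_1) (simp add: D_def)
  have one_minus_Q: "x - Q x = Q.fc (\<lambda>q. 1 - q) x" if "x \<in> H" for x
    using Q.fc_diff[of x "\<lambda>_. 1" "\<lambda>q. q"] that by (simp add: continuous_on_id)
  have R_eq: "R v = Q.fc f v" if v: "v \<in> H" for v
  proof -
    define x where "x = Q.fc (\<lambda>q. 1 / D q) v"
    have x: "x \<in> H" using v D_inv by (simp add: x_def)
    let ?Px = "x - Q x"
    have "(Q (Q x), Q x - Q (Q x)) \<in> B" "(Q ?Px, ?Px - Q ?Px) \<in> B"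
      unfolding BQ Q.gen_def using x by auto
    then have "(Q (Q x), ?Px - Q ?Px) \<in> gen"
      unfolding B(3)[symmetric] using x by (auto simp: Q.R_diff)
    then have R: "R (Q (Q x) + (?Px - Q ?Px)) = Q (Q x)" by (simp add: gen_iff)
    have QQ: "Q (Q x) = Q.fc (\<lambda>q. q * q) x"
      using x by (subst Q.fc_mult) (auto intro: continuous_intros)
    have PP: "?Px - Q ?Px = Q.fc (\<lambda>q. (1 - q) * (1 - q)) x"
    proof -
      have "?Px - Q ?Px = Q.fc (\<lambda>q. 1 - q) ?Px" by (rule one_minus_Q) (use x in simp)
      also have "\<dots> = Q.fc (\<lambda>q. 1 - q) (Q.fc (\<lambda>q. 1 - q) x)" by (simp only: one_minus_Q[OF x])
      also have "\<dots> = Q.fc (\<lambda>q. (1 - q) * (1 - q)) x"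
        using x by (intro Q.fc_mult[symmetric] continuous_intros)
      finally show ?thesis .
    qed
    have "Q (Q x) + (?Px - Q ?Px) = Q.fc (\<lambda>q. q * q + (1 - q) * (1 - q)) x"
      unfolding QQ PP using x by (intro Q.fc_add[symmetric] continuous_intros)
    also have "\<dots> = Q.fc D x" by (rule Q.fc_cong) (simp add: D_def power2_eq_square)
    also have "\<dots> = Q.fc (\<lambda>q. D q * (1 / D q)) v"
      unfolding x_def using v D_cont D_inv by (intro Q.fc_mult[symmetric])
    also have "\<dots> = Q.fc (\<lambda>_. 1) v" by (rule Q.fc_cong) (use D_pos in \<open>simp add: less_imp_neq[symmetric]\<close>)
    finally have "Q (Q x) + (?Px - Q ?Px) = v" using v by simp
    with R have "R v = Q (Q x)" by simp
    also have "\<dots> = Q.fc (\<lambda>q. (q * q) * (1 / D q)) v"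
      unfolding QQ unfolding x_def using v D_inv
      by (intro Q.fc_mult[symmetric] continuous_on_mult continuous_on_id)
    also have "\<dots> = Q.fc f v" by (rule Q.fc_cong) (simp add: f_def power2_eq_square)
    finally show ?thesis .
  qed
  have pc: "pos_contraction H ip R" by unfold_locales
  note comp = Q.fc_compose[OF pc R_eq f_cont f_01]
  have sf: "continuous_on {0..1} (\<lambda>q. sqrt (f q))" "continuous_on {0..1} (\<lambda>q. sqrt (1 - f q))"
    by (intro continuous_intros f_cont)+
  have "B \<subseteq> root"
  proof (rule subrelI)
    fix u w assume "(u, w) \<in> B"
    then obtain x where x: "x \<in> H" "u = Q x" "w = x - Q x" unfolding BQ Q.gen_def by auto
    have w: "w = Q.fc (\<lambda>q. 1 - q) x" and u: "u = Q.fc (\<lambda>q. q) x" using x by (simp_all add: one_minus_Q)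
    have uw: "u \<in> H" "w \<in> H" using x by auto
    have "C w = Q.fc (\<lambda>q. sqrt (f q)) w"
      unfolding C_def using uw cont_sqrt by (intro comp)
    also have "\<dots> = Q.fc (\<lambda>q. sqrt (f q) * (1 - q)) x"
      unfolding w by (intro Q.fc_mult[symmetric] sf x continuous_on_diff continuous_on_const continuous_on_id)
    also have "\<dots> = Q.fc (\<lambda>q. sqrt (1 - f q) * q) x"
    proof (rule Q.fc_cong)
      fix q :: real assume q: "q \<in> {0..1}"
      have "1 - f q = (1 - q)\<^sup>2 / D q"
        using D_pos[of q] by (simp add: f_def D_def field_simps)
      then show "sqrt (f q) * (1 - q) = sqrt (1 - f q) * q"
        using q by (simp add: f_def real_sqrt_divide)
    qed
    also have "\<dots> = Q.fc (\<lambda>q. sqrt (1 - f q)) u"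
      unfolding u by (intro Q.fc_mult sf x continuous_on_id)
    also have "\<dots> = S u"
      unfolding S_def using uw cont_sqrt by (intro comp[symmetric])
    finally show "(u, w) \<in> root" using uw by (simp add: root_iff)
  qed
  then show ?thesis by (rule self_adjoint_subset_eq[OF B(1) self_adjoint_root])
qed

lemma op_sqrt_gen: "op_sqrt H ip gen = root"
  unfolding op_sqrt_def
proof (rule the_equality)
  show "self_adjoint H ip root \<and> nonneg_op ip root \<and> root O root = gen"
    by (intro conjI self_adjoint_root nonneg_root root_root)
  show "B = root" if "self_adjoint H ip B \<and> nonneg_op ip B \<and> B O B = gen" for B
    using that by (intro root_unique) blast+
qed

end

subsection \<open>Closed forms and their operators\<close>

text \<open>Kato's first representation theorem. A closed form is one whose domain \<open>Q\<close> is a Hilbert space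
  for \<open>q + ip\<close>; the resolvent is the Riesz representation of \<open>ip v\<close> in that space.\<close>

locale closed_form = hilbert_top H ip + form: hilbert Q "\<lambda>u v. q u v + ip u v"
  for H :: "'a::real_vector set" and ip :: "'a \<Rightarrow> 'a \<Rightarrow> real" and Q and q :: "'a \<Rightarrow> 'a \<Rightarrow> real" +
  assumes Q_sub: "Q \<subseteq> H"
    and q_nonneg: "u \<in> Q \<Longrightarrow> 0 \<le> q u u"
    and Q_dense: "\<lbrakk>z \<in> H; \<And>x. x \<in> Q \<Longrightarrow> ip z x = 0\<rbrakk> \<Longrightarrow> z = 0"
begin

definition form_op :: "('a \<times> 'a) set" where
  "form_op = {(u, w). u \<in> Q \<and> w \<in> H \<and> (\<forall>x\<in>Q. q u x = ip w x)}"

lemma Q_H [simp]: "u \<in> Q \<Longrightarrow> u \<in> H" using Q_sub by blast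

lemma nrm_le_form: "u \<in> Q \<Longrightarrow> nrm u \<le> form.nrm u"
  using q_nonneg[of u] by (simp add: nrm_def form.nrm_def)

lemma form_resolvent_ex:
  assumes v: "v \<in> H"
  shows "\<exists>u\<in>Q. \<forall>x\<in>Q. q u x + ip u x = ip v x"
proof -
  obtain w where "w \<in> Q" "\<And>x. x \<in> Q \<Longrightarrow> ip v x = q w x + ip w x"
  proof (rule form.riesz[of "ip v" "nrm v"])
    fix x assume x: "x \<in> Q"
    have "\<bar>ip v x\<bar> \<le> nrm v * nrm x" using cauchy_schwarz v x by simp
    also have "\<dots> \<le> nrm v * form.nrm x" using nrm_le_form x v by (intro mult_left_mono) auto
    finally show "\<bar>ip v x\<bar> \<le> nrm v * form.nrm x" .
  qed (use v in \<open>auto simp: ip_add2 ip_scale2\<close>)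
  then show ?thesis by metis
qed

definition RQ :: "'a \<Rightarrow> 'a" where
  "RQ v = (SOME u. u \<in> Q \<and> (\<forall>x\<in>Q. q u x + ip u x = ip v x))"

lemma RQ: "v \<in> H \<Longrightarrow> RQ v \<in> Q" "v \<in> H \<Longrightarrow> x \<in> Q \<Longrightarrow> q (RQ v) x + ip (RQ v) x = ip v x"
proof -
  assume v: "v \<in> H"
  have "RQ v \<in> Q \<and> (\<forall>x\<in>Q. q (RQ v) x + ip (RQ v) x = ip v x)"
    unfolding RQ_def by (rule someI_ex) (use form_resolvent_ex[OF v] in blast)
  then show "RQ v \<in> Q" "x \<in> Q \<Longrightarrow> q (RQ v) x + ip (RQ v) x = ip v x" by auto
qed

lemma RQ_eqI:
  assumes "u \<in> Q" "v \<in> H" "\<And>x. x \<in> Q \<Longrightarrow> q u x + ip u x = ip v x"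
  shows "RQ v = u"
  using assms RQ[OF assms(2)] by (intro form.ip_eqI) auto

lemma resolvent_RQ: "resolvent H ip RQ"
proof
  fix u v assume uv: "u \<in> H" "v \<in> H"
  show "RQ u \<in> H" using RQ uv by simp
  show "RQ (u + v) = RQ u + RQ v"
  proof (rule RQ_eqI)
    show "q (RQ u + RQ v) x + ip (RQ u + RQ v) x = ip (u + v) x" if "x \<in> Q" for x
      using form.ip_add[of "RQ u" "RQ v" x] RQ uv that by (simp add: ip_add)
  qed (use RQ uv in auto)
  show "RQ (r *\<^sub>R u) = r *\<^sub>R RQ u" for r
  proof (rule RQ_eqI)
    show "q (r *\<^sub>R RQ u) x + ip (r *\<^sub>R RQ u) x = ip (r *\<^sub>R u) x" if "x \<in> Q" for x
      using form.ip_scale[of "RQ u" x r] RQ uv that by (simp add: ip_scale)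
  qed (use RQ uv in auto)
  have "q (RQ u) (RQ v) + ip (RQ u) (RQ v) = q (RQ v) (RQ u) + ip (RQ v) (RQ u)"
    using RQ uv by (intro form.ip_commute) auto
  then show "ip (RQ u) v = ip u (RQ v)"
    using RQ(2)[OF uv(1) RQ(1)[OF uv(2)]] RQ(2)[OF uv(2) RQ(1)[OF uv(1)]] uv RQ(1)[OF uv(1)]
      ip_commute[of v "RQ u"] by simp
  have eq: "q (RQ u) (RQ u) + ip (RQ u) (RQ u) = ip u (RQ u)" using RQ uv by blast
  have q0: "0 \<le> q (RQ u) (RQ u)" using q_nonneg RQ uv by blast
  have RuH: "RQ u \<in> H" using RQ uv by simp
  have c: "ip (RQ u) u = ip u (RQ u)" using RuH uv by (simp add: ip_commute)
  show p: "0 \<le> ip (RQ u) u" using eq q0 c ip_nonneg[OF RuH] by linarith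
  have "0 \<le> ip (u - RQ u) (u - RQ u)" using uv RuH by (simp add: ip_nonneg)
  then have "2 * ip u (RQ u) \<le> ip u u + ip (RQ u) (RQ u)" using uv RuH by (simp add: ip_square_diff)
  then show "ip (RQ u) u \<le> ip u u" using eq q0 c by linarith
  assume "RQ u = 0"
  show "u = 0"
  proof (rule Q_dense[OF uv(1)])
    fix x assume x: "x \<in> Q"
    have "q 0 x + ip 0 x = 0" by (rule form.ip_0(1)[OF x])
    then show "ip u x = 0" using RQ(2)[OF uv(1) x] \<open>RQ u = 0\<close> by simp
  qed
qed

sublocale res: resolvent H ip RQ by (rule resolvent_RQ)

lemma gen_eq_form_op: "res.gen = form_op"
proof (intro subset_antisym subrelI)
  fix u w assume "(u, w) \<in> res.gen"
  then obtain v where v: "v \<in> H" "u = RQ v" "w = v - RQ v" unfolding res.gen_def by auto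
  have "q u x = ip w x" if x: "x \<in> Q" for x
    using RQ(2)[OF v(1) x] v RQ(1)[OF v(1)] x by (simp add: ip_diff)
  then show "(u, w) \<in> form_op" using v RQ(1)[OF v(1)] by (simp add: form_op_def)
next
  fix u w assume uw: "(u, w) \<in> form_op"
  then have "RQ (u + w) = u" by (intro RQ_eqI) (auto simp: form_op_def ip_add)
  then show "(u, w) \<in> res.gen" using uw by (simp add: res.gen_iff form_op_def)
qed

text \<open>\<open>C\<close> is an isometry of \<open>H\<close> onto the form domain: it is one on its own, dense, range, where
  \<open>C\<^sup>2 = R\<close>; a vector \<open>u\<close> of the form domain is reached because \<open>ip u\<close> is dominated by \<open>C\<close>.\<close>

lemma form_C:
  assumes w: "w \<in> H"
  shows "res.C w \<in> Q" "q (res.C w) (res.C w) + ip (res.C w) (res.C w) = ip w w"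
proof -
  let ?F = "\<lambda>u v. q u v + ip u v"
  obtain s where s: "\<And>n::nat. s n \<in> H" "tends (\<lambda>n. res.C (s n)) w sequentially"
    using res.dense_C[OF w] by blast
  have CH: "res.C (s n) \<in> H" for n using s by simp
  have CC: "res.C (res.C (s n)) = RQ (s n)" for n using s by (simp add: res.C_C)
  have FR: "?F (RQ v) (RQ v) = ip (res.C v) (res.C v)" if v: "v \<in> H" for v
    using RQ(2)[OF v RQ(1)[OF v]] v by (simp add: res.C_sym res.C_C)
  have Rdiff: "RQ (s m) - RQ (s n) = RQ (s m - s n)" for m n using s by (simp add: res.R_diff)
  obtain z where z: "z \<in> Q" "form.tends (\<lambda>n. RQ (s n)) z sequentially"
  proof (rule form.cauchy_tends)
    show "RQ (s n) \<in> Q" for n using s RQ by blast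
    fix e :: real assume e: "e > 0"
    have "?F (RQ (s m) - RQ (s n)) (RQ (s m) - RQ (s n)) =
        ip (res.C (s m) - res.C (s n)) (res.C (s m) - res.C (s n))" for m n
      unfolding Rdiff using FR[of "s m - s n"] s by (simp add: res.C_linear)
    then show "\<exists>N. \<forall>m\<ge>N. \<forall>n\<ge>N. ?F (RQ (s m) - RQ (s n)) (RQ (s m) - RQ (s n)) < e"
      using tends_cauchy[OF CH w s(2) e] by simp
  qed auto
  have RsQ: "RQ (s n) \<in> Q" for n using s RQ by blast
  have "tends (\<lambda>n. RQ (s n)) z sequentially"
  proof (rule tends_squeeze)
    show "\<forall>\<^sub>F n in sequentially. nrm (RQ (s n) - z) \<le> form.nrm (RQ (s n) - z)"
      using RsQ z by (intro always_eventually allI nrm_le_form form.H_diff)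
    show "(\<lambda>n. form.nrm (RQ (s n) - z)) \<longlonglongrightarrow> 0" using z(2) by (simp add: form.tends_def)
  qed (use RsQ z in auto)
  moreover have "tends (\<lambda>n. RQ (s n)) (res.C w) sequentially"
    using res.tends_C[OF s(2) CH w] by (simp add: CC)
  ultimately have zw: "z = res.C w"
    by (rule tends_unique) (use RsQ z w in auto)
  show "res.C w \<in> Q" using z zw by simp
  have "(\<lambda>n. ?F (RQ (s n)) (RQ (s n))) \<longlonglongrightarrow> ?F z z"
    using z RsQ by (intro form.tends_ip) auto
  moreover have "(\<lambda>n. ip (res.C (s n)) (res.C (s n))) \<longlonglongrightarrow> ip w w"
    using s CH w by (intro tends_ip) auto
  ultimately show "?F (res.C w) (res.C w) = ip w w"
    using FR s(1) zw LIMSEQ_unique by auto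
qed

lemma form_dom: "res.C ` H = Q"
proof (intro subset_antisym subsetI)
  fix u assume u: "u \<in> Q"
  obtain w where w: "w \<in> H" "\<And>d. d \<in> H \<Longrightarrow> ip u d = ip w (res.C d)"
  proof (rule dominated_functional[OF subspace_H, of res.C "ip u" "form.nrm u"])
    fix d assume d: "d \<in> H"
    have "ip u d = ip d u" using u d by (simp add: ip_commute)
    also have "\<dots> = q (RQ d) u + ip (RQ d) u" using RQ d u by simp
    also have "\<bar>\<dots>\<bar> \<le> form.nrm (RQ d) * form.nrm u" using RQ d u by (intro form.cauchy_schwarz)
    also have "form.nrm (RQ d) = nrm (res.C d)"
      using form_C(2)[of "res.C d"] d by (simp add: form.nrm_def nrm_def res.C_C)
    finally show "\<bar>ip u d\<bar> \<le> form.nrm u * nrm (res.C d)" by (simp add: mult.commute)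
  qed (use u in \<open>auto simp: res.C_linear ip_add2 ip_scale2\<close>)
  have "u = res.C w" by (rule ip_eqI) (use u w in \<open>auto simp: res.C_sym\<close>)
  then show "u \<in> res.C ` H" using w by blast
qed (use form_C in auto)

lemma self_adjoint_form_op: "self_adjoint H ip form_op"
  using res.self_adjoint_gen gen_eq_form_op by simp

lemma nonneg_form_op: "nonneg_op ip form_op"
  using res.nonneg_gen gen_eq_form_op by simp

lemma op_sqrt_form_op: "op_sqrt H ip form_op = res.root"
  using res.op_sqrt_gen gen_eq_form_op by simp

lemma Domain_root: "Domain res.root = Q"
proof -
  have "Domain res.root = res.C ` H" by (auto simp: res.root_def)
  then show ?thesis by (simp only: form_dom)
qed

lemma root_form_square: "(u, w) \<in> res.root \<Longrightarrow> ip w w = q u u"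
proof -
  assume "(u, w) \<in> res.root"
  then obtain v where v: "v \<in> H" "u = res.C v" "w = res.S v" by (auto simp: res.root_def)
  then show ?thesis using res.ip_C_S[of v v] form_C(2)[of v] by simp
qed

end

subsection \<open>Characterisation of Friedrichs extensions\<close>

context hilbert_top
begin

text \<open>A non-negative self-adjoint operator is determined by the domain and the norm of its square
  root \<open>B\<close>: by polarization the form of \<open>B\<close> is determined, and \<open>A = B B = B\<^sup>* B\<close> can be read off from it.\<close>

lemma op_sqrt_determines:
  assumes A: "self_adjoint H ip A" "nonneg_op ip A" and A': "self_adjoint H ip A'" "nonneg_op ip A'"
    and dom: "Domain (op_sqrt H ip A) = Domain (op_sqrt H ip A')"
    and norm: "\<And>u b b'. (u, b) \<in> op_sqrt H ip A \<Longrightarrow> (u, b') \<in> op_sqrt H ip A' \<Longrightarrow> ip b b = ip b' b'"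
  shows "A \<subseteq> A'"
proof (rule subrelI)
  fix u w assume uw: "(u, w) \<in> A"
  obtain R where R: "resolvent H ip R" and AR: "A = resolvent.gen H R"
    using resolvent_exists[OF A] by blast
  interpret R: resolvent H ip R by (rule R)
  obtain R' where R': "resolvent H ip R'" and AR': "A' = resolvent.gen H R'"
    using resolvent_exists[OF A'] by blast
  interpret R': resolvent H ip R' by (rule R')
  note root = R.op_sqrt_gen[folded AR] and root' = R'.op_sqrt_gen[folded AR']
  obtain b where b: "(u, b) \<in> R.root" "(b, w) \<in> R.root"
    using uw unfolding AR R.root_root[symmetric] by auto
  have "u \<in> Domain R'.root" using b(1) dom root root' by auto
  then obtain b' where b': "(u, b') \<in> R'.root" by auto
  have pol: "ip b y = ip b' y'" if y: "(x, y) \<in> R.root" and y': "(x, y') \<in> R'.root" for x y y'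
  proof -
    note L = self_adjoint_linear[OF R.self_adjoint_root] and L' = self_adjoint_linear[OF R'.self_adjoint_root]
    note D = self_adjointD[OF R.self_adjoint_root] and D' = self_adjointD[OF R'.self_adjoint_root]
    have "ip (b + y) (b + y) = ip (b' + y') (b' + y')"
      using norm[unfolded root root'] L(1)[OF b(1) y] L'(1)[OF b' y'] by blast
    moreover have "ip (b - y) (b - y) = ip (b' - y') (b' - y')"
      using norm[unfolded root root'] L(3)[OF b(1) y] L'(3)[OF b' y'] by blast
    ultimately show ?thesis
      using D(2)[OF b(1)] D(2)[OF y] D'(2)[OF b'] D'(2)[OF y'] by (simp add: ip_square_add ip_square_diff)
  qed
  have "(b', w) \<in> R'.root"
  proof (rule self_adjointD(4)[OF R'.self_adjoint_root])
    show bw: "b' \<in> H" "w \<in> H"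
      using self_adjointD(2)[OF R'.self_adjoint_root b'] self_adjointD(2)[OF R.self_adjoint_root b(2)] .
    fix x y' assume y': "(x, y') \<in> R'.root"
    then have "x \<in> Domain R.root" using dom root root' by auto
    then obtain y where y: "(x, y) \<in> R.root" by auto
    have "ip y' b' = ip b' y'" 
      using bw self_adjointD(2)[OF R'.self_adjoint_root y'] by (simp add: ip_commute)
    also have "\<dots> = ip b y" using pol[OF y y'] by simp
    also have "\<dots> = ip y b"
      using self_adjointD(2)[OF R.self_adjoint_root b(1)] self_adjointD(2)[OF R.self_adjoint_root y] by (simp add: ip_commute)
    also have "\<dots> = ip x w" using self_adjointD(3)[OF R.self_adjoint_root b(2) y] .
    finally show "ip y' b' = ip x w" .
  qed
  with b' show "(u, w) \<in> A'" unfolding AR' R'.root_root[symmetric] by blast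
qed

end

text \<open>The description of the Friedrichs extension prescribes the domain and the norm of the square
  root, so \<open>op_sqrt_determines\<close> yields uniqueness.\<close>

lemma (in closed_form) friedrichs_eq:
  assumes sub: "A \<subseteq> form_op"
    and dom: "form_closure_dom H ip (Domain A) (friedrichs_form ip A) = Q"
    and val: "\<And>u. u \<in> Q \<Longrightarrow> form_closure H ip (Domain A) (friedrichs_form ip A) u = q u u + ip u u"
  shows "friedrichs H ip A = form_op"
  unfolding friedrichs_def
proof (rule the_equality)
  let ?P = "\<lambda>S. self_adjoint H ip S \<and> nonneg_op ip S \<and> A \<subseteq> S \<and>
        Domain (op_sqrt H ip S) = form_closure_dom H ip (Domain A) (friedrichs_form ip A) \<and>
        (\<forall>(u, w) \<in> op_sqrt H ip S.
           form_closure H ip (Domain A) (friedrichs_form ip A) u = ip w w + ip u u)"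
  show P: "?P form_op"
  proof (intro conjI)
    show "\<forall>(u, w) \<in> op_sqrt H ip form_op.
        form_closure H ip (Domain A) (friedrichs_form ip A) u = ip w w + ip u u"
    proof (clarify)
      fix u w assume "(u, w) \<in> op_sqrt H ip form_op"
      then have uw: "(u, w) \<in> res.root" by (simp add: op_sqrt_form_op)
      then have "u \<in> Q" using Domain_root by auto
      then show "form_closure H ip (Domain A) (friedrichs_form ip A) u = ip w w + ip u u"
        using val root_form_square[OF uw] by simp
    qed
  qed (simp_all add: self_adjoint_form_op nonneg_form_op sub dom op_sqrt_form_op Domain_root)
  fix S assume S: "?P S"
  have S': "self_adjoint H ip S" "nonneg_op ip S" "self_adjoint H ip form_op" "nonneg_op ip form_op"
    using S P by blast+
  have 1: "Domain (op_sqrt H ip S) = Domain (op_sqrt H ip form_op)"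
    using S P by (elim conjE) (rule trans, assumption, rule sym)
  have 2: "ip b b = ip b' b'" if "(u, b) \<in> op_sqrt H ip S" "(u, b') \<in> op_sqrt H ip form_op" for u b b'
  proof -
    have "ip b b + ip u u = ip b' b' + ip u u" using S P that by (elim conjE) (drule (1) bspec, drule (1) bspec, simp)
    then show ?thesis by simp
  qed
  show "S = form_op"
  proof
    show "S \<subseteq> form_op" by (rule op_sqrt_determines[OF S' 1 2])
    show "form_op \<subseteq> S" by (rule op_sqrt_determines[OF S'(3,4,1,2) 1[symmetric] 2[symmetric]])
  qed
qed

section \<open>Strongly continuous semigroups\<close>

context hilbert_top
begin

lemma mcomplete_H: "Metric_space.mcomplete H (\<lambda>u v. nrm (u - v))"
proof -
  interpret Metric_space H "\<lambda>u v. nrm (u - v)" by (rule metric)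
  show ?thesis
    unfolding mcomplete_def
  proof (intro allI impI)
    fix s assume s: "MCauchy s"
    then have sH: "s n \<in> H" for n by (auto simp: MCauchy_def)
    obtain l where l: "l \<in> H" "tends s l sequentially"
    proof (rule cauchy_tends[OF sH])
      fix e :: real assume "e > 0"
      then obtain N where N: "\<And>m n. m \<ge> N \<Longrightarrow> n \<ge> N \<Longrightarrow> nrm (s m - s n) < sqrt e"
        using s unfolding MCauchy_def by (metis real_sqrt_gt_0_iff)
      then have "ip (s m - s n) (s m - s n) < e" if "m \<ge> N" "n \<ge> N" for m n
        using that by (simp add: nrm_def)
      then show "\<exists>N. \<forall>m\<ge>N. \<forall>n\<ge>N. ip (s m - s n) (s m - s n) < e" by blast
    qed
    then have "limitin (hs_top H ip) s l sequentially" using sH by (simp add: limitin_hs_top)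
    then show "\<exists>x. limitin mtopology s x sequentially" unfolding hs_top_eq by blast
  qed
qed

lemma ball_in_interior:
  assumes "x \<in> hs_top H ip interior_of F"
  obtains r where "r > 0" "x \<in> H" "\<And>y. y \<in> H \<Longrightarrow> nrm (y - x) < r \<Longrightarrow> y \<in> F"
proof -
  interpret Metric_space H "\<lambda>u v. nrm (u - v)" by (rule metric)
  obtain U where U: "openin mtopology U" "x \<in> U" "U \<subseteq> F"
    using assms unfolding hs_top_eq interior_of_def by blast
  then obtain r where r: "r > 0" "mball x r \<subseteq> U" "x \<in> H"
    unfolding openin_mtopology by blast
  have "y \<in> F" if "y \<in> H" "nrm (y - x) < r" for y
  proof -
    have "y \<in> mball x r" using that r by (simp add: nrm_minus_commute)
    then show ?thesis using r U by blast
  qed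
  with r show thesis by (intro that)
qed

lemma tends_compose:
  assumes "tends s l F" "filterlim g F G"
  shows "tends (\<lambda>i. s (g i)) l G"
  using filterlim_compose[OF assms[unfolded tends_def]] unfolding tends_def by simp

lemma bounded_tends:
  assumes "tends s l F" "\<forall>\<^sub>F i in F. s i \<in> H" "l \<in> H"
    and f: "\<And>u. u \<in> H \<Longrightarrow> f u \<in> H" "\<And>u v. u \<in> H \<Longrightarrow> v \<in> H \<Longrightarrow> f (u - v) = f u - f v"
      "\<And>u. u \<in> H \<Longrightarrow> nrm (f u) \<le> K * nrm u"
  shows "tends (\<lambda>i. f (s i)) (f l) F"
proof (rule tends_squeeze)
  show "\<forall>\<^sub>F i in F. nrm (f (s i) - f l) \<le> K * nrm (s i - l)"
    using assms(2)
  proof eventually_elim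
    case (elim i)
    then show ?case using f(2)[of "s i" l] f(3)[of "s i - l"] assms(3) by simp
  qed
  show "((\<lambda>i. K * nrm (s i - l)) \<longlongrightarrow> 0) F"
    using assms(1) unfolding tends_def by (rule tendsto_mult_right_zero)
  show "\<forall>\<^sub>F i in F. f (s i) \<in> H" using assms(2) by eventually_elim (rule f(1))
qed (use assms f in auto)

end

locale c0 = hilbert_top +
  fixes T :: "real \<Rightarrow> 'a \<Rightarrow> 'a"
  assumes c0: "c0_semigroup H ip T"
begin

lemma T_in [simp]: "t \<ge> 0 \<Longrightarrow> u \<in> H \<Longrightarrow> T t u \<in> H"
  and T_add: "t \<ge> 0 \<Longrightarrow> u \<in> H \<Longrightarrow> v \<in> H \<Longrightarrow> T t (u + v) = T t u + T t v"
  and T_scale: "t \<ge> 0 \<Longrightarrow> u \<in> H \<Longrightarrow> T t (r *\<^sub>R u) = r *\<^sub>R T t u"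
  and T_bdd: "t \<ge> 0 \<Longrightarrow> \<exists>K. \<forall>u\<in>H. nrm (T t u) \<le> K * nrm u"
  and T_0: "u \<in> H \<Longrightarrow> T 0 u = u"
  and T_plus: "s \<ge> 0 \<Longrightarrow> t \<ge> 0 \<Longrightarrow> u \<in> H \<Longrightarrow> T (s + t) u = T s (T t u)"
  and T_lim: "u \<in> H \<Longrightarrow> limitin (hs_top H ip) (\<lambda>t. T t u) u (at_right 0)"
  using c0 unfolding c0_semigroup_def nrm_def by (blast, blast, blast, blast, blast, blast, blast)

lemma T_diff: "t \<ge> 0 \<Longrightarrow> u \<in> H \<Longrightarrow> v \<in> H \<Longrightarrow> T t (u - v) = T t u - T t v"
  using T_add[of t u "-v"] T_scale[of t v "-1"] by simp

lemma T_tends: "u \<in> H \<Longrightarrow> tends (\<lambda>t. T t u) u (at_right 0)"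
  using T_lim[of u] unfolding limitin_hs_top by blast

lemma eventually_pos: "(\<And>t. t > 0 \<Longrightarrow> P t) \<Longrightarrow> \<forall>\<^sub>F t in at_right (0::real). P t"
  by (auto simp: eventually_at_right_field intro: exI[of _ 1])

text \<open>Every orbit is bounded for small times, by continuity at \<open>0\<close>, but for times that depend on the
  vector. By Baire's theorem one of the closed sets \<open>F n\<close>, on which the time is uniform, has an
  interior point, and linearity spreads the bound from there.\<close>

lemma bounded_near_0: "\<exists>d>0. \<exists>K\<ge>1. \<forall>t\<in>{0..d}. \<forall>u\<in>H. nrm (T t u) \<le> K * nrm u"
proof -
  define F where "F n = {u\<in>H. \<forall>t\<in>{0..1 / Suc n}. nrm (T t u) \<le> real n}" for n
  have closed: "closedin (hs_top H ip) (F n)" for n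
  proof -
    have "u \<in> F n" if u: "u \<in> hs_top H ip closure_of (F n)" for u
    proof -
      obtain s where s: "u \<in> H" "\<And>k. s k \<in> F n" "\<And>k::nat. s k \<in> H" "tends s u sequentially"
        using u unfolding closure_of_hs_top by blast
      have "nrm (T t u) \<le> n" if t: "t \<in> {0..1 / Suc n}" for t
      proof -
        obtain K where K: "\<And>u. u \<in> H \<Longrightarrow> nrm (T t u) \<le> K * nrm u" using T_bdd[of t] t by auto
        have "tends (\<lambda>k. T t (s k)) (T t u) sequentially"
        proof (rule bounded_tends[where f = "T t" and K = K])
          show "\<forall>\<^sub>F k in sequentially. s k \<in> H" using s(3) by simp
        qed (use s(1,4) t K in \<open>auto simp: T_diff\<close>)
        then have "(\<lambda>k. nrm (T t (s k))) \<longlonglongrightarrow> nrm (T t u)"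
          using s t by (intro tends_nrm) auto
        then show ?thesis
          by (rule LIMSEQ_le_const2) (use s(2) t in \<open>auto simp: F_def\<close>)
      qed
      then show ?thesis using s(1) by (simp add: F_def)
    qed
    then have "hs_top H ip closure_of (F n) \<subseteq> F n" by blast
    moreover have "F n \<subseteq> hs_top H ip closure_of (F n)"
      by (rule closure_of_subset) (simp add: F_def)
    ultimately show ?thesis by (metis closure_of_eq subset_antisym)
  qed
  have cover: "\<Union>(range F) = H"
  proof (intro subset_antisym subsetI)
    fix u assume u: "u \<in> H"
    have lim: "((\<lambda>t. nrm (T t u)) \<longlongrightarrow> nrm u) (at_right 0)"
      using u by (intro tends_nrm T_tends eventually_pos) auto
    then have "\<forall>\<^sub>F t in at_right 0. nrm (T t u) < nrm u + 1" by (rule order_tendstoD) simp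
    then obtain b where b: "b > 0" "\<And>t. 0 < t \<Longrightarrow> t < b \<Longrightarrow> nrm (T t u) < nrm u + 1"
      by (auto simp: eventually_at_right_field)
    obtain n where n: "max (1 / b) (nrm u + 1) < real n" using reals_Archimedean2 by blast
    have "1 / Suc n < b" using n b(1) by (simp add: field_simps)
    then have "nrm (T t u) \<le> real n" if "t \<in> {0..1 / Suc n}" for t
      using b(2)[of t] n that T_0[OF u] by (cases "t = 0") auto
    then have "u \<in> F n" using u unfolding F_def by blast
    then show "u \<in> \<Union>(range F)" by blast
  qed (auto simp: F_def)
  have "\<exists>n. hs_top H ip interior_of (F n) \<noteq> {}"
  proof (rule ccontr)
    assume *: "\<nexists>n. hs_top H ip interior_of (F n) \<noteq> {}"
    have "Metric_space.mtopology H (\<lambda>u v. nrm (u - v)) interior_of \<Union>(range F) = {}"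
      using closed * unfolding hs_top_eq
      by (intro Metric_space.metric_Baire_category_alt[OF metric mcomplete_H]) auto
    then have "hs_top H ip interior_of H = {}" unfolding cover hs_top_eq .
    then show False using interior_of_topspace[of "hs_top H ip"] H_0 by (metis empty_iff topspace_hs_top)
  qed
  then obtain n x where "x \<in> hs_top H ip interior_of (F n)" by blast
  then obtain r where r: "r > 0" "x \<in> H" "\<And>y. y \<in> H \<Longrightarrow> nrm (y - x) < r \<Longrightarrow> y \<in> F n"
    by (rule ball_in_interior) (rule that)
  have bound: "nrm (T t u) \<le> (4 * real n / r) * nrm u" if t: "t \<in> {0..1 / Suc n}" and u: "u \<in> H" for t u
  proof (cases "u = 0")
    case True
    then show ?thesis using T_scale[of t 0 0] t by simp
  next
    case False
    then have nu: "nrm u > 0" using u nrm_nonneg[OF u] nrm_eq_0[OF u] by linarith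
    define h where "h = (r / (2 * nrm u)) *\<^sub>R u"
    have h: "h \<in> H" "nrm h < r" using u r nu by (auto simp: h_def nrm_scale)
    have "x + h \<in> F n" "x \<in> F n" using r h by (auto intro!: r(3))
    then have "nrm (T t (x + h)) \<le> n" "nrm (T t x) \<le> n" using t by (auto simp: F_def)
    moreover have "T t h = T t (x + h) - T t x" using r h t by (simp flip: T_diff)
    moreover have "nrm (T t (x + h) - T t x) \<le> nrm (T t (x + h)) + nrm (T t x)"
      using nrm_triangle3[of "T t (x + h)" 0 "T t x"] r h t by (simp add: nrm_neg)
    ultimately have "nrm (T t h) \<le> 2 * real n" by simp
    moreover have "nrm (T t h) = r / (2 * nrm u) * nrm (T t u)"
      using u r nu t by (simp add: h_def T_scale nrm_scale)
    ultimately show ?thesis using nu r by (simp add: field_simps)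
  qed
  have "\<forall>t\<in>{0..1 / real (Suc n)}. \<forall>u\<in>H. nrm (T t u) \<le> max 1 (4 * real n / r) * nrm u"
  proof (intro ballI)
    fix t u assume tu: "t \<in> {0..1 / real (Suc n)}" "u \<in> H"
    have "nrm (T t u) \<le> (4 * real n / r) * nrm u" using bound[OF tu] .
    also have "\<dots> \<le> max 1 (4 * real n / r) * nrm u" using tu by (intro mult_right_mono) auto
    finally show "nrm (T t u) \<le> max 1 (4 * real n / r) * nrm u" .
  qed
  moreover have "1 \<le> max 1 (4 * real n / r)" "0 < 1 / real (Suc n)" by auto
  ultimately show ?thesis by blast
qed

lemma bounded_on_interval: "\<exists>M\<ge>0. \<forall>t\<in>{0..b}. \<forall>u\<in>H. nrm (T t u) \<le> M * nrm u"
proof -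
  obtain d K where d: "d > 0" and K: "K \<ge> 1" "\<And>t u. t \<in> {0..d} \<Longrightarrow> u \<in> H \<Longrightarrow> nrm (T t u) \<le> K * nrm u"
    using bounded_near_0 by blast
  have step: "nrm (T (real k * s) u) \<le> K ^ k * nrm u" if "s \<in> {0..d}" "u \<in> H" for k s u
  proof (induction k)
    case (Suc k)
    have "nrm (T (real (Suc k) * s) u) = nrm (T s (T (real k * s) u))"
      using that T_plus[of s "real k * s" u] by (simp add: algebra_simps)
    also have "\<dots> \<le> K * nrm (T (real k * s) u)" using that by (intro K) auto
    also have "\<dots> \<le> K * (K ^ k * nrm u)" using Suc K by (intro mult_left_mono) auto
    finally show ?case by simp
  qed (use that T_0 in simp)
  obtain n0 where n0: "b / d < real n0" using reals_Archimedean2 by blast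
  define n where "n = Suc n0"
  have n: "b / d < real n" "n > 0" using n0 by (auto simp: n_def)
  have "nrm (T t u) \<le> K ^ n * nrm u" if t: "t \<in> {0..b}" and u: "u \<in> H" for t u
  proof -
    have "t \<le> b" "b < real n * d" using t n d by (auto simp: field_simps)
    then have "t / n \<le> d" using n by (simp add: field_simps)
    then have "t / n \<in> {0..d}" using t by auto
    from step[OF this u, of n] show ?thesis using n by simp
  qed
  then show ?thesis using K by (intro exI[of _ "K ^ n"]) auto
qed

lemma orbit_difference:
  assumes "0 \<le> s" "0 \<le> t" "u \<in> H" "\<And>r u. r \<in> {0..b} \<Longrightarrow> u \<in> H \<Longrightarrow> nrm (T r u) \<le> M * nrm u" "s \<le> b" "t \<le> b"
  shows "nrm (T s u - T t u) \<le> M * nrm (T \<bar>s - t\<bar> u - u)"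
proof -
  have *: "nrm (T s u - T t u) \<le> M * nrm (T (s - t) u - u)" if "0 \<le> t" "t \<le> s" "t \<le> b" for s t
  proof -
    have "T s u = T t (T (s - t) u)" using T_plus[of t "s - t" u] that assms(3) by simp
    then have "T s u - T t u = T t (T (s - t) u - u)" using that assms(3) by (simp add: T_diff)
    then show ?thesis using assms(4)[of t "T (s - t) u - u"] that assms(3) by simp
  qed
  show ?thesis
  proof (cases "t \<le> s")
    case False
    then show ?thesis
      using *[of s t] assms nrm_minus_commute[of "T s u" "T t u"] by (simp add: abs_minus_commute)
  qed (use * assms in auto)
qed

lemma orbit_continuous:
  assumes t: "t \<in> {0..b}" and u: "u \<in> H"
  shows "tends (\<lambda>s. T s u) (T t u) (at t within {0..b})"
proof -
  obtain M where M: "\<And>r u. r \<in> {0..b} \<Longrightarrow> u \<in> H \<Longrightarrow> nrm (T r u) \<le> M * nrm u"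
    using bounded_on_interval by blast
  show ?thesis
  proof (rule tends_squeeze)
    show "\<forall>\<^sub>F s in at t within {0..b}. nrm (T s u - T t u) \<le> M * nrm (T \<bar>s - t\<bar> u - u)"
      unfolding eventually_at_filter using t u M by (intro always_eventually allI impI orbit_difference) auto
    have "filterlim (\<lambda>s. \<bar>s - t\<bar>) (at_right 0) (at t within {0..b})"
      unfolding filterlim_at
    proof
      have "((\<lambda>s. \<bar>s - t\<bar>) \<longlongrightarrow> \<bar>t - t\<bar>) (at t within {0..b})"
        by (intro tendsto_intros)
      then show "((\<lambda>s. \<bar>s - t\<bar>) \<longlongrightarrow> 0) (at t within {0..b})" by simp
      show "\<forall>\<^sub>F s in at t within {0..b}. \<bar>s - t\<bar> \<in> {0<..} \<and> \<bar>s - t\<bar> \<noteq> 0"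
        by (simp add: eventually_at_filter)
    qed
    then show "((\<lambda>s. M * nrm (T \<bar>s - t\<bar> u - u)) \<longlongrightarrow> 0) (at t within {0..b})"
      using tends_compose[OF T_tends[OF u]] unfolding tends_def
      by (intro tendsto_mult_right_zero) blast
    show "\<forall>\<^sub>F s in at t within {0..b}. T s u \<in> H"
      using u by (simp add: eventually_at_filter)
  qed (use t u in auto)
qed

text \<open>The reflection is present because \<open>A\<close> stands for the non-negative operator, and \<open>- A\<close> generates.\<close>

definition dom_neg :: "('a \<times> 'a) set \<Rightarrow> bool" where
  "dom_neg A \<longleftrightarrow> semigroup_generator H ip T = (\<lambda>(x, y). (x, - y)) ` A"

lemma dom_neg_iff:
  assumes "dom_neg A" "w \<in> H"
  shows "(u, w) \<in> A \<longleftrightarrow> u \<in> H \<and> tends (\<lambda>t. (1 / t) *\<^sub>R (T t u - u)) (- w) (at_right 0)"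
proof -
  have "(u, w) \<in> A \<longleftrightarrow> (u, - w) \<in> semigroup_generator H ip T"
    using assms(1) unfolding dom_neg_def by force
  also have "\<dots> \<longleftrightarrow> u \<in> H \<and> tends (\<lambda>t. (1 / t) *\<^sub>R (T t u - u)) (- w) (at_right 0)"
    using assms(2) unfolding semigroup_generator_def
    by (auto simp: limitin_hs_top intro!: eventually_pos)
  finally show ?thesis .
qed

lemma dom_neg_invariant:
  assumes A: "dom_neg A" and uw: "(u, w) \<in> A" "w \<in> H" and t: "t \<ge> 0"
  shows "(T t u, T t w) \<in> A"
proof -
  have u: "u \<in> H" "tends (\<lambda>h. (1 / h) *\<^sub>R (T h u - u)) (- w) (at_right 0)"
    using dom_neg_iff[OF A uw(2)] uw(1) by auto
  obtain K where K: "\<And>u. u \<in> H \<Longrightarrow> nrm (T t u) \<le> K * nrm u" using T_bdd[OF t] by blast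
  have "tends (\<lambda>h. T t ((1 / h) *\<^sub>R (T h u - u))) (T t (- w)) (at_right 0)"
  proof (rule bounded_tends[where f = "T t" and K = K])
    show "\<forall>\<^sub>F h in at_right 0. (1 / h) *\<^sub>R (T h u - u) \<in> H" using u by (intro eventually_pos) auto
  qed (use u uw t K in \<open>auto simp: T_diff\<close>)
  moreover have "\<forall>\<^sub>F h in at_right 0. T t ((1 / h) *\<^sub>R (T h u - u)) = (1 / h) *\<^sub>R (T h (T t u) - T t u)"
  proof (rule eventually_pos)
    fix h :: real assume h: "h > 0"
    have "T t (T h u) = T h (T t u)" using T_plus[of t h u] T_plus[of h t u] t h u by (simp add: add.commute)
    then show "T t ((1 / h) *\<^sub>R (T h u - u)) = (1 / h) *\<^sub>R (T h (T t u) - T t u)"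
      using u t h by (simp add: T_scale T_diff)
  qed
  ultimately have "tends (\<lambda>h. (1 / h) *\<^sub>R (T h (T t u) - T t u)) (T t (- w)) (at_right 0)"
    unfolding tends_def by (elim Lim_transform_eventually) (auto elim: eventually_mono)
  moreover have "T t (- w) = - T t w" using T_scale[OF t uw(2), of "-1"] by simp
  ultimately show ?thesis
    using dom_neg_iff[OF A, of "T t w" "T t u"] u uw t by simp
qed

text \<open>The right derivative is the definition of the generator, applied to \<open>T t u\<close>. For the left
  derivative \<open>T (t - k)\<close> is taken out as a factor, which is bounded uniformly in \<open>k\<close>.\<close>

lemma orbit_derivative:
  assumes A: "dom_neg A" and uw: "(u, w) \<in> A" "w \<in> H" and t: "t > 0"
  shows "tends (\<lambda>h. (1 / h) *\<^sub>R (T (t + h) u - T t u)) (- T t w) (at 0)"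
proof -
  have u: "u \<in> H" "tends (\<lambda>h. (1 / h) *\<^sub>R (T h u - u)) (- w) (at_right 0)"
    using dom_neg_iff[OF A uw(2)] uw(1) by auto
  have Tu: "T t u \<in> H" "T t w \<in> H" using u uw t by auto
  have right: "tends (\<lambda>h. (1 / h) *\<^sub>R (T (t + h) u - T t u)) (- T t w) (at_right 0)"
  proof -
    have "tends (\<lambda>h. (1 / h) *\<^sub>R (T h (T t u) - T t u)) (- T t w) (at_right 0)"
      using dom_neg_iff[OF A Tu(2), of "T t u"] dom_neg_invariant[OF A uw, of t] t
      by (meson less_imp_le)
    moreover have "\<forall>\<^sub>F h in at_right 0. T h (T t u) = T (t + h) u"
      using T_plus[of _ t u] t u by (intro eventually_pos) (simp add: add.commute)
    ultimately show ?thesis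
      unfolding tends_def by (elim Lim_transform_eventually) (auto elim: eventually_mono)
  qed
  obtain M where M: "M \<ge> 0" "\<And>r u. r \<in> {0..t} \<Longrightarrow> u \<in> H \<Longrightarrow> nrm (T r u) \<le> M * nrm u"
    using bounded_on_interval by blast
  let ?q = "\<lambda>k. (1 / k) *\<^sub>R (T k u - u)"
  have left: "tends (\<lambda>k. (1 / - k) *\<^sub>R (T (t + - k) u - T t u)) (- T t w) (at_right 0)"
    unfolding tends_def
  proof (rule tendsto_sandwich[OF _ _ tendsto_const])
    have "\<forall>\<^sub>F k in at_right 0. k < t" using t by (auto simp: eventually_at_right_field)
    moreover have "\<forall>\<^sub>F k in at_right 0. k > (0 :: real)" by (rule eventually_pos)
    ultimately have "\<forall>\<^sub>F k in at_right 0. 0 < k \<and> k < t" by eventually_elim simp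
    then show "\<forall>\<^sub>F k in at_right 0. nrm ((1 / - k) *\<^sub>R (T (t + - k) u - T t u) - - T t w) \<le>
        M * (nrm (?q k - - w) + nrm (T k w - w))"
    proof eventually_elim
      case (elim k)
      then have k: "0 < k" "k < t" by auto
      have Ttk: "T t v = T (t - k) (T k v)" if "v \<in> H" for v using T_plus[of "t - k" k v] that k by simp
      have q: "?q k \<in> H" using u k by simp
      have "(1 / - k) *\<^sub>R (T (t + - k) u - T t u) = T (t - k) (?q k)"
        using u k Ttk[OF u(1)] by (simp add: T_scale T_diff flip: scaleR_minus_right)
      moreover have "T t w = T (t - k) (T k w)" using Ttk uw by blast
      ultimately have "(1 / - k) *\<^sub>R (T (t + - k) u - T t u) - - T t w = T (t - k) (?q k + T k w)"
        using q k uw by (simp add: T_add)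
      also have "?q k + T k w = (?q k - - w) + (T k w - w)" by simp
      finally have "nrm ((1 / - k) *\<^sub>R (T (t + - k) u - T t u) - - T t w) \<le> M * nrm ((?q k - - w) + (T k w - w))"
        using M(2)[of "t - k"] q k uw by simp
      also have "\<dots> \<le> M * (nrm (?q k - - w) + nrm (T k w - w))"
        using M(1) q k uw by (intro mult_left_mono nrm_triangle) auto
      finally show ?case .
    qed
    show "((\<lambda>k. M * (nrm (?q k - - w) + nrm (T k w - w))) \<longlongrightarrow> 0) (at_right 0)"
      using u(2) T_tends[OF uw(2)] unfolding tends_def
      by (intro tendsto_mult_right_zero tendsto_add_zero)
    show "\<forall>\<^sub>F k in at_right 0. 0 \<le> nrm ((1 / - k) *\<^sub>R (T (t + - k) u - T t u) - - T t w)"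
      using \<open>\<forall>\<^sub>F k in at_right 0. 0 < k \<and> k < t\<close> by eventually_elim (use Tu u in simp)
  qed
  show ?thesis
    using right left unfolding tends_def
    by (intro filterlim_split_at) (simp_all add: filterlim_at_left_to_right)
qed

end

context hilbert_top
begin

lemma ip_derivative:
  assumes v: "tends (\<lambda>h. (1 / h) *\<^sub>R (v (t + h) - v t)) D (at 0)" and w: "tends (\<lambda>h. (1 / h) *\<^sub>R (w (t + h) - w t)) E (at 0)"
    and H: "\<forall>\<^sub>F h in at 0. v (t + h) \<in> H \<and> w (t + h) \<in> H" "v t \<in> H" "w t \<in> H" "D \<in> H" "E \<in> H"
    and cont: "tends (\<lambda>h. w (t + h)) (w t) (at 0)"
  shows "((\<lambda>s. ip (v s) (w s)) has_real_derivative ip D (w t) + ip (v t) E) (at t)"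
  unfolding DERIV_def
proof (rule Lim_transform_eventually)
  have Hv: "\<forall>\<^sub>F h in at 0. v (t + h) \<in> H" "\<forall>\<^sub>F h in at 0. w (t + h) \<in> H"
    using H(1) by (auto elim: eventually_mono)
  have qv: "\<forall>\<^sub>F h in at 0. (1 / h) *\<^sub>R (v (t + h) - v t) \<in> H" using Hv(1) by eventually_elim (use H in simp)
  have qw: "\<forall>\<^sub>F h in at 0. (1 / h) *\<^sub>R (w (t + h) - w t) \<in> H" using Hv(2) by eventually_elim (use H in simp)
  show "((\<lambda>h. ip ((1 / h) *\<^sub>R (v (t + h) - v t)) (w (t + h)) + ip (v t) ((1 / h) *\<^sub>R (w (t + h) - w t)))
      \<longlongrightarrow> ip D (w t) + ip (v t) E) (at 0)"
    by (intro tendsto_add tends_ip v w cont tends_const qv qw Hv H) (simp add: H)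
  show "\<forall>\<^sub>F h in at 0. ip ((1 / h) *\<^sub>R (v (t + h) - v t)) (w (t + h)) + ip (v t) ((1 / h) *\<^sub>R (w (t + h) - w t)) =
      (ip (v (t + h)) (w (t + h)) - ip (v t) (w t)) / h"
    using H(1) by eventually_elim (use H in \<open>simp add: ip_scale ip_scale2 ip_diff ip_diff2 diff_divide_distrib\<close>)
qed

text \<open>The core of the uniqueness of the semigroup generated by \<open>- A\<close>. For \<open>u\<close> and \<open>x\<close> in the
  domain of the symmetric operator \<open>A\<close> the function \<open>s \<mapsto> \<langle>T' s u, T (t - s) x\<rangle>\<close> has derivative zero; its values at the end points
  are \<open>\<langle>u, T t x\<rangle>\<close> and \<open>\<langle>T' t u, x\<rangle>\<close>.\<close>

lemma semigroup_pairing: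
  assumes T: "c0 H ip T" and T': "c0 H ip T'" and A: "self_adjoint H ip A"
    and gT: "c0.dom_neg H ip T A" and gT': "c0.dom_neg H ip T' A"
    and uw: "(u, w) \<in> A" and xy: "(x, y) \<in> A" and t: "t > 0"
  shows "ip (T' t u) x = ip u (T t x)"
proof -
  interpret T: c0 H ip T by (rule T)
  interpret T': c0 H ip T' by (rule T')
  note D = self_adjointD[OF A]
  have H: "u \<in> H" "w \<in> H" "x \<in> H" "y \<in> H" using D uw xy by blast+
  define \<psi> where "\<psi> s = ip (T' s u) (T (t - s) x)" for s
  have "\<psi> t = \<psi> 0"
  proof (rule DERIV_isconst_end[OF t])
    show "continuous_on {0..t} \<psi>"
      unfolding continuous_on_def
    proof
      fix s assume s: "s \<in> {0..t}"
      have "filterlim (\<lambda>r. t - r) (at (t - s) within {0..t}) (at s within {0..t})"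
        unfolding filterlim_at
      proof
        show "((\<lambda>r. t - r) \<longlongrightarrow> t - s) (at s within {0..t})" by (intro tendsto_intros)
        show "\<forall>\<^sub>F r in at s within {0..t}. t - r \<in> {0..t} \<and> t - r \<noteq> t - s" by (simp add: eventually_at_filter)
      qed
      moreover have "tends (\<lambda>r. T r x) (T (t - s) x) (at (t - s) within {0..t})"
        by (rule T.orbit_continuous) (use s H in auto)
      ultimately have "tends (\<lambda>r. T (t - r) x) (T (t - s) x) (at s within {0..t})"
        by (rule tends_compose[rotated])
      then show "(\<psi> \<longlongrightarrow> \<psi> s) (at s within {0..t})"
        unfolding \<psi>_def using T'.orbit_continuous[OF s H(1)] s H
        by (intro tends_ip) (auto simp: eventually_at_filter)
    qed
    fix s assume s: "0 < s" "s < t"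
    have sH: "T' s u \<in> H" "T' s w \<in> H" "T (t - s) x \<in> H" "T (t - s) y \<in> H" using H s by auto
    have refl: "filterlim (\<lambda>h::real. - h) (at 0) (at 0)"
      unfolding filterlim_at by (auto simp: eventually_at_filter intro!: tendsto_eq_intros)
    have ev: "\<forall>\<^sub>F h in at 0. s + h \<in> {0..t}"
    proof -
      have "((\<lambda>h. s + h) \<longlongrightarrow> s + 0) (at (0::real))" by (intro tendsto_intros)
      then have "\<forall>\<^sub>F h in at 0. s + h \<in> {0<..<t}" by (rule topological_tendstoD) (use s in auto)
      then show ?thesis by eventually_elim simp
    qed
    have dT: "tends (\<lambda>h. (1 / h) *\<^sub>R (T (t - (s + h)) x - T (t - s) x)) (T (t - s) y) (at 0)"
    proof -
      have "tends (\<lambda>h. (1 / - h) *\<^sub>R (T (t - s + - h) x - T (t - s) x)) (- T (t - s) y) (at 0)"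
        by (rule tends_compose[OF T.orbit_derivative[OF gT xy H(4)] refl]) (use s in simp)
      then have "((\<lambda>h. nrm (- ((1 / h) *\<^sub>R (T (t - (s + h)) x - T (t - s) x) - T (t - s) y))) \<longlongrightarrow> 0) (at 0)"
        unfolding tends_def by (simp add: algebra_simps)
      then show ?thesis
        unfolding tends_def
      proof (rule Lim_transform_eventually)
        show "\<forall>\<^sub>F h in at 0. nrm (- ((1 / h) *\<^sub>R (T (t - (s + h)) x - T (t - s) x) - T (t - s) y)) =
          nrm ((1 / h) *\<^sub>R (T (t - (s + h)) x - T (t - s) x) - T (t - s) y)"
          using ev by eventually_elim (rule nrm_neg, use H sH in simp)
      qed
    qed
    have cT: "tends (\<lambda>h. T (t - (s + h)) x) (T (t - s) x) (at 0)"
    proof -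
      have "filterlim (\<lambda>h. t - (s + h)) (at (t - s) within {0..t}) (at 0)"
        unfolding filterlim_at
      proof
        show "((\<lambda>h. t - (s + h)) \<longlongrightarrow> t - s) (at 0)" by (auto intro!: tendsto_eq_intros)
        show "\<forall>\<^sub>F h in at 0. t - (s + h) \<in> {0..t} \<and> t - (s + h) \<noteq> t - s"
          using ev eventually_neq_at_within[of 0 0 UNIV] by eventually_elim auto
      qed
      moreover have "tends (\<lambda>r. T r x) (T (t - s) x) (at (t - s) within {0..t})"
        by (rule T.orbit_continuous) (use s H in auto)
      ultimately show ?thesis by (rule tends_compose[rotated])
    qed
    have "(\<psi> has_real_derivative ip (- T' s w) (T (t - s) x) + ip (T' s u) (T (t - s) y)) (at s)"
      unfolding \<psi>_def
    proof (rule ip_derivative)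
      show "\<forall>\<^sub>F h in at 0. T' (s + h) u \<in> H \<and> T (t - (s + h)) x \<in> H"
        using ev by eventually_elim (use H in auto)
    qed (use T'.orbit_derivative[OF gT' uw H(2) s(1)] dT cT sH in auto)
    moreover have "ip (T' s w) (T (t - s) x) = ip (T' s u) (T (t - s) y)"
      using T.dom_neg_invariant[OF gT xy H(4), of "t - s"] T'.dom_neg_invariant[OF gT' uw H(2), of s] s
      by (intro D(3)) auto
    ultimately show "(\<psi> has_real_derivative 0) (at s)" using sH by (simp add: ip_neg)
  qed
  then show ?thesis using H by (simp add: \<psi>_def T.T_0 T'.T_0)
qed

lemma semigroup_unique:
  assumes T: "c0 H ip T" and T': "c0 H ip T'" and A: "self_adjoint H ip A"
    and gT: "c0.dom_neg H ip T A" and gT': "c0.dom_neg H ip T' A"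
    and t: "t \<ge> 0" and u: "u \<in> H"
  shows "T' t u = T t u"
proof (cases "t = 0")
  case True
  then show ?thesis using c0.T_0[OF T u] c0.T_0[OF T' u] by simp
next
  case False
  then have t: "t > 0" using t by simp
  interpret T: c0 H ip T by (rule T)
  interpret T': c0 H ip T' by (rule T')
  have dense: "hs_top H ip closure_of Domain A = H" using A by (simp add: self_adjoint_def)
  have eq: "T' t x = T t x" if xy: "(x, y) \<in> A" for x y
  proof -
    have xH: "x \<in> H" using self_adjointD[OF A] xy by blast
    have "T' t x - T t x = 0"
    proof (rule closure_of_trivial_complement[OF dense])
      fix z assume "z \<in> Domain A"
      then obtain z' where z: "(z, z') \<in> A" by auto
      then have zH: "z \<in> H" using self_adjointD[OF A] by blast
      have "ip (T' t x) z = ip x (T t z)" by (rule semigroup_pairing[OF T T' A gT gT' xy z t])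
      also have "\<dots> = ip (T t x) z"
        by (rule semigroup_pairing[OF T T A gT gT xy z t, symmetric])
      finally show "ip z (T' t x - T t x) = 0"
        using zH xH t by (simp add: ip_diff2 ip_commute[of z])
    qed (use xH t in auto)
    then show ?thesis by simp
  qed
  have "u \<in> hs_top H ip closure_of Domain A" using u dense by simp
  then obtain s where s: "\<And>n. s n \<in> Domain A" "\<And>n::nat. s n \<in> H" "tends s u sequentially"
    unfolding closure_of_hs_top by blast
  obtain K where K: "\<And>u. u \<in> H \<Longrightarrow> nrm (T t u) \<le> K * nrm u" using T.T_bdd[of t] t by auto
  obtain K' where K': "\<And>u. u \<in> H \<Longrightarrow> nrm (T' t u) \<le> K' * nrm u" using T'.T_bdd[of t] t by auto
  have "tends (\<lambda>n. T t (s n)) (T t u) sequentially"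
    by (rule bounded_tends[where f = "T t" and K = K]) (use s u t K in \<open>auto simp: T.T_diff\<close>)
  moreover have "tends (\<lambda>n. T' t (s n)) (T' t u) sequentially"
    by (rule bounded_tends[where f = "T' t" and K = K']) (use s u t K' in \<open>auto simp: T'.T_diff\<close>)
  moreover have "T' t (s n) = T t (s n)" for n using s(1)[of n] eq by auto
  ultimately show ?thesis
    using s(2) u t by (intro tends_unique[where s = "\<lambda>n. T t (s n)"]) auto
qed

end

section \<open>The semigroup and the inverse square root of an operator\<close>

text \<open>The function \<open>exp (- t \<lambda>)\<close> in the variable \<open>b = 1 / (1 + \<lambda>)\<close>; the value \<open>0\<close> at \<open>b = 0\<close>
  corresponds to \<open>\<lambda> = \<infinity>\<close>.\<close>

definition expb :: "real \<Rightarrow> real \<Rightarrow> real" where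
  "expb t b = (if b \<le> 0 then 0 else exp (- t * (1 / b - 1)))"

lemma expb_01: "t \<ge> 0 \<Longrightarrow> b \<in> {0..1} \<Longrightarrow> 0 \<le> expb t b \<and> expb t b \<le> 1"
  by (auto simp: expb_def field_simps mult_left_le_one_le)

lemma expb_plus: "expb (s + t) b = expb s b * expb t b"
  by (auto simp: expb_def algebra_simps simp flip: exp_add)

lemma continuous_expb:
  assumes t: "t > 0"
  shows "continuous_on {0..1} (expb t)"
  unfolding continuous_on_def
proof
  fix b :: real assume b: "b \<in> {0..1}"
  show "(expb t \<longlongrightarrow> expb t b) (at b within {0..1})"
  proof (cases "b = 0")
    case True
    have "(expb t \<longlongrightarrow> 0) (at 0 within {0..1})"
    proof (rule tendsto_sandwich[OF _ _ tendsto_const])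
      show "\<forall>\<^sub>F b in at 0 within {0..1}. 0 \<le> expb t b"
        using t expb_01[of t] by (auto simp: eventually_at_filter)
      show "\<forall>\<^sub>F b in at 0 within {0..1}. expb t b \<le> exp t * b / t"
        unfolding eventually_at_filter
      proof (intro always_eventually allI impI)
        fix b :: real assume b: "b \<noteq> 0" "b \<in> {0..1}"
        have "t / b \<le> exp (t / b)" using exp_ge_add_one_self[of "t / b"] by linarith
        then have "exp (- (t / b)) \<le> b / t"
          using b t by (simp add: exp_minus field_simps)
        then have "exp t * exp (- (t / b)) \<le> exp t * (b / t)" by (intro mult_left_mono) auto
        moreover have "expb t b = exp t * exp (- (t / b))"
          using b by (simp add: expb_def algebra_simps flip: exp_add)
        ultimately show "expb t b \<le> exp t * b / t" by simp
      qed
      show "((\<lambda>b. exp t * b / t) \<longlongrightarrow> 0) (at 0 within {0..1})"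
        using t by (auto intro!: tendsto_eq_intros)
    qed
    then show ?thesis using True by (simp add: expb_def)
  next
    case False
    then have b0: "b > 0" using b by simp
    have "((\<lambda>b. exp (- t * (1 / b - 1))) \<longlongrightarrow> exp (- t * (1 / b - 1))) (at b)"
      using b0 by (intro tendsto_intros) auto
    moreover have "\<forall>\<^sub>F b in at b. exp (- t * (1 / b - 1)) = expb t b"
      using order_tendstoD(1)[OF tendsto_ident_at b0, of UNIV] by eventually_elim (simp add: expb_def)
    ultimately have "(expb t \<longlongrightarrow> exp (- t * (1 / b - 1))) (at b)"
      by (rule Lim_transform_eventually)
    then have "(expb t \<longlongrightarrow> exp (- t * (1 / b - 1))) (at b within {0..1})"
      by (rule tendsto_within_subset) simp
    then show ?thesis using b0 by (simp add: expb_def)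
  qed
qed

lemma expb_limit: "b > 0 \<Longrightarrow> ((\<lambda>t. expb t b) \<longlongrightarrow> 1) (at_right 0)"
  by (auto simp: expb_def intro!: tendsto_eq_intros)

lemma expb_quotient_bound:
  assumes "t > 0" "b \<in> {0..1}"
  shows "\<bar>(expb t b - 1) / t * b\<bar> \<le> 1"
proof (cases "b = 0")
  case False
  then have b: "b > 0" "b \<le> 1" using assms by auto
  have "1 - t * (1 / b - 1) \<le> expb t b"
    using exp_ge_add_one_self[of "- t * (1 / b - 1)"] b by (simp add: expb_def)
  then have "(1 - expb t b) / t \<le> 1 / b - 1" using assms(1) by (simp add: divide_le_eq mult.commute)
  then have "(1 - expb t b) / t * b \<le> (1 / b - 1) * b" using b by (intro mult_right_mono) auto
  also have "\<dots> \<le> 1" using b by (simp add: field_simps)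
  finally have "(1 - expb t b) / t * b \<le> 1" .
  moreover have "0 \<le> (1 - expb t b) / t * b" using expb_01[of t b] assms b by simp
  moreover have "\<bar>(expb t b - 1) / t * b\<bar> = \<bar>(1 - expb t b) / t * b\<bar>"
    by (simp add: abs_mult abs_divide abs_minus_commute)
  ultimately show ?thesis by linarith
qed simp

lemma expb_quotient_limit:
  assumes b: "b > 0"
  shows "((\<lambda>t. (expb t b - 1) / t * b) \<longlongrightarrow> b - 1) (at_right 0)"
proof -
  have "((\<lambda>t. exp (- t * (1 / b - 1))) has_real_derivative - (1 / b - 1)) (at 0)"
    by (auto intro!: derivative_eq_intros)
  then have "((\<lambda>t. (exp (- t * (1 / b - 1)) - 1) / t) \<longlongrightarrow> - (1 / b - 1)) (at 0)"
    by (simp add: DERIV_def)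
  then have "((\<lambda>t. (expb t b - 1) / t) \<longlongrightarrow> - (1 / b - 1)) (at_right 0)"
    using b by (simp add: expb_def filterlim_at_split)
  then have "((\<lambda>t. (expb t b - 1) / t * b) \<longlongrightarrow> - (1 / b - 1) * b) (at_right 0)"
    by (intro tendsto_intros)
  moreover have "- (1 / b - 1) * b = b - 1" using b by (simp add: field_simps)
  ultimately show ?thesis by simp
qed

text \<open>The Gamma integral behind \<open>\<lambda>\<^bsup>-1/2\<^esup> = \<pi>\<^bsup>-1/2\<^esup> \<integral> t\<^bsup>-1/2\<^esup> exp (- t \<lambda>) dt\<close>.\<close>

lemma nn_integral_powr_exp:
  assumes r: "r > 0"
  shows "(\<integral>\<^sup>+t. ennreal (indicator {0<..} t * (t powr (-1/2) * exp (- t * r))) \<partial>lborel) =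
    ennreal (sqrt pi / sqrt r)"
proof -
  have "ennreal (Gamma (1/2)) = (\<integral>\<^sup>+t. ennreal (indicator {0..} t * t powr (1/2 - 1) / exp t) \<partial>lborel)"
    by (rule Gamma_conv_nn_integral_real) simp
  also have "\<dots> = (\<integral>\<^sup>+t. ennreal (indicator {0<..} t * (t powr (-1/2) * exp (- t))) \<partial>lborel)"
    by (intro nn_integral_cong) (auto simp: indicator_def exp_minus field_simps)
  also have "\<dots> = ennreal \<bar>r\<bar> * (\<integral>\<^sup>+t. ennreal (indicator {0<..} (0 + r * t) * ((0 + r * t) powr (-1/2) * exp (- (0 + r * t)))) \<partial>lborel)"
    using r by (intro nn_integral_real_affine) auto
  also have "\<dots> = (\<integral>\<^sup>+t. ennreal \<bar>r\<bar> * ennreal (indicator {0<..} (0 + r * t) * ((0 + r * t) powr (-1/2) * exp (- (0 + r * t)))) \<partial>lborel)"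
    by (intro nn_integral_cmult[symmetric]) measurable
  also have "\<dots> = (\<integral>\<^sup>+t. ennreal (sqrt r) * ennreal (indicator {0<..} t * (t powr (-1/2) * exp (- t * r))) \<partial>lborel)"
  proof (intro nn_integral_cong)
    fix t :: real
    have "r * r powr (-1/2) = sqrt r"
      using r by (simp add: powr_minus powr_half_sqrt real_div_sqrt field_simps flip: real_sqrt_mult)
    then have "r * (indicator {0<..} (0 + r * t) * ((0 + r * t) powr (-1/2) * exp (- (0 + r * t)))) =
        sqrt r * (indicator {0<..} t * (t powr (-1/2) * exp (- t * r)))"
      using r by (auto simp: indicator_def powr_mult zero_less_mult_iff mult.commute)
    then show "ennreal \<bar>r\<bar> * ennreal (indicator {0<..} (0 + r * t) * ((0 + r * t) powr (-1/2) * exp (- (0 + r * t)))) =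
        ennreal (sqrt r) * ennreal (indicator {0<..} t * (t powr (-1/2) * exp (- t * r)))"
      using r by (simp flip: ennreal_mult)
  qed
  also have "\<dots> = ennreal (sqrt r) * (\<integral>\<^sup>+t. ennreal (indicator {0<..} t * (t powr (-1/2) * exp (- t * r))) \<partial>lborel)"
    by (intro nn_integral_cmult) measurable
  finally have eq: "ennreal (sqrt pi) = ennreal (sqrt r) * (\<integral>\<^sup>+t. ennreal (indicator {0<..} t * (t powr (-1/2) * exp (- t * r))) \<partial>lborel)"
    by (simp add: Gamma_one_half_real)
  have "ennreal (sqrt pi / sqrt r) = ennreal (1 / sqrt r) * ennreal (sqrt pi)"
    using r by (simp flip: ennreal_mult)
  also have "\<dots> = (ennreal (1 / sqrt r) * ennreal (sqrt r)) * (\<integral>\<^sup>+t. ennreal (indicator {0<..} t * (t powr (-1/2) * exp (- t * r))) \<partial>lborel)"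
    unfolding eq by (simp add: mult.assoc)
  also have "ennreal (1 / sqrt r) * ennreal (sqrt r) = 1"
    using r by (simp flip: ennreal_mult)
  finally show ?thesis by simp
qed

lemma (in hilbert) tends_cong:
  "\<lbrakk>tends s l F; \<forall>\<^sub>F i in F. s i = t i\<rbrakk> \<Longrightarrow> tends t l F"
  unfolding tends_def by (erule Lim_transform_eventually) (auto elim: eventually_mono)

context resolvent
begin

definition T :: "real \<Rightarrow> 'a \<Rightarrow> 'a" where
  "T t = (if t \<le> 0 then (\<lambda>u. u) else fc (expb t))"

lemma T_pos: "t > 0 \<Longrightarrow> T t u = fc (expb t) u"
  by (simp add: T_def)

lemma AE_spec_pos:
  assumes u: "u \<in> H"
  shows "AE x in spec u. x > 0"
proof -
  have "AE x in spec u. x \<noteq> 0"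
    by (rule injective_fc_null) (use u R_inj in \<open>auto simp: continuous_on_id\<close>)
  moreover have "AE x in spec u. x \<in> {0..1}"
    by (rule AE_I2) (simp add: space_spec[OF u])
  ultimately show ?thesis by eventually_elim auto
qed

text \<open>Dominated convergence for functions of \<open>R\<close>. Convergence at \<open>0\<close> is not required, since spectral measures
  do not charge that point.\<close>

lemma fc_tends:
  assumes u: "u \<in> H" and f: "\<And>t. t > 0 \<Longrightarrow> continuous_on {0..1} (f t)" and g: "continuous_on {0..1} g"
    and bd: "\<And>t b. t > 0 \<Longrightarrow> b \<in> {0..1} \<Longrightarrow> \<bar>f t b\<bar> \<le> B" "\<And>b. b \<in> {0..1} \<Longrightarrow> \<bar>g b\<bar> \<le> B"
    and lim: "\<And>b. b > 0 \<Longrightarrow> ((\<lambda>t. f t b) \<longlongrightarrow> g b) (at_right 0)"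
  shows "tends (\<lambda>t. fc (f t) u) (fc g u) (at_right (0::real))"
proof -
  have ev: "\<forall>\<^sub>F t in at_right (0::real). t > 0" by (simp add: eventually_at_filter)
  have evH: "\<forall>\<^sub>F t in at_right 0. fc (f t) u \<in> H" using ev by eventually_elim (use u f in simp)
  have fg: "continuous_on {0..1} (\<lambda>b. (f t b - g b)\<^sup>2)" if "t > 0" for t
    using f[OF that] g by (intro continuous_intros)
  have lim2: "((\<lambda>t. \<integral>b. (f t b - g b)\<^sup>2 \<partial>spec u) \<longlongrightarrow> 0) (at_right 0)"
  proof (rule tendsto_at_right_sequentially[where b = 1])
    fix s :: "nat \<Rightarrow> real" assume s: "\<And>n. 0 < s n" "s \<longlonglongrightarrow> 0"
    have "(\<lambda>n. \<integral>b. (f (s n) b - g b)\<^sup>2 \<partial>spec u) \<longlonglongrightarrow> (\<integral>b. 0 \<partial>spec u)"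
    proof (rule integral_dominated_convergence[where w = "\<lambda>_. (2 * B)\<^sup>2"])
      show "(\<lambda>b. (f (s n) b - g b)\<^sup>2) \<in> borel_measurable (spec u)" for n
        using measurable_spec[OF u fg[OF s(1)]] .
      show "AE b in spec u. (\<lambda>n. (f (s n) b - g b)\<^sup>2) \<longlonglongrightarrow> 0"
        using AE_spec_pos[OF u]
      proof eventually_elim
        case (elim b)
        have "filterlim s (at_right 0) sequentially"
          unfolding filterlim_at using s by (auto simp: less_imp_neq[symmetric])
        then have "(\<lambda>n. f (s n) b) \<longlonglongrightarrow> g b"
          by (rule filterlim_compose[OF lim[OF elim]])
        then have "(\<lambda>n. (f (s n) b - g b)\<^sup>2) \<longlonglongrightarrow> (g b - g b)\<^sup>2" by (intro tendsto_intros)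
        then show ?case by simp
      qed
      show "AE b in spec u. norm ((f (s n) b - g b)\<^sup>2) \<le> (2 * B)\<^sup>2" for n
      proof (rule AE_I2)
        fix b assume "b \<in> space (spec u)"
        then have b: "b \<in> {0..1}" by (simp add: space_spec[OF u])
        have "\<bar>f (s n) b - g b\<bar> \<le> 2 * B" using bd(1)[OF s(1)[of n] b] bd(2)[OF b] by linarith
        then have "\<bar>f (s n) b - g b\<bar>\<^sup>2 \<le> (2 * B)\<^sup>2" by (intro power_mono) auto
        then show "norm ((f (s n) b - g b)\<^sup>2) \<le> (2 * B)\<^sup>2" by simp
      qed
      show "integrable (spec u) (\<lambda>_. (2 * B)\<^sup>2)" by (intro integrable_spec u continuous_intros)
    qed simp
    then show "(\<lambda>n. \<integral>b. (f (s n) b - g b)\<^sup>2 \<partial>spec u) \<longlonglongrightarrow> 0" by simp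
  qed simp
  show ?thesis
  proof (subst tends_sq)
    show "((\<lambda>t. ip (fc (f t) u - fc g u) (fc (f t) u - fc g u)) \<longlongrightarrow> 0) (at_right 0)"
    proof (rule Lim_transform_eventually[OF lim2])
      show "\<forall>\<^sub>F t in at_right 0. (\<integral>b. (f t b - g b)\<^sup>2 \<partial>spec u) = ip (fc (f t) u - fc g u) (fc (f t) u - fc g u)"
        using ev
      proof eventually_elim
        case (elim t)
        have "ip (fc (\<lambda>b. f t b - g b) u) (fc (\<lambda>b. f t b - g b) u) = (\<integral>b. (f t b - g b)\<^sup>2 \<partial>spec u)"
          by (intro fc_square u continuous_on_diff f elim g)
        then show ?case using fc_diff[OF u f[OF elim] g] by simp
      qed
    qed
  qed (use evH u g in auto)
qed

lemma c0_T: "c0_semigroup H ip T"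
  unfolding c0_semigroup_def
proof (intro conjI allI ballI impI)
  fix t :: real assume t: "t \<ge> 0"
  have c: "t > 0 \<Longrightarrow> continuous_on {0..1} (expb t)" by (rule continuous_expb)
  show "T t u \<in> H" if "u \<in> H" for u using that c t by (auto simp: T_def)
  show "T t (u + v) = T t u + T t v" if "u \<in> H" "v \<in> H" for u v using that c by (simp add: T_def fc_add2)
  show "T t (r *\<^sub>R u) = r *\<^sub>R T t u" if "u \<in> H" for u r using that c by (simp add: T_def fc_scale2)
  have "nrm (T t u) \<le> 1 * nrm u" if u: "u \<in> H" for u
  proof (cases "t = 0")
    case False
    then have t0: "t > 0" using t by simp
    have "nrm (fc (expb t) u) \<le> 1 * nrm u"
    proof (rule fc_bound[OF u c[OF t0]])
      show "\<bar>expb t b\<bar> \<le> 1" if "b \<in> {0..1}" for b using expb_01[OF t that] by simp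
    qed
    then show ?thesis using t0 by (simp add: T_pos)
  qed (simp add: T_def)
  then show "\<exists>K. \<forall>u\<in>H. sqrt (ip (T t u) (T t u)) \<le> K * sqrt (ip u u)" unfolding nrm_def by blast
next
  fix s t :: real and u assume st: "s \<ge> 0" "t \<ge> 0" and u: "u \<in> H"
  show "T (s + t) u = T s (T t u)"
  proof (cases "s = 0 \<or> t = 0")
    case False
    then have st: "s > 0" "t > 0" using st by auto
    have "fc (expb (s + t)) u = fc (\<lambda>b. expb s b * expb t b) u" by (rule fc_cong) (rule expb_plus)
    also have "\<dots> = fc (expb s) (fc (expb t) u)" by (intro fc_mult u continuous_expb st)
    finally show ?thesis using st by (simp add: T_def)
  qed (auto simp: T_def)
next
  fix u assume u: "u \<in> H"
  have ev: "\<forall>\<^sub>F t in at_right (0::real). t > 0" by (simp add: eventually_at_filter)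
  have "tends (\<lambda>t. fc (expb t) u) (fc (\<lambda>_. 1) u) (at_right 0)"
    by (rule fc_tends[where B = 1]) (use u continuous_expb expb_limit expb_01 less_imp_le in \<open>auto simp: abs_le_iff\<close>)
  moreover have "\<forall>\<^sub>F t in at_right 0. fc (expb t) u = T t u"
    using ev by eventually_elim (simp add: T_pos)
  ultimately have "tends (\<lambda>t. T t u) u (at_right 0)"
    using u tends_cong by simp
  moreover have "\<forall>\<^sub>F t in at_right 0. T t u \<in> H"
    using ev by eventually_elim (use u continuous_expb in \<open>simp add: T_pos\<close>)
  ultimately show "limitin (hs_top H ip) (\<lambda>t. T t u) u (at_right 0)"
    using u by (simp add: limitin_hs_top)
qed (simp add: T_def)

sublocale T: c0 H ip T by unfold_locales (rule c0_T)

lemma T_sym: "t \<ge> 0 \<Longrightarrow> u \<in> H \<Longrightarrow> v \<in> H \<Longrightarrow> ip (T t u) v = ip u (T t v)"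
  by (cases "t = 0") (auto simp: T_def intro!: fc_sym continuous_expb)

text \<open>The inclusion of \<open>- A\<close> in the generator is dominated convergence; the converse holds since the
  generator is a symmetric extension of the self-adjoint operator \<open>- A\<close>.\<close>

lemma generator_T: "T.dom_neg gen"
proof -
  have ev: "\<forall>\<^sub>F t in at_right (0::real). t > 0" by (simp add: eventually_at_filter)
  have quot: "tends (\<lambda>t. (1 / t) *\<^sub>R (T t x - x)) (- y) (at_right 0)" if xy: "(x, y) \<in> gen" for x y
  proof -
    obtain v where v: "v \<in> H" "x = R v" "y = v - R v" using xy by (auto simp: gen_def)
    have c: "continuous_on {0..1} (\<lambda>b. (expb t b - 1) / t * b)" if "t > 0" for t
      by (intro continuous_intros continuous_expb that) (use that in simp)
    have "tends (\<lambda>t. fc (\<lambda>b. (expb t b - 1) / t * b) v) (fc (\<lambda>b. b - 1) v) (at_right 0)"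
      by (rule fc_tends[where B = 1]) (use v c expb_quotient_bound expb_quotient_limit in \<open>auto intro!: continuous_intros\<close>)
    moreover have "fc (\<lambda>b. b - 1) v = - y"
      using v fc_diff[of v "\<lambda>b. b" "\<lambda>_. 1"] by (simp add: continuous_on_id)
    moreover have "\<forall>\<^sub>F t in at_right 0. fc (\<lambda>b. (expb t b - 1) / t * b) v = (1 / t) *\<^sub>R (T t x - x)"
      using ev
    proof eventually_elim
      case (elim t)
      have e: "continuous_on {0..1} (expb t)" using elim by (rule continuous_expb)
      have "fc (\<lambda>b. (expb t b - 1) / t * b) v = fc (\<lambda>b. (1 / t) * (expb t b - 1) * b) v"
        by (rule fc_cong) simp
      also have "\<dots> = fc (\<lambda>b. (1 / t) * (expb t b - 1)) (fc (\<lambda>b. b) v)"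
        using e v by (intro fc_mult continuous_intros)
      also have "fc (\<lambda>b. b) v = x" using v by simp
      also have "fc (\<lambda>b. (1 / t) * (expb t b - 1)) x = (1 / t) *\<^sub>R fc (\<lambda>b. expb t b - 1) x"
        using e v by (intro fc_scale continuous_intros) auto
      also have "fc (\<lambda>b. expb t b - 1) x = fc (expb t) x - fc (\<lambda>_. 1) x"
        using e v by (intro fc_diff continuous_intros) auto
      finally show ?case using v elim by (simp add: T_pos)
    qed
    ultimately show ?thesis using tends_cong by simp
  qed
  note D = self_adjointD[OF self_adjoint_gen]
  have "semigroup_generator H ip T = (\<lambda>(x, y). (x, - y)) ` gen"
  proof (intro subset_antisym subrelI)
    fix u w assume "(u, w) \<in> semigroup_generator H ip T"
    then have u: "u \<in> H" "w \<in> H" and lim: "tends (\<lambda>t. (1 / t) *\<^sub>R (T t u - u)) w (at_right 0)"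
      by (auto simp: semigroup_generator_def limitin_hs_top)
    have "(u, - w) \<in> gen"
    proof (rule D(4))
      fix x y assume xy: "(x, y) \<in> gen"
      have xyH: "x \<in> H" "y \<in> H" using D(1,2)[OF xy] .
      have 1: "((\<lambda>t. ip ((1 / t) *\<^sub>R (T t x - x)) u) \<longlongrightarrow> ip (- y) u) (at_right 0)"
        using ev by (intro tends_ip_const quot[OF xy]) (use xyH u in \<open>auto elim: eventually_mono\<close>)
      have 2: "((\<lambda>t. ip ((1 / t) *\<^sub>R (T t u - u)) x) \<longlongrightarrow> ip w x) (at_right 0)"
        using ev by (intro tends_ip_const lim) (use xyH u in \<open>auto elim: eventually_mono\<close>)
      have 3: "\<forall>\<^sub>F t in at_right 0. ip ((1 / t) *\<^sub>R (T t u - u)) x = ip ((1 / t) *\<^sub>R (T t x - x)) u"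
        using ev
      proof eventually_elim
        case (elim t)
        have "ip (T t u) x = ip (T t x) u"
          using T_sym[of t u x] ip_commute[of u "T t x"] elim xyH u by simp
        then show ?case using elim xyH u by (simp add: ip_scale ip_diff ip_commute[of u x])
      qed
      have "ip w x = ip (- y) u"
        by (rule tendsto_unique[OF trivial_limit_at_right_real Lim_transform_eventually[OF 2 3] 1])
      then show "ip y u = ip x (- w)" using xyH u by (simp add: ip_neg ip_neg2 ip_commute[of x w])
    qed (use u in auto)
    then show "(u, w) \<in> (\<lambda>(x, y). (x, - y)) ` gen" by force
  next
    fix u w assume "(u, w) \<in> (\<lambda>(x, y). (x, - y)) ` gen"
    then obtain y where y: "(u, y) \<in> gen" "w = - y" by auto
    have H: "u \<in> H" "y \<in> H" using D(1,2)[OF y(1)] .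
    have "\<forall>\<^sub>F t in at_right 0. (1 / t) *\<^sub>R (T t u - u) \<in> H"
      using ev by eventually_elim (use H in simp)
    then show "(u, w) \<in> semigroup_generator H ip T"
      using quot[OF y(1)] H y(2) by (simp add: semigroup_generator_def limitin_hs_top)
  qed
  then show ?thesis by (simp add: T.dom_neg_def)
qed

lemma exp_neg_gen:
  assumes "t \<ge> 0" "u \<in> H"
  shows "exp_neg H ip gen t u = T t u"
  unfolding exp_neg_def
proof (rule the_equality)
  show "\<exists>T'. c0_semigroup H ip T' \<and> semigroup_generator H ip T' = (\<lambda>(x, y). (x, - y)) ` gen \<and> T t u = T' t u"
    using c0_T generator_T unfolding T.dom_neg_def by blast
  fix v assume "\<exists>T'. c0_semigroup H ip T' \<and> semigroup_generator H ip T' = (\<lambda>(x, y). (x, - y)) ` gen \<and> v = T' t u"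
  then obtain T' where T': "c0_semigroup H ip T'" "semigroup_generator H ip T' = (\<lambda>(x, y). (x, - y)) ` gen" "v = T' t u"
    by blast
  have c0: "c0 H ip T'" by unfold_locales (rule T'(1))
  have "c0.dom_neg H ip T' gen" using T'(2) by (simp add: c0.dom_neg_def[OF c0])
  then show "v = T t u"
    using semigroup_unique[OF T.c0_axioms c0 self_adjoint_gen generator_T _ assms] T'(3) by blast
qed

text \<open>The integral formula for the inverse square root, \<open>\<pi>\<^bsup>-1/2\<^esup> \<integral> t\<^bsup>-1/2\<^esup> T t (S v) dt = C v\<close> in the weak
  sense; formally \<open>S v = A\<^bsup>1/2\<^esup> C v\<close>. On the diagonal all functions are non-negative, and Tonelli's theorem
  reduces the claim to the scalar integral; polarization gives the general case.\<close>

lemma inverse_root_integral_diag: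
  assumes v: "v \<in> H" and S_inj: "\<And>v. v \<in> H \<Longrightarrow> S v = 0 \<Longrightarrow> v = 0"
  shows "has_bochner_integral lborel (\<lambda>t. indicator {0<..} t *\<^sub>R (t powr (-1/2) * ip (T t (S v)) v))
    (sqrt pi * ip (C v) v)"
proof -
  interpret sv: finite_measure "spec v" by (rule finite_spec[OF v])
  interpret pair_sigma_finite "spec v" lborel by unfold_locales
  define g where "g b t = indicator {0<..} t * (t powr (-1/2) * (expb t b * sqrt (1 - b)))" for b t :: real
  have ident: "(\<lambda>b. b) \<in> measurable (spec v) borel"
    using measurable_spec[OF v continuous_on_id] .
  have fst: "fst \<in> measurable (spec v \<Otimes>\<^sub>M lborel) borel"
    by (rule measurable_compose[OF measurable_fst ident])
  have snd: "snd \<in> measurable (spec v \<Otimes>\<^sub>M lborel) borel"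
    by (rule measurable_compose[OF measurable_snd, where g = "\<lambda>x. x"]) simp
  have pair: "(\<lambda>p. (fst p, snd p)) \<in> measurable (spec v \<Otimes>\<^sub>M lborel) (borel \<Otimes>\<^sub>M borel)"
    using fst snd by measurable
  have gg: "(\<lambda>p. g (fst p) (snd p)) \<in> borel_measurable (borel \<Otimes>\<^sub>M borel)"
    unfolding g_def expb_def by measurable
  have g_meas: "(\<lambda>p. g (fst p) (snd p)) \<in> borel_measurable (spec v \<Otimes>\<^sub>M lborel)"
    using measurable_compose[OF pair gg] by simp
  have g_meas': "(\<lambda>(b, t). ennreal (g b t)) \<in> borel_measurable (spec v \<Otimes>\<^sub>M lborel)"
    using g_meas by (simp add: case_prod_beta')
  have E_S: "ip (T t (S v)) v = (\<integral>b. expb t b * sqrt (1 - b) \<partial>spec v)"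
    and E_int: "integrable (spec v) (\<lambda>b. expb t b * sqrt (1 - b))" if t: "t > 0" for t
  proof -
    have c: "continuous_on {0..1} (\<lambda>b. expb t b * sqrt (1 - b))"
      by (intro continuous_intros continuous_expb t)
    have "T t (S v) = fc (\<lambda>b. expb t b * sqrt (1 - b)) v"
      unfolding T_pos[OF t] S_def by (intro fc_mult[symmetric] v continuous_expb t cont_sqrt)
    then show "ip (T t (S v)) v = (\<integral>b. expb t b * sqrt (1 - b) \<partial>spec v)" using fc_spec[OF v c] by simp
    show "integrable (spec v) (\<lambda>b. expb t b * sqrt (1 - b))" by (rule integrable_spec[OF v c])
  qed
  have g_nonneg: "0 \<le> g b t" if "b \<in> {0..1}" for b t
    using that expb_01[of t b] by (auto simp: g_def indicator_def)
  have inner_b: "(\<integral>\<^sup>+b. ennreal (g b t) \<partial>spec v) =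
      ennreal (indicator {0<..} t *\<^sub>R (t powr (-1/2) * ip (T t (S v)) v))" 
    and nonneg: "0 \<le> indicator {0<..} t *\<^sub>R (t powr (-1/2) * ip (T t (S v)) v)"
    and int_g: "(\<integral>b. g b t \<partial>spec v) = indicator {0<..} t *\<^sub>R (t powr (-1/2) * ip (T t (S v)) v)" for t
  proof -
    show ig: "(\<integral>b. g b t \<partial>spec v) = indicator {0<..} t *\<^sub>R (t powr (-1/2) * ip (T t (S v)) v)"
      using E_S[of t] by (cases "t > 0") (auto simp: g_def)
    show "0 \<le> indicator {0<..} t *\<^sub>R (t powr (-1/2) * ip (T t (S v)) v)"
      unfolding ig[symmetric] by (intro integral_nonneg_AE AE_I2 g_nonneg) (simp add: space_spec[OF v])
    have "integrable (spec v) (\<lambda>b. g b t)"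
      using E_int[of t] by (cases "t > 0") (auto simp: g_def)
    then have "(\<integral>\<^sup>+b. ennreal (g b t) \<partial>spec v) = ennreal (\<integral>b. g b t \<partial>spec v)"
      by (intro nn_integral_eq_integral AE_I2 g_nonneg) (simp_all add: space_spec[OF v])
    then show "(\<integral>\<^sup>+b. ennreal (g b t) \<partial>spec v) =
      ennreal (indicator {0<..} t *\<^sub>R (t powr (-1/2) * ip (T t (S v)) v))" by (simp only: ig)
  qed
  have "AE b in spec v. sqrt (1 - b) \<noteq> 0"
    by (rule injective_fc_null) (use v S_inj cont_sqrt in \<open>auto simp: S_def\<close>)
  then have inner_t: "AE b in spec v. (\<integral>\<^sup>+t. ennreal (g b t) \<partial>lborel) = ennreal (sqrt pi * sqrt b)"
    using AE_spec_pos[OF v] AE_space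
  proof eventually_elim
    case (elim b)
    then have b: "0 < b" "b < 1" by (auto simp: space_spec[OF v] less_le)
    define r where "r = 1 / b - 1"
    have r: "r > 0" using b by (simp add: r_def field_simps)
    have "(\<integral>\<^sup>+t. ennreal (g b t) \<partial>lborel) =
        (\<integral>\<^sup>+t. ennreal (sqrt (1 - b)) * ennreal (indicator {0<..} t * (t powr (-1/2) * exp (- t * r))) \<partial>lborel)"
    proof (intro nn_integral_cong)
      fix t
      have "g b t = sqrt (1 - b) * (indicator {0<..} t * (t powr (-1/2) * exp (- t * r)))"
        using b by (simp add: g_def expb_def r_def)
      then show "ennreal (g b t) = ennreal (sqrt (1 - b)) * ennreal (indicator {0<..} t * (t powr (-1/2) * exp (- t * r)))"
        using b by (simp add: ennreal_mult')
    qed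
    also have "\<dots> = ennreal (sqrt (1 - b)) * ennreal (sqrt pi / sqrt r)"
      by (subst nn_integral_cmult) (use nn_integral_powr_exp[OF r] in auto)
    also have "\<dots> = ennreal (sqrt (1 - b) * (sqrt pi / sqrt r))"
      using b r by (intro ennreal_mult[symmetric]) auto
    also have "sqrt (1 - b) * (sqrt pi / sqrt r) = sqrt pi * sqrt b"
    proof -
      have "1 - b = r * b" using b by (simp add: r_def field_simps)
      then have "sqrt (1 - b) = sqrt r * sqrt b" by (simp add: real_sqrt_mult)
      then show ?thesis using r by simp
    qed
    finally show ?case .
  qed
  have "(\<integral>\<^sup>+t. ennreal (indicator {0<..} t *\<^sub>R (t powr (-1/2) * ip (T t (S v)) v)) \<partial>lborel) =
      (\<integral>\<^sup>+t. \<integral>\<^sup>+b. ennreal (g b t) \<partial>spec v \<partial>lborel)"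
    by (simp only: inner_b)
  also have "\<dots> = (\<integral>\<^sup>+b. \<integral>\<^sup>+t. ennreal (g b t) \<partial>lborel \<partial>spec v)"
    using Fubini'[OF g_meas'] by simp
  also have "\<dots> = (\<integral>\<^sup>+b. ennreal (sqrt pi * sqrt b) \<partial>spec v)"
    by (rule nn_integral_cong_AE[OF inner_t])
  also have "\<dots> = ennreal (\<integral>b. sqrt pi * sqrt b \<partial>spec v)"
  proof (rule nn_integral_eq_integral)
    show "integrable (spec v) (\<lambda>b. sqrt pi * sqrt b)" by (intro integrable_spec v continuous_intros)
    show "AE b in spec v. 0 \<le> sqrt pi * sqrt b"
      by (rule AE_I2) (simp add: space_spec[OF v])
  qed
  also have "(\<integral>b. sqrt pi * sqrt b \<partial>spec v) = sqrt pi * ip (C v) v"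
    using fc_spec[OF v cont_sqrt(1)] by (simp add: C_def)
  finally have nn: "(\<integral>\<^sup>+t. ennreal (indicator {0<..} t *\<^sub>R (t powr (-1/2) * ip (T t (S v)) v)) \<partial>lborel) =
      ennreal (sqrt pi * ip (C v) v)" .
  show ?thesis
  proof (rule has_bochner_integral_nn_integral[OF _ _ _ nn])
    have "(\<lambda>(t, b). g b t) \<in> borel_measurable (lborel \<Otimes>\<^sub>M spec v)"
      using measurable_compose[OF measurable_pair_swap' g_meas] by (simp add: case_prod_beta')
    then have "(\<lambda>t. \<integral>b. g b t \<partial>spec v) \<in> borel_measurable lborel"
      by (rule sv.borel_measurable_lebesgue_integral)
    then show "(\<lambda>t. indicator {0<..} t *\<^sub>R (t powr (-1/2) * ip (T t (S v)) v)) \<in> borel_measurable lborel"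
      by (simp only: int_g)
    show "0 \<le> sqrt pi * ip (C v) v"
      unfolding C_def using fc_nonneg[OF v cont_sqrt(1)] by simp
  qed (use nonneg in simp)
qed

lemma inverse_root_integral:
  assumes vw: "v \<in> H" "w \<in> H" and S_inj: "\<And>v. v \<in> H \<Longrightarrow> S v = 0 \<Longrightarrow> v = 0"
  shows "has_bochner_integral lborel (\<lambda>t. indicator {0<..} t *\<^sub>R (t powr (-1/2) * ip (T t (S v)) w))
    (sqrt pi * ip (C v) w)"
proof -
  let ?h = "\<lambda>z t. indicator {0<..} t *\<^sub>R (t powr (-1/2) * ip (T t (S z)) z)"
  have "has_bochner_integral lborel (\<lambda>t. (1/4) * (?h (v + w) t - ?h (v - w) t))
      ((1/4) * (sqrt pi * ip (C (v + w)) (v + w) - sqrt pi * ip (C (v - w)) (v - w)))"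
  proof (intro has_bochner_integral_mult_right has_bochner_integral_diff)
    show "has_bochner_integral lborel (?h (v + w)) (sqrt pi * ip (C (v + w)) (v + w))"
      "has_bochner_integral lborel (?h (v - w)) (sqrt pi * ip (C (v - w)) (v - w))"
      by (rule inverse_root_integral_diag[OF _ S_inj]; use vw in simp)+
  qed
  moreover have "(1/4) * (?h (v + w) t - ?h (v - w) t) = indicator {0<..} t *\<^sub>R (t powr (-1/2) * ip (T t (S v)) w)" for t
  proof (cases "t > 0")
    case True
    have cross: "ip (T t (S w)) v = ip (T t (S v)) w"
    proof -
      have "T t (S z) = S (T t z)" if "z \<in> H" for z
        unfolding T_pos[OF True] S_def using that cont_sqrt continuous_expb[OF True] by (intro fc_commute)
      then have "ip (T t (S w)) v = ip w (T t (S v))"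
        using vw True by (simp add: S_sym T_sym)
      then show ?thesis using vw True by (simp add: ip_commute)
    qed
    have "ip (T t (S (v + w))) (v + w) - ip (T t (S (v - w))) (v - w) = 4 * ip (T t (S v)) w"
      using vw True cross by (simp add: S_linear T.T_add T.T_diff ip_simps)
    then show ?thesis using True by (simp add: algebra_simps)
  qed simp
  moreover have "(1/4) * (sqrt pi * ip (C (v + w)) (v + w) - sqrt pi * ip (C (v - w)) (v - w)) = sqrt pi * ip (C v) w"
  proof -
    have "ip (C w) v = ip (C v) w" using vw ip_commute[of w "C v"] by (simp add: C_sym[of w v])
    then have "ip (C (v + w)) (v + w) - ip (C (v - w)) (v - w) = 4 * ip (C v) w"
      using vw by (simp add: C_linear ip_simps)
    then show ?thesis by (simp add: algebra_simps)
  qed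
  ultimately show ?thesis by simp
qed

end

section \<open>Networks\<close>

subsection \<open>Square-summable functions\<close>

lemma ell2_iff: "u \<in> ell2 \<longleftrightarrow> (\<lambda>x. (u x)\<^sup>2) summable_on UNIV"
  by (simp add: ell2_def)

lemma ell2_mult_summable:
  assumes "u \<in> ell2" "v \<in> ell2"
  shows "(\<lambda>x. u x * v x) summable_on UNIV"
proof -
  have "(\<lambda>x. (u x)\<^sup>2 + (v x)\<^sup>2) summable_on UNIV"
    using assms unfolding ell2_iff by (rule summable_on_add)
  moreover have "norm (u x * v x) \<le> (u x)\<^sup>2 + (v x)\<^sup>2" for x
  proof -
    have "0 \<le> (\<bar>u x\<bar> - \<bar>v x\<bar>)\<^sup>2" by simp
    then have "2 * \<bar>u x * v x\<bar> \<le> (u x)\<^sup>2 + (v x)\<^sup>2" by (simp add: power2_diff abs_mult)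
    then show ?thesis unfolding real_norm_def by (smt (verit) zero_le_power2)
  qed
  ultimately have "(\<lambda>x. norm (u x * v x)) summable_on UNIV"
    by (rule summable_on_comparison_test) simp
  then show ?thesis by (rule abs_summable_summable)
qed

lemma ell2_add: 
  assumes "u \<in> ell2" "v \<in> ell2" shows "u + v \<in> ell2"
proof -
  have "(\<lambda>x. (u x)\<^sup>2 + (v x)\<^sup>2 + 2 * (u x * v x)) summable_on UNIV"
    using assms ell2_mult_summable[OF assms] unfolding ell2_iff
    by (intro summable_on_add summable_on_cmult_right)
  then show ?thesis by (simp add: ell2_iff power2_sum algebra_simps)
qed

lemma ell2_scale: "u \<in> ell2 \<Longrightarrow> r *\<^sub>R u \<in> ell2"
  by (simp add: ell2_iff power_mult_distrib summable_on_cmult_right)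

lemma ell2_finite_support: "finite {x. u x \<noteq> 0} \<Longrightarrow> u \<in> ell2"
  unfolding ell2_iff by (rule finite_nonzero_values_imp_summable_on) (auto elim: rev_finite_subset)

lemma ell2_bound_of_finite_sums:
  assumes "\<And>F. finite F \<Longrightarrow> (\<Sum>x\<in>F. (u x)\<^sup>2) \<le> B"
  shows "u \<in> ell2" "ell2_ip u u \<le> B"
proof -
  show u: "u \<in> ell2" unfolding ell2_iff
    by (rule nonneg_bdd_above_summable_on) (use assms in \<open>auto intro!: bdd_aboveI[of _ B]\<close>)
  show "ell2_ip u u \<le> B"
    unfolding ell2_ip_def using u assms
    by (intro infsum_le_finite_sums) (auto simp: ell2_iff simp flip: power2_eq_square)
qed

lemma ell2_finite_sum_le:
  assumes "u \<in> ell2" "finite F"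
  shows "(\<Sum>x\<in>F. (u x)\<^sup>2) \<le> ell2_ip u u"
  unfolding ell2_ip_def power2_eq_square[symmetric]
  using assms by (intro finite_sum_le_infsum) (auto simp: ell2_iff)

lemma ell2_point_le: "u \<in> ell2 \<Longrightarrow> (u x)\<^sup>2 \<le> ell2_ip u u"
  using ell2_finite_sum_le[of u "{x}"] by simp

lemma ell2_complete:
  fixes s :: "nat \<Rightarrow> 'v \<Rightarrow> real"
  assumes s: "\<And>n. s n \<in> ell2"
    and cauchy: "\<And>e. 0 < e \<Longrightarrow> \<exists>N. \<forall>m\<ge>N. \<forall>n\<ge>N. ell2_ip (s m - s n) (s m - s n) < e"
  shows "\<exists>l\<in>ell2. (\<lambda>n. ell2_ip (s n - l) (s n - l)) \<longlonglongrightarrow> 0"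
proof -
  have diff: "s m - s n \<in> ell2" for m n
    using ell2_add[OF s[of m] ell2_scale[OF s[of n], of "-1"]] by simp
  have "Cauchy (\<lambda>n. s n x)" for x
    unfolding Cauchy_def
  proof (intro allI impI)
    fix e :: real assume "e > 0"
    then obtain N where N: "\<And>m n. m \<ge> N \<Longrightarrow> n \<ge> N \<Longrightarrow> ell2_ip (s m - s n) (s m - s n) < e\<^sup>2"
      using cauchy[of "e\<^sup>2"] by auto
    have "dist (s m x) (s n x) < e" if "m \<ge> N" "n \<ge> N" for m n
    proof -
      have "(s m x - s n x)\<^sup>2 < e\<^sup>2" using ell2_point_le[OF diff, of m n x] N[OF that] by simp
      then have "\<bar>s m x - s n x\<bar>\<^sup>2 < e\<^sup>2" by simp
      then show ?thesis unfolding dist_real_def by (rule power2_less_imp_less) (use \<open>e > 0\<close> in simp)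
    qed
    then show "\<exists>M. \<forall>m\<ge>M. \<forall>n\<ge>M. dist (s m x) (s n x) < e" by blast
  qed
  then obtain l where l: "\<And>x. (\<lambda>n. s n x) \<longlonglongrightarrow> l x"
    unfolding Cauchy_convergent_iff convergent_def by metis
  have tail: "\<exists>N. \<forall>m\<ge>N. s m - l \<in> ell2 \<and> ell2_ip (s m - l) (s m - l) \<le> e" if e: "e > 0" for e
  proof -
    obtain N where N: "\<And>m n. m \<ge> N \<Longrightarrow> n \<ge> N \<Longrightarrow> ell2_ip (s m - s n) (s m - s n) < e"
      using cauchy[OF e] by auto
    have "(\<Sum>x\<in>F. ((s m - l) x)\<^sup>2) \<le> e" if m: "m \<ge> N" and F: "finite F" for m F
    proof (rule LIMSEQ_le_const2)
      show "(\<lambda>n. \<Sum>x\<in>F. (s m x - s n x)\<^sup>2) \<longlonglongrightarrow> (\<Sum>x\<in>F. ((s m - l) x)\<^sup>2)"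
        by (auto intro!: tendsto_intros l)
      have "(\<Sum>x\<in>F. (s m x - s n x)\<^sup>2) \<le> e" if "n \<ge> N" for n
        using ell2_finite_sum_le[OF diff F, of m n] N[OF m that] by simp
      then show "\<exists>N. \<forall>n\<ge>N. (\<Sum>x\<in>F. (s m x - s n x)\<^sup>2) \<le> e" by blast
    qed
    then have "\<forall>m\<ge>N. s m - l \<in> ell2 \<and> ell2_ip (s m - l) (s m - l) \<le> e"
      using ell2_bound_of_finite_sums[of "s _ - l" e] by blast
    then show ?thesis by blast
  qed
  obtain N where "s N - l \<in> ell2" using tail[of 1] by auto
  then have "l \<in> ell2" using ell2_add[OF s[of N] ell2_scale[of "s N - l" "-1"]] by simp
  moreover have "(\<lambda>n. ell2_ip (s n - l) (s n - l)) \<longlonglongrightarrow> 0"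
  proof (rule LIMSEQ_I)
    fix e :: real assume e: "e > 0"
    obtain N where N: "\<And>m. m \<ge> N \<Longrightarrow> ell2_ip (s m - l) (s m - l) \<le> e / 2" using tail[of "e / 2"] e by auto
    have "norm (ell2_ip (s n - l) (s n - l) - 0) < e" if "n \<ge> N" for n
    proof -
      have "0 \<le> ell2_ip (s n - l) (s n - l)" unfolding ell2_ip_def by (intro infsum_nonneg) simp
      then show ?thesis using N[OF that] e by simp
    qed
    then show "\<exists>no. \<forall>n\<ge>no. norm (ell2_ip (s n - l) (s n - l) - 0) < e" by blast
  qed
  ultimately show ?thesis by blast
qed

interpretation ell2: hilbert_top "ell2 :: ('v \<Rightarrow> real) set" ell2_ip
proof
  show "subspace (ell2 :: ('v \<Rightarrow> real) set)"
    by (rule subspaceI) (auto simp: ell2_add ell2_scale intro: ell2_finite_support)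
  fix u v w :: "'v \<Rightarrow> real"
  show "0 \<le> ell2_ip u u" unfolding ell2_ip_def by (intro infsum_nonneg) simp
  then show "0 \<le> ell2_ip u u" .
  show "ell2_ip (- u) (- u) = ell2_ip u u" by (simp add: ell2_ip_def)
  assume u: "u \<in> ell2"
  show "u = 0" if "ell2_ip u u = 0"
  proof
    fix x show "u x = 0 x" using ell2_point_le[OF u, of x] that by simp
  qed
  show "ell2_ip (r *\<^sub>R u) w = r * ell2_ip u w" for r
    by (simp add: ell2_ip_def infsum_cmult_right' mult.assoc)
  assume v: "v \<in> ell2"
  show "ell2_ip u v = ell2_ip v u" by (simp add: ell2_ip_def mult.commute)
  assume w: "w \<in> ell2"
  show "ell2_ip (u + v) w = ell2_ip u w + ell2_ip v w"
    unfolding ell2_ip_def using infsum_add[OF ell2_mult_summable[OF u w] ell2_mult_summable[OF v w]]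
    by (simp add: distrib_right)
next
  fix s :: "nat \<Rightarrow> 'v \<Rightarrow> real"
  assume "\<And>n. s n \<in> ell2" "\<And>e. 0 < e \<Longrightarrow> \<exists>N. \<forall>m\<ge>N. \<forall>n\<ge>N. ell2_ip (s m - s n) (s m - s n) < e"
  then show "\<exists>l\<in>ell2. (\<lambda>n. ell2_ip (s n - l) (s n - l)) \<longlonglongrightarrow> 0" by (rule ell2_complete)
qed

lemma delta_apply: "delta x y = (if y = x then 1 else 0)"
  by (simp add: delta_def indicator_def)

lemma delta_ell2 [simp]: "delta x \<in> ell2"
  by (rule ell2_finite_support) (simp add: delta_apply)

lemma ell2_ip_finite:
  assumes "finite F" "\<And>x. x \<notin> F \<Longrightarrow> u x = 0"
  shows "ell2_ip u v = (\<Sum>x\<in>F. u x * v x)"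
proof -
  have "ell2_ip u v = infsum (\<lambda>x. u x * v x) F"
    unfolding ell2_ip_def by (rule infsum_cong_neutral) (use assms in auto)
  then show ?thesis using assms by simp
qed

lemma ell2_ip_delta: "ell2_ip (delta x) u = u x" "ell2_ip u (delta x) = u x"
proof -
  show 1: "ell2_ip (delta x) u = u x"
    by (subst ell2_ip_finite[of "{x}"]) (auto simp: delta_apply)
  then show "ell2_ip u (delta x) = u x" by (simp add: ell2_ip_def mult.commute)
qed

lemma ell2_tends_pointwise:
  assumes "ell2.tends s l F" "\<forall>\<^sub>F i in F. s i \<in> ell2" "l \<in> ell2"
  shows "((\<lambda>i. s i x) \<longlongrightarrow> l x) F"
  using ell2.tends_ip_const[OF assms, of "delta x"] by (simp add: ell2_ip_delta)

lemma Phi_dom_iff: "\<xi> \<in> Phi_dom \<longleftrightarrow> finite {x. \<xi> x \<noteq> 0}"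
proof
  assume "\<xi> \<in> Phi_dom"
  then show "finite {x. \<xi> x \<noteq> 0}"
    unfolding Phi_dom_def
  proof (induction rule: span_induct_alt)
    case (step r d \<xi>)
    then obtain x where d: "d = delta x" by auto
    have "{y. (r *\<^sub>R d + \<xi>) y \<noteq> 0} \<subseteq> insert x {y. \<xi> y \<noteq> 0}" by (auto simp: d delta_apply)
    then show ?case using step by (meson finite.insertI finite_subset)
  qed simp
next
  assume fin: "finite {x. \<xi> x \<noteq> 0}"
  have "(\<Sum>x | \<xi> x \<noteq> 0. \<xi> x *\<^sub>R delta x) \<in> Phi_dom"
    unfolding Phi_dom_def by (intro span_sum span_scale span_base) auto
  moreover have "(\<Sum>x | \<xi> x \<noteq> 0. \<xi> x *\<^sub>R delta x) = \<xi>"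
  proof
    fix y
    have "(\<Sum>x | \<xi> x \<noteq> 0. \<xi> x *\<^sub>R delta x) y = (\<Sum>x | \<xi> x \<noteq> 0. \<xi> x * delta x y)"
      by (induction rule: infinite_finite_induct) auto
    also have "\<dots> = \<xi> y" using fin by (simp add: delta_apply if_distrib sum.delta cong: if_cong)
    finally show "(\<Sum>x | \<xi> x \<noteq> 0. \<xi> x *\<^sub>R delta x) y = \<xi> y" .
  qed
  ultimately show "\<xi> \<in> Phi_dom" by simp
qed

lemma Phi_dom_ell2: "\<xi> \<in> Phi_dom \<Longrightarrow> \<xi> \<in> ell2"
  by (simp add: Phi_dom_iff ell2_finite_support)

lemma subspace_Phi_dom: "subspace Phi_dom"
  by (simp add: Phi_dom_def)

lemma delta_Phi_dom [simp]: "delta x \<in> Phi_dom"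
  by (simp add: Phi_dom_iff delta_apply)

subsection \<open>The energy form\<close>

definition grad :: "('v \<Rightarrow> 'v \<Rightarrow> real) \<Rightarrow> ('v \<Rightarrow> real) \<Rightarrow> 'v \<times> 'v \<Rightarrow> real" where
  "grad c u = (\<lambda>(x, y). sqrt (c x y) * (u x - u y))"

lemma grad_linear: "grad c (u + v) = grad c u + grad c v" "grad c (r *\<^sub>R u) = r *\<^sub>R grad c u"
    "grad c (u - v) = grad c u - grad c v" "grad c (- u) = - grad c u" "grad c 0 = 0"
  by (auto simp: grad_def fun_eq_iff algebra_simps)

locale conductances =
  fixes c :: "'v \<Rightarrow> 'v \<Rightarrow> real"
  assumes network: "network c"
begin

lemma c_nonneg: "0 \<le> c x y" and c_sym: "c x y = c y x" and c_finite: "finite {y. 0 < c x y}"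
  and connected: "(\<lambda>x y. 0 < c x y)\<^sup>*\<^sup>* x y"
  using network by (auto simp: network_def)

lemma energy_dom_iff: "u \<in> energy_dom c \<longleftrightarrow> grad c u \<in> ell2"
proof -
  have "(\<lambda>(x, y). c x y * (u x - u y)\<^sup>2) = (\<lambda>p. (grad c u p)\<^sup>2)"
    using c_nonneg by (auto simp: grad_def power_mult_distrib)
  then show ?thesis by (simp add: energy_dom_def ell2_iff)
qed

lemma energy_grad: "energy c u v = ell2_ip (grad c u) (grad c v) / 2"
proof -
  have "(\<lambda>(x, y). c x y * (u x - u y) * (v x - v y)) = (\<lambda>p. grad c u p * grad c v p)"
  proof
    fix p :: "'v \<times> 'v"
    obtain x y where p: "p = (x, y)" by force
    have "c x y = sqrt (c x y) * sqrt (c x y)" using c_nonneg by simp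
    then show "(case p of (x, y) \<Rightarrow> c x y * (u x - u y) * (v x - v y)) = grad c u p * grad c v p"
      by (simp add: p grad_def algebra_simps)
  qed
  then show ?thesis by (simp add: energy_def ell2_ip_def)
qed

lemma subspace_energy_dom: "subspace (energy_dom c)"
  by (rule subspaceI) (auto simp: energy_dom_iff grad_linear)

lemma energy_nonneg: "0 \<le> energy c u u"
  by (simp add: energy_grad ell2.ip_square_nonneg)

lemma energy_edge:
  assumes "u \<in> energy_dom c" "0 < c x y"
  shows "\<bar>u x - u y\<bar> \<le> sqrt (2 / c x y) * sqrt (energy c u u)"
proof -
  have "c x y * (u x - u y)\<^sup>2 \<le> 2 * energy c u u"
    using ell2_point_le[of "grad c u" "(x, y)"] assms
    by (simp add: energy_dom_iff energy_grad) (simp add: grad_def power_mult_distrib)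
  then have "(u x - u y)\<^sup>2 \<le> 2 / c x y * energy c u u" using assms by (simp add: field_simps)
  then have "sqrt ((u x - u y)\<^sup>2) \<le> sqrt (2 / c x y * energy c u u)" by (rule real_sqrt_le_mono)
  then show ?thesis by (simp only: real_sqrt_mult real_sqrt_abs)
qed

text \<open>Each edge of a path between the two vertices contributes a multiple of the root of the energy.
  Evaluations of differences are therefore continuous, which gives dipoles and completeness.\<close>

lemma energy_difference: "\<exists>K\<ge>0. \<forall>u\<in>energy_dom c. \<bar>u x - u y\<bar> \<le> K * sqrt (energy c u u)"
  using connected[of x y]
proof (induction rule: rtranclp_induct)
  case base
  then show ?case by (intro exI[of _ 0]) simp
next
  case (step y z)
  then obtain K where K: "K \<ge> 0" "\<forall>u\<in>energy_dom c. \<bar>u x - u y\<bar> \<le> K * sqrt (energy c u u)" by blast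
  have "\<bar>u x - u z\<bar> \<le> (K + sqrt (2 / c y z)) * sqrt (energy c u u)" if u: "u \<in> energy_dom c" for u
  proof -
    have "\<bar>u x - u y\<bar> \<le> K * sqrt (energy c u u)" using K u by blast
    with energy_edge[OF u step(2)] show ?thesis by (simp add: distrib_right)
  qed
  moreover have "0 \<le> K + sqrt (2 / c y z)" using K step(2) by simp
  ultimately show ?case by blast
qed

lemma energy_zero:
  assumes "u \<in> energy_dom c" "energy c u u = 0"
  shows "u x = u y"
  using energy_difference[of x y] assms by fastforce

lemma laplacian_linear:
  "laplacian c (u + v) = laplacian c u + laplacian c v" "laplacian c (r *\<^sub>R u) = r *\<^sub>R laplacian c u"
  "laplacian c (u - v) = laplacian c u - laplacian c v" "laplacian c 0 = 0"
  by (auto simp: laplacian_def fun_eq_iff algebra_simps sum.distrib sum_subtractf sum_distrib_left)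

lemma laplacian_delta: "laplacian c (delta x) = (\<Sum>y | 0 < c x y. c x y *\<^sub>R (delta x - delta y))"
proof
  fix z
  have eval: "(\<Sum>y | 0 < c x y. c x y *\<^sub>R (delta x - delta y)) z = (\<Sum>y | 0 < c x y. c x y * (delta x z - delta y z))"
    by (induction rule: infinite_finite_induct) auto
  show "laplacian c (delta x) z = (\<Sum>y | 0 < c x y. c x y *\<^sub>R (delta x - delta y)) z"
  proof (cases "z = x")
    case True
    then show ?thesis unfolding eval by (simp add: laplacian_def delta_apply eq_commute)
  next
    case False
    have "laplacian c (delta x) z = (\<Sum>y | 0 < c z y. if y = x then - c z x else 0)"
      unfolding laplacian_def using False by (intro sum.cong) (auto simp: delta_apply)
    also have "\<dots> = - c z x" using c_finite c_nonneg[of z x] by (auto simp: sum.delta less_le)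
    also have "\<dots> = (\<Sum>y | 0 < c x y. if y = z then - c x z else 0)"
      using c_finite c_nonneg[of x z] c_sym[of x z] by (auto simp: sum.delta less_le)
    also have "\<dots> = (\<Sum>y | 0 < c x y. c x y * (delta x z - delta y z))"
      using False by (intro sum.cong) (auto simp: delta_apply)
    finally show ?thesis unfolding eval .
  qed
qed

lemma laplacian_Phi_dom: "\<xi> \<in> Phi_dom \<Longrightarrow> laplacian c \<xi> \<in> Phi_dom"
  unfolding Phi_dom_def
proof (induction rule: span_induct_alt)
  case base
  show ?case unfolding laplacian_linear(4) by (rule span_zero)
next
  case (step r d \<xi>)
  then obtain x where d: "d = delta x" by auto
  have "laplacian c d \<in> span (range delta)"
    unfolding d laplacian_delta by (intro span_sum span_scale span_diff span_base) auto
  then show ?case using step unfolding laplacian_linear(1,2) by (intro span_add span_scale)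
qed

lemma ell2_ip_laplacian_delta:
  assumes "u \<in> ell2"
  shows "ell2_ip u (laplacian c (delta x)) = laplacian c u x"
proof -
  have "ell2_ip (laplacian c (delta x)) u = (\<Sum>y | 0 < c x y. c x y * (u x - u y))"
    unfolding laplacian_delta using assms
    by (simp add: ell2.ip_sum ell2.ip_scale ell2.ip_diff ell2_ip_delta)
  then show ?thesis using assms by (simp add: laplacian_def ell2_ip_def mult.commute)
qed

text \<open>Green's formula. The energy against \<open>delta x\<close> is a sum over edges leaving \<open>x\<close> plus the
  sum over the same edges in the opposite direction.\<close>

lemma energy_delta: "energy c u (delta x) = laplacian c u x"
proof -
  let ?N = "{y. 0 < c x y}"
  define f where "f = (\<lambda>(a, b). c a b * (u a - u b) * delta x a)"
  have "infsum f UNIV = infsum f ({x} \<times> ?N)"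
    using c_nonneg by (intro infsum_cong_neutral) (auto simp: f_def delta_apply less_le split: if_splits)
  also have "\<dots> = (\<Sum>a\<in>{x}. \<Sum>b\<in>?N. f (a, b))"
    using c_finite by (simp only: sum.cartesian_product) simp
  also have "\<dots> = (\<Sum>y\<in>?N. f (x, y))" by simp
  also have "\<dots> = laplacian c u x" by (simp add: f_def laplacian_def delta_apply)
  finally have inf1: "infsum f UNIV = laplacian c u x" .
  have "finite {p. f p \<noteq> 0}"
  proof (rule finite_subset)
    show "{p. f p \<noteq> 0} \<subseteq> {x} \<times> ?N" using c_nonneg by (auto simp: f_def delta_apply less_le split: if_splits)
  qed (use c_finite in simp)
  then have s1: "f summable_on UNIV" by (intro finite_nonzero_values_imp_summable_on) simp
  have bij: "bij_betw prod.swap UNIV (UNIV :: ('v \<times> 'v) set)" by (rule bij_swap)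
  have s2: "(\<lambda>p. f (prod.swap p)) summable_on UNIV"
    using s1 summable_on_reindex_bij_betw[OF bij, of f] by simp
  have inf2: "infsum (\<lambda>p. f (prod.swap p)) UNIV = infsum f UNIV"
    by (rule infsum_reindex_bij_betw[OF bij])
  have "(\<lambda>(a, b). c a b * (u a - u b) * (delta x a - delta x b)) = (\<lambda>p. f p + f (prod.swap p))"
    using c_sym by (auto simp: f_def fun_eq_iff algebra_simps)
  then have "energy c u (delta x) = (infsum f UNIV + infsum (\<lambda>p. f (prod.swap p)) UNIV) / 2"
    unfolding energy_def using infsum_add[OF s1 s2] by simp
  then show ?thesis using inf1 inf2 by simp
qed

lemma delta_energy_dom [simp]: "delta x \<in> energy_dom c"
proof -
  let ?N = "{y. 0 < c x y}"
  have "{p. grad c (delta x) p \<noteq> 0} \<subseteq> {x} \<times> ?N \<union> ?N \<times> {x}"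
    using c_nonneg c_sym by (auto simp: grad_def delta_apply less_le split: if_splits)
  moreover have "finite ({x} \<times> ?N \<union> ?N \<times> {x})" using c_finite by simp
  ultimately show ?thesis unfolding energy_dom_iff by (intro ell2_finite_support) (rule finite_subset)
qed

lemma Phi_dom_energy_dom: "\<xi> \<in> Phi_dom \<Longrightarrow> \<xi> \<in> energy_dom c"
  unfolding Phi_dom_def by (rule subsetD[OF span_minimal[OF _ subspace_energy_dom]]) auto

text \<open>A maximum principle: a square-summable function attains its largest absolute value, and there
  \<open>z\<close> and \<open>laplacian c z\<close> cannot have opposite signs.\<close>

lemma maximum_principle:
  assumes z: "z \<in> ell2" and eq: "\<And>x. z x + laplacian c z x = 0"
  shows "z = 0"
proof (rule ccontr)
  assume "z \<noteq> 0"
  then obtain x0 where x0: "z x0 \<noteq> 0" by (auto simp: fun_eq_iff)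
  define F where "F = {x. \<bar>z x\<bar> \<ge> \<bar>z x0\<bar>}"
  have "finite F"
  proof (rule ccontr)
    assume inf: "infinite F"
    obtain n :: nat where n: "ell2_ip z z / (z x0)\<^sup>2 < real n" using reals_Archimedean2 by blast
    obtain F' where F': "F' \<subseteq> F" "finite F'" "card F' = n" using infinite_arbitrarily_large[OF inf] by blast
    have "real n * (z x0)\<^sup>2 = (\<Sum>x\<in>F'. (z x0)\<^sup>2)" using F' by simp
    also have "\<dots> \<le> (\<Sum>x\<in>F'. (z x)\<^sup>2)"
      using F'(1) by (intro sum_mono) (auto simp: F_def abs_le_square_iff)
    also have "\<dots> \<le> ell2_ip z z" by (rule ell2_finite_sum_le[OF z F'(2)])
    finally show False using n x0 by (simp add: field_simps)
  qed
  moreover have "x0 \<in> F" by (simp add: F_def)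
  ultimately have "Max ((\<lambda>y. \<bar>z y\<bar>) ` F) \<in> (\<lambda>y. \<bar>z y\<bar>) ` F" by (intro Max_in) auto
  then obtain x where x: "x \<in> F" "\<bar>z x\<bar> = Max ((\<lambda>y. \<bar>z y\<bar>) ` F)" by auto
  have x: "x \<in> F" "\<And>y. y \<in> F \<Longrightarrow> \<bar>z y\<bar> \<le> \<bar>z x\<bar>"
    unfolding x(2) using x(1) \<open>finite F\<close> by auto
  have max: "\<bar>z y\<bar> \<le> \<bar>z x\<bar>" for y
  proof (cases "y \<in> F")
    case False
    then have "\<bar>z y\<bar> \<le> \<bar>z x0\<bar>" by (simp add: F_def)
    also have "\<dots> \<le> \<bar>z x\<bar>" using x(1) by (simp add: F_def)
    finally show ?thesis .
  qed (rule x(2))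
  have zx: "z x \<noteq> 0" using x(1) x0 by (auto simp: F_def)
  show False
  proof (cases "z x > 0")
    case True
    have "0 \<le> laplacian c z x"
      unfolding laplacian_def
    proof (intro sum_nonneg mult_nonneg_nonneg)
      show "0 \<le> z x - z y" for y using max[of y] True by simp
    qed (use c_nonneg in auto)
    then show False using eq[of x] True by simp
  next
    case False
    have "laplacian c z x \<le> 0"
      unfolding laplacian_def
    proof (intro sum_nonpos mult_nonneg_nonpos)
      show "z x - z y \<le> 0" for y using max[of y] False by simp
    qed (use c_nonneg in auto)
    then show False using eq[of x] False zx by simp
  qed
qed

end

section \<open>The Laplacian on square-summable functions\<close>

lemma Phi_dom_induct [consumes 1, case_names zero step]:
  assumes "\<xi> \<in> Phi_dom" "P 0" "\<And>r x \<xi>. \<xi> \<in> Phi_dom \<Longrightarrow> P \<xi> \<Longrightarrow> P (r *\<^sub>R delta x + \<xi>)"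
  shows "P \<xi>"
proof -
  have "\<xi> \<in> Phi_dom \<and> P \<xi>"
    using assms(1)[unfolded Phi_dom_def]
  proof (induction rule: span_induct_alt)
    case base
    show ?case using assms(2) subspace_0[OF subspace_Phi_dom] by (rule conjI[rotated])
  next
    case (step r d \<xi>)
    then obtain x where d: "d = delta x" by auto
    have "r *\<^sub>R d + \<xi> \<in> Phi_dom"
      using step unfolding d by (intro subspace_add subspace_scale subspace_Phi_dom delta_Phi_dom) auto
    moreover have "P (r *\<^sub>R d + \<xi>)" using step assms(3) unfolding d by blast
    ultimately show ?case by (rule conjI)
  qed
  then show ?thesis by blast
qed

context conductances
begin

text \<open>This is what makes the energy a closed form.\<close>

lemma grad_closed:
  assumes u: "\<And>n. u n \<in> energy_dom c" and g: "g \<in> ell2" "ell2.tends (\<lambda>n. grad c (u n)) g sequentially"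
    and lim: "\<And>x. (\<lambda>n::nat. u n x) \<longlonglongrightarrow> l x"
  shows "grad c l = g"
proof
  fix p :: "'v \<times> 'v"
  obtain x y where p: "p = (x, y)" by force
  have "(\<lambda>n. grad c (u n) p) \<longlonglongrightarrow> g p"
    using g u by (intro ell2_tends_pointwise) (auto simp: energy_dom_iff)
  moreover have "(\<lambda>n. grad c (u n) p) \<longlonglongrightarrow> grad c l p"
    unfolding p grad_def by (auto intro!: tendsto_intros lim)
  ultimately show "grad c l p = g p" by (rule LIMSEQ_unique[rotated])
qed

definition D2 :: "('v \<Rightarrow> real) set" where "D2 = ell2 \<inter> energy_dom c"

lemma energy_add: "u \<in> energy_dom c \<Longrightarrow> v \<in> energy_dom c \<Longrightarrow> w \<in> energy_dom c \<Longrightarrow>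
    energy c (u + v) w = energy c u w + energy c v w"
  by (simp add: energy_grad energy_dom_iff grad_linear ell2.ip_add add_divide_distrib)

lemma energy_scale: "u \<in> energy_dom c \<Longrightarrow> w \<in> energy_dom c \<Longrightarrow> energy c (r *\<^sub>R u) w = r * energy c u w"
  by (simp add: energy_grad energy_dom_iff grad_linear ell2.ip_scale)

lemma energy_commute: "energy c u v = energy c v u"
  by (simp add: energy_grad ell2_ip_def mult.commute)

lemma hilbert_D2: "hilbert D2 (\<lambda>u v. energy c u v + ell2_ip u v)"
proof
  have sub: "subspace D2"
    unfolding D2_def by (rule subspace_inter[OF ell2.subspace_H subspace_energy_dom])
  then show "subspace D2" .
  fix u v w :: "'v \<Rightarrow> real"
  assume u: "u \<in> D2"
  show "0 \<le> energy c u u + ell2_ip u u" by (rule add_nonneg_nonneg[OF energy_nonneg ell2.ip_square_nonneg])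
  show "u = 0" if "energy c u u + ell2_ip u u = 0"
  proof -
    have "ell2_ip u u = 0" using that energy_nonneg[of u] ell2.ip_square_nonneg[of u] by linarith
    then show ?thesis using u ell2.ip_definite by (auto simp: D2_def)
  qed
  show "energy c (r *\<^sub>R u) w + ell2_ip (r *\<^sub>R u) w = r * (energy c u w + ell2_ip u w)" if "w \<in> D2" for r
    using u that by (simp add: D2_def energy_scale ell2.ip_scale distrib_left)
  assume v: "v \<in> D2"
  show "energy c u v + ell2_ip u v = energy c v u + ell2_ip v u"
    using u v by (simp add: energy_commute[of u v] ell2.ip_commute[of u v] D2_def)
  assume w: "w \<in> D2"
  show "energy c (u + v) w + ell2_ip (u + v) w = energy c u w + ell2_ip u w + (energy c v w + ell2_ip v w)"
    using u v w by (simp add: D2_def energy_add ell2.ip_add)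
next
  fix s :: "nat \<Rightarrow> 'v \<Rightarrow> real"
  assume s: "\<And>n. s n \<in> D2"
    and cauchy: "\<And>e. 0 < e \<Longrightarrow> \<exists>N. \<forall>m\<ge>N. \<forall>n\<ge>N. energy c (s m - s n) (s m - s n) + ell2_ip (s m - s n) (s m - s n) < e"
  have s': "s n \<in> ell2" "s n \<in> energy_dom c" "grad c (s n) \<in> ell2" for n
    using s by (auto simp: D2_def energy_dom_iff)
  obtain l where l: "l \<in> ell2" "ell2.tends s l sequentially"
  proof (rule ell2.cauchy_tends[of s])
    fix e :: real assume "e > 0"
    then obtain N where "\<And>m n. m \<ge> N \<Longrightarrow> n \<ge> N \<Longrightarrow> energy c (s m - s n) (s m - s n) + ell2_ip (s m - s n) (s m - s n) < e"
      using cauchy by blast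
    then have "ell2_ip (s m - s n) (s m - s n) < e" if "m \<ge> N" "n \<ge> N" for m n
      using that energy_nonneg[of "s m - s n"] by (smt (verit))
    then show "\<exists>N. \<forall>m\<ge>N. \<forall>n\<ge>N. ell2_ip (s m - s n) (s m - s n) < e" by blast
  qed (use s' in auto)
  obtain g where g: "g \<in> ell2" "ell2.tends (\<lambda>n. grad c (s n)) g sequentially"
  proof (rule ell2.cauchy_tends[of "\<lambda>n. grad c (s n)"])
    fix e :: real assume "e > 0"
    then obtain N where "\<And>m n. m \<ge> N \<Longrightarrow> n \<ge> N \<Longrightarrow> energy c (s m - s n) (s m - s n) + ell2_ip (s m - s n) (s m - s n) < e / 2"
      using cauchy[of "e / 2"] by auto
    then have "ell2_ip (grad c (s m) - grad c (s n)) (grad c (s m) - grad c (s n)) < e" if "m \<ge> N" "n \<ge> N" for m n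
      using that ell2.ip_square_nonneg[of "s m - s n"] unfolding energy_grad grad_linear by (smt (verit) field_sum_of_halves)
    then show "\<exists>N. \<forall>m\<ge>N. \<forall>n\<ge>N. ell2_ip (grad c (s m) - grad c (s n)) (grad c (s m) - grad c (s n)) < e" by blast
  qed (use s' in auto)
  have gl: "grad c l = g"
    using s' l by (intro grad_closed[OF s'(2) g] ell2_tends_pointwise[OF l(2)]) auto
  then have "l \<in> D2" using l g by (simp add: D2_def energy_dom_iff)
  moreover have "(\<lambda>n. energy c (s n - l) (s n - l) + ell2_ip (s n - l) (s n - l)) \<longlonglongrightarrow> 0 / 2 + 0"
    unfolding energy_grad grad_linear gl
    using l g s' by (intro tendsto_intros) (auto simp flip: ell2.tends_sq)
  ultimately show "\<exists>l\<in>D2. (\<lambda>n. energy c (s n - l) (s n - l) + ell2_ip (s n - l) (s n - l)) \<longlonglongrightarrow> 0" by auto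
qed

lemma D2_simps [simp]: "u \<in> D2 \<Longrightarrow> u \<in> ell2" "u \<in> D2 \<Longrightarrow> u \<in> energy_dom c"
  by (auto simp: D2_def)

lemma Phi_dom_D2: "\<xi> \<in> Phi_dom \<Longrightarrow> \<xi> \<in> D2"
  unfolding D2_def using Phi_dom_ell2 Phi_dom_energy_dom by blast

sublocale E2: closed_form ell2 ell2_ip D2 "energy c"
proof (intro closed_form.intro hilbert_D2 closed_form_axioms.intro)
  show "hilbert_top ell2 (ell2_ip :: ('v \<Rightarrow> real) \<Rightarrow> _)" by unfold_locales
  show "z = 0" if "z \<in> ell2" "\<And>x. x \<in> D2 \<Longrightarrow> ell2_ip z x = 0" for z
  proof
    fix x show "z x = 0 x" using that(2)[of "delta x"] Phi_dom_D2 by (simp add: ell2_ip_delta)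
  qed
qed (auto simp: energy_nonneg)

lemma laplacian_delta_ell2 [simp]: "laplacian c (delta x) \<in> ell2"
  by (intro Phi_dom_ell2 laplacian_Phi_dom delta_Phi_dom)

lemma energy_Phi_dom:
  assumes "\<xi> \<in> Phi_dom" "u \<in> D2"
  shows "energy c \<xi> u = ell2_ip (laplacian c \<xi>) u"
  using assms(1)
proof (induction rule: Phi_dom_induct)
  case zero
  have "energy c 0 u = 0" unfolding energy_grad grad_linear by (simp add: ell2_ip_def)
  moreover have "ell2_ip 0 u = 0" by (simp add: ell2_ip_def)
  ultimately show ?case unfolding laplacian_linear(4) by (rule trans[OF _ sym])
next
  case (step r x \<xi>)
  define d where d: "d = delta x"
  have \<xi>: "\<xi> \<in> Phi_dom" by (rule step)
  have "energy c d u = ell2_ip (laplacian c d) u"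
    unfolding d using assms(2) energy_delta[of u x] ell2_ip_laplacian_delta[of u x]
      ell2.ip_commute[OF laplacian_delta_ell2[of x] D2_simps(1)[OF assms(2)]]
    by (simp add: energy_commute[of "delta x"])
  moreover have "laplacian c d \<in> ell2" "laplacian c \<xi> \<in> ell2" "d \<in> energy_dom c" "\<xi> \<in> energy_dom c"
    using d \<xi> laplacian_Phi_dom Phi_dom_ell2 Phi_dom_energy_dom by auto
  moreover have "r *\<^sub>R d \<in> energy_dom c"
    using subspace_scale[OF subspace_energy_dom] \<open>d \<in> energy_dom c\<close> by blast
  ultimately show ?case
    using step assms(2) unfolding laplacian_linear d[symmetric]
    by (subst energy_add; simp add: energy_scale ell2.ip_add ell2.ip_scale)
qed

text \<open>The range of \<open>1 + laplacian\<close> on finitely supported functions is dense: a vector orthogonal to it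
  satisfies the equation of the maximum principle. This is essential self-adjointness.\<close>

lemma resolvent_range_dense:
  assumes "u \<in> ell2"
  obtains s where "\<And>n::nat. s n \<in> Phi_dom" "ell2.tends (\<lambda>n. s n + laplacian c (s n)) u sequentially"
proof -
  let ?D = "(\<lambda>\<xi>. \<xi> + laplacian c \<xi>) ` Phi_dom"
  obtain t where t: "\<And>n::nat. t n \<in> ?D" "ell2.tends t u sequentially"
  proof (rule ell2.dense_of_trivial_complement[of ?D u])
    have lin: "linear (\<lambda>\<xi>. \<xi> + laplacian c \<xi>)"
      by (rule linearI) (simp_all only: laplacian_linear scaleR_add_right ac_simps)
    show "subspace ?D" by (rule linear_subspace_image[OF lin subspace_Phi_dom])
    show "?D \<subseteq> ell2" using Phi_dom_ell2 laplacian_Phi_dom by (auto intro!: ell2.H_add)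
    fix z :: "'v \<Rightarrow> real" assume z: "z \<in> ell2" "\<And>d. d \<in> ?D \<Longrightarrow> ell2_ip z d = 0"
    show "z = 0"
    proof (rule maximum_principle[OF z(1)])
      fix x
      have "ell2_ip z (delta x + laplacian c (delta x)) = 0" by (rule z(2)) auto
      then show "z x + laplacian c z x = 0"
        using z(1)
        by (simp add: ell2.ip_add2 ell2_ip_delta ell2_ip_laplacian_delta)
    qed
  qed (use assms in auto)
  then have "\<forall>n. \<exists>\<xi>\<in>Phi_dom. t n = \<xi> + laplacian c \<xi>" by auto
  then obtain s where s: "\<And>n. s n \<in> Phi_dom" "\<And>n. t n = s n + laplacian c (s n)" by metis
  then have "t = (\<lambda>n. s n + laplacian c (s n))" by auto
  with s t show thesis using that by blast
qed

lemma Phi_dom_form_op: "\<xi> \<in> Phi_dom \<Longrightarrow> (\<xi>, laplacian c \<xi>) \<in> E2.form_op"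
  unfolding E2.form_op_def using Phi_dom_D2 energy_Phi_dom laplacian_Phi_dom Phi_dom_ell2 by auto

end

lemma (in hilbert_top) self_adjoint_closed:
  assumes A: "self_adjoint H ip A"
    and st: "\<And>n::nat. (s n, t n) \<in> A" and lim: "tends s u sequentially" "tends t w sequentially"
    and uw: "u \<in> H" "w \<in> H"
  shows "(u, w) \<in> A"
proof (rule self_adjointD(4)[OF A uw])
  note D = self_adjointD[OF A]
  have stH: "s n \<in> H" "t n \<in> H" for n using D(1,2)[OF st] .
  fix x y assume xy: "(x, y) \<in> A"
  have xyH: "x \<in> H" "y \<in> H" using D(1,2)[OF xy] .
  have "(\<lambda>n. ip y (s n)) \<longlonglongrightarrow> ip y u" using xyH stH lim uw by (intro tends_ip tends_const) auto
  moreover have "(\<lambda>n. ip x (t n)) \<longlonglongrightarrow> ip x w" using xyH stH lim uw by (intro tends_ip tends_const) auto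
  moreover have "ip y (s n) = ip x (t n)" for n using D(3)[OF st xy] .
  ultimately show "ip y u = ip x w" by (simp add: LIMSEQ_unique)
qed

lemma (in hilbert_top) op_closure_subset_self_adjoint:
  assumes "self_adjoint H ip A" "B \<subseteq> A"
  shows "op_closure H ip B \<subseteq> A"
proof (rule subrelI)
  fix u w assume "(u, w) \<in> op_closure H ip B"
  then obtain s t where st: "u \<in> H" "w \<in> H" "\<And>n::nat. (s n, t n) \<in> B"
      "tends s u sequentially" "tends t w sequentially"
    unfolding op_closure_iff by blast
  have "(s n, t n) \<in> A" for n using st(3) assms(2) by blast
  then show "(u, w) \<in> A" by (rule self_adjoint_closed[OF assms(1) _ st(4,5,1,2)])
qed

context conductances
begin

text \<open>The form operator is a self-adjoint extension. Conversely its resolvent is continuous and maps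
  \<open>s + laplacian c s\<close> to \<open>s\<close>; since such vectors are dense, each of its pairs is a limit of pairs
  with finite support.\<close>

theorem laplacian_2_eq: "laplacian_2 c = E2.form_op"
proof (rule subset_antisym)
  let ?G = "(\<lambda>\<xi>. (\<xi>, laplacian c \<xi>)) ` span (range delta)"
  have sub: "?G \<subseteq> E2.form_op" using Phi_dom_form_op by (auto simp: Phi_dom_def)
  then show "laplacian_2 c \<subseteq> E2.form_op"
    unfolding laplacian_2_def by (rule ell2.op_closure_subset_self_adjoint[OF E2.self_adjoint_form_op])
  show "E2.form_op \<subseteq> laplacian_2 c"
  proof (rule subrelI)
    fix u w assume uw: "(u, w) \<in> E2.form_op"
    have gen: "u \<in> ell2" "w \<in> ell2" "E2.RQ (u + w) = u"
      using uw unfolding E2.gen_eq_form_op[symmetric] E2.res.gen_iff by auto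
    obtain s where s: "\<And>n::nat. s n \<in> Phi_dom" "ell2.tends (\<lambda>n. s n + laplacian c (s n)) (u + w) sequentially"
      using resolvent_range_dense[of "u + w"] gen by auto
    have sH: "s n \<in> ell2" "laplacian c (s n) \<in> ell2" for n
      using s(1) Phi_dom_ell2 laplacian_Phi_dom by blast+
    have Rs: "E2.RQ (s n + laplacian c (s n)) = s n" for n
      using Phi_dom_form_op[OF s(1)[of n]] unfolding E2.gen_eq_form_op[symmetric] E2.res.gen_iff by auto
    have "ell2.nrm (E2.RQ v) \<le> 1 * ell2.nrm v" if v: "v \<in> ell2" for v
      using E2.res.fc_bound[OF v continuous_on_id, of 1] E2.res.fc_id[OF v] by auto
    then have "ell2.tends (\<lambda>n. E2.RQ (s n + laplacian c (s n))) (E2.RQ (u + w)) sequentially"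
      using s(2) sH gen by (intro ell2.bounded_tends[where f = E2.RQ and K = 1]) (auto simp: E2.res.R_diff)
    then have lim: "ell2.tends s u sequentially" by (simp add: Rs gen)
    have "ell2.tends (\<lambda>n. s n + laplacian c (s n) - s n) (u + w - u) sequentially"
      using s(2) lim sH gen by (intro ell2.tends_diff) auto
    then have "ell2.tends (\<lambda>n. laplacian c (s n)) w sequentially" by simp
    with lim s(1) sH gen show "(u, w) \<in> laplacian_2 c"
      unfolding laplacian_2_def ell2.op_closure_iff Phi_dom_def
      by (intro conjI exI[of _ s] exI[of _ "\<lambda>n. laplacian c (s n)"]) (auto intro!: allI)
  qed
qed

lemma laplacian_2_sqrt_eq: "laplacian_2_sqrt c = E2.res.root"
  by (simp add: laplacian_2_sqrt_def laplacian_2_eq E2.op_sqrt_form_op)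

lemma exp_neg_laplacian_2:
  assumes "t > 0" "\<xi> \<in> ell2"
  shows "exp_neg ell2 ell2_ip (laplacian_2 c) t \<xi> = E2.res.T t \<xi>"
  unfolding laplacian_2_eq E2.gen_eq_form_op[symmetric] using assms by (intro E2.res.exp_neg_gen) auto

end

locale infinite_network = conductances c for c :: "'v \<Rightarrow> 'v \<Rightarrow> real" +
  assumes infinite: "infinite (UNIV :: 'v set)"
begin

text \<open>A vector in the kernel has energy zero and hence is constant; on an infinite set only the constant
  \<open>0\<close> is square-summable.\<close>

lemma S_injective:
  assumes v: "v \<in> ell2" "E2.res.S v = 0"
  shows "v = 0"
proof -
  have "E2.res.S 0 = 0" using E2.res.S_linear(3)[of 0 0] by simp
  then have "v - E2.RQ v = 0" using E2.res.S_S[OF v(1)] v(2) by simp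
  then have "(v, 0) \<in> E2.form_op"
    unfolding E2.gen_eq_form_op[symmetric] E2.res.gen_def using v(1) by (metis (no_types, lifting) diff_eq_eq add_0 image_iff)
  then have vD: "v \<in> D2" and "energy c v v = 0" by (auto simp: E2.form_op_def)
  then have const: "v x = v y" for x y using energy_zero by simp
  have "v x = 0" for x
  proof (rule ccontr)
    assume nz: "v x \<noteq> 0"
    obtain n :: nat where n: "ell2_ip v v / (v x)\<^sup>2 < real n" using reals_Archimedean2 by blast
    obtain F :: "'v set" where F: "finite F" "card F = n" using infinite_arbitrarily_large[OF infinite] by blast
    have "real n * (v x)\<^sup>2 = (\<Sum>y\<in>F. (v x)\<^sup>2)" using F by simp
    also have "\<dots> = (\<Sum>y\<in>F. (v y)\<^sup>2)" by (intro sum.cong arg_cong[where f = "\<lambda>r. r\<^sup>2"] const refl)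
    also have "\<dots> \<le> ell2_ip v v" using ell2_finite_sum_le[OF v(1) F(1)] .
    finally show False using n nz by (simp add: field_simps)
  qed
  then show ?thesis by auto
qed

lemma pi_powr: "pi powr (- 1/2) * (sqrt pi * r) = r"
proof -
  have "pi powr (-1/2) = 1 / sqrt pi" by (simp add: powr_minus powr_half_sqrt field_simps)
  then show ?thesis by simp
qed

text \<open>One inclusion is \<open>inverse_root_integral\<close> evaluated at vertices. For the other one, let \<open>\<eta>\<close> be
  the function defined by the integral at \<open>\<xi>\<close>. The integral is known to represent \<open>\<eta>\<close> only at
  vertices, so it may be tested only against finitely supported functions, for instance
  \<open>laplacian c \<phi> = S (S v)\<close> with \<open>v = \<phi> + laplacian c \<phi>\<close>. The factors \<open>S\<close> moved to \<open>\<xi>\<close> turn it into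
  the known integral at \<open>S (S \<xi>)\<close>, whence \<open>S (S \<eta>) = C (S \<xi>)\<close> by density of the vectors \<open>v\<close>, and
  \<open>S \<eta> = C \<xi>\<close> by injectivity of \<open>S\<close>.\<close>

lemma laplacian_2_inv_sqrt_Domain: "Domain (laplacian_2_inv_sqrt c) = Range E2.res.root"
proof (intro subset_antisym subsetI)
  fix \<xi> assume "\<xi> \<in> Range E2.res.root"
  then obtain v where v: "v \<in> ell2" "\<xi> = E2.res.S v" by (auto simp: E2.res.root_def)
  have int: "has_bochner_integral lborel (\<lambda>t. indicator {0<..} t *\<^sub>R (t powr (-1/2) * exp_neg ell2 ell2_ip (laplacian_2 c) t \<xi> x))
      (sqrt pi * E2.res.C v x)" for x
  proof -
    have hb: "has_bochner_integral lborel (\<lambda>t. indicator {0<..} t *\<^sub>R (t powr (-1/2) * ell2_ip (E2.res.T t (E2.res.S v)) (delta x)))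
      (sqrt pi * ell2_ip (E2.res.C v) (delta x))"
      by (rule E2.res.inverse_root_integral[OF v(1) delta_ell2 S_injective])
    have eq: "indicator {0<..} t *\<^sub>R (t powr (-1/2) * ell2_ip (E2.res.T t (E2.res.S v)) (delta x)) =
        indicator {0<..} t *\<^sub>R (t powr (-1/2) * exp_neg ell2 ell2_ip (laplacian_2 c) t \<xi> x)" for t
      using v by (cases "t > 0") (auto simp: exp_neg_laplacian_2 ell2_ip_delta)
    show ?thesis using hb[unfolded eq] unfolding ell2_ip_delta(2) .
  qed
  have "(\<xi>, E2.res.C v) \<in> laplacian_2_inv_sqrt c"
    unfolding laplacian_2_inv_sqrt_def
  proof (intro CollectI case_prodI2 conjI allI)
    fix a b assume ab: "(\<xi>, E2.res.C v) = (a, b)"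
    show "(a, b) \<in> ell2 \<times> ell2" using ab v by auto
    fix x
    show "set_integrable lborel {0<..} (\<lambda>t. t powr (- 1/2) * exp_neg ell2 ell2_ip (laplacian_2 c) t a x)"
      using int[of x] ab by (auto simp: set_integrable_def has_bochner_integral_iff)
    show "b x = pi powr (- 1/2) * (LINT t:{0<..}|lborel. t powr (- 1/2) * exp_neg ell2 ell2_ip (laplacian_2 c) t a x)"
      using int[of x] ab pi_powr by (auto simp: set_lebesgue_integral_def has_bochner_integral_iff)
  qed
  then show "\<xi> \<in> Domain (laplacian_2_inv_sqrt c)" by blast
next
  let ?T = "\<lambda>t \<xi> x. t powr (- 1/2) * exp_neg ell2 ell2_ip (laplacian_2 c) t \<xi> x"
  fix \<xi> assume "\<xi> \<in> Domain (laplacian_2_inv_sqrt c)"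
  then obtain \<eta> where \<xi>: "\<xi> \<in> ell2" and \<eta>: "\<eta> \<in> ell2"
    and int: "\<And>x. set_integrable lborel {0<..} (\<lambda>t. ?T t \<xi> x)"
    and val: "\<And>x. \<eta> x = pi powr (- 1/2) * (LINT t:{0<..}|lborel. ?T t \<xi> x)"
    unfolding laplacian_2_inv_sqrt_def by auto
  let ?C = E2.res.C and ?S = E2.res.S
  \<comment> \<open>The formula for \<open>\<eta>\<close> tested against finitely supported functions.\<close>
  have weak: "has_bochner_integral lborel (\<lambda>t. indicator {0<..} t *\<^sub>R (t powr (- 1/2) * ell2_ip (E2.res.T t \<xi>) \<psi>))
      (sqrt pi * ell2_ip \<eta> \<psi>)" if "\<psi> \<in> Phi_dom" for \<psi>
    using that
  proof (induction rule: Phi_dom_induct)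
    case zero
    have "ell2_ip (E2.res.T t \<xi>) 0 = 0" for t by (simp add: ell2_ip_def)
    moreover have "ell2_ip \<eta> 0 = 0" by (simp add: ell2_ip_def)
    ultimately show ?case using has_bochner_integral_zero by (simp del: zero_fun_apply)
  next
    case (step r x \<psi>)
    define d where d: "d = delta x"
    have \<psi>: "\<psi> \<in> ell2" using step Phi_dom_ell2 by blast
    have hb: "has_bochner_integral lborel (\<lambda>t. indicator {0<..} t *\<^sub>R ?T t \<xi> x) (sqrt pi * \<eta> x)"
    proof -
      have "sqrt pi * \<eta> x = (LINT t:{0<..}|lborel. ?T t \<xi> x)"
        unfolding val using pi_powr[of "LINT t:{0<..}|lborel. ?T t \<xi> x"] by (simp add: mult.left_commute)
      then show ?thesis using int[of x]
        by (simp add: has_bochner_integral_iff set_integrable_def set_lebesgue_integral_def)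
    qed
    have eq1: "indicator {0<..} t *\<^sub>R ?T t \<xi> x =
        indicator {0<..} t *\<^sub>R (t powr (- 1/2) * ell2_ip (E2.res.T t \<xi>) d)" for t
      using \<xi> by (cases "t > 0") (auto simp: exp_neg_laplacian_2 ell2_ip_delta d)
    have eq2: "\<eta> x = ell2_ip \<eta> d" by (simp add: d ell2_ip_delta)
    have "has_bochner_integral lborel (\<lambda>t. indicator {0<..} t *\<^sub>R (t powr (- 1/2) * ell2_ip (E2.res.T t \<xi>) d))
        (sqrt pi * ell2_ip \<eta> d)" using hb[unfolded eq1] unfolding eq2 .
    from has_bochner_integral_add[OF has_bochner_integral_mult_right[of r, OF this] step(2)]
    have sum: "has_bochner_integral lborel (\<lambda>t. r * (indicator {0<..} t *\<^sub>R (t powr (- 1/2) * ell2_ip (E2.res.T t \<xi>) d)) +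
        indicator {0<..} t *\<^sub>R (t powr (- 1/2) * ell2_ip (E2.res.T t \<xi>) \<psi>)) (r * (sqrt pi * ell2_ip \<eta> d) + sqrt pi * ell2_ip \<eta> \<psi>)"
      by blast
    have dH: "d \<in> ell2" by (simp add: d)
    have eq3: "r * (indicator {0<..} t *\<^sub>R (t powr (- 1/2) * ell2_ip (E2.res.T t \<xi>) d)) +
        indicator {0<..} t *\<^sub>R (t powr (- 1/2) * ell2_ip (E2.res.T t \<xi>) \<psi>) =
        indicator {0<..} t *\<^sub>R (t powr (- 1/2) * ell2_ip (E2.res.T t \<xi>) (r *\<^sub>R d + \<psi>))" for t
    proof (cases "t > 0")
      case True
      then have "E2.res.T t \<xi> \<in> ell2" using \<xi> by simp
      then have "ell2_ip (E2.res.T t \<xi>) (r *\<^sub>R d + \<psi>) = r * ell2_ip (E2.res.T t \<xi>) d + ell2_ip (E2.res.T t \<xi>) \<psi>"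
        using dH \<psi> ell2.ip_add2[OF ell2.H_scale[OF dH] \<psi>] ell2.ip_scale2[OF dH] by metis
      then show ?thesis by (simp only:) (simp add: algebra_simps)
    qed simp
    have eq4: "r * (sqrt pi * ell2_ip \<eta> d) + sqrt pi * ell2_ip \<eta> \<psi> = sqrt pi * ell2_ip \<eta> (r *\<^sub>R d + \<psi>)"
    proof -
      have "ell2_ip \<eta> (r *\<^sub>R d + \<psi>) = r * ell2_ip \<eta> d + ell2_ip \<eta> \<psi>"
        using dH \<psi> \<eta> ell2.ip_add2[OF ell2.H_scale[OF dH] \<psi>] ell2.ip_scale2[OF dH] by metis
      then show ?thesis by (simp only:) (simp add: algebra_simps)
    qed
    show ?case using sum[unfolded eq3 eq4] unfolding d .
  qed
  have key: "ell2_ip (?S (?S \<eta>)) v = ell2_ip (?C (?S \<xi>)) v" if \<phi>: "\<phi> \<in> Phi_dom" and v_def: "v = \<phi> + laplacian c \<phi>" for \<phi> v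
  proof -
    have vH: "v \<in> ell2" unfolding v_def by (intro ell2.H_add Phi_dom_ell2 laplacian_Phi_dom \<phi>)
    have "E2.RQ v = \<phi>"
      using Phi_dom_form_op[OF \<phi>] unfolding E2.gen_eq_form_op[symmetric] E2.res.gen_iff v_def by auto
    then have SS: "?S (?S v) = laplacian c \<phi>" using E2.res.S_S[OF vH] v_def by simp
    have hb1: "has_bochner_integral lborel (\<lambda>t. indicator {0<..} t *\<^sub>R (t powr (- 1/2) * ell2_ip (E2.res.T t \<xi>) (?S (?S v))))
        (sqrt pi * ell2_ip \<eta> (?S (?S v)))"
      unfolding SS by (rule weak[OF laplacian_Phi_dom[OF \<phi>]])
    have hb2: "has_bochner_integral lborel (\<lambda>t. indicator {0<..} t *\<^sub>R (t powr (-1/2) * ell2_ip (E2.res.T t (?S (?S \<xi>))) v))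
        (sqrt pi * ell2_ip (?C (?S \<xi>)) v)"
      by (rule E2.res.inverse_root_integral[OF _ vH S_injective]) (use \<xi> in simp_all)
    have eq: "indicator {0<..} t *\<^sub>R (t powr (-1/2) * ell2_ip (E2.res.T t (?S (?S \<xi>))) v) =
        indicator {0<..} t *\<^sub>R (t powr (- 1/2) * ell2_ip (E2.res.T t \<xi>) (?S (?S v)))" for t
    proof (cases "t > 0")
      case True
      have "ell2_ip (E2.res.T t (?S (?S \<xi>))) v = ell2_ip \<xi> (?S (?S (E2.res.T t v)))"
        using \<xi> vH True by (simp add: E2.res.T_sym E2.res.S_sym)
      also have "?S (?S (E2.res.T t v)) = E2.res.T t (?S (?S v))"
      proof -
        have "?S (E2.res.T t z) = E2.res.T t (?S z)" if "z \<in> ell2" for z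
          unfolding E2.res.T_pos[OF True] E2.res.S_def
          using that E2.res.cont_sqrt continuous_expb[OF True] by (intro E2.res.fc_commute)
        then show ?thesis using vH by simp
      qed
      also have "ell2_ip \<xi> \<dots> = ell2_ip (E2.res.T t \<xi>) (?S (?S v))"
        using \<xi> vH True by (simp add: E2.res.T_sym)
      finally show ?thesis by simp
    qed simp
    have "sqrt pi * ell2_ip \<eta> (?S (?S v)) = sqrt pi * ell2_ip (?C (?S \<xi>)) v"
      using has_bochner_integral_eq[OF hb1 hb2[unfolded eq]] .
    then have "ell2_ip \<eta> (?S (?S v)) = ell2_ip (?C (?S \<xi>)) v" by simp
    then show ?thesis using \<eta> vH by (simp add: E2.res.S_sym)
  qed
  have "?S (?S \<eta>) - ?C (?S \<xi>) = 0"
  proof -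
    let ?z = "?S (?S \<eta>) - ?C (?S \<xi>)"
    have zH: "?z \<in> ell2" using \<eta> \<xi> by simp
    obtain s where s: "\<And>n::nat. s n \<in> Phi_dom" "ell2.tends (\<lambda>n. s n + laplacian c (s n)) ?z sequentially"
      using resolvent_range_dense[OF zH] by blast
    have sH: "s n + laplacian c (s n) \<in> ell2" for n
      by (intro ell2.H_add Phi_dom_ell2 laplacian_Phi_dom s(1))
    have "(\<lambda>n. ell2_ip (s n + laplacian c (s n)) ?z) \<longlonglongrightarrow> ell2_ip ?z ?z"
      by (rule ell2.tends_ip_const[OF s(2)]) (use sH zH in auto)
    moreover have "ell2_ip (s n + laplacian c (s n)) ?z = 0" for n
    proof -
      have "ell2_ip ?z (s n + laplacian c (s n)) = 0"
        using key[OF s(1) refl, of n] sH[of n] \<eta> \<xi> by (simp add: ell2.ip_diff)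
      then show ?thesis using ell2.ip_commute[OF sH zH] by simp
    qed
    ultimately have "ell2_ip ?z ?z = 0" by (simp add: LIMSEQ_const_iff)
    then show ?thesis using ell2.ip_definite[OF zH] by blast
  qed
  then have "?S (?S \<eta> - ?C \<xi>) = 0" using \<eta> \<xi> by (simp add: E2.res.S_linear E2.res.S_C)
  from S_injective[OF _ this] have "?S \<eta> - ?C \<xi> = 0" using \<eta> \<xi> by simp
  then have "(\<eta>, \<xi>) \<in> E2.res.root" using \<eta> \<xi> by (simp add: E2.res.root_iff)
  then show "\<xi> \<in> Range E2.res.root" by blast
qed

end

section \<open>The energy space\<close>

subsection \<open>Functions modulo constants\<close>

lemma fclass_surj: obtains u where "w = fclass u"
proof -
  have "\<exists>u. w = fclass u"
    by transfer (rule exI, rule equivp_reflp[OF equivp_eq_mod_const])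
  then show thesis using that by blast
qed

lemma fclass_eq_iff: "fclass u = fclass v \<longleftrightarrow> (\<exists>k. \<forall>x. u x = v x + k)"
  by transfer (simp add: eq_mod_const_def)

lemma fclass_linear:
  "fclass (u + v) = fclass u + fclass v" "fclass (r *\<^sub>R u) = r *\<^sub>R fclass u"
  "fclass (u - v) = fclass u - fclass v" "fclass (- u) = - fclass u" "fclass 0 = 0"
  by (transfer, rule equivp_reflp[OF equivp_eq_mod_const])+

lemma energy_ip_fclass: "energy_ip c (fclass u) (fclass v) = energy c u v"
  by transfer (rule refl)

lemma laplacian_class_fclass: "laplacian_class c (fclass u) = laplacian c u"
  by transfer (rule refl)

lift_definition class_diff :: "'v fun_mod_const \<Rightarrow> 'v \<Rightarrow> 'v \<Rightarrow> real" is "\<lambda>u x y. u x - u y"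
  unfolding eq_mod_const_def by auto

lemma class_diff_fclass: "class_diff (fclass u) x y = u x - u y"
  by transfer (rule refl)

lemma class_diff_linear:
  "class_diff (u + v) x y = class_diff u x y + class_diff v x y"
  "class_diff (r *\<^sub>R u) x y = r * class_diff u x y"
  by (transfer, simp add: algebra_simps)+

context conductances
begin

lemma energy_space_iff: "fclass u \<in> energy_space c \<longleftrightarrow> u \<in> energy_dom c"
proof
  assume "fclass u \<in> energy_space c"
  then obtain v where v: "v \<in> energy_dom c" "fclass u = fclass v" by (auto simp: energy_space_def)
  then obtain k where "\<And>x. u x = v x + k" by (auto simp: fclass_eq_iff)
  then have "grad c u = grad c v" by (auto simp: grad_def fun_eq_iff)
  with v show "u \<in> energy_dom c" by (simp add: energy_dom_iff)
qed (auto simp: energy_space_def)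

lemma energy_space_cases:
  assumes "w \<in> energy_space c"
  obtains u where "w = fclass u" "u \<in> energy_dom c" "u x = 0"
proof -
  obtain v where v: "w = fclass v" by (rule fclass_surj)
  define u where "u y = v y - v x" for y
  have "w = fclass u" unfolding v fclass_eq_iff by (intro exI[of _ "v x"]) (simp add: u_def)
  moreover have "u \<in> energy_dom c" using assms \<open>w = fclass u\<close> energy_space_iff by simp
  ultimately show thesis using that by (simp add: u_def)
qed

lemma class_diff_bound: "\<exists>K\<ge>0. \<forall>w\<in>energy_space c. \<bar>class_diff w x y\<bar> \<le> K * sqrt (energy_ip c w w)"
proof -
  obtain K where K: "K \<ge> 0" "\<And>u. u \<in> energy_dom c \<Longrightarrow> \<bar>u x - u y\<bar> \<le> K * sqrt (energy c u u)"
    using energy_difference[of x y] by blast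
  have "\<bar>class_diff w x y\<bar> \<le> K * sqrt (energy_ip c w w)" if w: "w \<in> energy_space c" for w
    using energy_space_cases[OF w] by (metis K(2) class_diff_fclass energy_ip_fclass)
  with K show ?thesis by blast
qed

lemma energy_space_complete:
  assumes s: "\<And>n. s n \<in> energy_space c"
    and cauchy: "\<And>e. 0 < e \<Longrightarrow> \<exists>N. \<forall>m\<ge>N. \<forall>n\<ge>N. energy_ip c (s m - s n) (s m - s n) < e"
  shows "\<exists>l\<in>energy_space c. (\<lambda>n::nat. energy_ip c (s n - l) (s n - l)) \<longlonglongrightarrow> 0"
proof -
  fix o' :: 'v
  have "\<exists>u. s n = fclass u \<and> u \<in> energy_dom c \<and> u o' = 0" for n
    using energy_space_cases[OF s[of n], of o'] by metis
  then obtain u where u: "\<And>n. s n = fclass (u n)" "\<And>n. u n \<in> energy_dom c" "\<And>n. u n o' = 0" by metis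
  have ed: "energy_ip c (s m - s n) (s m - s n) = energy c (u m - u n) (u m - u n)" for m n
    by (simp add: u(1) energy_ip_fclass flip: fclass_linear)
  have ud: "u m - u n \<in> energy_dom c" for m n
    using u(2) subspace_diff[OF subspace_energy_dom] by blast
  have gr: "grad c (u n) \<in> ell2" for n using u(2) by (simp add: energy_dom_iff)
  have "Cauchy (\<lambda>n. u n x)" for x
    unfolding Cauchy_def
  proof (intro allI impI)
    fix e :: real assume e: "e > 0"
    obtain K where K: "K \<ge> 0" "\<And>u. u \<in> energy_dom c \<Longrightarrow> \<bar>u x - u o'\<bar> \<le> K * sqrt (energy c u u)"
      using energy_difference[of x o'] by blast
    define d where "d = (e / (K + 1))\<^sup>2"
    have d: "d > 0" "sqrt d = e / (K + 1)" using e K by (auto simp: d_def)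
    obtain N where N: "\<And>m n. m \<ge> N \<Longrightarrow> n \<ge> N \<Longrightarrow> energy c (u m - u n) (u m - u n) < d"
      using cauchy[OF d(1)] unfolding ed by blast
    have "dist (u m x) (u n x) < e" if "m \<ge> N" "n \<ge> N" for m n
    proof -
      have "dist (u m x) (u n x) = \<bar>(u m - u n) x - (u m - u n) o'\<bar>" by (simp add: dist_real_def u(3))
      also have "\<dots> \<le> K * sqrt (energy c (u m - u n) (u m - u n))" by (rule K(2)[OF ud])
      also have "\<dots> \<le> K * sqrt d" using N[OF that] K by (intro mult_left_mono) auto
      also have "\<dots> < e" using K e by (simp add: d(2) field_simps)
      finally show ?thesis .
    qed
    then show "\<exists>M. \<forall>m\<ge>M. \<forall>n\<ge>M. dist (u m x) (u n x) < e" by blast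
  qed
  then obtain l where l: "\<And>x. (\<lambda>n. u n x) \<longlonglongrightarrow> l x"
    unfolding Cauchy_convergent_iff convergent_def by metis
  obtain g where g: "g \<in> ell2" "ell2.tends (\<lambda>n. grad c (u n)) g sequentially"
  proof (rule ell2.cauchy_tends[of "\<lambda>n. grad c (u n)"])
    fix e :: real assume "e > 0"
    then obtain N where N: "\<And>m n. m \<ge> N \<Longrightarrow> n \<ge> N \<Longrightarrow> energy c (u m - u n) (u m - u n) < e / 2"
      using cauchy[of "e / 2"] unfolding ed by auto
    have "ell2_ip (grad c (u m) - grad c (u n)) (grad c (u m) - grad c (u n)) < e" if "m \<ge> N" "n \<ge> N" for m n
      using N[OF that] unfolding energy_grad grad_linear by simp
    then show "\<exists>N. \<forall>m\<ge>N. \<forall>n\<ge>N. ell2_ip (grad c (u m) - grad c (u n)) (grad c (u m) - grad c (u n)) < e" by blast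
  qed (use gr in auto)
  have gl: "grad c l = g" by (rule grad_closed[OF u(2) g l])
  have "l \<in> energy_dom c" using g gl by (simp add: energy_dom_iff)
  then have "fclass l \<in> energy_space c" by (simp add: energy_space_iff)
  moreover have "(\<lambda>n. energy_ip c (s n - fclass l) (s n - fclass l)) \<longlonglongrightarrow> 0 / 2"
    unfolding u(1) fclass_linear[symmetric] energy_ip_fclass energy_grad grad_linear gl
    using g gr by (intro tendsto_intros) (auto simp flip: ell2.tends_sq)
  ultimately show ?thesis by auto
qed

sublocale HE: hilbert_top "energy_space c" "energy_ip c"
proof
  show "subspace (energy_space c)"
  proof (rule subspaceI)
    show "0 \<in> energy_space c"
      using energy_space_iff[of 0] subspace_0[OF subspace_energy_dom] unfolding fclass_linear by blast
    fix w z assume wz: "w \<in> energy_space c"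
    then obtain u where u: "w = fclass u" "u \<in> energy_dom c" by (rule energy_space_cases)
    show "r *\<^sub>R w \<in> energy_space c" for r
      using subspace_scale[OF subspace_energy_dom u(2), of r] energy_space_iff[of "r *\<^sub>R u"]
      unfolding u(1) fclass_linear by blast
    assume "z \<in> energy_space c"
    then obtain v where v: "z = fclass v" "v \<in> energy_dom c" by (rule energy_space_cases)
    show "w + z \<in> energy_space c"
      using subspace_add[OF subspace_energy_dom u(2) v(2)] energy_space_iff[of "u + v"]
      unfolding u(1) v(1) fclass_linear by blast
  qed
  fix w z y :: "'v fun_mod_const"
  obtain u where u: "w = fclass u" by (rule fclass_surj)
  obtain v where v: "z = fclass v" by (rule fclass_surj)
  obtain t where t: "y = fclass t" by (rule fclass_surj)
  show "0 \<le> energy_ip c w w" unfolding u energy_ip_fclass by (rule energy_nonneg)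
  then show "0 \<le> energy_ip c w w" .
  show "energy_ip c (- w) (- w) = energy_ip c w w"
    unfolding u fclass_linear[symmetric] energy_ip_fclass energy_grad grad_linear
    by (simp add: ell2.ip_square_neg)
  show "energy_ip c w z = energy_ip c z w"
    unfolding u v energy_ip_fclass by (rule energy_commute)
  assume w: "w \<in> energy_space c"
  then have ud: "u \<in> energy_dom c" unfolding u energy_space_iff .
  show "w = 0" if "energy_ip c w w = 0"
  proof -
    have "energy c u u = 0" using that unfolding u energy_ip_fclass .
    then have eq: "u x = u y" for x y by (rule energy_zero[OF ud])
    have "fclass u = fclass 0" unfolding fclass_eq_iff using eq[of _ undefined] by (intro exI[of _ "u undefined"]) simp
    then show ?thesis unfolding u fclass_linear .
  qed
  assume y: "y \<in> energy_space c"
  then have td: "t \<in> energy_dom c" unfolding t energy_space_iff .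
  show "energy_ip c (r *\<^sub>R w) y = r * energy_ip c w y" for r
    unfolding u t fclass_linear[symmetric] energy_ip_fclass by (rule energy_scale[OF ud td])
  assume z: "z \<in> energy_space c"
  then have vd: "v \<in> energy_dom c" unfolding v energy_space_iff .
  show "energy_ip c (w + z) y = energy_ip c w y + energy_ip c z y"
    unfolding u v t fclass_linear[symmetric] energy_ip_fclass by (rule energy_add[OF ud vd td])
qed (rule energy_space_complete)

lemma class_diff_zero:
  assumes "\<And>x. class_diff w x y = 0"
  shows "w = 0"
proof -
  obtain u where u: "w = fclass u" by (rule fclass_surj)
  have "fclass u = fclass 0"
    unfolding fclass_eq_iff using assms by (intro exI[of _ "u y"]) (simp add: u class_diff_fclass)
  then show ?thesis by (simp only: u fclass_linear)
qed

lemma fclass_delta [simp]: "fclass (delta x) \<in> energy_space c"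
  by (simp add: energy_space_iff)

lemma laplacian_class_ip: "laplacian_class c w x = energy_ip c w (fclass (delta x))"
proof -
  obtain u where u: "w = fclass u" by (rule fclass_surj)
  show ?thesis unfolding u energy_ip_fclass laplacian_class_fclass by (rule energy_delta[symmetric])
qed

lemma dipole:
  shows dipole_in [simp]: "dipole c r x \<in> energy_space c"
    and dipole_ip: "w \<in> energy_space c \<Longrightarrow> energy_ip c (dipole c r x) w = class_diff w x r"
proof -
  let ?P = "\<lambda>v. v \<in> energy_space c \<and> (\<forall>u\<in>energy_dom c. energy_ip c v (fclass u) = u x - u r)"
  obtain K where K: "\<And>w. w \<in> energy_space c \<Longrightarrow> \<bar>class_diff w x r\<bar> \<le> K * HE.nrm w"
    using class_diff_bound[of x r] unfolding HE.nrm_def by blast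
  obtain v where v: "v \<in> energy_space c" "\<And>w. w \<in> energy_space c \<Longrightarrow> class_diff w x r = energy_ip c v w"
    by (rule HE.riesz[of "\<lambda>w. class_diff w x r" K]) (use K class_diff_linear in auto)
  have "?P v"
  proof (intro conjI ballI v(1))
    fix u assume "u \<in> energy_dom c"
    then show "energy_ip c v (fclass u) = u x - u r"
      using v(2)[of "fclass u"] by (simp add: energy_space_iff class_diff_fclass)
  qed
  moreover have "v' = v" if v': "?P v'" for v'
  proof (rule HE.ip_eqI)
    fix w assume "w \<in> energy_space c"
    then obtain u where "w = fclass u" "u \<in> energy_dom c" by (rule energy_space_cases)
    then show "energy_ip c v' w = energy_ip c v w" using v' \<open>?P v\<close> by simp
  qed (use v v' in auto)
  ultimately have P: "?P (dipole c r x)" unfolding dipole_def by (rule theI)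
  then show "dipole c r x \<in> energy_space c" by blast
  show "energy_ip c (dipole c r x) w = class_diff w x r" if "w \<in> energy_space c"
  proof -
    obtain u where "w = fclass u" "u \<in> energy_dom c" using \<open>w \<in> _\<close> by (rule energy_space_cases)
    then show ?thesis using P by (simp add: class_diff_fclass)
  qed
qed

end

locale transient_network = infinite_network c for c :: "'v \<Rightarrow> 'v \<Rightarrow> real" +
  fixes ref :: 'v
  assumes transient: "transient c"
begin

text \<open>Dipoles move a monopole from one vertex to another.\<close>

lemma monopole_exists: "\<exists>w. monopole c ref w"
proof -
  obtain x w where w: "w \<in> energy_space c" "laplacian_class c w = delta x"
    using transient by (auto simp: transient_def monopole_def)
  have "laplacian_class c (w - dipole c ref x) y = delta ref y" for y
  proof -
    have "laplacian_class c (w - dipole c ref x) y = delta x y - (delta y x - delta y ref)"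
      using w laplacian_class_ip[of w y] unfolding laplacian_class_ip[of "w - dipole c ref x"]
      by (simp add: HE.ip_diff dipole_ip class_diff_fclass)
    then show ?thesis by (simp add: delta_apply)
  qed
  then have "monopole c ref (w - dipole c ref x)" using w by (auto simp: monopole_def)
  then show ?thesis by blast
qed

text \<open>The minimal monopole is the component of any monopole orthogonal to the harmonic functions.\<close>

lemma min_monopole: "monopole c ref (min_monopole c ref)"
proof -
  obtain w1 where w1: "w1 \<in> energy_space c" "laplacian_class c w1 = delta ref"
    using monopole_exists by (auto simp: monopole_def)
  define D where "D = {h \<in> energy_space c. \<forall>x. energy_ip c h (fclass (delta x)) = 0}"
  have subD: "subspace D"
    unfolding D_def by (rule subspaceI) (auto simp: HE.ip_add HE.ip_scale)
  have DH: "h \<in> energy_space c" if "h \<in> D" for h using that by (simp add: D_def)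
  obtain z s where z: "z \<in> energy_space c" "\<And>h. h \<in> D \<Longrightarrow> energy_ip c w1 h = energy_ip c z h"
    and s: "\<And>n::nat. s n \<in> D" "HE.tends s z sequentially"
  proof (rule HE.dominated_functional[OF subD, where T = "\<lambda>h. h" and \<phi> = "energy_ip c w1" and K = "HE.nrm w1"])
    fix h assume h: "h \<in> D"
    show "\<bar>energy_ip c w1 h\<bar> \<le> HE.nrm w1 * HE.nrm h" using HE.cauchy_schwarz[OF w1(1) DH[OF h]] .
    show "energy_ip c w1 (r *\<^sub>R h) = r * energy_ip c w1 h" for r using HE.ip_scale2[OF DH[OF h] w1(1)] .
    fix h' assume h': "h' \<in> D"
    show "energy_ip c w1 (h + h') = energy_ip c w1 h + energy_ip c w1 h'"
      using HE.ip_add2[OF DH[OF h] DH[OF h'] w1(1)] .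
  qed (use DH in auto)
  have "z \<in> D"
  proof -
    have "energy_ip c z (fclass (delta x)) = 0" for x
    proof -
      have "(\<lambda>n. energy_ip c (s n) (fclass (delta x))) \<longlonglongrightarrow> energy_ip c z (fclass (delta x))"
        by (rule HE.tends_ip_const[OF s(2)]) (use s DH z in auto)
      moreover have "energy_ip c (s n) (fclass (delta x)) = 0" for n using s(1)[of n] by (simp add: D_def)
      ultimately show ?thesis by (simp add: LIMSEQ_const_iff)
    qed
    then show ?thesis using z by (simp add: D_def)
  qed
  define w where "w = w1 - z"
  have wH: "w \<in> energy_space c" using w1 z by (simp add: w_def)
  have mono_iff: "monopole c ref w' \<longleftrightarrow> w' \<in> energy_space c \<and> w' - w \<in> D" for w'
  proof -
    have "laplacian_class c w' = delta ref \<longleftrightarrow> (\<forall>x. energy_ip c (w' - w) (fclass (delta x)) = 0)"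
      if w': "w' \<in> energy_space c"
    proof -
      have "energy_ip c (w' - w) (fclass (delta x)) = laplacian_class c w' x - delta ref x" for x
        using w' wH w1 z \<open>z \<in> D\<close> laplacian_class_ip[of w1 x]
        by (simp add: laplacian_class_ip HE.ip_diff w_def D_def)
      then show ?thesis by (auto simp: fun_eq_iff)
    qed
    then show ?thesis using wH by (auto simp: monopole_def D_def)
  qed
  have orth: "energy_ip c w h = 0" if "h \<in> D" for h
    using z(2)[OF that] DH[OF that] w1 z by (simp add: w_def HE.ip_diff)
  have pyth: "energy_ip c w' w' = energy_ip c w w + energy_ip c (w' - w) (w' - w)" if "monopole c ref w'" for w'
  proof -
    have d: "w' - w \<in> D" "w' \<in> energy_space c" using that mono_iff by auto
    have "energy_ip c (w + (w' - w)) (w + (w' - w)) = energy_ip c w w + energy_ip c (w' - w) (w' - w)"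
      using HE.ip_square_add[OF wH DH[OF d(1)]] orth[OF d(1)] by simp
    then show ?thesis by simp
  qed
  have "0 \<in> D" using subspace_0[OF subD] .
  have mw: "monopole c ref w" unfolding mono_iff using wH \<open>0 \<in> D\<close> by simp
  have "min_monopole c ref = w"
    unfolding min_monopole_def
  proof (rule the_equality)
    show "monopole c ref w \<and> (\<forall>w'. monopole c ref w' \<longrightarrow> energy_ip c w w \<le> energy_ip c w' w')"
    proof (intro conjI allI impI mw)
      fix w' assume "monopole c ref w'"
      then show "energy_ip c w w \<le> energy_ip c w' w'"
        using pyth[of w'] HE.ip_square_nonneg[of "w' - w"] by linarith
    qed
    fix w' assume w': "monopole c ref w' \<and> (\<forall>w''. monopole c ref w'' \<longrightarrow> energy_ip c w' w' \<le> energy_ip c w'' w'')"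
    then have "energy_ip c (w' - w) (w' - w) \<le> 0" using pyth[of w'] mw by (smt (verit))
    then have "energy_ip c (w' - w) (w' - w) = 0" using HE.ip_square_nonneg[of "w' - w"] by linarith
    moreover have "w' - w \<in> energy_space c" using w' mono_iff DH by blast
    ultimately have "w' - w = 0" using HE.ip_definite by blast
    then show "w' = w" by simp
  qed
  with mw show ?thesis by simp
qed

abbreviation "w0 \<equiv> min_monopole c ref"
abbreviation "W \<equiv> wv c ref"

lemma w0_in [simp]: "w0 \<in> energy_space c"
  using min_monopole by (simp add: monopole_def)

lemma W_in [simp]: "W x \<in> energy_space c"
  by (simp add: wv_def)

lemma W_ip: "w \<in> energy_space c \<Longrightarrow> energy_ip c (W x) w = energy_ip c w0 w + class_diff w x ref"
  by (simp add: wv_def HE.ip_add dipole_ip)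

lemma W_delta: "energy_ip c (W x) (fclass (delta y)) = delta x y"
proof -
  have "energy_ip c w0 (fclass (delta y)) = delta ref y"
    using min_monopole laplacian_class_ip[of w0 y] by (simp add: monopole_def)
  then show ?thesis by (simp add: W_ip class_diff_fclass delta_apply)
qed

lemma fclass_D2 [simp]: "\<eta> \<in> D2 \<Longrightarrow> fclass \<eta> \<in> energy_space c"
  by (simp add: energy_space_iff)

text \<open>Finitely supported functions are dense in \<open>D2\<close> for the norm of the form, again by the maximum principle.\<close>

lemma Phi_dom_dense_D2:
  assumes "u \<in> D2"
  obtains s where "\<And>n::nat. s n \<in> Phi_dom" "E2.form.tends s u sequentially"
proof (rule E2.form.dense_of_trivial_complement[OF subspace_Phi_dom _ _ assms])
  show "Phi_dom \<subseteq> D2" using Phi_dom_D2 by blast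
  fix z assume z: "z \<in> D2" "\<And>d. d \<in> Phi_dom \<Longrightarrow> energy c z d + ell2_ip z d = 0"
  show "z = 0"
  proof (rule maximum_principle)
    fix x show "z x + laplacian c z x = 0"
      using z(2)[OF delta_Phi_dom, of x] by (simp add: energy_delta ell2_ip_delta)
  qed (use z in simp)
qed (use that in blast)

text \<open>The reproducing property: paired with a square-summable function of finite energy, the
  element \<open>W x\<close> returns its value at \<open>x\<close>. Both sides are continuous on \<open>D2\<close> and agree on
  finitely supported functions.\<close>

lemma W_reproducing:
  assumes u: "u \<in> D2"
  shows "energy_ip c (W x) (fclass u) = u x"
proof -
  obtain s where s: "\<And>n::nat. s n \<in> Phi_dom" "E2.form.tends s u sequentially"
    using Phi_dom_dense_D2[OF u] by blast
  have sD: "s n \<in> D2" for n using s(1) Phi_dom_D2 by blast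
  have suD: "s n - u \<in> D2" for n using sD u by (rule E2.form.H_diff)
  have on_Phi: "energy_ip c (W x) (fclass \<xi>) = \<xi> x" if "\<xi> \<in> Phi_dom" for \<xi>
    using that
  proof (induction rule: Phi_dom_induct)
    case zero
    show ?case unfolding fclass_linear by simp
  next
    case (step r y \<xi>)
    have "fclass \<xi> \<in> energy_space c" using step Phi_dom_D2 by simp
    then show ?case
      using step unfolding fclass_linear by (simp add: HE.ip_add2 HE.ip_scale2 W_delta) (simp add: delta_apply)
  qed
  have "HE.tends (\<lambda>n. fclass (s n)) (fclass u) sequentially"
  proof (rule HE.tends_squeeze)
    show "\<forall>\<^sub>F n in sequentially. HE.nrm (fclass (s n) - fclass u) \<le> E2.form.nrm (s n - u)"
      unfolding fclass_linear[symmetric] HE.nrm_def E2.form.nrm_def energy_ip_fclass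
      using ell2.ip_square_nonneg by (intro always_eventually allI real_sqrt_le_mono) simp
    show "(\<lambda>n. E2.form.nrm (s n - u)) \<longlonglongrightarrow> 0" using s(2) by (simp add: E2.form.tends_def)
  qed (use sD u in simp_all)
  then have "(\<lambda>n. energy_ip c (fclass (s n)) (W x)) \<longlonglongrightarrow> energy_ip c (fclass u) (W x)"
    using sD u by (intro HE.tends_ip_const) auto
  moreover have "energy_ip c (fclass (s n)) (W x) = s n x" for n
    using on_Phi[OF s(1)] HE.ip_commute[of "fclass (s n)" "W x"] sD by simp
  moreover have "(\<lambda>n. s n x) \<longlonglongrightarrow> u x"
  proof -
    have "ell2.tends s u sequentially"
    proof (rule ell2.tends_squeeze)
      show "\<forall>\<^sub>F n in sequentially. ell2.nrm (s n - u) \<le> E2.form.nrm (s n - u)"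
        using suD by (intro always_eventually allI E2.nrm_le_form)
      show "(\<lambda>n. E2.form.nrm (s n - u)) \<longlonglongrightarrow> 0" using s(2) by (simp add: E2.form.tends_def)
    qed (use sD u in simp_all)
    then show ?thesis by (rule ell2_tends_pointwise) (use sD u in simp_all)
  qed
  ultimately have "energy_ip c (fclass u) (W x) = u x" by (simp add: LIMSEQ_unique)
  then show ?thesis using HE.ip_commute[of "fclass u" "W x"] u by simp
qed

subsection \<open>The map \<open>Phi\<close> and its closure\<close>

lemma Phi_eq_sum:
  assumes "finite F" "\<And>x. x \<notin> F \<Longrightarrow> \<xi> x = 0"
  shows "Phi c ref \<xi> = (\<Sum>x\<in>F. \<xi> x *\<^sub>R W x)"
  unfolding Phi_def using assms by (intro sum.mono_neutral_left) auto

lemma Phi_in [simp]: "Phi c ref \<xi> \<in> energy_space c"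
  unfolding Phi_def by (intro HE.H_sum HE.H_scale W_in)

lemma Phi_linear:
  assumes "\<xi> \<in> Phi_dom" "\<eta> \<in> Phi_dom"
  shows "Phi c ref (\<xi> + \<eta>) = Phi c ref \<xi> + Phi c ref \<eta>" "Phi c ref (\<xi> - \<eta>) = Phi c ref \<xi> - Phi c ref \<eta>"
    "Phi c ref (r *\<^sub>R \<xi>) = r *\<^sub>R Phi c ref \<xi>"
proof -
  let ?F = "{x. \<xi> x \<noteq> 0} \<union> {x. \<eta> x \<noteq> 0}"
  have F: "finite ?F" using assms by (simp add: Phi_dom_iff)
  note eq = Phi_eq_sum[OF F]
  show "Phi c ref (\<xi> + \<eta>) = Phi c ref \<xi> + Phi c ref \<eta>"
    by (subst (1 2 3) eq) (auto simp: scaleR_add_left sum.distrib)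
  show "Phi c ref (\<xi> - \<eta>) = Phi c ref \<xi> - Phi c ref \<eta>"
    by (subst (1 2 3) eq) (auto simp: scaleR_diff_left sum_subtractf)
  show "Phi c ref (r *\<^sub>R \<xi>) = r *\<^sub>R Phi c ref \<xi>"
    by (subst (1 2) eq) (auto simp: scaleR_sum_right)
qed

lemma Phi_delta: "Phi c ref (delta x) = W x"
  by (subst Phi_eq_sum[of "{x}"]) (auto simp: delta_apply)

lemma Phi_ip:
  assumes \<xi>: "\<xi> \<in> Phi_dom" and w: "w \<in> energy_space c"
  shows "energy_ip c (Phi c ref \<xi>) w = (\<Sum>x | \<xi> x \<noteq> 0. \<xi> x * energy_ip c (W x) w)"
  unfolding Phi_def using w by (simp add: HE.ip_sum HE.ip_scale)

lemma span_W: "span (range W) = Phi c ref ` Phi_dom"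
proof (rule subset_antisym)
  show "span (range W) \<subseteq> Phi c ref ` Phi_dom"
  proof (rule span_minimal)
    show "range W \<subseteq> Phi c ref ` Phi_dom" using Phi_delta delta_Phi_dom by (metis image_eqI image_subsetI)
    show "subspace (Phi c ref ` Phi_dom)"
    proof (rule subspaceI)
      have "Phi c ref 0 = 0" by (subst Phi_eq_sum[of "{}"]) auto
      then show "0 \<in> Phi c ref ` Phi_dom" using subspace_0[OF subspace_Phi_dom] by (metis image_eqI)
      show "x + y \<in> Phi c ref ` Phi_dom" if "x \<in> Phi c ref ` Phi_dom" "y \<in> Phi c ref ` Phi_dom" for x y
      proof -
        obtain a b where ab: "a \<in> Phi_dom" "b \<in> Phi_dom" "x = Phi c ref a" "y = Phi c ref b"
          using \<open>x \<in> _\<close> \<open>y \<in> _\<close> by blast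
        have "x + y = Phi c ref (a + b)" unfolding ab(3,4) by (rule Phi_linear(1)[OF ab(1,2), symmetric])
        then show ?thesis using subspace_add[OF subspace_Phi_dom ab(1,2)] by (rule image_eqI)
      qed
      show "r *\<^sub>R x \<in> Phi c ref ` Phi_dom" if "x \<in> Phi c ref ` Phi_dom" for x r
      proof -
        obtain a where a: "a \<in> Phi_dom" "x = Phi c ref a" using \<open>x \<in> _\<close> by blast
        have "r *\<^sub>R x = Phi c ref (r *\<^sub>R a)" unfolding a(2) by (rule Phi_linear(3)[OF a(1) a(1), symmetric])
        then show ?thesis using subspace_scale[OF subspace_Phi_dom a(1)] by (rule image_eqI)
      qed
    qed
  qed
  show "Phi c ref ` Phi_dom \<subseteq> span (range W)"
  proof (rule image_subsetI)
    fix \<xi> show "Phi c ref \<xi> \<in> span (range W)"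
      unfolding Phi_def by (intro span_sum span_scale span_base rangeI)
  qed
qed

lemma laplacian_class_Phi:
  assumes "\<xi> \<in> Phi_dom"
  shows "laplacian_class c (Phi c ref \<xi>) = \<xi>"
proof
  fix y
  have fin: "finite {x. \<xi> x \<noteq> 0}" using assms by (simp add: Phi_dom_iff)
  have "laplacian_class c (Phi c ref \<xi>) y = (\<Sum>x | \<xi> x \<noteq> 0. \<xi> x * delta x y)"
    unfolding laplacian_class_ip by (simp add: Phi_ip[OF assms] W_delta)
  also have "\<dots> = (\<Sum>x | \<xi> x \<noteq> 0. if x = y then \<xi> x else 0)"
    by (intro sum.cong) (auto simp: delta_apply)
  also have "\<dots> = \<xi> y" using fin by simp
  finally show "laplacian_class c (Phi c ref \<xi>) y = \<xi> y" .
qed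

text \<open>The weak form of the equation \<open>laplacian v = \<xi>\<close>: the inverse of the adjoint of
  \<open>\<eta> \<mapsto> fclass \<eta>\<close> on \<open>D2\<close>. It is a relation, since \<open>v\<close> is determined by \<open>\<xi>\<close> only up to classes
  orthogonal to those of \<open>D2\<close>.\<close>

definition G :: "(('v \<Rightarrow> real) \<times> 'v fun_mod_const) set" where
  "G = {(\<xi>, v). \<xi> \<in> ell2 \<and> v \<in> energy_space c \<and> (\<forall>\<eta>\<in>D2. energy_ip c v (fclass \<eta>) = ell2_ip \<xi> \<eta>)}"

lemma G_D: "(\<xi>, v) \<in> G \<Longrightarrow> \<xi> \<in> ell2" "(\<xi>, v) \<in> G \<Longrightarrow> v \<in> energy_space c"
  "(\<xi>, v) \<in> G \<Longrightarrow> \<eta> \<in> D2 \<Longrightarrow> energy_ip c v (fclass \<eta>) = ell2_ip \<xi> \<eta>"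
  by (auto simp: G_def)

lemma G_linear:
  "(\<xi>, v) \<in> G \<Longrightarrow> (\<xi>', v') \<in> G \<Longrightarrow> (\<xi> + \<xi>', v + v') \<in> G"
  "(\<xi>, v) \<in> G \<Longrightarrow> (\<xi>', v') \<in> G \<Longrightarrow> (\<xi> - \<xi>', v - v') \<in> G"
  "(\<xi>, v) \<in> G \<Longrightarrow> (r *\<^sub>R \<xi>, r *\<^sub>R v) \<in> G"
  unfolding G_def by (auto simp del: plus_fun_apply minus_apply scaleR_fun_apply simp: ell2.ip_add HE.ip_add ell2.ip_scale HE.ip_scale ell2.ip_diff HE.ip_diff)

lemma G_zero: "(0, 0) \<in> G"
  unfolding G_def by (auto simp: ell2_ip_def)

lemma Phi_G: 
  assumes "\<xi> \<in> Phi_dom"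
  shows "(\<xi>, Phi c ref \<xi>) \<in> G"
proof -
  have fin: "finite {x. \<xi> x \<noteq> 0}" using assms by (simp add: Phi_dom_iff)
  have "energy_ip c (Phi c ref \<xi>) (fclass \<eta>) = ell2_ip \<xi> \<eta>" if "\<eta> \<in> D2" for \<eta>
    using that ell2_ip_finite[OF fin, of \<xi> \<eta>] by (simp add: Phi_ip[OF assms] W_reproducing)
  then show ?thesis unfolding G_def using Phi_dom_ell2[OF assms] by auto
qed

lemma G_closed:
  assumes G: "\<And>n. (s n, t n) \<in> G" and lim: "ell2.tends s \<xi> sequentially" "HE.tends t v sequentially"
    and in_spaces: "\<xi> \<in> ell2" "v \<in> energy_space c"
  shows "(\<xi>, v) \<in> G"
proof -
  have "energy_ip c v (fclass \<eta>) = ell2_ip \<xi> \<eta>" if \<eta>: "\<eta> \<in> D2" for \<eta>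
  proof (rule LIMSEQ_unique)
    show "(\<lambda>n. energy_ip c (t n) (fclass \<eta>)) \<longlonglongrightarrow> energy_ip c v (fclass \<eta>)"
      using lim G_D[OF G] in_spaces \<eta> by (intro HE.tends_ip_const) auto
    have "(\<lambda>n. ell2_ip (s n) \<eta>) \<longlonglongrightarrow> ell2_ip \<xi> \<eta>"
      using lim G_D[OF G] in_spaces \<eta> by (intro ell2.tends_ip_const) auto
    then show "(\<lambda>n. energy_ip c (t n) (fclass \<eta>)) \<longlonglongrightarrow> ell2_ip \<xi> \<eta>"
      using G_D(3)[OF G \<eta>] by simp
  qed
  then show ?thesis using in_spaces by (auto simp: G_def)
qed

text \<open>By \<open>W_ip\<close> the function \<open>\<xi>\<close> differs by a constant from any representative of \<open>v\<close>.\<close>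

lemma class_of_values:
  assumes v: "v \<in> energy_space c" and \<xi>: "\<xi> \<in> ell2" and eq: "\<And>x. energy_ip c v (W x) = \<xi> x"
  shows "\<xi> \<in> D2" "v = fclass \<xi>"
proof -
  obtain u where u: "v = fclass u" "u \<in> energy_dom c" using v by (rule energy_space_cases)
  have "\<xi> x = u x + (energy_ip c w0 v - u ref)" for x
    using eq[of x] HE.ip_commute[of v "W x"] W_ip[OF v, of x] v by (simp add: u(1) class_diff_fclass)
  then have "fclass \<xi> = fclass u" unfolding fclass_eq_iff by blast
  then show eq: "v = fclass \<xi>" using u by simp
  have "\<xi> \<in> energy_dom c" using v unfolding eq energy_space_iff .
  then show "\<xi> \<in> D2" using \<xi> unfolding D2_def by blast
qed

lemma hilbert_G: "hilbert G (\<lambda>p q. ell2_ip (fst p) (fst q) + energy_ip c (snd p) (snd q))"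
proof
  show "subspace G"
  proof (rule subspaceI)
    show "0 \<in> G" unfolding zero_prod_def by (rule G_zero)
    fix a b assume a: "a \<in> G"
    show "r *\<^sub>R a \<in> G" for r
      using G_linear(3)[of "fst a" "snd a"] a by (simp only: prod.collapse scaleR_prod_def)
    assume b: "b \<in> G"
    show "a + b \<in> G"
      using G_linear(1)[of "fst a" "snd a" "fst b" "snd b"] a b by (simp only: prod.collapse plus_prod_def)
  qed
  fix p q r :: "('v \<Rightarrow> real) \<times> 'v fun_mod_const"
  show nn: "0 \<le> ell2_ip (fst p) (fst p) + energy_ip c (snd p) (snd p)"
    by (rule add_nonneg_nonneg[OF ell2.ip_square_nonneg HE.ip_square_nonneg])
  assume p: "p \<in> G"
  have pH: "fst p \<in> ell2" "snd p \<in> energy_space c" using p G_D by (metis prod.collapse)+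
  show "p = 0" if "ell2_ip (fst p) (fst p) + energy_ip c (snd p) (snd p) = 0"
  proof -
    have "ell2_ip (fst p) (fst p) = 0" "energy_ip c (snd p) (snd p) = 0"
      using that ell2.ip_square_nonneg[of "fst p"] HE.ip_square_nonneg[of "snd p"] by linarith+
    then have "fst p = 0" "snd p = 0" using ell2.ip_definite[OF pH(1)] HE.ip_definite[OF pH(2)] by blast+
    then show ?thesis by (simp add: prod_eq_iff)
  qed
  assume q: "q \<in> G"
  have qH: "fst q \<in> ell2" "snd q \<in> energy_space c" using q G_D by (metis prod.collapse)+
  show "ell2_ip (fst p) (fst q) + energy_ip c (snd p) (snd q) = ell2_ip (fst q) (fst p) + energy_ip c (snd q) (snd p)"
    using ell2.ip_commute[OF pH(1) qH(1)] HE.ip_commute[OF pH(2) qH(2)] by simp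
  show "ell2_ip (fst (t *\<^sub>R p)) (fst q) + energy_ip c (snd (t *\<^sub>R p)) (snd q) =
      t * (ell2_ip (fst p) (fst q) + energy_ip c (snd p) (snd q))" for t
    unfolding fst_scaleR snd_scaleR ell2.ip_scale[OF pH(1) qH(1)] HE.ip_scale[OF pH(2) qH(2)] by (simp add: distrib_left)
  assume r: "r \<in> G"
  have rH: "fst r \<in> ell2" "snd r \<in> energy_space c" using r G_D by (metis prod.collapse)+
  show "ell2_ip (fst (p + q)) (fst r) + energy_ip c (snd (p + q)) (snd r) =
      ell2_ip (fst p) (fst r) + energy_ip c (snd p) (snd r) + (ell2_ip (fst q) (fst r) + energy_ip c (snd q) (snd r))"
    unfolding fst_add snd_add ell2.ip_add[OF pH(1) qH(1) rH(1)] HE.ip_add[OF pH(2) qH(2) rH(2)] by simp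
next
  fix s :: "nat \<Rightarrow> ('v \<Rightarrow> real) \<times> 'v fun_mod_const"
  assume s: "\<And>n. s n \<in> G"
    and cauchy: "\<And>e. 0 < e \<Longrightarrow> \<exists>N. \<forall>m\<ge>N. \<forall>n\<ge>N. ell2_ip (fst (s m - s n)) (fst (s m - s n)) + energy_ip c (snd (s m - s n)) (snd (s m - s n)) < e"
  have sG: "(fst (s n), snd (s n)) \<in> G" for n using s by simp
  have sH: "fst (s n) \<in> ell2" "snd (s n) \<in> energy_space c" for n using G_D(1,2)[OF sG] .
  obtain \<xi> where \<xi>: "\<xi> \<in> ell2" "ell2.tends (\<lambda>n. fst (s n)) \<xi> sequentially"
  proof (rule ell2.cauchy_tends[of "\<lambda>n. fst (s n)"])
    fix e :: real assume "e > 0"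
    then obtain N where N: "\<And>m n. m \<ge> N \<Longrightarrow> n \<ge> N \<Longrightarrow> ell2_ip (fst (s m - s n)) (fst (s m - s n)) + energy_ip c (snd (s m - s n)) (snd (s m - s n)) < e"
      using cauchy by blast
    have "ell2_ip (fst (s m) - fst (s n)) (fst (s m) - fst (s n)) < e" if "m \<ge> N" "n \<ge> N" for m n
      using N[OF that] HE.ip_square_nonneg[of "snd (s m) - snd (s n)"] unfolding fst_diff snd_diff by linarith
    then show "\<exists>N. \<forall>m\<ge>N. \<forall>n\<ge>N. ell2_ip (fst (s m) - fst (s n)) (fst (s m) - fst (s n)) < e" by blast
  qed (use sH in auto)
  obtain v where v: "v \<in> energy_space c" "HE.tends (\<lambda>n. snd (s n)) v sequentially"
  proof (rule HE.cauchy_tends[of "\<lambda>n. snd (s n)"])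
    fix e :: real assume "e > 0"
    then obtain N where N: "\<And>m n. m \<ge> N \<Longrightarrow> n \<ge> N \<Longrightarrow> ell2_ip (fst (s m - s n)) (fst (s m - s n)) + energy_ip c (snd (s m - s n)) (snd (s m - s n)) < e"
      using cauchy by blast
    have "energy_ip c (snd (s m) - snd (s n)) (snd (s m) - snd (s n)) < e" if "m \<ge> N" "n \<ge> N" for m n
      using N[OF that] ell2.ip_square_nonneg[of "fst (s m) - fst (s n)"] unfolding fst_diff snd_diff by linarith
    then show "\<exists>N. \<forall>m\<ge>N. \<forall>n\<ge>N. energy_ip c (snd (s m) - snd (s n)) (snd (s m) - snd (s n)) < e" by blast
  qed (use sH in auto)
  have "(\<xi>, v) \<in> G" by (rule G_closed[OF sG \<xi>(2) v(2) \<xi>(1) v(1)])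
  moreover have "(\<lambda>n. ell2_ip (fst (s n - (\<xi>, v))) (fst (s n - (\<xi>, v))) + energy_ip c (snd (s n - (\<xi>, v))) (snd (s n - (\<xi>, v)))) \<longlonglongrightarrow> 0 + 0"
  proof (rule tendsto_add)
    show "(\<lambda>n. ell2_ip (fst (s n - (\<xi>, v))) (fst (s n - (\<xi>, v)))) \<longlonglongrightarrow> 0"
      unfolding fst_diff fst_conv using \<xi> sH by (subst ell2.tends_sq[symmetric]) auto
    show "(\<lambda>n. energy_ip c (snd (s n - (\<xi>, v))) (snd (s n - (\<xi>, v)))) \<longlonglongrightarrow> 0"
      unfolding snd_diff snd_conv using v sH by (subst HE.tends_sq[symmetric]) auto
  qed
  ultimately show "\<exists>l\<in>G. (\<lambda>n. ell2_ip (fst (s n - l)) (fst (s n - l)) + energy_ip c (snd (s n - l)) (snd (s n - l))) \<longlonglongrightarrow> 0"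
    by (intro bexI[of _ "(\<xi>, v)"]) simp_all
qed

sublocale GH: hilbert G "\<lambda>p q. ell2_ip (fst p) (fst q) + energy_ip c (snd p) (snd q)"
  by (rule hilbert_G)

end

section \<open>The closure of \<open>Phi\<close> and the Friedrichs extension\<close>

context closed_form
begin

lemma form_tends_imp_tends:
  assumes "form.tends s u F" "\<And>i. s i \<in> Q" "u \<in> Q"
  shows "tends s u F"
proof (rule tends_squeeze)
  show "\<forall>\<^sub>F i in F. nrm (s i - u) \<le> form.nrm (s i - u)"
    using assms by (intro always_eventually allI nrm_le_form form.H_diff)
  show "((\<lambda>i. form.nrm (s i - u)) \<longlongrightarrow> 0) F" using assms(1) by (simp add: form.tends_def)
qed (use assms in simp_all)

text \<open>By completeness, the convergence that defines the closure of a form is convergence for the form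
  norm. Any subspace that is dense for this norm is therefore a core.\<close>

lemma form_conv_core:
  assumes D: "D \<subseteq> Q" "\<And>u v. u \<in> D \<Longrightarrow> v \<in> D \<Longrightarrow> u - v \<in> D"
    and f: "\<And>u. u \<in> D \<Longrightarrow> f u = q u u + ip u u"
  shows "form_conv H ip D f s u \<longleftrightarrow> (\<forall>n. s n \<in> D) \<and> u \<in> Q \<and> form.tends s u sequentially"
proof
  assume conv: "form_conv H ip D f s u"
  then have s: "s n \<in> D" for n by (simp add: form_conv_def)
  then have sQ: "s n \<in> Q" for n using D by blast
  have u: "u \<in> H" "tends s u sequentially"
    using conv by (auto simp: form_conv_def limitin_hs_top)
  have eq: "f (s m - s n) = q (s m - s n) (s m - s n) + ip (s m - s n) (s m - s n)" for m n
    using f D(2) s by blast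
  obtain z where z: "z \<in> Q" "form.tends s z sequentially"
  proof (rule form.cauchy_tends[OF sQ])
    have "\<forall>e>0. \<exists>N. \<forall>m\<ge>N. \<forall>n\<ge>N. q (s m - s n) (s m - s n) + ip (s m - s n) (s m - s n) < e"
      using conv unfolding form_conv_def eq by blast
    then show "\<exists>N. \<forall>m\<ge>N. \<forall>n\<ge>N. q (s m - s n) (s m - s n) + ip (s m - s n) (s m - s n) < e" if "e > 0" for e
      using that by blast
  qed (rule that)
  then have "tends s z sequentially" using sQ by (intro form_tends_imp_tends)
  then have "z = u" by (rule tends_unique[OF _ u(2)]) (use sQ z u in auto)
  then show "(\<forall>n. s n \<in> D) \<and> u \<in> Q \<and> form.tends s u sequentially" using s z by blast
next
  assume *: "(\<forall>n. s n \<in> D) \<and> u \<in> Q \<and> form.tends s u sequentially"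
  then have s: "\<And>n. s n \<in> D" and u: "u \<in> Q" and lim: "form.tends s u sequentially" by auto
  have sQ: "s n \<in> Q" for n using s D by blast
  have eq: "f (s m - s n) = q (s m - s n) (s m - s n) + ip (s m - s n) (s m - s n)" for m n
    using f D(2) s by blast
  have "limitin (hs_top H ip) s u sequentially"
    unfolding limitin_hs_top using form_tends_imp_tends[OF lim sQ u] sQ u by simp
  moreover have "\<exists>N. \<forall>m\<ge>N. \<forall>n\<ge>N. f (s m - s n) < e" if "e > 0" for e
    unfolding eq using form.tends_cauchy[OF sQ u lim that] .
  ultimately show "form_conv H ip D f s u" using s by (simp add: form_conv_def)
qed

lemma form_closure_core:
  assumes D: "D \<subseteq> Q" "\<And>u v. u \<in> D \<Longrightarrow> v \<in> D \<Longrightarrow> u - v \<in> D"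
    and f: "\<And>u. u \<in> D \<Longrightarrow> f u = q u u + ip u u"
    and dense: "\<And>u. u \<in> Q \<Longrightarrow> \<exists>s. (\<forall>n::nat. s n \<in> D) \<and> form.tends s u sequentially"
  shows "form_closure_dom H ip D f = Q"
    and "u \<in> Q \<Longrightarrow> form_closure H ip D f u = q u u + ip u u"
proof -
  have conv: "form_conv H ip D f s u \<longleftrightarrow> (\<forall>n. s n \<in> D) \<and> u \<in> Q \<and> form.tends s u sequentially" for s u
    using D f by (rule form_conv_core)
  show "form_closure_dom H ip D f = Q"
    unfolding form_closure_dom_def conv using dense by blast
  assume u: "u \<in> Q"
  have val: "(\<lambda>n. f (s n)) \<longlonglongrightarrow> q u u + ip u u" if s: "\<forall>n. s n \<in> D" "form.tends s u sequentially" for s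
  proof -
    have sQ: "s n \<in> Q" for n using s D by blast
    have "(\<lambda>n. q (s n) (s n) + ip (s n) (s n)) \<longlonglongrightarrow> q u u + ip u u"
      by (rule form.tends_ip) (use s sQ u in auto)
    then show ?thesis using f s(1) by simp
  qed
  have "{r. \<exists>s. form_conv H ip D f s u \<and> (\<lambda>n. f (s n)) \<longlonglongrightarrow> r} = {q u u + ip u u}"
  proof (intro subset_antisym subsetI)
    fix r assume "r \<in> {r. \<exists>s. form_conv H ip D f s u \<and> (\<lambda>n. f (s n)) \<longlonglongrightarrow> r}"
    then obtain s where "form_conv H ip D f s u" "(\<lambda>n. f (s n)) \<longlonglongrightarrow> r" by blast
    then show "r \<in> {q u u + ip u u}" using val[of s] LIMSEQ_unique unfolding conv by blast
  next
    fix r assume "r \<in> {q u u + ip u u}"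
    then show "r \<in> {r. \<exists>s. form_conv H ip D f s u \<and> (\<lambda>n. f (s n)) \<longlonglongrightarrow> r}"
      using dense[OF u] u val unfolding conv by blast
  qed
  then show "form_closure H ip D f u = q u u + ip u u" by (simp add: form_closure_def)
qed

lemma form_op_unique: "(u, w) \<in> form_op \<Longrightarrow> (u, w') \<in> form_op \<Longrightarrow> w = w'"
proof -
  assume uw: "(u, w) \<in> form_op" "(u, w') \<in> form_op"
  then have H: "w \<in> H" "w' \<in> H" by (auto simp: form_op_def)
  have "w - w' = 0"
    by (rule Q_dense) (use uw H in \<open>auto simp: form_op_def ip_diff\<close>)
  then show ?thesis by simp
qed

end

lemma (in hilbert_top) op_closure_diff:
  assumes B: "\<And>u w u' w'. (u, w) \<in> B \<Longrightarrow> (u', w') \<in> B \<Longrightarrow> (u - u', w - w') \<in> B"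
    and "(u, w) \<in> op_closure H ip B" "(u', w') \<in> op_closure H ip B"
  shows "(u - u', w - w') \<in> op_closure H ip B"
proof -
  obtain s t where st: "u \<in> H" "w \<in> H" "\<And>n::nat. (s n, t n) \<in> B" "\<And>n. s n \<in> H" "\<And>n. t n \<in> H"
    "tends s u sequentially" "tends t w sequentially"
    using assms(2) unfolding op_closure_iff by blast
  obtain s' t' where st': "u' \<in> H" "w' \<in> H" "\<And>n::nat. (s' n, t' n) \<in> B" "\<And>n. s' n \<in> H" "\<And>n. t' n \<in> H"
    "tends s' u' sequentially" "tends t' w' sequentially"
    using assms(3) unfolding op_closure_iff by blast
  have "tends (\<lambda>n. s n - s' n) (u - u') sequentially" "tends (\<lambda>n. t n - t' n) (w - w') sequentially"
    using st st' by (auto intro!: tends_diff)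
  moreover have "(s n - s' n, t n - t' n) \<in> B \<and> s n - s' n \<in> H \<and> t n - t' n \<in> H" for n
    using B st st' by simp
  ultimately show ?thesis using st st' unfolding op_closure_iff by (meson H_diff)
qed

context transient_network
begin

text \<open>\<open>G\<close> is the closure of \<open>Phi\<close>: a pair in \<open>G\<close> orthogonal to the graph of \<open>Phi\<close> has the
  form \<open>(\<xi>, - fclass \<xi>)\<close>, and membership in \<open>G\<close> then forces \<open>|v|\<^sup>2 = - |\<xi>|\<^sup>2\<close>.\<close>

lemma G_approx:
  assumes "(\<xi>, v) \<in> G"
  obtains s where "\<And>n::nat. s n \<in> Phi_dom" "ell2.tends s \<xi> sequentially"
    "HE.tends (\<lambda>n. Phi c ref (s n)) v sequentially"
proof -
  let ?D = "(\<lambda>\<phi>. (\<phi>, Phi c ref \<phi>)) ` Phi_dom"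
  obtain t where t: "\<And>n::nat. t n \<in> ?D" "GH.tends t (\<xi>, v) sequentially"
  proof (rule GH.dense_of_trivial_complement[of ?D "(\<xi>, v)"])
    show "subspace ?D"
    proof (rule subspaceI)
      have "Phi c ref 0 = 0" by (subst Phi_eq_sum[of "{}"]) auto
      then have zero: "0 = (0, Phi c ref 0)" by (simp only: zero_prod_def)
      show "0 \<in> ?D"
      proof (rule image_eqI[where x = 0])
        show "0 = (0, Phi c ref 0)" by (rule zero)
      qed (rule subspace_0[OF subspace_Phi_dom])
      fix p assume "p \<in> ?D"
      then obtain a where a: "a \<in> Phi_dom" "p = (a, Phi c ref a)" by blast
      show "r *\<^sub>R p \<in> ?D" for r
      proof (rule image_eqI[where x = "r *\<^sub>R a"])
        show "r *\<^sub>R p = (r *\<^sub>R a, Phi c ref (r *\<^sub>R a))"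
          unfolding a(2) scaleR_prod_def fst_conv snd_conv Phi_linear(3)[OF a(1) a(1)] ..
      qed (rule subspace_scale[OF subspace_Phi_dom a(1)])
      fix p' assume "p' \<in> ?D"
      then obtain b where b: "b \<in> Phi_dom" "p' = (b, Phi c ref b)" by blast
      show "p + p' \<in> ?D"
      proof (rule image_eqI[where x = "a + b"])
        show "p + p' = (a + b, Phi c ref (a + b))"
          unfolding a(2) b(2) plus_prod_def fst_conv snd_conv Phi_linear(1)[OF a(1) b(1)] ..
      qed (rule subspace_add[OF subspace_Phi_dom a(1) b(1)])
    qed
    show "?D \<subseteq> G" using Phi_G by blast
    fix z assume z: "z \<in> G" "\<And>d. d \<in> ?D \<Longrightarrow> ell2_ip (fst z) (fst d) + energy_ip c (snd z) (snd d) = 0"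
    obtain \<xi> v where zz: "z = (\<xi>, v)" by force
    have in_G: "(\<xi>, v) \<in> G" using z zz by simp
    note H = G_D(1,2)[OF in_G]
    have "energy_ip c v (W x) = (- \<xi>) x" for x
    proof -
      have "ell2_ip \<xi> (delta x) + energy_ip c v (Phi c ref (delta x)) = 0"
        using z(2)[of "(delta x, Phi c ref (delta x))"] zz by simp
      then show ?thesis by (simp add: ell2_ip_delta Phi_delta)
    qed
    then have D: "- \<xi> \<in> D2" "v = fclass (- \<xi>)"
      using class_of_values[OF H(2) ell2.H_neg[OF H(1)]] by blast+
    have "energy_ip c v v = ell2_ip \<xi> (- \<xi>)" using G_D(3)[OF in_G D(1)] D(2) by simp
    also have "\<dots> = - ell2_ip \<xi> \<xi>" by (rule ell2.ip_neg2[OF H(1) H(1)])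
    finally have "energy_ip c v v = 0" "ell2_ip \<xi> \<xi> = 0"
      using HE.ip_square_nonneg[of v] ell2.ip_square_nonneg[of \<xi>] by linarith+
    then have "v = 0" "\<xi> = 0" using HE.ip_definite[OF H(2)] ell2.ip_definite[OF H(1)] by blast+
    then show "z = 0" unfolding zz zero_prod_def by (rule arg_cong2[rotated])
  qed (use assms in auto)
  then have "\<forall>n. \<exists>\<phi>\<in>Phi_dom. t n = (\<phi>, Phi c ref \<phi>)" by blast
  then obtain s where s: "\<And>n. s n \<in> Phi_dom" "\<And>n. t n = (s n, Phi c ref (s n))" by metis
  have nrm: "GH.nrm (t n - (\<xi>, v)) = sqrt (ell2_ip (s n - \<xi>) (s n - \<xi>) + energy_ip c (Phi c ref (s n) - v) (Phi c ref (s n) - v))" for n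
    unfolding GH.nrm_def s(2) by (simp only: fst_diff snd_diff fst_conv snd_conv)
  have lim: "(\<lambda>n. GH.nrm (t n - (\<xi>, v))) \<longlonglongrightarrow> 0" using t(2) by (simp add: GH.tends_def)
  note H = G_D(1,2)[OF assms]
  have "ell2.tends s \<xi> sequentially"
  proof (rule ell2.tends_squeeze[OF _ lim])
    show "\<forall>\<^sub>F n in sequentially. ell2.nrm (s n - \<xi>) \<le> GH.nrm (t n - (\<xi>, v))"
      unfolding nrm ell2.nrm_def using HE.ip_square_nonneg by (intro always_eventually allI real_sqrt_le_mono) simp
  qed (use H Phi_dom_ell2[OF s(1)] in auto)
  moreover have "HE.tends (\<lambda>n. Phi c ref (s n)) v sequentially"
  proof (rule HE.tends_squeeze[OF _ lim])
    show "\<forall>\<^sub>F n in sequentially. HE.nrm (Phi c ref (s n) - v) \<le> GH.nrm (t n - (\<xi>, v))"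
      unfolding nrm HE.nrm_def using ell2.ip_square_nonneg by (intro always_eventually allI real_sqrt_le_mono) simp
  qed (use H in auto)
  ultimately show thesis using s(1) that by blast
qed

subsection \<open>The relation \<open>Phi_tilde\<close>\<close>

lemma M_form_eq:
  assumes "\<xi> \<in> Phi_dom"
  shows "M_form c ref \<xi> = energy_ip c (Phi c ref \<xi>) (Phi c ref \<xi>)"
proof -
  have fin: "finite {x. \<xi> x \<noteq> 0}" using assms by (simp add: Phi_dom_iff)
  have row: "(\<Sum>y | \<xi> y \<noteq> 0. M_matrix c ref x y * \<xi> y) = energy_ip c (W x) (Phi c ref \<xi>)" for x
  proof -
    have "energy_ip c (W x) (Phi c ref \<xi>) = energy_ip c (Phi c ref \<xi>) (W x)" by (simp add: HE.ip_commute)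
    also have "\<dots> = (\<Sum>y | \<xi> y \<noteq> 0. \<xi> y * energy_ip c (W y) (W x))" by (simp add: Phi_ip[OF assms])
    also have "\<dots> = (\<Sum>y | \<xi> y \<noteq> 0. M_matrix c ref x y * \<xi> y)"
      by (intro sum.cong refl) (simp add: M_matrix_def HE.ip_commute[of "W x"])
    finally show ?thesis by simp
  qed
  show ?thesis
    unfolding M_form_def row using ell2_ip_finite[OF fin, of \<xi>] by (simp add: Phi_ip[OF assms])
qed

lemma M_form_conv:
  "form_conv ell2 ell2_ip Phi_dom (M_form c ref) s \<xi> \<longleftrightarrow>
    (\<forall>n. s n \<in> Phi_dom) \<and> \<xi> \<in> ell2 \<and> ell2.tends s \<xi> sequentially \<and>
    (\<exists>v. (\<xi>, v) \<in> G \<and> HE.tends (\<lambda>n. Phi c ref (s n)) v sequentially)"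
proof -
  have Mdiff: "M_form c ref (s m - s n) = energy_ip c (Phi c ref (s m) - Phi c ref (s n)) (Phi c ref (s m) - Phi c ref (s n))"
    if "\<forall>n. s n \<in> Phi_dom" for m n
    using M_form_eq[OF subspace_diff[OF subspace_Phi_dom], of "s m" "s n"] Phi_linear(2)[of "s m" "s n"] that by simp
  show ?thesis
  proof
    assume conv: "form_conv ell2 ell2_ip Phi_dom (M_form c ref) s \<xi>"
    then have s: "\<forall>n. s n \<in> Phi_dom" and \<xi>: "\<xi> \<in> ell2" "ell2.tends s \<xi> sequentially"
      by (auto simp: form_conv_def ell2.limitin_hs_top)
    obtain v where v: "v \<in> energy_space c" "HE.tends (\<lambda>n. Phi c ref (s n)) v sequentially"
    proof (rule HE.cauchy_tends[of "\<lambda>n. Phi c ref (s n)"])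
      have "\<forall>e>0. \<exists>N. \<forall>m\<ge>N. \<forall>n\<ge>N. energy_ip c (Phi c ref (s m) - Phi c ref (s n)) (Phi c ref (s m) - Phi c ref (s n)) < e"
        using conv unfolding form_conv_def Mdiff[OF s] by blast
      then show "\<exists>N. \<forall>m\<ge>N. \<forall>n\<ge>N. energy_ip c (Phi c ref (s m) - Phi c ref (s n)) (Phi c ref (s m) - Phi c ref (s n)) < e" if "e > 0" for e
        using that by blast
    qed (use that in auto)
    have "(\<xi>, v) \<in> G" using s by (intro G_closed[OF Phi_G \<xi>(2) v(2) \<xi>(1) v(1)]) blast
    with s \<xi> v show "(\<forall>n. s n \<in> Phi_dom) \<and> \<xi> \<in> ell2 \<and> ell2.tends s \<xi> sequentially \<and>
        (\<exists>v. (\<xi>, v) \<in> G \<and> HE.tends (\<lambda>n. Phi c ref (s n)) v sequentially)" by blast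
  next
    assume *: "(\<forall>n. s n \<in> Phi_dom) \<and> \<xi> \<in> ell2 \<and> ell2.tends s \<xi> sequentially \<and>
        (\<exists>v. (\<xi>, v) \<in> G \<and> HE.tends (\<lambda>n. Phi c ref (s n)) v sequentially)"
    then obtain v where v: "(\<xi>, v) \<in> G" "HE.tends (\<lambda>n. Phi c ref (s n)) v sequentially" by blast
    have s: "\<forall>n. s n \<in> Phi_dom" using * by blast
    have "\<exists>N. \<forall>m\<ge>N. \<forall>n\<ge>N. M_form c ref (s m - s n) < e" if "e > 0" for e
      unfolding Mdiff[OF s] using HE.tends_cauchy[OF Phi_in G_D(2)[OF v(1)] v(2) that] .
    moreover have "\<forall>\<^sub>F n in sequentially. s n \<in> ell2" using s Phi_dom_ell2 by (intro always_eventually) blast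
    ultimately show "form_conv ell2 ell2_ip Phi_dom (M_form c ref) s \<xi>"
      using * by (simp add: form_conv_def ell2.limitin_hs_top)
  qed
qed

lemma qM_dom_eq: "qM_dom c ref = Domain G"
proof (intro subset_antisym subsetI)
  show "\<xi> \<in> Domain G" if "\<xi> \<in> qM_dom c ref" for \<xi>
    using that unfolding qM_dom_def form_closure_dom_def M_form_conv by blast
  fix \<xi> assume "\<xi> \<in> Domain G"
  then obtain v where v: "(\<xi>, v) \<in> G" by blast
  obtain s where "\<And>n::nat. s n \<in> Phi_dom" "ell2.tends s \<xi> sequentially"
    "HE.tends (\<lambda>n. Phi c ref (s n)) v sequentially" by (rule G_approx[OF v]) (rule that)
  then show "\<xi> \<in> qM_dom c ref"
    using v G_D(1)[OF v] unfolding qM_dom_def form_closure_dom_def M_form_conv by blast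
qed

text \<open>The limit of the form depends on the limit \<open>v\<close> of the images under \<open>Phi\<close>. As \<open>G\<close> may be
  multivalued, so may be the limit, and \<open>qM\<close> takes the infimum.\<close>

lemma qM_values: "{r. \<exists>s. form_conv ell2 ell2_ip Phi_dom (M_form c ref) s \<xi> \<and> (\<lambda>n. M_form c ref (s n)) \<longlonglongrightarrow> r} =
    {energy_ip c v v |v. (\<xi>, v) \<in> G}" (is "?L = ?R")
proof -
  have lim: "(\<lambda>n. M_form c ref (s n)) \<longlonglongrightarrow> energy_ip c v v"
    if "\<And>n. s n \<in> Phi_dom" "(\<xi>, v) \<in> G" "HE.tends (\<lambda>n. Phi c ref (s n)) v sequentially" for s v
  proof -
    have "(\<lambda>n. energy_ip c (Phi c ref (s n)) (Phi c ref (s n))) \<longlonglongrightarrow> energy_ip c v v"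
      by (rule HE.tends_ip) (use that G_D(2) in auto)
    then show ?thesis using M_form_eq that(1) by simp
  qed
  show ?thesis
  proof (intro subset_antisym subsetI)
    fix r assume "r \<in> ?L"
    then obtain s where s: "form_conv ell2 ell2_ip Phi_dom (M_form c ref) s \<xi>" "(\<lambda>n. M_form c ref (s n)) \<longlonglongrightarrow> r" by blast
    then obtain v where v: "(\<xi>, v) \<in> G" "HE.tends (\<lambda>n. Phi c ref (s n)) v sequentially" "\<And>n. s n \<in> Phi_dom"
      unfolding M_form_conv by blast
    have "r = energy_ip c v v" by (rule LIMSEQ_unique[OF s(2) lim[OF v(3,1,2)]])
    with v show "r \<in> ?R" by blast
  next
    fix r assume "r \<in> ?R"
    then obtain v where v: "(\<xi>, v) \<in> G" "r = energy_ip c v v" by blast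
    obtain s where s: "\<And>n::nat. s n \<in> Phi_dom" "ell2.tends s \<xi> sequentially"
      "HE.tends (\<lambda>n. Phi c ref (s n)) v sequentially" by (rule G_approx[OF v(1)]) (rule that)
    have "form_conv ell2 ell2_ip Phi_dom (M_form c ref) s \<xi>"
      unfolding M_form_conv using s v G_D(1) by blast
    with lim[OF s(1) v(1) s(3)] v(2) show "r \<in> ?L" by blast
  qed
qed

lemma qM_le: "(\<xi>, v) \<in> G \<Longrightarrow> qM c ref \<xi> \<le> energy_ip c v v"
  unfolding qM_def form_closure_def qM_values
  by (rule cInf_lower) (use HE.ip_square_nonneg in \<open>auto intro!: bdd_belowI[of _ 0]\<close>)

lemma qM_nonneg: "\<xi> \<in> Domain G \<Longrightarrow> 0 \<le> qM c ref \<xi>"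
  unfolding qM_def form_closure_def qM_values
  by (rule cInf_greatest) (use HE.ip_square_nonneg in auto)

lemma qM_approx:
  assumes "\<xi> \<in> Domain G" "e > 0"
  obtains v where "(\<xi>, v) \<in> G" "energy_ip c v v < qM c ref \<xi> + e"
proof -
  have "\<exists>r\<in>{energy_ip c v v |v. (\<xi>, v) \<in> G}. r < qM c ref \<xi> + e"
    by (rule cInf_lessD) (use assms in \<open>auto simp: qM_def form_closure_def qM_values\<close>)
  then show thesis using that by blast
qed

text \<open>If \<open>qM (s n - \<xi>)\<close> tends to \<open>0\<close>, then \<open>s n - \<xi>\<close> is related by \<open>G\<close> to classes \<open>v n\<close> that tend
  to \<open>0\<close>; so the weak equation for \<open>Phi (s n) - v n\<close>, whose right-hand side is \<open>\<xi>\<close>, passes to the limit.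
  Conversely the form at \<open>s n - \<xi>\<close> is at most the energy of \<open>Phi (s n) - u\<close>, whichever \<open>u\<close> related
  to \<open>\<xi>\<close> is chosen.\<close>

theorem Phi_tilde_eq: "Phi_tilde c ref = G"
proof (intro subset_antisym subrelI)
  fix \<xi> u assume "(\<xi>, u) \<in> Phi_tilde c ref"
  then obtain s where \<xi>: "\<xi> \<in> Domain G" and s: "\<And>n. s n \<in> Phi_dom"
    and lim: "(\<lambda>n. qM c ref (s n - \<xi>)) \<longlonglongrightarrow> 0"
    and u: "u \<in> energy_space c" "HE.tends (\<lambda>n. Phi c ref (s n)) u sequentially"
    unfolding Phi_tilde_def by (auto simp: qM_dom_eq HE.limitin_hs_top)
  have sG: "s n - \<xi> \<in> Domain G" for n using \<xi> G_linear(2)[OF Phi_G[OF s]] by blast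
  have \<xi>H: "\<xi> \<in> ell2" using \<xi> G_D(1) by blast
  \<comment> \<open>Representatives that almost attain the infimum defining the closed form.\<close>
  have "\<exists>v. (s n - \<xi>, v) \<in> G \<and> energy_ip c v v < qM c ref (s n - \<xi>) + 1 / Suc n" for n
    using qM_approx[OF sG, of "1 / Suc n" n] by (metis of_nat_0_less_iff zero_less_Suc zero_less_divide_1_iff)
  then obtain v where v: "\<And>n. (s n - \<xi>, v n) \<in> G" "\<And>n. energy_ip c (v n) (v n) < qM c ref (s n - \<xi>) + 1 / Suc n"
    by metis
  have vH: "v n \<in> energy_space c" for n using G_D(2)[OF v(1)] .
  have "HE.tends v 0 sequentially"
  proof (subst HE.tends_sq)
    have "(\<lambda>n. energy_ip c (v n) (v n)) \<longlonglongrightarrow> 0"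
    proof (rule tendsto_sandwich[OF _ _ tendsto_const])
      show "\<forall>\<^sub>F n in sequentially. energy_ip c (v n) (v n) \<le> qM c ref (s n - \<xi>) + 1 / Suc n"
        using v(2) by (intro always_eventually allI less_imp_le)
      show "(\<lambda>n. qM c ref (s n - \<xi>) + 1 / Suc n) \<longlonglongrightarrow> 0"
        using tendsto_add[OF lim LIMSEQ_Suc[OF lim_1_over_n]] by simp
    qed (use HE.ip_square_nonneg in auto)
    then show "(\<lambda>n. energy_ip c (v n - 0) (v n - 0)) \<longlonglongrightarrow> 0" by simp
  qed (use vH in auto)
  have "energy_ip c u (fclass \<eta>) = ell2_ip \<xi> \<eta>" if \<eta>: "\<eta> \<in> D2" for \<eta>
  proof -
    have "(\<lambda>n. energy_ip c (Phi c ref (s n)) (fclass \<eta>) - energy_ip c (v n) (fclass \<eta>)) \<longlonglongrightarrow>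
        energy_ip c u (fclass \<eta>) - energy_ip c 0 (fclass \<eta>)"
      using u vH \<eta> \<open>HE.tends v 0 sequentially\<close> by (intro tendsto_diff HE.tends_ip_const) auto
    moreover have "energy_ip c (Phi c ref (s n)) (fclass \<eta>) - energy_ip c (v n) (fclass \<eta>) = ell2_ip \<xi> \<eta>" for n
      using G_D(3)[OF Phi_G[OF s] \<eta>] G_D(3)[OF v(1) \<eta>] Phi_dom_ell2[OF s] \<xi>H \<eta>
      by (simp add: ell2.ip_diff)
    ultimately show ?thesis using \<eta> by (simp add: LIMSEQ_const_iff)
  qed
  then show "(\<xi>, u) \<in> G" using \<xi>H u(1) by (auto simp: G_def)
next
  fix \<xi> u assume G: "(\<xi>, u) \<in> G"
  obtain s where s: "\<And>n::nat. s n \<in> Phi_dom" "HE.tends (\<lambda>n. Phi c ref (s n)) u sequentially"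
    by (rule G_approx[OF G]) (rule that)
  have H: "\<xi> \<in> ell2" "u \<in> energy_space c" using G_D[OF G] by auto
  have diff: "(s n - \<xi>, Phi c ref (s n) - u) \<in> G" for n using G_linear(2)[OF Phi_G[OF s(1)] G] .
  have "(\<lambda>n. qM c ref (s n - \<xi>)) \<longlonglongrightarrow> 0"
  proof (rule tendsto_sandwich[OF _ _ tendsto_const])
    show "\<forall>\<^sub>F n in sequentially. 0 \<le> qM c ref (s n - \<xi>)"
      using qM_nonneg diff by (intro always_eventually) blast
    show "\<forall>\<^sub>F n in sequentially. qM c ref (s n - \<xi>) \<le> energy_ip c (Phi c ref (s n) - u) (Phi c ref (s n) - u)"
      using qM_le diff by (intro always_eventually) blast
    show "(\<lambda>n. energy_ip c (Phi c ref (s n) - u) (Phi c ref (s n) - u)) \<longlonglongrightarrow> 0"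
      using s(2) H by (subst HE.tends_sq[symmetric]) auto
  qed
  moreover have "limitin (hs_top (energy_space c) (energy_ip c)) (\<lambda>n. Phi c ref (s n)) u sequentially"
    using s(2) H by (simp add: HE.limitin_hs_top)
  ultimately show "(\<xi>, u) \<in> Phi_tilde c ref"
    unfolding Phi_tilde_def qM_dom_eq using G s(1) by blast
qed

text \<open>The domain of \<open>G\<close> is the range of the square root of the Laplacian. Both say that
  \<open>ell2_ip \<xi>\<close> is bounded on \<open>D2\<close> by the square root of the energy; the representing vector is
  sought in the energy space in one case and in \<open>ell2\<close> in the other.\<close>

lemma Domain_G: "Domain G = Range E2.res.root"
proof (intro subset_antisym subsetI)
  fix \<xi> assume "\<xi> \<in> Domain G"
  then obtain v where v: "(\<xi>, v) \<in> G" by blast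
  note H = G_D(1,2)[OF v]
  obtain g where g: "g \<in> ell2" "\<And>d. d \<in> ell2 \<Longrightarrow> ell2_ip \<xi> (E2.res.C d) = ell2_ip g (E2.res.S d)"
  proof (rule ell2.dominated_functional[OF ell2.subspace_H, where T = E2.res.S and \<phi> = "\<lambda>d. ell2_ip \<xi> (E2.res.C d)" and K = "HE.nrm v"])
    fix d :: "'v \<Rightarrow> real" assume d: "d \<in> ell2"
    have root: "(E2.res.C d, E2.res.S d) \<in> E2.res.root" using d by (auto simp: E2.res.root_def)
    have CD: "E2.res.C d \<in> D2" by (rule E2.form_C(1)[OF d])
    have nrm_eq: "ell2.nrm (E2.res.S d) = HE.nrm (fclass (E2.res.C d))"
      unfolding HE.nrm_def ell2.nrm_def energy_ip_fclass E2.root_form_square[OF root] ..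
    show "\<bar>ell2_ip \<xi> (E2.res.C d)\<bar> \<le> HE.nrm v * ell2.nrm (E2.res.S d)"
      unfolding G_D(3)[OF v CD, symmetric] nrm_eq by (rule HE.cauchy_schwarz[OF H(2) fclass_D2[OF CD]])
    show "ell2_ip \<xi> (E2.res.C (r *\<^sub>R d)) = r * ell2_ip \<xi> (E2.res.C d)" for r
      unfolding E2.res.C_linear(3)[OF d] by (rule ell2.ip_scale2) (use d H in auto)
    fix e :: "'v \<Rightarrow> real" assume e: "e \<in> ell2"
    show "ell2_ip \<xi> (E2.res.C (d + e)) = ell2_ip \<xi> (E2.res.C d) + ell2_ip \<xi> (E2.res.C e)"
      unfolding E2.res.C_linear(1)[OF d e] by (rule ell2.ip_add2) (use d e H in auto)
    show "E2.res.S (d + e) = E2.res.S d + E2.res.S e" by (rule E2.res.S_linear(1)[OF d e])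
  qed (auto simp del: scaleR_fun_apply simp: E2.res.S_linear)
  have "(g, \<xi>) \<in> E2.res.root"
  proof (rule ell2.self_adjointD(4)[OF E2.res.self_adjoint_root g(1) H(1)])
    fix x y assume "(x, y) \<in> E2.res.root"
    then obtain d where d: "d \<in> ell2" "x = E2.res.C d" "y = E2.res.S d" by (auto simp: E2.res.root_def)
    then show "ell2_ip y g = ell2_ip x \<xi>"
      using g(2)[OF d(1)] ell2.ip_commute[OF g(1), of y] ell2.ip_commute[OF H(1), of x] by simp
  qed
  then show "\<xi> \<in> Range E2.res.root" by blast
next
  fix \<xi> assume "\<xi> \<in> Range E2.res.root"
  then obtain g where g: "(g, \<xi>) \<in> E2.res.root" by blast
  note D = ell2.self_adjointD[OF E2.res.self_adjoint_root]
  have H: "g \<in> ell2" "\<xi> \<in> ell2" using D(1,2)[OF g] .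
  have subD: "subspace D2" by (rule E2.form.subspace_H)
  obtain v where v: "v \<in> energy_space c" "\<And>\<eta>. \<eta> \<in> D2 \<Longrightarrow> ell2_ip \<xi> \<eta> = energy_ip c v (fclass \<eta>)"
  proof (rule HE.dominated_functional[OF subD, where T = fclass and \<phi> = "ell2_ip \<xi>" and K = "ell2.nrm g"])
    fix \<eta> assume \<eta>: "\<eta> \<in> D2"
    then obtain h where h: "(\<eta>, h) \<in> E2.res.root" using E2.Domain_root by blast
    have hH: "h \<in> ell2" using D(2)[OF h] .
    have nrm_eq: "HE.nrm (fclass \<eta>) = ell2.nrm h"
      unfolding HE.nrm_def ell2.nrm_def energy_ip_fclass E2.root_form_square[OF h] ..
    show "\<bar>ell2_ip \<xi> \<eta>\<bar> \<le> ell2.nrm g * HE.nrm (fclass \<eta>)"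
      unfolding D(3)[OF h g] nrm_eq by (rule ell2.cauchy_schwarz[OF H(1) hH])
    show "ell2_ip \<xi> (r *\<^sub>R \<eta>) = r * ell2_ip \<xi> \<eta>" for r using ell2.ip_scale2[OF _ H(2)] \<eta> by simp
    fix \<eta>' assume \<eta>': "\<eta>' \<in> D2"
    show "ell2_ip \<xi> (\<eta> + \<eta>') = ell2_ip \<xi> \<eta> + ell2_ip \<xi> \<eta>'"
      by (rule ell2.ip_add2) (use \<eta> \<eta>' H in auto)
  qed (simp_all only: fclass_linear fclass_D2)
  then have "(\<xi>, v) \<in> G" using H by (auto simp: G_def)
  then show "\<xi> \<in> Domain G" by blast
qed

subsection \<open>The Friedrichs extension of the Laplacian on the energy space\<close>

text \<open>The adjoint of \<open>\<eta> \<mapsto> fclass \<eta>\<close>, the functional inverse of \<open>G\<close>. Testing with \<open>delta x\<close> shows that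
  it is single-valued; on \<open>Range G\<close> it is the Laplacian.\<close>

definition J :: "'v fun_mod_const \<Rightarrow> 'v \<Rightarrow> real" where
  "J v = (THE \<xi>. (\<xi>, v) \<in> G)"

lemma J_eq: 
  assumes "(\<xi>, v) \<in> G"
  shows "J v = \<xi>"
  unfolding J_def
proof (rule the_equality)
  show "(\<xi>, v) \<in> G" by (rule assms)
  fix \<xi>' assume G: "(\<xi>', v) \<in> G"
  show "\<xi>' = \<xi>"
  proof
    fix x
    have "delta x \<in> D2" using Phi_dom_D2 by simp
    from G_D(3)[OF assms this] G_D(3)[OF G this] show "\<xi>' x = \<xi> x" by (simp add: ell2_ip_delta)
  qed
qed

lemma J_G: "v \<in> Range G \<Longrightarrow> (J v, v) \<in> G"
  using J_eq by blast

lemma hilbert_J: "hilbert (Range G) (\<lambda>u v. ell2_ip (J u) (J v) + energy_ip c u v)"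
proof
  have sub: "subspace (Range G)"
    by (rule subspaceI) (use G_zero G_linear in blast)+
  then show "subspace (Range G)" .
  fix u v w :: "'v fun_mod_const"
  show "0 \<le> ell2_ip (J u) (J u) + energy_ip c u u"
    by (rule add_nonneg_nonneg[OF ell2.ip_square_nonneg HE.ip_square_nonneg])
  assume "u \<in> Range G"
  then have u: "(J u, u) \<in> G" by (rule J_G)
  show "u = 0" if "ell2_ip (J u) (J u) + energy_ip c u u = 0"
    using that ell2.ip_square_nonneg[of "J u"] HE.ip_square_nonneg[of u] HE.ip_definite[OF G_D(2)[OF u]] by linarith
  assume "v \<in> Range G"
  then have v: "(J v, v) \<in> G" by (rule J_G)
  show "ell2_ip (J u) (J v) + energy_ip c u v = ell2_ip (J v) (J u) + energy_ip c v u"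
    using ell2.ip_commute[OF G_D(1)[OF u] G_D(1)[OF v]] HE.ip_commute[OF G_D(2)[OF u] G_D(2)[OF v]] by simp
  show "ell2_ip (J (r *\<^sub>R u)) (J v) + energy_ip c (r *\<^sub>R u) v = r * (ell2_ip (J u) (J v) + energy_ip c u v)" for r
    unfolding J_eq[OF G_linear(3)[OF u]] ell2.ip_scale[OF G_D(1)[OF u] G_D(1)[OF v]] HE.ip_scale[OF G_D(2)[OF u] G_D(2)[OF v]]
    by (simp add: distrib_left)
  assume "w \<in> Range G"
  then have w: "(J w, w) \<in> G" by (rule J_G)
  show "ell2_ip (J (u + v)) (J w) + energy_ip c (u + v) w =
      ell2_ip (J u) (J w) + energy_ip c u w + (ell2_ip (J v) (J w) + energy_ip c v w)"
    unfolding J_eq[OF G_linear(1)[OF u v]] ell2.ip_add[OF G_D(1)[OF u] G_D(1)[OF v] G_D(1)[OF w]]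
      HE.ip_add[OF G_D(2)[OF u] G_D(2)[OF v] G_D(2)[OF w]] by simp
next
  fix s :: "nat \<Rightarrow> 'v fun_mod_const"
  assume s: "\<And>n. s n \<in> Range G"
    and cauchy: "\<And>e. 0 < e \<Longrightarrow> \<exists>N. \<forall>m\<ge>N. \<forall>n\<ge>N. ell2_ip (J (s m - s n)) (J (s m - s n)) + energy_ip c (s m - s n) (s m - s n) < e"
  have sG: "(J (s n), s n) \<in> G" for n using J_G[OF s] .
  have Jd: "J (s m - s n) = J (s m) - J (s n)" for m n by (rule J_eq[OF G_linear(2)[OF sG sG]])
  obtain p where p: "p \<in> G" "GH.tends (\<lambda>n. (J (s n), s n)) p sequentially"
  proof (rule GH.cauchy_tends[of "\<lambda>n. (J (s n), s n)"])
    show "\<exists>N. \<forall>m\<ge>N. \<forall>n\<ge>N. ell2_ip (fst ((J (s m), s m) - (J (s n), s n))) (fst ((J (s m), s m) - (J (s n), s n))) +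
        energy_ip c (snd ((J (s m), s m) - (J (s n), s n))) (snd ((J (s m), s m) - (J (s n), s n))) < e" if "e > 0" for e
      using cauchy[OF that] unfolding Jd fst_diff snd_diff fst_conv snd_conv .
  qed (use sG in auto)
  obtain \<xi> v where pv: "p = (\<xi>, v)" by force
  have G: "(\<xi>, v) \<in> G" using p pv by simp
  have Jv: "J (s n - v) = J (s n) - \<xi>" for n by (rule J_eq[OF G_linear(2)[OF sG G]])
  have "(\<lambda>n. ell2_ip (fst ((J (s n), s n) - p)) (fst ((J (s n), s n) - p)) + energy_ip c (snd ((J (s n), s n) - p)) (snd ((J (s n), s n) - p))) \<longlonglongrightarrow> 0"
    using p sG by (subst GH.tends_sq[symmetric]) auto
  then have "(\<lambda>n. ell2_ip (J (s n - v)) (J (s n - v)) + energy_ip c (s n - v) (s n - v)) \<longlonglongrightarrow> 0"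
    unfolding pv fst_diff snd_diff fst_conv snd_conv Jv .
  then show "\<exists>l\<in>Range G. (\<lambda>n. ell2_ip (J (s n - l)) (J (s n - l)) + energy_ip c (s n - l) (s n - l)) \<longlonglongrightarrow> 0"
    using G by blast
qed

lemma W_Range_G: "W x \<in> Range G"
  using Phi_G[OF delta_Phi_dom, of x] unfolding Phi_delta by blast

sublocale FE: closed_form "energy_space c" "energy_ip c" "Range G" "\<lambda>u v. ell2_ip (J u) (J v)"
proof (intro closed_form.intro hilbert_J closed_form_axioms.intro)
  show "hilbert_top (energy_space c) (energy_ip c)" by (rule HE.hilbert_top_axioms)
  show "Range G \<subseteq> energy_space c" using G_D(2) by blast
  show "0 \<le> ell2_ip (J u) (J u)" for u by (rule ell2.ip_square_nonneg)
  fix z assume z: "z \<in> energy_space c" "\<And>x. x \<in> Range G \<Longrightarrow> energy_ip c z x = 0"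
  have W0: "energy_ip c w0 z + class_diff z x ref = 0" for x
    using z(2)[OF W_Range_G, of x] W_ip[OF z(1), of x] HE.ip_commute[OF z(1) W_in, of x] by simp
  obtain u where u: "z = fclass u" by (rule fclass_surj)
  have "class_diff z ref ref = 0" by (simp add: u class_diff_fclass)
  then have "class_diff z x ref = 0" for x using W0[of x] W0[of ref] by linarith
  then show "z = 0" by (rule class_diff_zero)
qed

text \<open>Tested against \<open>W x\<close>, the defining equation of the form operator says that \<open>w\<close> has the values of
  \<open>J u\<close> up to a constant, so that \<open>J u\<close> represents \<open>w\<close> and has finite energy.\<close>

lemma FE_form_op_iff: "(u, w) \<in> FE.form_op \<longleftrightarrow> (\<exists>\<xi>\<in>D2. (\<xi>, u) \<in> G \<and> w = fclass \<xi>)"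
proof
  assume uw: "(u, w) \<in> FE.form_op"
  then have u: "u \<in> Range G" and w: "w \<in> energy_space c"
    and eq: "\<And>x. x \<in> Range G \<Longrightarrow> ell2_ip (J u) (J x) = energy_ip c w x"
    by (auto simp: FE.form_op_def)
  have G: "(J u, u) \<in> G" using J_G[OF u] .
  have "energy_ip c w (W x) = J u x" for x
    using eq[OF W_Range_G, of x] J_eq[OF Phi_G[OF delta_Phi_dom, of x]] by (simp add: Phi_delta ell2_ip_delta)
  from class_of_values[OF w G_D(1)[OF G] this] show "\<exists>\<xi>\<in>D2. (\<xi>, u) \<in> G \<and> w = fclass \<xi>" using G by blast
next
  assume "\<exists>\<xi>\<in>D2. (\<xi>, u) \<in> G \<and> w = fclass \<xi>"
  then obtain \<xi> where \<xi>: "\<xi> \<in> D2" "(\<xi>, u) \<in> G" "w = fclass \<xi>" by blast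
  have "ell2_ip (J u) (J x) = energy_ip c w x" if "x \<in> Range G" for x
  proof -
    have x: "(J x, x) \<in> G" using J_G[OF that] .
    have "ell2_ip (J u) (J x) = ell2_ip (J x) \<xi>"
      using J_eq[OF \<xi>(2)] ell2.ip_commute[OF G_D(1)[OF \<xi>(2)] G_D(1)[OF x]] by simp
    also have "\<dots> = energy_ip c w x"
      using G_D(3)[OF x \<xi>(1)] HE.ip_commute[OF fclass_D2[OF \<xi>(1)] G_D(2)[OF x]] \<xi>(3) by simp
    finally show ?thesis .
  qed
  then show "(u, w) \<in> FE.form_op" using \<xi> by (auto simp: FE.form_op_def)
qed

lemma laplacian_E_eq:
  "laplacian_E c ref = op_closure (energy_space c) (energy_ip c) ((\<lambda>\<xi>. (Phi c ref \<xi>, fclass \<xi>)) ` Phi_dom)"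
proof -
  have "(\<lambda>u. (u, fclass (laplacian_class c u))) ` span (range W) = (\<lambda>\<xi>. (Phi c ref \<xi>, fclass \<xi>)) ` Phi_dom"
    unfolding span_W image_image by (intro image_cong refl) (simp add: laplacian_class_Phi)
  then show ?thesis by (simp add: laplacian_E_def)
qed

text \<open>The closed form restricts to the form of the Laplacian on \<open>span (range W)\<close>, which is a core because
  the graph of \<open>Phi\<close> is dense in \<open>G\<close>.\<close>

theorem laplacian_F_eq: "laplacian_F c ref = FE.form_op"
  unfolding laplacian_F_def
proof -
  let ?B = "(\<lambda>\<xi>. (Phi c ref \<xi>, fclass \<xi>)) ` Phi_dom"
  let ?A = "laplacian_E c ref"
  have B_sub: "?B \<subseteq> FE.form_op"
  proof (rule image_subsetI)
    show "(Phi c ref \<xi>, fclass \<xi>) \<in> FE.form_op" if "\<xi> \<in> Phi_dom" for \<xi>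
      unfolding FE_form_op_iff using Phi_G[OF that] Phi_dom_D2[OF that] by blast
  qed
  have A_sub: "?A \<subseteq> FE.form_op"
    unfolding laplacian_E_eq by (rule HE.op_closure_subset_self_adjoint[OF FE.self_adjoint_form_op B_sub])
  have B_A: "?B \<subseteq> ?A"
  proof
    fix p assume "p \<in> ?B"
    then obtain \<xi> where \<xi>: "\<xi> \<in> Phi_dom" "p = (Phi c ref \<xi>, fclass \<xi>)" by blast
    have H: "Phi c ref \<xi> \<in> energy_space c" "fclass \<xi> \<in> energy_space c" using \<xi> Phi_dom_D2 by auto
    show "p \<in> ?A"
      unfolding laplacian_E_eq \<xi>(2) HE.op_closure_iff
      by (intro conjI H exI[of _ "\<lambda>_. Phi c ref \<xi>"] exI[of _ "\<lambda>_. fclass \<xi>"] allI HE.tends_const imageI \<xi>(1))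
  qed
  have A_diff: "(u - u', w - w') \<in> ?A" if "(u, w) \<in> ?A" "(u', w') \<in> ?A" for u w u' w'
    unfolding laplacian_E_eq
  proof (rule HE.op_closure_diff)
    show "(u, w) \<in> op_closure (energy_space c) (energy_ip c) ?B" "(u', w') \<in> op_closure (energy_space c) (energy_ip c) ?B"
      using that unfolding laplacian_E_eq .
    fix a b a' b' assume "(a, b) \<in> ?B" "(a', b') \<in> ?B"
    then obtain \<xi> \<xi>' where \<xi>: "\<xi> \<in> Phi_dom" "a = Phi c ref \<xi>" "b = fclass \<xi>" and \<xi>': "\<xi>' \<in> Phi_dom" "a' = Phi c ref \<xi>'" "b' = fclass \<xi>'"
      by blast
    show "(a - a', b - b') \<in> ?B"
    proof (rule image_eqI[where x = "\<xi> - \<xi>'"])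
      show "(a - a', b - b') = (Phi c ref (\<xi> - \<xi>'), fclass (\<xi> - \<xi>'))"
        unfolding \<xi>(2,3) \<xi>'(2,3) Phi_linear(2)[OF \<xi>(1) \<xi>'(1)] fclass_linear ..
    qed (rule subspace_diff[OF subspace_Phi_dom \<xi>(1) \<xi>'(1)])
  qed
  have DQ: "Domain ?A \<subseteq> Range G" using A_sub by (auto simp: FE.form_op_def)
  have Ddiff: "u - v \<in> Domain ?A" if "u \<in> Domain ?A" "v \<in> Domain ?A" for u v using that A_diff by blast
  have form: "friedrichs_form (energy_ip c) ?A u = ell2_ip (J u) (J u) + energy_ip c u u" if uD: "u \<in> Domain ?A" for u
  proof -
    obtain w where w: "(u, w) \<in> ?A" using uD by blast
    have "op_app ?A u = w"
      unfolding op_app_def using w A_sub FE.form_op_unique by (intro the_equality) blast+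
    moreover have "energy_ip c u w = ell2_ip (J u) (J u)"
    proof -
      have "(u, w) \<in> FE.form_op" using w A_sub by blast
      then have "u \<in> Range G" "w \<in> energy_space c" "ell2_ip (J u) (J u) = energy_ip c w u"
        by (auto simp: FE.form_op_def)
      then show ?thesis using HE.ip_commute[of u w] by simp
    qed
    ultimately show ?thesis by (simp add: friedrichs_form_def)
  qed
  have dense: "\<exists>s. (\<forall>n::nat. s n \<in> Domain ?A) \<and> FE.form.tends s u sequentially" if u: "u \<in> Range G" for u
  proof -
    have G: "(J u, u) \<in> G" using J_G[OF u] .
    obtain s where s: "\<And>n::nat. s n \<in> Phi_dom" "ell2.tends s (J u) sequentially"
      "HE.tends (\<lambda>n. Phi c ref (s n)) u sequentially" by (rule G_approx[OF G]) (rule that)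
    have sR: "Phi c ref (s n) \<in> Range G" for n using Phi_G[OF s(1)] by blast
    have Jd: "J (Phi c ref (s n) - u) = s n - J u" for n by (rule J_eq[OF G_linear(2)[OF Phi_G[OF s(1)] G]])
    have "FE.form.tends (\<lambda>n. Phi c ref (s n)) u sequentially"
    proof (subst FE.form.tends_sq)
      have "(\<lambda>n. ell2_ip (s n - J u) (s n - J u) + energy_ip c (Phi c ref (s n) - u) (Phi c ref (s n) - u)) \<longlonglongrightarrow> 0 + 0"
      proof (rule tendsto_add)
        show "(\<lambda>n. ell2_ip (s n - J u) (s n - J u)) \<longlonglongrightarrow> 0"
          using s(2) Phi_dom_ell2[OF s(1)] G_D(1)[OF G] by (subst ell2.tends_sq[symmetric]) auto
        show "(\<lambda>n. energy_ip c (Phi c ref (s n) - u) (Phi c ref (s n) - u)) \<longlonglongrightarrow> 0"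
          using s G_D(2)[OF G] by (subst HE.tends_sq[symmetric]) auto
      qed
      then show "(\<lambda>n. ell2_ip (J (Phi c ref (s n) - u)) (J (Phi c ref (s n) - u)) +
          energy_ip c (Phi c ref (s n) - u) (Phi c ref (s n) - u)) \<longlonglongrightarrow> 0" unfolding Jd by simp
    qed (use sR u in auto)
    moreover have "Phi c ref (s n) \<in> Domain ?A" for n using B_A s(1) by blast
    ultimately show ?thesis by (intro exI[of _ "\<lambda>n. Phi c ref (s n)"] conjI allI)
  qed
  show "friedrichs (energy_space c) (energy_ip c) ?A = FE.form_op"
    by (rule FE.friedrichs_eq[OF A_sub]) (rule FE.form_closure_core[OF DQ Ddiff form dense]; assumption)+
qed

end

theorem theorem4p18:
  fixes c :: "'v \<Rightarrow> 'v \<Rightarrow> real" and ref :: 'v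
  assumes "network c"
    and "infinite (UNIV :: 'v set)"
    and "transient c"
  shows "Domain (laplacian_F c ref) =
    Phi_tilde c ref `` (Domain (laplacian_2_sqrt c) \<inter> Domain (laplacian_2_inv_sqrt c))"
proof -
  interpret transient_network c ref
    by unfold_locales (use assms in auto)
  have "Domain (laplacian_F c ref) = G `` D2"
    unfolding laplacian_F_eq by (intro set_eqI) (simp only: Domain_iff FE_form_op_iff Image_iff, blast)
  also have "\<dots> = G `` (D2 \<inter> Domain G)" by blast
  also have "\<dots> = Phi_tilde c ref `` (Domain (laplacian_2_sqrt c) \<inter> Domain (laplacian_2_inv_sqrt c))"
    unfolding Phi_tilde_eq laplacian_2_sqrt_eq laplacian_2_inv_sqrt_Domain Domain_G E2.Domain_root ..
  finally show ?thesis .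
qed

end
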